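(* Let $(X,d)$ be a geodesic metric space that is topologically equivalent (homeomorphic) to a surface. Assume that $(X,d)$ is locally biLipschitz homogeneous. Then: (1) the metric space $(X,d)$ is locally doubling; (2) the Hausdorff dimension of $(X,d)$ is finite; (3) the Hausdorff $2$-measure $\mathcal{H}^2$ of small balls has a quadratic lower bound: for each point $p\in X$ there are constants $c,\bar r>0$ such that $$\mathcal{H}^2(B(p,r))\ge c\,r^2\quad\text{for } r<\bar r;$$ (4) every point of $(X,d)$ has a neighborhood that is locally linearly contractible.
   Context: A geodesic metric space is a metric space in which any two points are the end points of a rectifiable curve whose length (the supremum of $\sum_i d(\gamma(t_i),\gamma(t_{i-1}))$ over partitions) is exactly the distance between the two points. A metric space $(X,d)$ is locally biLipschitz homogeneous if for every two points $x_1,x_2\in X$ there are neighborhoods $U_1$ of $x_1$ and $U_2$ of $x_2$ and a biLipschitz homeomorphism $f:U_1\to U_2$ such that $f(x_1)=x_2$. A metric space is doubling if there is a constant $N\in\mathbb{N}$ such that each ball $B(x,2R)$ is contained in the union of at most $N$ balls of radius $R$. It is locally doubling if any point has a neighborhood that is doubling. A metric space is locally linearly contractible if there is a constant $C\ge 1$ such that each metric ball of radius $R<C^{-1}$ in the space can be contracted to a point inside the ball of the same center but radius $CR$. *)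

theory Defs
  imports "HOL-Analysis.Analysis"
begin

text \<open>
  A set \<open>S :: 'a::metric_space set\<close> stands for the metric space \<open>S\<close> with the restriction of
  \<^const>\<open>dist\<close>; its balls are the sets \<open>ball x r \<inter> S\<close> with \<open>x \<in> S\<close>. The whole space
  is \<open>UNIV :: 'a set\<close>; proper subsets occur only as neighbourhoods carrying the induced metric.
  Neighbourhoods are not required to be open.
\<close>

definition neighbourhood_in :: "'a::topological_space set \<Rightarrow> 'a \<Rightarrow> 'a set \<Rightarrow> bool" where
  "neighbourhood_in S x U \<longleftrightarrow>
     U \<subseteq> S \<and> (\<exists>V. openin (top_of_set S) V \<and> x \<in> V \<and> V \<subseteq> U)"

lemma neighbourhood_in_UNIV: "neighbourhood_in UNIV x U \<longleftrightarrow> x \<in> interior U"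
  by (auto simp: neighbourhood_in_def interior_def)

definition surface :: "'b topology \<Rightarrow> bool" where
  "surface T \<longleftrightarrow>
     Hausdorff_space T \<and> second_countable T \<and>
     (\<forall>x\<in>topspace T. \<exists>U V. openin T U \<and> x \<in> U \<and> open (V :: (real^2) set) \<and>
        subtopology T U homeomorphic_space top_of_set V)"

definition path_length :: "(real \<Rightarrow> 'a::metric_space) \<Rightarrow> ennreal" where
  "path_length g =
     (SUP (n, t) \<in> {(n :: nat, t :: nat \<Rightarrow> real).
                      t 0 = 0 \<and> t n = 1 \<and> (\<forall>i<n. t i \<le> t (Suc i))}.
        \<Sum>i<n. ennreal (dist (g (t (Suc i))) (g (t i))))"

definition rectifiable :: "(real \<Rightarrow> 'a::metric_space) \<Rightarrow> bool" where
  "rectifiable g \<longleftrightarrow> path g \<and> path_length g < \<infinity>"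

definition geodesic_space :: "'a::metric_space set \<Rightarrow> bool" where
  "geodesic_space S \<longleftrightarrow>
     (\<forall>x\<in>S. \<forall>y\<in>S. \<exists>g. rectifiable g \<and> path_image g \<subseteq> S \<and>
        pathstart g = x \<and> pathfinish g = y \<and> path_length g = ennreal (dist x y))"

definition bilipschitz_homeomorphism ::
    "'a::metric_space set \<Rightarrow> 'b::metric_space set \<Rightarrow> ('a \<Rightarrow> 'b) \<Rightarrow> bool" where
  "bilipschitz_homeomorphism U V f \<longleftrightarrow>
     (\<exists>g. homeomorphism U V f g \<and> (\<exists>L. L-lipschitz_on U f) \<and> (\<exists>L. L-lipschitz_on V g))"

definition locally_bilipschitz_homogeneous :: "'a::metric_space set \<Rightarrow> bool" where
  "locally_bilipschitz_homogeneous S \<longleftrightarrow>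
     (\<forall>x1\<in>S. \<forall>x2\<in>S. \<exists>U1 U2 f. neighbourhood_in S x1 U1 \<and> neighbourhood_in S x2 U2 \<and>
        bilipschitz_homeomorphism U1 U2 f \<and> f x1 = x2)"

definition doubling :: "'a::metric_space set \<Rightarrow> bool" where
  "doubling S \<longleftrightarrow>
     (\<exists>N::nat. \<forall>x\<in>S. \<forall>R>0. \<exists>C\<subseteq>S. finite C \<and> card C \<le> N \<and>
        ball x (2 * R) \<inter> S \<subseteq> (\<Union>c\<in>C. ball c R \<inter> S))"

definition locally_doubling :: "'a::metric_space set \<Rightarrow> bool" where
  "locally_doubling S \<longleftrightarrow> (\<forall>x\<in>S. \<exists>U. neighbourhood_in S x U \<and> doubling U)"

text \<open>
  The Hausdorff measure below carries no normalising constant. In the case \<open>s = 0\<close> the usual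
  convention (each nonempty set has weight 1) is spelled out because \<open>0 powr 0 = 0\<close>. Covers are
  restricted to bounded sets since \<^const>\<open>diameter\<close> is meaningless on unbounded ones; finite
  covers are included by padding with the empty set.
\<close>

definition diameter_power :: "real \<Rightarrow> 'a::metric_space set \<Rightarrow> ennreal" where
  "diameter_power s C =
     (if C = {} then 0 else if s = 0 then 1 else ennreal (diameter C powr s))"

definition hausdorff_measure :: "real \<Rightarrow> 'a::metric_space set \<Rightarrow> ennreal" where
  "hausdorff_measure s A =
     (SUP \<delta>\<in>{0<..}.
        INF C \<in> {C :: nat \<Rightarrow> 'a set.
                   A \<subseteq> (\<Union>i. C i) \<and> (\<forall>i. bounded (C i) \<and> diameter (C i) \<le> \<delta>)}.
          \<Sum>i. diameter_power s (C i))"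

definition hausdorff_dimension :: "'a::metric_space set \<Rightarrow> ennreal" where
  "hausdorff_dimension A = Inf {ennreal s | s. 0 \<le> s \<and> hausdorff_measure s A = 0}"

text \<open>Contractibility of one ball inside a larger one means that the inclusion map is
  null-homotopic.\<close>

definition locally_linearly_contractible :: "'a::metric_space set \<Rightarrow> bool" where
  "locally_linearly_contractible S \<longleftrightarrow>
     (\<exists>C\<ge>1. \<forall>x\<in>S. \<forall>R. 0 < R \<and> R < inverse C \<longrightarrow>
        (\<exists>a. homotopic_with_canon (\<lambda>_. True) (ball x R \<inter> S) (ball x (C * R) \<inter> S)
               (\<lambda>y. y) (\<lambda>_. a)))"

end

theory Submission
  imports Defs "HOL-Complex_Analysis.Riemann_Mapping"
begin

text \<open>
  Baire's theorem makes the constants of local homogeneity uniform on a set \<open>A\<close> that is dense near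
  a point \<open>x0\<close> lying in the middle of a biLipschitz arc; hence every point of \<open>A\<close> is the middle of
  a biLipschitz arc of uniform size. In a planar chart, a point of \<open>A\<close> enclosed by a set \<open>K\<close> sends
  both halves of its arc through \<open>K\<close>, so the filling of \<open>K\<close> is at most a constant factor larger than
  \<open>K\<close>. If at some scale no point were enclosed by boundedly many small continua, small spheres would
  contain many separated points, and crosscuts through these points would produce enclosing sets at a
  comparable scale. So enclosing sets exist at all scales; moved by the homogeneity maps, they cover
  balls by boundedly many smaller balls, which gives doubling and finite dimension.

  For the lower bound on the area, each sphere around \<open>x0\<close> contains a continuum that encloses \<open>x0\<close>
  and, since it meets both halves of an arc, has diameter comparable to the radius; integrate over
  the radius. For contractibility, a maximal family of geodesic arms at a point yields arbitrarily
  small biLipschitz circles. Such a circle is a Lipschitz neighbourhood retract, so contractions in the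
  surface, which come from the Riemann mapping theorem, can be pushed into the region it encloses.
\<close>

text \<open>Two obstacles shape the constants. First, \<open>A\<close> is only dense, so nothing
  passes to limits in \<open>A\<close>: whatever needs an arc or a homogeneity map first moves to a
  nearby point of \<open>A\<close>. Second, the complexity of enclosing sets must not grow with the
  depth of the descent. A set enclosing a point at scale \<open>g\<close> is a union of at most
  \<open>n\<close> pieces of size \<open>\<epsilon> * g\<close>. If no such set exists at
  \<open>J\<close> scales in ratio \<open>\<rho>\<close>, a ball contains at least
  \<open>(n + 1) ^ J\<close> points with gaps comparable to \<open>\<rho> ^ J * g\<close>, whereas
  one biLipschitz arc passes close to at most a fixed multiple of \<open>1 / \<rho> ^ J\<close> of
  them. As \<open>n + 1 \<ge> 2 / \<rho>\<close>, an excess factor \<open>2 ^ J\<close> remains,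
  which beats the fixed number of pairs of pieces once \<open>J\<close> is large. The number of
  pieces stays fixed because each new set of the descent consists of two arcs and two old pieces,
  whatever the set before it was.\<close>

section \<open>Auxiliary facts on plane sets, paths and integer-valued functions\<close>

lemma outside_unbounded_connected:
  fixes S T :: "complex set"
  assumes "connected T" "\<not> bounded T" "T \<inter> S = {}"
  shows "T \<subseteq> outside S"
proof
  fix x assume "x \<in> T"
  then have "T \<subseteq> connected_component_set (- S) x"
    using assms by (intro connected_component_maximal) auto
  then show "x \<in> outside S"
    using assms(2) bounded_subset by (auto simp: outside)
qed

lemma infdist_compact_attains:
  fixes S :: "'b::metric_space set"
  assumes "compact S" "S \<noteq> {}"
  obtains p where "p \<in> S" "dist y p = infdist y S"
proof -
  obtain p where p: "p \<in> S" "\<And>q. q \<in> S \<Longrightarrow> dist y p \<le> dist y q"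
    using continuous_attains_inf[OF assms, of "dist y"] continuous_on_dist[OF continuous_on_const continuous_on_id]
    by blast
  have "dist y p \<le> infdist y S"
    using p(2) assms(2) by (auto simp: infdist_notempty intro!: cINF_greatest)
  then show thesis using that[OF p(1)] infdist_le[OF p(1), of y] by linarith
qed

lemma compact_near_set:
  fixes S :: "'b::metric_space set"
  assumes "compact S"
  shows "closed {y. \<exists>p\<in>S. dist y p \<le> r}"
proof (cases "S = {}")
  case False
  have "{y. \<exists>p\<in>S. dist y p \<le> r} = {y. infdist y S \<le> r}"
  proof -
    have "(\<exists>p\<in>S. dist y p \<le> r) \<longleftrightarrow> infdist y S \<le> r" for y
    proof
      assume "\<exists>p\<in>S. dist y p \<le> r" then show "infdist y S \<le> r" using infdist_le order_trans by metis
    next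
      assume "infdist y S \<le> r"
      then show "\<exists>p\<in>S. dist y p \<le> r"
        using infdist_compact_attains[OF assms False, of y] by metis
    qed
    then show ?thesis by simp
  qed
  moreover have "closed {y. infdist y S \<le> r}"
    by (intro closed_Collect_le continuous_intros)
  ultimately show ?thesis by simp
qed auto

lemma exp_eq_imp_int_multiple:
  assumes "exp (\<i> * of_real a) = exp (\<i> * of_real b)"
  shows "(a - b) / (2 * pi) \<in> \<int>"
proof -
  obtain n :: int where "\<i> * complex_of_real a = \<i> * of_real b + (of_int (2 * n) * pi) * \<i>"
    using assms unfolding exp_eq by blast
  then have "Im (\<i> * complex_of_real a) = Im (\<i> * of_real b + (of_int (2 * n) * pi) * \<i>)" by simp
  then have "a = b + 2 * of_int n * pi" by simp
  then have "(a - b) / (2 * pi) = of_int n" by simp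
  then show ?thesis by simp
qed

lemma int_valued_const:
  fixes f :: "'b::topological_space \<Rightarrow> real"
  assumes "connected S" "continuous_on S f" "\<And>x. x \<in> S \<Longrightarrow> f x \<in> \<int>" "x \<in> S" "y \<in> S"
  shows "f x = f y"
proof (rule ccontr)
  assume ne: "f x \<noteq> f y"
  have c: "connected (f ` S)" by (rule connected_continuous_image[OF assms(2,1)])
  obtain a b where ab: "a < b" "a \<in> f ` S" "b \<in> f ` S"
    using ne assms(4,5) by (metis imageI linorder_neqE_linordered_idom)
  have a1: "a \<in> \<int>" and b1: "b \<in> \<int>" using assms(3) ab(2,3) by blast+
  define m where "m = a + 1/2"
  have "b \<ge> a + 1"
  proof -
    obtain i j where "a = of_int i" "b = of_int j" using a1 b1 by (metis Ints_cases)
    then show ?thesis using ab(1) by simp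
  qed
  then have "m \<in> {a..b}" by (auto simp: m_def)
  then have "m \<in> f ` S" using connected_contains_Icc[OF c ab(2,3)] by blast
  then have "m \<in> \<int>" using assms(3) by auto
  then have "m - a \<in> \<int>" using a1 Ints_diff by blast
  then have "(1/2::real) \<in> \<int>" by (simp add: m_def)
  then obtain n where "(1/2::real) = of_int n" by (rule Ints_cases)
  then have "1 = real_of_int (2 * n)" by simp
  then have "1 = 2 * n" by linarith
  then show False by presburger
qed

lemma path_last_exit:
  fixes p :: "real \<Rightarrow> 'b::t2_space"
  assumes "path p" "closed C" "pathstart p \<in> C" "pathfinish p \<notin> C"
  obtains s where "0 \<le> s" "s < 1" "p s \<in> C" "\<And>t. s < t \<Longrightarrow> t \<le> 1 \<Longrightarrow> p t \<notin> C"
proof -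
  define T where "T = {0..1} \<inter> p -` C"
  have "closed T" unfolding T_def
    using assms(1,2) by (intro continuous_closed_preimage) (auto simp: path_def)
  then have "compact T" by (simp add: T_def compact_eq_bounded_closed bounded_Int)
  moreover have "0 \<in> T" using assms(3) by (simp add: T_def pathstart_def)
  ultimately obtain s where s: "s \<in> T" "\<And>t. t \<in> T \<Longrightarrow> t \<le> s"
    using compact_attains_sup[of T] by blast
  show thesis
  proof (rule that[of s])
    show "0 \<le> s" "p s \<in> C" using s(1) by (auto simp: T_def)
    show "s < 1" using s(1) assms(4) by (auto simp: T_def pathfinish_def less_le)
    show "p t \<notin> C" if "s < t" "t \<le> 1" for t
    proof
      assume "p t \<in> C"
      then have "t \<in> T" using that s(1) by (simp add: T_def)
      then show False using s(2)[of t] that by simp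
    qed
  qed
qed

lemma ex_pow2: "\<exists>J. (x::real) < 2 ^ J"
  using real_arch_pow[of 2 x] by simp

section \<open>Filling sets in a planar chart\<close>

text \<open>The image is the whole plane, so that a compact subset of \<open>W\<close> has a
  canonical exterior, the unbounded component of the complement of its image, and theorems of plane
  topology apply without boundary effects.\<close>

locale planar_chart =
  fixes W :: "'a::metric_space set" and h :: "'a \<Rightarrow> complex" and k :: "complex \<Rightarrow> 'a"
  assumes open_W: "open W" and homeo: "homeomorphism W UNIV h k"
begin

lemma kh [simp]: "x \<in> W \<Longrightarrow> k (h x) = x"
  using homeo by (auto simp: homeomorphism_def)

lemma hk [simp]: "h (k z) = z"
  using homeo by (auto simp: homeomorphism_def)

lemma k_in [simp]: "k z \<in> W"
  using homeo by (auto simp: homeomorphism_def)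

lemma range_k: "range k = W"
  using homeo by (auto simp: homeomorphism_def)

lemma cont_h: "continuous_on S h" if "S \<subseteq> W" for S
  using homeo that continuous_on_subset by (auto simp: homeomorphism_def)

lemma cont_k: "continuous_on S k"
  using homeo continuous_on_subset by (auto simp: homeomorphism_def)

lemma inj_h: "inj_on h W"
  by (metis inj_onI kh)

lemma inj_k: "inj k"
  by (metis injI hk)

lemma open_k: "open (k ` U)" if "open U"
proof -
  have "openin (top_of_set W) (k ` U)"
    using homeomorphism_imp_open_map[OF homeomorphism_symD[OF homeo]] that by auto
  then show ?thesis using open_W openin_open_trans by blast
qed

lemma h_image_eq: "S \<subseteq> W \<Longrightarrow> z \<in> h ` S \<longleftrightarrow> k z \<in> S"
  by (metis image_iff kh hk subsetD)

lemma compact_h: "compact K \<Longrightarrow> K \<subseteq> W \<Longrightarrow> compact (h ` K)"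
  by (simp add: compact_continuous_image cont_h)

definition ext :: "'a set \<Rightarrow> 'a set" where "ext K = k ` outside (h ` K)"

text \<open>The hull of \<open>K\<close> in the chart: \<open>K\<close> together with the bounded
  components of its complement in the plane. It takes the part of the inside of a Jordan curve, for
  sets that need not be curves.\<close>

definition fil :: "'a set \<Rightarrow> 'a set" where "fil K = k ` (- outside (h ` K))"

lemma fil_eq: "fil K = W - ext K"
  unfolding fil_def ext_def using range_k inj_k by (metis Compl_eq_Diff_UNIV image_set_diff)

lemma fil_subset_W: "fil K \<subseteq> W"
  by (auto simp: fil_eq)

lemma ext_fil_disjoint: "ext K \<inter> fil K = {}"
  by (auto simp: fil_eq)

lemma mem_fil: "x \<in> fil K \<longleftrightarrow> x \<in> W \<and> h x \<notin> outside (h ` K)"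
  by (force simp: fil_def image_iff)

lemma subset_fil: "K \<subseteq> W \<Longrightarrow> K \<subseteq> fil K"
  by (auto simp: mem_fil outside_def)

lemma compact_fil: assumes "compact K" "K \<subseteq> W" shows "compact (fil K)"
proof -
  have "closed (- outside (h ` K))"
    using open_outside[OF compact_imp_closed[OF compact_h[OF assms]]] by (simp add: closed_open)
  moreover have "bounded (- outside (h ` K))"
    using cobounded_outside compact_imp_bounded compact_h[OF assms] by blast
  ultimately show ?thesis unfolding fil_def
    by (simp add: compact_continuous_image compact_eq_bounded_closed cont_k)
qed

lemma open_fil_minus: assumes "compact K" "K \<subseteq> W" shows "open (fil K - K)"
proof -
  have "fil K - K = k ` inside (h ` K)"
  proof -
    have "- outside (h ` K) = inside (h ` K) \<union> h ` K"
      by (simp add: union_with_inside[symmetric] Un_commute)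
    moreover have "k ` h ` K = K" using assms(2) by (force simp: image_iff subset_iff)
    ultimately have "fil K = k ` inside (h ` K) \<union> K"
      by (simp add: fil_def image_Un)
    moreover have "k ` inside (h ` K) \<inter> K = {}"
    proof -
      have False if "z \<in> inside (h ` K)" "k z \<in> K" for z
      proof -
        have "z \<in> h ` K" using that(2) hk[of z] imageI[of "k z" K h] by metis
        then show False using that(1) inside_no_overlap[of "h ` K"] by blast
      qed
      then show ?thesis by blast
    qed
    ultimately show ?thesis by auto
  qed
  then show ?thesis
    using open_k open_inside compact_imp_closed compact_h[OF assms] by metis
qed

text \<open>The boundary of \<open>fil K\<close> lies in \<open>K\<close>, since both
  \<open>fil K - K\<close> and the complement of \<open>fil K\<close> in the whole space are
  open.\<close>

lemma connected_meets:
  assumes "compact K" "K \<subseteq> W" "connected C" "C \<inter> fil K \<noteq> {}" "\<not> C \<subseteq> fil K"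
  shows "C \<inter> K \<noteq> {}"
proof
  assume "C \<inter> K = {}"
  then have "C \<inter> (fil K - K) \<noteq> {}" "C \<inter> (- fil K) \<noteq> {}" "C \<subseteq> (fil K - K) \<union> (- fil K)"
    using assms(4,5) by auto
  moreover have "open (- fil K)"
    using compact_fil[OF assms(1,2)] compact_imp_closed by blast
  ultimately show False
    using connectedD[OF \<open>connected C\<close> open_fil_minus[OF assms(1,2)], of "- fil K"] by auto
qed

lemma connected_subset_fil:
  assumes "compact K" "K \<subseteq> W" "connected C" "C \<inter> fil K \<noteq> {}" "C \<inter> K = {}"
  shows "C \<subseteq> fil K"
  using connected_meets assms by blast

text \<open>The exterior of \<open>K\<close> is connected and unbounded in the chart and misses
  \<open>K1\<close>, hence lies in the exterior of \<open>K1\<close>. Containment in the hull is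
  enough; in the descent the new set runs through the inside of the old one.\<close>

lemma ext_mono:
  assumes "compact K" "K \<subseteq> W" "compact K1" "K1 \<subseteq> fil K"
  shows "ext K \<subseteq> ext K1"
proof -
  have "outside (h ` K) \<subseteq> outside (h ` K1)"
  proof (rule outside_unbounded_connected)
    show "connected (outside (h ` K))"
      by (intro connected_outside compact_imp_bounded compact_h assms) auto
    show "\<not> bounded (outside (h ` K))"
      by (intro unbounded_outside compact_imp_bounded compact_h assms)
    show "outside (h ` K) \<inter> h ` K1 = {}"
      using assms(4) by (auto simp: mem_fil subset_iff)
  qed
  then show ?thesis by (auto simp: ext_def)
qed

lemma fil_mono:
  assumes "compact K" "K \<subseteq> W" "compact K1" "K1 \<subseteq> fil K"
  shows "fil K1 \<subseteq> fil K"
  using ext_mono[OF assms] by (auto simp: fil_eq)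

text \<open>A set inside a disc of the plane has its hull in the disc. The radii come from passing
  between metric balls and discs of the chart, so they are not comparable; a linear estimate is only
  reached in \<open>fil_cball\<close>.\<close>

lemma fil_small:
  assumes "x0 \<in> W" "\<rho> > 0"
  obtains \<rho>1 where "\<rho>1 > 0" "\<rho>1 \<le> \<rho>" "ball x0 \<rho>1 \<subseteq> W"
    "\<And>K. compact K \<Longrightarrow> K \<subseteq> ball x0 \<rho>1 \<Longrightarrow> fil K \<subseteq> ball x0 \<rho>"
proof -
  have "open (h ` (ball x0 \<rho> \<inter> W))"
  proof -
    have "openin (top_of_set W) (ball x0 \<rho> \<inter> W)"
      by (intro open_subset open_Int open_W) auto
    from homeomorphism_imp_open_map[OF homeo this] show ?thesis by simp
  qed
  moreover have "h x0 \<in> h ` (ball x0 \<rho> \<inter> W)" using assms by auto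
  ultimately obtain e where e: "e > 0" "ball (h x0) e \<subseteq> h ` (ball x0 \<rho> \<inter> W)"
    using open_contains_ball by blast
  have "open (k ` ball (h x0) e)" by (rule open_k) auto
  moreover have "x0 \<in> k ` ball (h x0) e" using e assms by (auto simp: image_iff intro!: bexI[of _ "h x0"])
  ultimately obtain d where d: "d > 0" "ball x0 d \<subseteq> k ` ball (h x0) e"
    using open_contains_ball by blast
  have sub: "k ` ball (h x0) e \<subseteq> ball x0 \<rho>"
    using e(2) by force
  show thesis
  proof (rule that[of "min d \<rho>"])
    show "ball x0 (min d \<rho>) \<subseteq> W" using d(2) k_in by auto
    fix K assume K: "compact K" "K \<subseteq> ball x0 (min d \<rho>)"
    then have "K \<subseteq> k ` ball (h x0) e" using d(2) by (force simp: subset_iff)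
    then have "h ` K \<subseteq> ball (h x0) e" by auto
    then have "- ball (h x0) e \<subseteq> outside (h ` K)"
      by (intro outside_subset_convex) auto
    then have "fil K \<subseteq> k ` ball (h x0) e" unfolding fil_def by auto
    then show "fil K \<subseteq> ball x0 \<rho>" using sub by auto
  qed (use d assms in auto)
qed

lemma compact_nbhd:
  assumes "x0 \<in> W"
  obtains \<rho> where "\<rho> > 0" "\<And>S. closed S \<Longrightarrow> S \<subseteq> ball x0 \<rho> \<Longrightarrow> compact S \<and> S \<subseteq> W"
proof -
  have "open (k ` ball (h x0) 1)" by (rule open_k) auto
  moreover have "x0 \<in> k ` ball (h x0) 1" using assms by (auto simp: image_iff intro!: bexI[of _ "h x0"])
  ultimately obtain d where d: "d > 0" "ball x0 d \<subseteq> k ` ball (h x0) 1"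
    using open_contains_ball by blast
  have c: "compact (k ` cball (h x0) 1)"
    by (intro compact_continuous_image cont_k) auto
  show thesis
  proof (rule that[OF d(1)])
    fix S assume S: "closed S" "S \<subseteq> ball x0 d"
    then have "S = S \<inter> k ` cball (h x0) 1" using d(2) by force
    then have "compact S" using c S(1) closed_Int_compact by metis
    moreover have "S \<subseteq> W" using S d(2) k_in by blast
    ultimately show "compact S \<and> S \<subseteq> W" ..
  qed
qed

text \<open>A compact plane set with connected complement carries no nontrivial circle-valued map;
  filling has removed every bounded complementary component.\<close>

lemma Borsukian_fil: assumes "compact K" "K \<subseteq> W" shows "Borsukian (h ` fil K)"
proof -
  have "h ` fil K = - outside (h ` K)" by (auto simp: fil_def image_image)
  moreover have "connected (outside (h ` K))"
    by (intro connected_outside compact_imp_bounded compact_h assms) auto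
  moreover have "compact (h ` fil K)"
    by (intro compact_h compact_fil assms fil_subset_W)
  ultimately show ?thesis
    using Borsukian_separation_compact[of "h ` fil K"] by simp
qed

lemma circle_map_lift:
  fixes F :: "'a \<Rightarrow> complex"
  assumes "compact K" "K \<subseteq> W" "continuous_on (fil K) F" "\<And>x. x \<in> fil K \<Longrightarrow> norm (F x) = 1"
  obtains g :: "'a \<Rightarrow> real" where "continuous_on (fil K) g"
    "\<And>x. x \<in> fil K \<Longrightarrow> F x = exp (\<i> * of_real (g x))"
proof -
  let ?S = "h ` fil K"
  have kh_fil: "k ` ?S = fil K" using fil_subset_W[of K] by (force simp: subset_iff image_iff)
  have "continuous_on ?S (F \<circ> k)"
    by (intro continuous_on_compose cont_k) (simp add: kh_fil assms(3))
  moreover have "(F \<circ> k) \<in> ?S \<rightarrow> sphere 0 1"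
    using assms(4) fil_subset_W[of K] by (force simp: subset_iff)
  ultimately obtain g where g: "continuous_on ?S (complex_of_real \<circ> g)"
     "\<And>z. z \<in> ?S \<Longrightarrow> (F \<circ> k) z = exp (\<i> * of_real (g z))"
    using Borsukian_fil[OF assms(1,2)] unfolding Borsukian_continuous_logarithm_circle_real by metis
  have "continuous_on ?S g"
    using continuous_on_Re[OF g(1)] by (simp add: o_def)
  then have "continuous_on (fil K) (g \<circ> h)"
    by (intro continuous_on_compose cont_h fil_subset_W)
  moreover have "F x = exp (\<i> * of_real ((g \<circ> h) x))" if "x \<in> fil K" for x
    using g(2)[of "h x"] that fil_subset_W by (auto simp: subset_iff)
  ultimately show thesis using that by blast
qed

text \<open>If every point enclosed by the loop were close to it, then winding once around along
  \<open>\<alpha>\<close> would define a circle-valued map on the whole enclosed set that has no lift.\<close>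

lemma enclosed_far_point:
  assumes \<alpha>: "compact \<alpha>" "connected \<alpha>" "\<alpha> \<subseteq> W" and \<beta>: "compact \<beta>" "connected \<beta>" "\<beta> \<subseteq> W"
    and e: "e1 \<in> \<alpha>" "e1 \<in> \<beta>" "e2 \<in> \<alpha>" "e2 \<in> \<beta>" and r: "r \<ge> 0"
    and near: "\<And>p q. p \<in> \<alpha> \<Longrightarrow> q \<in> \<beta> \<Longrightarrow> dist p q \<le> 2 * r \<Longrightarrow> dist p e1 \<le> u \<or> dist p e2 \<le> u"
    and far: "2 * (u + r) < dist e1 e2"
  obtains y where "y \<in> fil (\<alpha> \<union> \<beta>)" "\<And>q. q \<in> \<alpha> \<union> \<beta> \<Longrightarrow> r < dist y q"
proof (rule ccontr)
  assume no: "\<not> thesis"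
  define K where "K = \<alpha> \<union> \<beta>"
  have K: "compact K" "K \<subseteq> W" using \<alpha> \<beta> by (auto simp: K_def)
  define A1 A2 where "A1 = {y. \<exists>p\<in>\<alpha>. dist y p \<le> r}" and "A2 = {y. \<exists>p\<in>\<beta>. dist y p \<le> r}"
  have cl: "closed A1" "closed A2"
    using compact_near_set[OF \<alpha>(1)] compact_near_set[OF \<beta>(1)] by (auto simp: A1_def A2_def)
  have cover: "fil K \<subseteq> A1 \<union> A2"
  proof (rule subsetI, rule ccontr)
    fix y assume y: "y \<in> fil K" "y \<notin> A1 \<union> A2"
    have "r < dist y q" if "q \<in> \<alpha> \<union> \<beta>" for q
      using y(2) that by (auto simp: A1_def A2_def not_le)
    then show False using no that y(1) unfolding K_def by blast
  qed
  define D where "D = dist e1 e2 - 2 * (u + r)"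
  have D: "D > 0" using far by (simp add: D_def)
  \<comment> \<open>\<open>v\<close> climbs from 0 near \<open>e1\<close> to 1 near
    \<open>e2\<close>. By \<open>near\<close>, a point within \<open>r\<close> of both continua is
    within \<open>u + r\<close> of one of the ends, so \<open>v\<close> is integral on
    \<open>A1 \<inter> A2\<close> and the phase \<open>2 * pi * v\<close> on \<open>A1\<close> glues
    with the constant 1 on \<open>A2\<close>.\<close>
  define v where "v y = max 0 (min 1 ((dist y e1 - (u + r)) / D))" for y
  have cont_v: "continuous_on S v" for S
    unfolding v_def by (intro continuous_intros) (use D in auto)
  have v_0: "v y = 0" if "dist y e1 \<le> u + r" for y
  proof -
    have "(dist y e1 - (u + r)) / D \<le> 0" using that D by (intro divide_nonpos_pos) auto
    then show ?thesis unfolding v_def by linarith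
  qed
  have v_1: "v y = 1" if "D \<le> dist y e1 - (u + r)" for y
  proof -
    have "1 \<le> (dist y e1 - (u + r)) / D" using that D by simp
    then show ?thesis unfolding v_def by linarith
  qed
  have v01: "v y \<in> {0, 1}" if yA: "y \<in> A1 \<inter> A2" for y
  proof -
    obtain p q where p: "p \<in> \<alpha>" "dist y p \<le> r" and q: "q \<in> \<beta>" "dist y q \<le> r"
      using yA unfolding A1_def A2_def by blast
    have "dist p q \<le> 2 * r" using p q dist_triangle3[of p q y] by simp
    then consider "dist p e1 \<le> u" | "dist p e2 \<le> u" using near p q by blast
    then show ?thesis
    proof cases
      case 1
      then have "dist y e1 \<le> u + r" using p dist_triangle[of y e1 p] by linarith
      then show ?thesis using v_0 by simp
    next
      case 2
      then have "dist y e2 \<le> u + r" using p dist_triangle[of y e2 p] by linarith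
      then have "dist y e1 - (u + r) \<ge> D" using dist_triangle3[of e1 e2 y] unfolding D_def by argo
      then show ?thesis using v_1 by simp
    qed
  qed
  have u0: "u \<ge> 0"
  proof -
    have "dist e1 e1 \<le> u \<or> dist e1 e2 \<le> u" using near[OF e(1,2)] r by simp
    then show ?thesis using zero_le_dist[of e1 e2] by (elim disjE) (simp, linarith)
  qed

  have v1: "v e1 = 0" using u0 r by (intro v_0) simp
  have v2: "v e2 = 1"
  proof -
    have "dist e2 e1 - (u + r) \<ge> D" using u0 r by (simp add: D_def dist_commute)
    then show ?thesis by (rule v_1)
  qed
  define F where "F y = (if y \<in> A1 then exp (\<i> * of_real (2 * pi * v y)) else 1)" for y
  have F2: "F y = 1" if "y \<in> A2" for y
  proof (cases "y \<in> A1")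
    case True
    then have "v y = 0 \<or> v y = 1" using v01[of y] that by blast
    moreover have "exp (\<i> * complex_of_real (2 * pi)) = 1" using exp_two_pi_i' by (simp add: mult.commute)
    ultimately show ?thesis by (auto simp: F_def True)
  qed (simp add: F_def)
  have contF: "continuous_on (fil K) F"
  proof -
    have "continuous_on (fil K \<inter> A1) F"
    proof (rule continuous_on_eq)
      show "continuous_on (fil K \<inter> A1) (\<lambda>y. exp (\<i> * of_real (2 * pi * v y)))"
        by (intro continuous_intros cont_v)
    qed (simp add: F_def)
    moreover have "continuous_on (fil K \<inter> A2) F"
      by (rule continuous_on_eq[where f = "\<lambda>y. 1"]) (auto simp: F2)
    moreover have "closed (fil K)" by (intro compact_imp_closed compact_fil K)
    then have "closed (fil K \<inter> A1)" "closed (fil K \<inter> A2)" using cl by auto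
    ultimately have "continuous_on ((fil K \<inter> A1) \<union> (fil K \<inter> A2)) F"
      by (intro continuous_on_closed_Un)
    moreover have "fil K = (fil K \<inter> A1) \<union> (fil K \<inter> A2)" using cover by blast
    ultimately show ?thesis by simp
  qed
  have normF: "norm (F y) = 1" for y by (auto simp: F_def)
  obtain g where g: "continuous_on (fil K) g" "\<And>x. x \<in> fil K \<Longrightarrow> F x = exp (\<i> * of_real (g x))"
    using circle_map_lift[OF K contF normF] by blast
  have sub: "\<alpha> \<subseteq> fil K" "\<beta> \<subseteq> fil K" using subset_fil[OF K(2)] by (auto simp: K_def)
  \<comment> \<open>Along \<open>\<beta>\<close> the lift stays at one multiple of a full turn,
    along \<open>\<alpha>\<close> it follows \<open>2 * pi * v\<close>. So its values at the two
    ends would be equal and yet differ by a full turn.\<close>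
  have "g e1 / (2 * pi) = g e2 / (2 * pi)"
  proof (rule int_valued_const[OF \<beta>(2)])
    show "continuous_on \<beta> (\<lambda>x. g x / (2 * pi))"
      by (intro continuous_intros continuous_on_subset[OF g(1) sub(2)]) auto
    fix x assume x: "x \<in> \<beta>"
    then have "F x = 1" using r by (intro F2) (auto simp: A2_def intro!: bexI[of _ x])
    then have "exp (\<i> * of_real (g x)) = exp (\<i> * of_real 0)" using g(2)[of x] x sub by auto
    from exp_eq_imp_int_multiple[OF this] show "g x / (2 * pi) \<in> \<int>" by simp
  qed (use e in auto)
  moreover have "(g e1 - 2 * pi * v e1) / (2 * pi) = (g e2 - 2 * pi * v e2) / (2 * pi)"
  proof (rule int_valued_const[OF \<alpha>(2)])
    show "continuous_on \<alpha> (\<lambda>x. (g x - 2 * pi * v x) / (2 * pi))"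
      by (intro continuous_intros continuous_on_subset[OF g(1) sub(1)] cont_v) auto
    fix x assume x: "x \<in> \<alpha>"
    then have "x \<in> A1" using r by (auto simp: A1_def intro!: bexI[of _ x])
    then have "F x = exp (\<i> * of_real (2 * pi * v x))" by (simp add: F_def)
    then have "exp (\<i> * of_real (g x)) = exp (\<i> * of_real (2 * pi * v x))" using g(2)[of x] x sub by auto
    from exp_eq_imp_int_multiple[OF this] show "(g x - 2 * pi * v x) / (2 * pi) \<in> \<int>" .
  qed (use e in auto)
  ultimately show False using v1 v2 by (simp add: field_simps)
qed

end

section \<open>BiLipschitz arcs and non-separating continua\<close>

definition bilip :: "real \<Rightarrow> (real \<Rightarrow> 'a::metric_space) \<Rightarrow> real set \<Rightarrow> bool" where
  "bilip L c S \<longleftrightarrow>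
     (\<forall>s\<in>S. \<forall>t\<in>S. \<bar>s - t\<bar> \<le> L * dist (c s) (c t) \<and> dist (c s) (c t) \<le> L * \<bar>s - t\<bar>)"

lemma bilip_subset: "bilip L c S \<Longrightarrow> T \<subseteq> S \<Longrightarrow> bilip L c T"
  by (meson bilip_def subsetD)

lemma bilipD:
  assumes "bilip L c S" "s \<in> S" "t \<in> S"
  shows "\<bar>s - t\<bar> \<le> L * dist (c s) (c t)" "dist (c s) (c t) \<le> L * \<bar>s - t\<bar>"
  using assms by (auto simp: bilip_def)

lemma bilip_inj: "bilip L c S \<Longrightarrow> inj_on c S"
  by (rule inj_onI) (use bilipD(1) in fastforce)

lemma bilip_cont: assumes "bilip L c S" shows "continuous_on S c"
proof (rule continuous_onI)
  fix x e :: real assume "x \<in> S" "e > 0"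
  show "\<exists>d>0. \<forall>x'\<in>S. dist x' x < d \<longrightarrow> dist (c x') (c x) \<le> e"
  proof (intro exI[of _ "e / (\<bar>L\<bar> + 1)"] conjI ballI impI)
    show "0 < e / (\<bar>L\<bar> + 1)" using \<open>e > 0\<close> by auto
    fix x' assume x': "x' \<in> S" "dist x' x < e / (\<bar>L\<bar> + 1)"
    have "dist (c x') (c x) \<le> L * \<bar>x' - x\<bar>" using bilipD(2)[OF assms x'(1) \<open>x \<in> S\<close>] .
    also have "\<dots> \<le> (\<bar>L\<bar> + 1) * \<bar>x' - x\<bar>" by (intro mult_right_mono) auto
    also have "\<dots> \<le> e" using x'(2) by (simp add: dist_real_def field_simps)
    finally show "dist (c x') (c x) \<le> e" .
  qed
qed

context planar_chart
begin

definition nonsep :: "'a set \<Rightarrow> bool" where "nonsep S \<longleftrightarrow> connected (- h ` S)"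

text \<open>Janiszewski's theorem; the connected intersection excludes that the union closes up to a
  loop.\<close>

lemma nonsep_Un:
  assumes "compact S" "S \<subseteq> W" "compact T" "T \<subseteq> W" "nonsep S" "nonsep T" "connected (S \<inter> T)"
  shows "nonsep (S \<union> T)"
proof -
  have "h ` (S \<inter> T) = h ` S \<inter> h ` T" using assms(2,4) inj_h by (simp add: inj_on_image_Int)
  moreover have "connected (h ` (S \<inter> T))"
    by (intro connected_continuous_image cont_h assms) (use assms in auto)
  ultimately show ?thesis
    using Janiszewski_connected[of "h ` S" "h ` T"] assms(5,6) compact_h[OF assms(1,2)]
      compact_imp_closed[OF compact_h[OF assms(3,4)]]
    by (simp add: nonsep_def image_Un)
qed

lemma nonsep_singleton: "nonsep {x}"
  using connected_punctured_universe[of "h x"] by (simp add: nonsep_def Compl_eq_Diff_UNIV)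

lemma nonsep_arc:
  fixes c :: "real \<Rightarrow> 'a"
  assumes "continuous_on {a..b} c" "inj_on c {a..b}" "c ` {a..b} \<subseteq> W" "a \<le> b"
  shows "nonsep (c ` {a..b})"
proof (cases "a = b")
  case True then show ?thesis using nonsep_singleton[of "c b"] by simp
next
  case False
  then have "a < b" using assms by simp
  define l where "l t = a + t * (b - a)" for t
  have im: "l ` {0..1} = {a..b}"
  proof -
    have "l ` {0..1} = (\<lambda>t. (b - a) * t + a) ` {0..1}" by (simp add: l_def algebra_simps)
    then show ?thesis using \<open>a < b\<close> by (simp add: image_affinity_atLeastAtMost)
  qed
  have "inj_on l {0..1}" using \<open>a < b\<close> by (auto simp: l_def inj_on_def)
  have "arc (h \<circ> c \<circ> l)"
    unfolding arc_def path_def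
  proof
    show "continuous_on {0..1} (h \<circ> c \<circ> l)"
      by (intro continuous_on_compose cont_h) (auto simp: l_def[abs_def] im[unfolded l_def[abs_def]] intro!: continuous_intros assms)
    show "inj_on (h \<circ> c \<circ> l) {0..1}"
      using \<open>inj_on l {0..1}\<close> assms(2) inj_on_subset[OF inj_h assms(3)] im
      by (auto intro!: comp_inj_on simp: image_comp[symmetric])
  qed
  moreover have "path_image (h \<circ> c \<circ> l) = h ` c ` {a..b}"
    unfolding path_image_def by (simp only: image_comp[symmetric] im)
  ultimately show ?thesis
    using connected_arc_complement[of "h \<circ> c \<circ> l"] by (simp add: nonsep_def)
qed

text \<open>Attaching an arc by its two ends to a non-separating continuum produces a set each point of
  whose new arc is still accessible from the exterior: removing a small open subarc leaves a
  non-separating set, by Janiszewski's theorem.\<close>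

lemma attached_arc_accessible:
  fixes c :: "real \<Rightarrow> 'a"
  assumes Q: "compact Q" "Q \<subseteq> W" "nonsep Q"
    and c: "continuous_on {u1..u2} c" "inj_on c {u1..u2}" "c ` {u1..u2} \<subseteq> W"
    and ends: "c u1 \<in> Q" "c u2 \<in> Q" and int: "\<And>s. u1 < s \<Longrightarrow> s < u2 \<Longrightarrow> c s \<notin> Q"
    and t: "u1 < t" "t < u2"
  shows "c t \<in> closure (ext (Q \<union> c ` {u1..u2}))"
proof -
  define K where "K = Q \<union> c ` {u1..u2}"
  have cc: "compact (c ` {a..b})" if "u1 \<le> a" "b \<le> u2" for a b
    by (rule compact_continuous_image[OF continuous_on_subset[OF c(1)]]) (use that in auto)
  have cW: "c ` {a..b} \<subseteq> W" if "u1 \<le> a" "b \<le> u2" for a b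
    using c(3) that by (auto simp: image_subset_iff)
  have K: "compact K" "K \<subseteq> W" using Q cc[of u1 u2] c by (auto simp: K_def)
  \<comment> \<open>Deleting the open subarc of radius \<open>\<eta>\<close> around \<open>t\<close>
    breaks the loop: \<open>A\<close> meets \<open>Q\<close>, and \<open>B\<close> meets
    \<open>Q \<union> A\<close>, in a single point, so the union does not separate. A path in its
    complement from \<open>c t\<close> to the exterior of \<open>K\<close> leaves the deleted subarc
    for the last time at a point of the closure of the exterior. Letting \<open>\<eta>\<close> tend
    to 0 gives the claim.\<close>
  have key: "\<exists>x \<in> c ` {t-\<eta>..t+\<eta>}. x \<in> closure (ext K)"
    if \<eta>: "0 < \<eta>" "u1 < t - \<eta>" "t + \<eta> < u2" for \<eta>
  proof -
    define A B where "A = c ` {u1..t-\<eta>}" and "B = c ` {t+\<eta>..u2}"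
    have A: "compact A" "A \<subseteq> W" and B: "compact B" "B \<subseteq> W"
      unfolding A_def B_def using \<eta> t cc[of u1 "t-\<eta>"] cc[of "t+\<eta>" u2] cW[of u1 "t-\<eta>"] cW[of "t+\<eta>" u2] by auto
    have nA: "nonsep A" "nonsep B" unfolding A_def B_def
      using \<eta> t cW[of u1 "t-\<eta>"] cW[of "t+\<eta>" u2]
      by (auto intro!: nonsep_arc continuous_on_subset[OF c(1)] inj_on_subset[OF c(2)])
    have QA: "Q \<inter> A = {c u1}"
    proof -
      have "s = u1" if "s \<in> {u1..t-\<eta>}" "c s \<in> Q" for s
        using int[of s] that \<eta> t by force
      then show ?thesis using ends(1) \<eta> t unfolding A_def by fastforce
    qed
    have AB: "A \<inter> B = {}"
      using c(2) \<eta> t by (force simp: A_def B_def inj_on_def)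
    have QB: "Q \<inter> B = {c u2}"
    proof -
      have "s = u2" if "s \<in> {t+\<eta>..u2}" "c s \<in> Q" for s
        using int[of s] that \<eta> t by force
      then show ?thesis using ends(2) \<eta> t unfolding B_def by fastforce
    qed
    have n1: "nonsep (Q \<union> A)" by (rule nonsep_Un[OF Q(1,2) A Q(3) nA(1)]) (simp add: QA)
    have "(Q \<union> A) \<inter> B = {c u2}" using QB AB by auto
    then have n2: "nonsep (Q \<union> A \<union> B)"
      by (intro nonsep_Un n1 nA B) (use Q A in auto)
    define N where "N = - h ` (Q \<union> A \<union> B)"
    have "connected N" using n2 by (simp add: N_def nonsep_def)
    moreover have "open N"
    proof -
      have "compact (h ` (Q \<union> A \<union> B))" by (intro compact_h) (use Q A B in auto)
      then show ?thesis unfolding N_def using compact_imp_closed by blast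
    qed
    ultimately have pc: "path_connected N" by (simp add: connected_open_path_connected)
    have ct: "h (c t) \<in> N"
    proof -
      have "c t \<notin> Q" using int t by blast
      moreover have "c t \<notin> A" "c t \<notin> B"
        using c(2) t \<eta> by (force simp: A_def B_def inj_on_def)+
      moreover have "c t \<in> W" using c(3) t by auto
      ultimately show ?thesis
        unfolding N_def using h_image_eq[of "Q \<union> A \<union> B"] Q A B by simp
    qed
    have "outside (h ` K) \<noteq> {}"
      using unbounded_outside[OF compact_imp_bounded[OF compact_h[OF K]]] by auto
    then obtain w where w: "w \<in> outside (h ` K)" by blast
    have "A \<subseteq> c ` {u1..u2}" "B \<subseteq> c ` {u1..u2}" unfolding A_def B_def using \<eta> t by auto
    then have sub: "Q \<union> A \<union> B \<subseteq> K" by (auto simp: K_def)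
    have "w \<notin> h ` K" using w outside_no_overlap[of "h ` K"] by blast
    then have "w \<in> N" using image_mono[OF sub, of h] unfolding N_def by blast
    then obtain p where p: "path p" "path_image p \<subseteq> N" "pathstart p = h (c t)" "pathfinish p = w"
      using pc ct unfolding path_connected_def by blast
    define C where "C = h ` c ` {t-\<eta>..t+\<eta>}"
    have "compact C" unfolding C_def using \<eta> t cc cW by (intro compact_h) auto
    moreover have "pathstart p \<in> C" using p \<eta> by (auto simp: C_def)
    moreover have "pathfinish p \<notin> C"
    proof -
      have "C \<subseteq> h ` K" using \<eta> t unfolding C_def K_def by auto
      then show ?thesis using \<open>w \<notin> h ` K\<close> p(4) by blast
    qed
    ultimately obtain s where s: "0 \<le> s" "s < 1" "p s \<in> C" "\<And>t. s < t \<Longrightarrow> t \<le> 1 \<Longrightarrow> p t \<notin> C"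
      using path_last_exit[OF p(1) compact_imp_closed] by metis
    have KN: "h ` K \<inter> N \<subseteq> C"
    proof -
      have "K \<subseteq> (Q \<union> A \<union> B) \<union> c ` {t-\<eta>..t+\<eta>}"
      proof -
        have "{u1..u2} = {u1..t-\<eta>} \<union> {t+\<eta>..u2} \<union> {t-\<eta>..t+\<eta>}" using \<eta> t by auto
        then show ?thesis unfolding K_def A_def B_def by (auto simp: image_Un)
      qed
      then show ?thesis unfolding N_def C_def by blast
    qed
    have pN: "p v \<in> N" if "0 \<le> v" "v \<le> 1" for v
      using p(2) that by (auto simp: path_image_def)
    have out: "p v \<in> outside (h ` K)" if "s < v" "v \<le> 1" for v
    proof -
      have "connected (p ` {v..1})"
        using p(1) s that unfolding path_def
        by (intro connected_continuous_image) (auto elim: continuous_on_subset)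
      moreover have "p ` {v..1} \<subseteq> - h ` K"
      proof
        fix z assume "z \<in> p ` {v..1}"
        then obtain v' where v': "z = p v'" "v \<le> v'" "v' \<le> 1" by auto
        have "z \<notin> C" "z \<in> N" using s(4)[of v'] pN[of v'] v' that s by auto
        then show "z \<in> - h ` K" using KN by blast
      qed
      moreover have "w \<in> p ` {v..1}" "p v \<in> p ` {v..1}" using p that by (auto simp: pathfinish_def)
      ultimately have "connected_component (- h ` K) w (p v)"
        unfolding connected_component_def by blast
      then show ?thesis using w outside_same_component by blast
    qed
    have "p s \<in> closure (outside (h ` K))"
    proof -
      have "continuous_on {s..1} p" using p(1) s unfolding path_def by (auto elim: continuous_on_subset)
      moreover have "p ` {s<..1} \<subseteq> closure (outside (h ` K))" using out closure_subset by fastforce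
      moreover have "closure {s<..1} = {s..1}" using s by (simp add: closure_greaterThanAtMost)
      ultimately have "p ` {s..1} \<subseteq> closure (outside (h ` K))"
        using image_closure_subset[of "{s<..1}" p "closure (outside (h ` K))"] by simp
      then show ?thesis using s by auto
    qed
    moreover have "k ` closure (outside (h ` K)) \<subseteq> closure (ext K)"
      unfolding ext_def by (intro image_closure_subset cont_k closed_closure closure_subset)
    ultimately have "k (p s) \<in> closure (ext K)" by blast
    moreover have "k (p s) \<in> c ` {t-\<eta>..t+\<eta>}"
      using s(3) c(3) \<eta> t unfolding C_def by (auto simp: image_subset_iff)
    ultimately show ?thesis by blast
  qed
  have "c t \<in> closure (closure (ext K))"
    unfolding closure_approachable[of "c t" "closure (ext K)"]
  proof (intro allI impI)
    fix e :: real assume "e > 0"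
    have "continuous (at t) c"
      using c(1) t by (metis atLeastAtMost_iff continuous_on_interior greaterThanLessThan_iff interior_atLeastAtMost_real)
    then obtain d where d: "d > 0" "\<And>s. dist s t < d \<Longrightarrow> dist (c s) (c t) < e"
      using \<open>e > 0\<close> unfolding continuous_at_eps_delta by (metis dist_commute)
    define \<eta> where "\<eta> = min (d/2) (min ((t - u1)/2) ((u2 - t)/2))"
    have \<eta>: "0 < \<eta>" "u1 < t - \<eta>" "t + \<eta> < u2" "\<eta> < d"
      using d(1) t unfolding \<eta>_def by (auto simp: min_def field_simps)
    obtain x where x: "x \<in> c ` {t-\<eta>..t+\<eta>}" "x \<in> closure (ext K)" using key[OF \<eta>(1-3)] by blast
    then obtain s where "x = c s" "t - \<eta> \<le> s" "s \<le> t + \<eta>" by auto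
    then have "dist x (c t) < e" using d(2)[of s] \<eta> by (auto simp: dist_real_def)
    then show "\<exists>y\<in>closure (ext K). dist y (c t) < e" using x by blast
  qed
  then show ?thesis by (simp add: K_def)
qed

text \<open>The subarc \<open>\<alpha>\<close> of half-width \<open>r / (4 * L)\<close> about
  \<open>ts\<close> stays within \<open>r / 4\<close> of \<open>c ts\<close>, hence away from
  \<open>M\<close>, and comes close to the rest of the arc only near its own two ends, because the
  arc is biLipschitz. So \<open>enclosed_far_point\<close> applies to \<open>\<alpha>\<close> and
  the rest of the loop. One factor \<open>L^2\<close> in the result comes from the distance between
  the ends, the other from how near to an end the close points must be.\<close>

lemma loop_encloses:
  assumes L: "L \<ge> 1" and c: "bilip L c {t1..t2}" "c ` {t1..t2} \<subseteq> W" and ts: "t1 \<le> ts" "ts \<le> t2"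
    and M: "compact M" "connected M" "M \<subseteq> W" "c t1 \<in> M" "c t2 \<in> M"
    and r: "r > 0" "\<And>m. m \<in> M \<Longrightarrow> r \<le> dist (c ts) m"
  obtains y where "y \<in> fil (c ` {t1..t2} \<union> M)"
    "\<And>q. q \<in> c ` {t1..t2} \<union> M \<Longrightarrow> r / (16 * L^4) < dist y q"
proof -
  define w where "w = r / (4 * L)"
  define \<alpha> where "\<alpha> = c ` {ts-w..ts+w}"
  define \<beta> where "\<beta> = c ` {t1..ts-w} \<union> M \<union> c ` {ts+w..t2}"
  define e1 e2 where "e1 = c (ts - w)" and "e2 = c (ts + w)"
  define \<rho> where "\<rho> = r / (16 * L^4)"
  define u where "u = 2 * L^2 * \<rho>"
  have w: "w > 0" "L * w = r / 4" using L r by (auto simp: w_def)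
  have big: "w < ts - t1" "w < t2 - ts"
  proof -
    have "r \<le> L * (ts - t1)" "r \<le> L * (t2 - ts)"
      using r(2)[OF M(4)] bilipD(2)[OF c(1), of ts t1] r(2)[OF M(5)] bilipD(2)[OF c(1), of ts t2] ts by auto
    moreover have "L * w < r" using w r by simp
    ultimately have "L * w < L * (ts - t1)" "L * w < L * (t2 - ts)" by linarith+
    then show "w < ts - t1" "w < t2 - ts" using L by (simp_all add: mult_less_cancel_left_pos)
  qed
  have cont: "continuous_on {a..b} c" if "t1 \<le> a" "b \<le> t2" for a b
    using bilip_cont[OF bilip_subset[OF c(1)]] that by auto
  have comp: "compact (c ` {a..b})" if "t1 \<le> a" "b \<le> t2" for a b
    using that by (intro compact_continuous_image cont) auto
  have con: "connected (c ` {a..b})" if "t1 \<le> a" "b \<le> t2" for a b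
    using that by (intro connected_continuous_image cont) auto
  have cW: "c ` {a..b} \<subseteq> W" if "t1 \<le> a" "b \<le> t2" for a b
    using c(2) that by (auto simp: image_subset_iff)
  have L2: "1 \<le> L^2" using L by (simp add: one_le_power)
  have \<rho>: "\<rho> > 0" using r L by (simp add: \<rho>_def)
  have uL: "u = r / (8 * L^2)"
    using L by (simp add: u_def \<rho>_def field_simps power2_eq_square eval_nat_numeral)
  have \<rho>u: "2 * \<rho> \<le> u" unfolding u_def using mult_right_mono[OF L2, of "2 * \<rho>"] \<rho> by simp
  have ur: "u \<le> r / 8"
  proof -
    have "r / (8 * L^2) \<le> r / (8 * 1)" using r L2 by (intro divide_left_mono) auto
    then show ?thesis by (simp add: uL)
  qed
  have "c ` {t1..t2} \<union> M = \<alpha> \<union> \<beta>"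
  proof -
    have "{t1..t2} = {t1..ts-w} \<union> {ts-w..ts+w} \<union> {ts+w..t2}" using big w by auto
    then show ?thesis unfolding \<alpha>_def \<beta>_def by (auto simp: image_Un)
  qed
  moreover have "\<exists>y. y \<in> fil (\<alpha> \<union> \<beta>) \<and> (\<forall>q\<in>\<alpha> \<union> \<beta>. \<rho> < dist y q)"
  proof (rule enclosed_far_point[of \<alpha> \<beta> e1 e2 \<rho> u])
    show "compact \<alpha>" "connected \<alpha>" "\<alpha> \<subseteq> W" unfolding \<alpha>_def
      using big by (auto intro!: comp con cW[THEN subsetD])
    show "compact \<beta>" "\<beta> \<subseteq> W" unfolding \<beta>_def
      using big w M cW[of t1 "ts - w"] cW[of "ts + w" t2] by (auto intro!: comp compact_Un)
    have "connected (c ` {t1..ts-w} \<union> M)"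
      using big w M by (intro connected_Un con) (auto intro!: exI[of _ "c t1"] simp: disjoint_iff)
    then show "connected \<beta>" unfolding \<beta>_def
      using big w M by (intro connected_Un con) (auto simp: disjoint_iff intro!: exI[of _ "c t2"])
    show "e1 \<in> \<alpha>" "e1 \<in> \<beta>" "e2 \<in> \<alpha>" "e2 \<in> \<beta>"
      unfolding e1_def e2_def \<alpha>_def \<beta>_def using big w by auto
    show "\<rho> \<ge> 0" using \<rho> by simp
    have "2 * w \<le> L * dist e1 e2"
      using bilipD(1)[OF c(1), of "ts - w" "ts + w"] big w by (simp add: e1_def e2_def)
    then have "L * (2 * w) \<le> L^2 * dist e1 e2" using L
      by (simp add: power2_eq_square mult.assoc mult_left_mono)
    then have "r / 2 \<le> L^2 * dist e1 e2" using w by simp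
    then have "4 * u \<le> dist e1 e2" using L2 L unfolding uL by (simp add: field_simps)
    then show "2 * (u + \<rho>) < dist e1 e2" using \<rho>u \<rho> by (simp add: algebra_simps)
    fix p q assume p: "p \<in> \<alpha>" and q: "q \<in> \<beta>" and d: "dist p q \<le> 2 * \<rho>"
    obtain a where a: "p = c a" "ts - w \<le> a" "a \<le> ts + w" using p by (auto simp: \<alpha>_def)
    have at: "a \<in> {t1..t2}" using a big by auto
    have L2\<rho>: "L * (L * (2 * \<rho>)) = u" by (simp add: u_def power2_eq_square)
    consider "q \<in> M" | b where "q = c b" "t1 \<le> b" "b \<le> ts - w" | b where "q = c b" "ts + w \<le> b" "b \<le> t2"
      using q by (auto simp: \<beta>_def)
    then show "dist p e1 \<le> u \<or> dist p e2 \<le> u"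
    proof cases
      case 1
      have "r \<le> dist (c ts) q" using r 1 by blast
      moreover have "dist (c ts) p \<le> L * w"
      proof -
        have "dist (c ts) (c a) \<le> L * \<bar>ts - a\<bar>" using bilipD(2)[OF c(1) _ at, of ts] ts by simp
        also have "\<dots> \<le> L * w" using L a by (intro mult_left_mono) auto
        finally show ?thesis using a by simp
      qed
      ultimately have "r \<le> r / 4 + 2 * \<rho>" using d w dist_triangle[of "c ts" q p] by linarith
      then show ?thesis using \<rho>u ur r by linarith
    next
      case 2
      have "\<bar>a - b\<bar> \<le> L * dist p q" using bilipD(1)[OF c(1) at, of b] 2 big w a by auto
      also have "\<dots> \<le> L * (2 * \<rho>)" using d L by (intro mult_left_mono) auto
      finally have ab: "\<bar>a - (ts - w)\<bar> \<le> L * (2 * \<rho>)" using 2 a by auto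
      have "dist p e1 \<le> L * \<bar>a - (ts - w)\<bar>"
        unfolding e1_def a(1) using bilipD(2)[OF c(1) at, of "ts - w"] big w by auto
      also have "\<dots> \<le> L * (L * (2 * \<rho>))" using ab L by (intro mult_left_mono) auto
      finally show ?thesis using L2\<rho> by simp
    next
      case 3
      have "\<bar>a - b\<bar> \<le> L * dist p q" using bilipD(1)[OF c(1) at, of b] 3 big w a by auto
      also have "\<dots> \<le> L * (2 * \<rho>)" using d L by (intro mult_left_mono) auto
      finally have ab: "\<bar>a - (ts + w)\<bar> \<le> L * (2 * \<rho>)" using 3 a by auto
      have "dist p e2 \<le> L * \<bar>a - (ts + w)\<bar>"
        unfolding e2_def a(1) using bilipD(2)[OF c(1) at, of "ts + w"] big w by auto
      also have "\<dots> \<le> L * (L * (2 * \<rho>))" using ab L by (intro mult_left_mono) auto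
      finally show ?thesis using L2\<rho> by simp
    qed
  qed blast
  ultimately show thesis using that unfolding \<rho>_def by metis
qed

end

section \<open>Enclosed points in a homogeneous geodesic surface\<close>

definition geodesic_arc :: "(real \<Rightarrow> 'a::metric_space) \<Rightarrow> real \<Rightarrow> bool" where
  "geodesic_arc c d \<longleftrightarrow> (\<forall>s\<in>{0..d}. \<forall>t\<in>{0..d}. dist (c s) (c t) = \<bar>s - t\<bar>)"

lemma geodesic_arc_bilip: "geodesic_arc c d \<Longrightarrow> 1 \<le> L \<Longrightarrow> bilip L c {0..d}"
  by (auto simp: geodesic_arc_def bilip_def mult_le_cancel_right1)

definition separated :: "real \<Rightarrow> 'a::metric_space set \<Rightarrow> bool" where
  "separated d F \<longleftrightarrow> (\<forall>x\<in>F. \<forall>y\<in>F. x \<noteq> y \<longrightarrow> d \<le> dist x y)"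

lemma separated_subset: "separated d F \<Longrightarrow> G \<subseteq> F \<Longrightarrow> separated d G"
  unfolding separated_def by blast

lemma separated_mono: "separated d F \<Longrightarrow> e \<le> d \<Longrightarrow> separated e F"
  unfolding separated_def by force

lemma card_separated_le_cover:
  assumes F: "separated d F" and C: "finite C" "F \<subseteq> (\<Union>c\<in>C. B c)"
    and B: "\<And>c x y. c \<in> C \<Longrightarrow> x \<in> B c \<Longrightarrow> y \<in> B c \<Longrightarrow> dist x y < d"
  shows "finite F \<and> card F \<le> card C"
proof -
  have "\<forall>x\<in>F. \<exists>c\<in>C. x \<in> B c" using C by blast
  then obtain f where f: "\<And>x. x \<in> F \<Longrightarrow> f x \<in> C \<and> x \<in> B (f x)" by metis
  have "inj_on f F"
  proof (rule inj_onI)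
    fix x y assume xy: "x \<in> F" "y \<in> F" "f x = f y"
    then have "dist x y < d" using f[of x] f[of y] B[of "f x" x y] by auto
    then show "x = y" using F xy by (force simp: separated_def)
  qed
  moreover have "f ` F \<subseteq> C" using f by auto
  ultimately show ?thesis using C(1) by (meson card_inj_on_le finite_imageD finite_subset)
qed

lemma compact_separated_bound:
  fixes S :: "'a::metric_space set"
  assumes "compact S" "d > 0"
  obtains N :: nat where "\<And>F. F \<subseteq> S \<Longrightarrow> separated d F \<Longrightarrow> finite F \<and> card F \<le> N"
proof -
  have "\<forall>x\<in>S. open (ball x (d/2))" "S \<subseteq> (\<Union>x\<in>S. ball x (d/2))" using assms by auto
  then obtain C where C: "C \<subseteq> S" "finite C" "S \<subseteq> (\<Union>x\<in>C. ball x (d/2))"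
    using compactE_image[OF assms(1), of S "\<lambda>x. ball x (d/2)"] by metis
  show thesis
  proof (rule that[of "card C"])
    fix F assume F: "F \<subseteq> S" "separated d F"
    show "finite F \<and> card F \<le> card C"
    proof (rule card_separated_le_cover[OF F(2) C(2)])
      show "F \<subseteq> (\<Union>x\<in>C. ball x (d/2))" using F C by blast
      show "dist x y < d" if "x \<in> ball c (d/2)" "y \<in> ball c (d/2)" for c x y
        using that dist_triangle_half_r[of c x d y] by auto
    qed
  qed
qed

lemma maximal_separated:
  assumes bd: "\<And>F. F \<subseteq> S \<Longrightarrow> separated d F \<Longrightarrow> finite F \<and> card F \<le> N" and "d > 0"
  obtains F where "F \<subseteq> S" "separated d F" "finite F" "\<And>x. x \<in> S \<Longrightarrow> \<exists>w\<in>F. dist x w < d"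
proof -
  define P where "P F \<longleftrightarrow> F \<subseteq> S \<and> separated d F" for F
  have "P {}" by (auto simp: P_def separated_def)
  then obtain F where F: "P F" "\<And>G. P G \<Longrightarrow> card G \<le> card F"
    using ex_has_greatest_nat[of P "{}" card "N + 1"] bd unfolding P_def by (metis le_imp_less_Suc Suc_eq_plus1)
  have fin: "finite F" using F(1) bd by (auto simp: P_def)
  show thesis
  proof (rule that[of F])
    show "F \<subseteq> S" "separated d F" using F(1) by (auto simp: P_def)
    show "finite F" by (rule fin)
    fix x assume x: "x \<in> S"
    show "\<exists>w\<in>F. dist x w < d"
    proof (rule ccontr)
      assume no: "\<not> ?thesis"
      then have "x \<notin> F" using \<open>d > 0\<close> by force
      have "P (insert x F)" using F(1) no x by (auto simp: P_def separated_def not_less dist_commute)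
      then have "card (insert x F) \<le> card F" using F(2) by blast
      then show False using \<open>x \<notin> F\<close> fin by simp
    qed
  qed
qed

text \<open>\<open>A\<close> collects the points at which local homogeneity holds with the uniform constants \<open>L\<close>, \<open>\<tau>\<close>;
  it is dense near \<open>x0\<close> but need not be closed.\<close>

locale hom_surface = planar_chart W h k
  for W :: "'a::metric_space set" and h :: "'a \<Rightarrow> complex" and k +
  fixes x0 :: 'a and A :: "'a set" and L \<tau> r1 :: real
  assumes geodesics: "\<exists>c. geodesic_arc c (dist x y) \<and> c 0 = x \<and> c (dist x y) = y"
    and L: "1 \<le> L" and \<tau>: "0 < \<tau>" and r1: "0 < r1" and r1_\<tau>: "16 * L\<^sup>2 * r1 \<le> \<tau>"
    and x0A: "x0 \<in> A"
    and dense: "x \<in> ball x0 (\<tau> / (4 * L)) \<Longrightarrow> 0 < e \<Longrightarrow> \<exists>a\<in>A. dist x a < e"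
    and arcs: "z \<in> A \<Longrightarrow> \<exists>\<sigma>. \<sigma> 0 = z \<and> bilip L \<sigma> {-\<tau>..\<tau>}"
    and homog: "y \<in> A \<Longrightarrow> z \<in> A \<Longrightarrow> \<exists>f. f y = z \<and> ball z (\<tau> / L) \<subseteq> f ` ball y \<tau> \<and>
         (\<forall>u\<in>ball y \<tau>. \<forall>v\<in>ball y \<tau>. dist u v \<le> L * dist (f u) (f v) \<and> dist (f u) (f v) \<le> L * dist u v)"
    and compact_small: "closed S \<Longrightarrow> S \<subseteq> ball x0 (4 * r1) \<Longrightarrow> compact S \<and> S \<subseteq> W"
    and fil_bounded: "compact K \<Longrightarrow> K \<subseteq> ball x0 (4 * r1) \<Longrightarrow> fil K \<subseteq> ball x0 (\<tau> / (4 * L))"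
begin

lemma LL [simp]: "0 < L" "0 \<le> L" "L \<noteq> 0" using L by auto

lemma small_cball:
  assumes "x \<in> ball x0 (2 * r1)" "R \<le> 2 * r1"
  shows "cball x R \<subseteq> ball x0 (4 * r1)" "compact (cball x R)" "cball x R \<subseteq> W"
proof -
  show 1: "cball x R \<subseteq> ball x0 (4 * r1)"
  proof
    fix y assume "y \<in> cball x R"
    then show "y \<in> ball x0 (4 * r1)" using assms dist_triangle[of x0 y x] by auto
  qed
  show "compact (cball x R)" "cball x R \<subseteq> W" using compact_small[OF closed_cball 1] by auto
qed

lemma compact_sub:
  assumes "compact K" "K \<subseteq> cball x R" "x \<in> ball x0 (2 * r1)" "R \<le> 2 * r1"
  shows "K \<subseteq> ball x0 (4 * r1)" "K \<subseteq> W" "fil K \<subseteq> ball x0 (\<tau> / (4 * L))"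
  using small_cball[OF assms(3,4)] assms fil_bounded by blast+

definition crosscut :: "'a set \<Rightarrow> 'a \<Rightarrow> (real \<Rightarrow> 'a) \<Rightarrow> real \<Rightarrow> real \<Rightarrow> bool" where
  "crosscut K z \<sigma> a b \<longleftrightarrow> \<sigma> 0 = z \<and> bilip L \<sigma> {a..b} \<and> a < 0 \<and> 0 < b \<and> \<sigma> a \<in> K \<and> \<sigma> b \<in> K \<and>
     (\<forall>t. a < t \<longrightarrow> t < b \<longrightarrow> \<sigma> t \<in> fil K - K)"

lemma half_crosscut:
  fixes \<sigma> :: "real \<Rightarrow> 'a"
  assumes K: "compact K" "K \<subseteq> W" and z: "\<sigma> 0 \<in> fil K - K"
    and c: "continuous_on {0..T} \<sigma>" and T: "T \<ge> 0" and out: "\<sigma> T \<notin> fil K"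
  obtains b where "0 < b" "b \<le> T" "\<sigma> b \<in> K" "\<And>t. 0 \<le> t \<Longrightarrow> t < b \<Longrightarrow> \<sigma> t \<in> fil K - K"
proof -
  define S where "S = {0..T} \<inter> \<sigma> -` K"
  have "closed S" unfolding S_def
    by (intro continuous_closed_preimage c compact_imp_closed K) auto
  then have "compact S" by (simp add: S_def compact_eq_bounded_closed bounded_Int)
  moreover have "S \<noteq> {}"
  proof -
    have "\<sigma> ` {0..T} \<inter> K \<noteq> {}"
    proof (rule connected_meets[OF K connected_continuous_image[OF c]])
      show "\<sigma> ` {0..T} \<inter> fil K \<noteq> {}" using z T by force
      show "\<not> \<sigma> ` {0..T} \<subseteq> fil K" using out T by force
    qed simp
    then show ?thesis by (auto simp: S_def)
  qed
  ultimately obtain b where b: "b \<in> S" "\<And>t. t \<in> S \<Longrightarrow> b \<le> t"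
    using compact_attains_inf[of S] by blast
  have b': "0 \<le> b" "b \<le> T" "\<sigma> b \<in> K" using b(1) by (auto simp: S_def)
  have "b \<noteq> 0" using z b' by auto
  show thesis
  proof (rule that[of b])
    show "0 < b" "b \<le> T" "\<sigma> b \<in> K" using b' \<open>b \<noteq> 0\<close> by auto
    fix t assume t: "0 \<le> t" "t < b"
    have "\<sigma> ` {0..t} \<inter> K = {}" using b(2) t b' by (force simp: S_def)
    moreover have "connected (\<sigma> ` {0..t})"
      using t b' by (intro connected_continuous_image continuous_on_subset[OF c]) auto
    ultimately have "\<sigma> ` {0..t} \<subseteq> fil K"
    proof (intro connected_subset_fil K)
      show "\<sigma> ` {0..t} \<inter> fil K \<noteq> {}" using z t by force
    qed
    moreover have "\<sigma> t \<in> \<sigma> ` {0..t}" using t by auto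
    ultimately show "\<sigma> t \<in> fil K - K" using \<open>\<sigma> ` {0..t} \<inter> K = {}\<close> by blast
  qed
qed

text \<open>Each end of the arc through \<open>z\<close> is at distance at least
  \<open>\<tau> / L\<close> from \<open>z\<close>, while two points of \<open>fil K\<close> are less
  than \<open>\<tau> / (2 * L)\<close> apart. So the arc leaves the hull on both sides, and its
  first exits lie on \<open>K\<close>.\<close>

lemma ex_crosscut:
  assumes K: "compact K" "K \<subseteq> ball x0 (4 * r1)" and z: "z \<in> A" "z \<in> fil K - K"
  obtains \<sigma> a b where "crosscut K z \<sigma> a b"
proof -
  obtain \<sigma> where \<sigma>: "\<sigma> 0 = z" "bilip L \<sigma> {-\<tau>..\<tau>}" using arcs[OF z(1)] by blast
  have KW: "K \<subseteq> W" using compact_small[OF compact_imp_closed K(2)] K(1) by auto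
  have far: "\<sigma> t \<notin> fil K" if "\<bar>t\<bar> = \<tau>" for t
  proof
    assume "\<sigma> t \<in> fil K"
    then have "dist x0 (\<sigma> t) < \<tau> / (4 * L)" "dist x0 z < \<tau> / (4 * L)" using fil_bounded[OF K] z by auto
    then have "dist (\<sigma> 0) (\<sigma> t) < \<tau> / (2 * L)" using dist_triangle3[of z "\<sigma> t" x0] \<sigma>(1) by simp
    then have "L * dist (\<sigma> 0) (\<sigma> t) < L * (\<tau> / (2 * L))" by (intro mult_strict_left_mono) auto
    then have "L * dist (\<sigma> 0) (\<sigma> t) < \<tau> / 2" by simp
    moreover have "\<tau> \<le> L * dist (\<sigma> 0) (\<sigma> t)"
    proof -
      have "0 \<in> {-\<tau>..\<tau>}" "t \<in> {-\<tau>..\<tau>}" using that \<tau> by auto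
      from bilipD(1)[OF \<sigma>(2) this] show ?thesis using that by simp
    qed
    ultimately show False using \<tau> by simp
  qed
  have cont: "continuous_on {-\<tau>..\<tau>} \<sigma>" by (rule bilip_cont[OF \<sigma>(2)])
  obtain b where b: "0 < b" "b \<le> \<tau>" "\<sigma> b \<in> K" "\<And>t. 0 \<le> t \<Longrightarrow> t < b \<Longrightarrow> \<sigma> t \<in> fil K - K"
    using half_crosscut[OF K(1) KW, of \<sigma> \<tau>] \<sigma>(1) z(2) \<tau> far[of \<tau>] continuous_on_subset[OF cont, of "{0..\<tau>}"] by auto
  obtain a where a: "0 < a" "a \<le> \<tau>" "\<sigma> (- a) \<in> K" "\<And>t. 0 \<le> t \<Longrightarrow> t < a \<Longrightarrow> \<sigma> (- t) \<in> fil K - K"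
  proof (rule half_crosscut[OF K(1) KW, of "\<sigma> \<circ> uminus" \<tau>])
    show "continuous_on {0..\<tau>} (\<sigma> \<circ> uminus)"
      using \<tau> by (intro continuous_on_compose continuous_on_subset[OF cont]) (auto intro!: continuous_intros)
  qed (use \<sigma>(1) z(2) \<tau> far[of "-\<tau>"] in auto)
  have "crosscut K z \<sigma> (- a) b"
    unfolding crosscut_def
  proof (intro conjI allI impI)
    show "bilip L \<sigma> {- a..b}" using \<sigma>(2) a b by (auto elim: bilip_subset)
    fix t assume t: "- a < t" "t < b"
    show "\<sigma> t \<in> fil K - K"
      using a(4)[of "-t"] b(4)[of t] t by (cases "t \<ge> 0") auto
  qed (use \<sigma> a b in auto)
  then show thesis using that by blast
qed

text \<open>The factor of \<open>fil_cball\<close>: \<open>R\<close> from the centre to an exit of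
  the arc, \<open>2 * L^2 * R\<close> from the exit to the middle of the arc, and \<open>R\<close>
  for replacing the given point by one of \<open>A\<close>; the remaining unit is slack.\<close>

definition Cf :: real where "Cf = 2 * L\<^sup>2 + 3"

lemma L2_ge: "1 \<le> L\<^sup>2" using L by (simp add: one_le_power)

lemma Cf_ge: "5 \<le> Cf" using L2_ge by (simp add: Cf_def)

text \<open>A point enclosed by a set of diameter comparable to \<open>R\<close> lies on a biLipschitz arc that
  leaves through the set in both directions; its two exits are close, hence so is the point.\<close>

lemma fil_cball:
  assumes x: "x \<in> ball x0 r1" and R: "0 < R" "R < r1" and K: "compact K" "K \<subseteq> cball x R"
  shows "fil K \<subseteq> ball x (Cf * R)"
proof
  fix y assume y: "y \<in> fil K"
  have Ks: "K \<subseteq> ball x0 (4 * r1)" "K \<subseteq> W" "fil K \<subseteq> ball x0 (\<tau> / (4 * L))"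
    using compact_sub[OF K] x R by auto
  show "y \<in> ball x (Cf * R)"
  proof (cases "y \<in> K")
    case True
    have "R < Cf * R" using Cf_ge R by simp
    then show ?thesis using True K(2) by auto
  next
    case False
    have op: "open (fil K - K)" by (rule open_fil_minus[OF K(1) Ks(2)])
    obtain e where e: "e > 0" "ball y e \<subseteq> fil K - K"
      using op y False open_contains_ball by blast
    have "y \<in> ball x0 (\<tau> / (4 * L))" using y Ks(3) by blast
    \<comment> \<open>Arcs exist only at points of \<open>A\<close>. The enclosed part is open, so
      \<open>y\<close> can be replaced by such a point without leaving it.\<close>
    then obtain z where "z \<in> A" "dist y z < min e R" using dense[of y "min e R"] e R by auto
    then have "\<exists>z\<in>A. z \<in> fil K - K \<and> dist y z < R" using e(2) by force
    then obtain z where z: "z \<in> A" "z \<in> fil K - K" "dist y z < R" by blast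
    obtain \<sigma> a b where cc: "crosscut K z \<sigma> a b" using ex_crosscut[OF K(1) Ks(1) z(1,2)] by blast
    have ab: "\<sigma> 0 = z" "bilip L \<sigma> {a..b}" "a < 0" "0 < b" "\<sigma> a \<in> K" "\<sigma> b \<in> K"
      using cc by (auto simp: crosscut_def)
    then have m: "0 \<in> {a..b}" "a \<in> {a..b}" "b \<in> {a..b}" by auto
    have db: "dist x (\<sigma> b) \<le> R" "dist x (\<sigma> a) \<le> R" using ab K(2) by auto
    then have "dist (\<sigma> a) (\<sigma> b) \<le> 2 * R"
      using dist_triangle3[of "\<sigma> a" "\<sigma> b" x] by linarith
    then have "L * dist (\<sigma> a) (\<sigma> b) \<le> L * (2 * R)" by (intro mult_left_mono) auto
    then have "\<bar>b\<bar> \<le> L * (2 * R)" using bilipD(1)[OF ab(2) m(2,3)] ab(3,4) by linarith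
    then have "L * \<bar>b\<bar> \<le> L * (L * (2 * R))" by (intro mult_left_mono) auto
    then have "dist z (\<sigma> b) \<le> 2 * L\<^sup>2 * R"
    proof -
      have "dist z (\<sigma> b) \<le> L * (L * (2 * R))"
        using order_trans[OF bilipD(2)[OF ab(2) m(1,3)]] ab(1) \<open>L * \<bar>b\<bar> \<le> L * (L * (2 * R))\<close>
        by (metis abs_minus_cancel diff_0)
      then show ?thesis by (simp add: power2_eq_square mult_ac)
    qed
    moreover note db(1)
    moreover have "dist x y \<le> dist x (\<sigma> b) + dist z (\<sigma> b) + dist y z"
      using dist_triangle[of x y "\<sigma> b"] dist_triangle[of "\<sigma> b" y z] by (simp add: dist_commute)
    ultimately have "dist x y < R + 2 * L\<^sup>2 * R + R" using z(3) by simp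
    also have "\<dots> \<le> Cf * R" using R by (simp add: Cf_def algebra_simps)
    finally show ?thesis by simp
  qed
qed


section \<open>Sets tiled by boundedly many small continua\<close>

text \<open>Non-separation is part of the notion because chunks are later joined to arcs by
  Janiszewski's theorem.\<close>

definition chunk :: "real \<Rightarrow> 'a set \<Rightarrow> bool" where
  "chunk d S \<longleftrightarrow> compact S \<and> connected S \<and> nonsep S \<and> S \<subseteq> W \<and> (\<forall>p\<in>S. \<forall>q\<in>S. dist p q \<le> d)"

definition tiled :: "nat \<Rightarrow> real \<Rightarrow> 'a set \<Rightarrow> bool" where
  "tiled n d K \<longleftrightarrow> (\<exists>F. finite F \<and> card F \<le> n \<and> \<Union>F = K \<and> (\<forall>S\<in>F. chunk d S))"

lemma tiled_mono: "tiled n d K \<Longrightarrow> n \<le> m \<Longrightarrow> d \<le> e \<Longrightarrow> tiled m e K"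
proof -
  assume a: "tiled n d K" "n \<le> m" "d \<le> e"
  obtain F where F: "finite F" "card F \<le> n" "\<Union>F = K" "\<forall>S\<in>F. chunk d S"
    using a(1) by (auto simp: tiled_def)
  have "chunk e S" if "S \<in> F" for S
    using F(4) that a(3) unfolding chunk_def by (meson order_trans)
  then show ?thesis using F a(2) unfolding tiled_def by (intro exI[of _ F]) auto
qed

lemma tiled_Un: assumes "tiled n d K" "tiled m d M" shows "tiled (n + m) d (K \<union> M)"
proof -
  obtain F G where "finite F" "card F \<le> n" "\<Union>F = K" "\<forall>S\<in>F. chunk d S"
    "finite G" "card G \<le> m" "\<Union>G = M" "\<forall>S\<in>G. chunk d S" using assms by (auto simp: tiled_def)
  then show ?thesis unfolding tiled_def
    by (intro exI[of _ "F \<union> G"]) (auto intro: order_trans[OF card_Un_le])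
qed

lemma tiled_chunk: "chunk d S \<Longrightarrow> tiled 1 d S"
  unfolding tiled_def by (rule exI[of _ "{S}"]) auto

lemma tiledD: assumes "tiled n d K" shows "compact K" "K \<subseteq> W"
  using assms by (auto simp: tiled_def chunk_def compact_Union)

lemma tiled_curve:
  assumes "bilip L c {a..b}" "c ` {a..b} \<subseteq> W" "a \<le> b" "L * (b - a) \<le> real m * d" "1 \<le> m"
  shows "tiled m d (c ` {a..b})"
  using assms
proof (induction m arbitrary: a)
  case (Suc m)
  have base: "chunk d (c ` {a..e})" if "a \<le> e" "e \<le> b" "L * (e - a) \<le> d" for e
    unfolding chunk_def
  proof (intro conjI)
    have bl: "bilip L c {a..e}" using Suc.prems(1) that by (auto elim: bilip_subset)
    show "compact (c ` {a..e})" "connected (c ` {a..e})"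
      by (auto intro!: compact_continuous_image connected_continuous_image bilip_cont[OF bl])
    show "c ` {a..e} \<subseteq> W" using Suc.prems(2) that by (auto simp: image_subset_iff)
    then show "nonsep (c ` {a..e})"
      using that by (intro nonsep_arc bilip_cont[OF bl] bilip_inj[OF bl])
    show "\<forall>p\<in>c ` {a..e}. \<forall>q\<in>c ` {a..e}. dist p q \<le> d"
    proof (clarify)
      fix s t assume st: "s \<in> {a..e}" "t \<in> {a..e}"
      have "dist (c s) (c t) \<le> L * \<bar>s - t\<bar>" by (rule bilipD(2)[OF bl st])
      also have "\<dots> \<le> L * (e - a)" using st by (intro mult_left_mono) auto
      finally show "dist (c s) (c t) \<le> d" using that by simp
    qed
  qed
  show ?case
  proof (cases "L * (b - a) \<le> d")
    case True
    have "tiled 1 d (c ` {a..b})" by (rule tiled_chunk[OF base]) (use True Suc.prems in auto)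
    then show ?thesis by (rule tiled_mono) auto
  next
    case False
    \<comment> \<open>A step of parameter length \<open>d / L\<close> has an image of diameter at
      most \<open>d\<close>; it uses up one of the \<open>Suc m\<close> chunks.\<close>
    define e where "e = a + d / L"
    have "m \<noteq> 0" using False Suc.prems by (intro notI) simp
    moreover have d: "d \<ge> 0"
    proof (rule ccontr)
      assume "\<not> 0 \<le> d"
      then have "real (Suc m) * d < 0" by (simp add: mult_pos_neg)
      moreover have "0 \<le> L * (b - a)" using Suc.prems by simp
      ultimately show False using Suc.prems by linarith
    qed
    have Le: "L * (e - a) = d" by (simp add: e_def)
    have e: "a \<le> e" "e \<le> b"
    proof -
      show "a \<le> e" using d by (simp add: e_def)
      have "L * (e - a) \<le> L * (b - a)" using Le False by simp
      then show "e \<le> b" by simp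
    qed
    have "tiled m d (c ` {e..b})"
    proof (rule Suc.IH)
      show "bilip L c {e..b}" using Suc.prems(1) e by (auto elim: bilip_subset)
      show "c ` {e..b} \<subseteq> W" using Suc.prems(2) e by (auto simp: image_subset_iff)
      have "L * (b - e) = L * (b - a) - d" using Le by (simp add: algebra_simps)
      then show "L * (b - e) \<le> real m * d" using Suc.prems(4) by (simp add: algebra_simps)
    qed (use e \<open>m \<noteq> 0\<close> in auto)
    moreover have "tiled 1 d (c ` {a..e})" by (rule tiled_chunk[OF base]) (use e Le in auto)
    ultimately have "tiled (1 + m) d (c ` {a..e} \<union> c ` {e..b})" by (intro tiled_Un)
    moreover have "c ` {a..e} \<union> c ` {e..b} = c ` {a..b}"
      using e by (simp add: image_Un[symmetric] ivl_disj_un_two_touch)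
    ultimately show ?thesis by simp
  qed
qed simp

lemma segment_to_center:
  fixes x y :: 'a
  obtains T where "connected T" "x \<in> T" "y \<in> T" "T \<subseteq> cball x (dist x y)"
proof -
  obtain c where c: "geodesic_arc c (dist x y)" "c 0 = x" "c (dist x y) = y"
    using geodesics[of x y] by blast
  show thesis
  proof (rule that[of "c ` {0..dist x y}"])
    show "connected (c ` {0..dist x y})"
      by (intro connected_continuous_image bilip_cont[OF geodesic_arc_bilip[OF c(1) order_refl]]) auto
    show "x \<in> c ` {0..dist x y}" using c(2) by force
    have "c (dist x y) \<in> c ` {0..dist x y}" by (rule imageI) simp
    then show "y \<in> c ` {0..dist x y}" by (simp add: c(3))
    have "dist (c 0) (c t) = \<bar>0 - t\<bar>" if "0 \<le> t" "t \<le> dist x y" for t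
      using c(1) that unfolding geodesic_arc_def by force
    then show "c ` {0..dist x y} \<subseteq> cball x (dist x y)" using c(2) by auto
  qed
qed

lemma connected_star:
  fixes x :: 'a
  assumes "\<And>y. y \<in> S \<Longrightarrow> cball x (dist x y) \<subseteq> S"
  shows "connected S"
proof (cases "S = {}")
  case False
  have "\<exists>T. connected T \<and> x \<in> T \<and> y \<in> T \<and> T \<subseteq> S" if "y \<in> S" for y
    using segment_to_center[of x y] assms[OF that] by (metis order_trans)
  then obtain T where T: "\<And>y. y \<in> S \<Longrightarrow> connected (T y) \<and> x \<in> T y \<and> y \<in> T y \<and> T y \<subseteq> S" by metis
  have "connected (\<Union>y\<in>S. T y)" using T by (intro connected_Union) auto
  moreover have "(\<Union>y\<in>S. T y) = S" using T by blast
  ultimately show ?thesis by simp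
qed simp

lemma connected_cball: "connected (cball x R)" for x :: 'a
  by (rule connected_star[of _ x]) auto

lemma connected_ball: "connected (ball x R)" for x :: 'a
  by (rule connected_star[of _ x]) auto

text \<open>Adding the inside to a connected set keeps it connected, and what remains as complement
  is the connected exterior. So filling turns a ball, which may well separate the plane, into a
  legitimate tile.\<close>

lemma chunk_fil:
  assumes "compact K" "connected K" "K \<subseteq> W" "\<And>p q. p \<in> fil K \<Longrightarrow> q \<in> fil K \<Longrightarrow> dist p q \<le> d"
  shows "chunk d (fil K)"
  unfolding chunk_def
proof (intro conjI ballI)
  have eq: "h ` fil K = - outside (h ` K)" by (auto simp: fil_def image_image)
  show "compact (fil K)" by (rule compact_fil[OF assms(1,3)])
  have "connected (h ` K \<union> inside (h ` K))"
    by (intro connected_with_inside compact_imp_closed compact_h connected_continuous_image cont_h assms)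
  then have "connected (k ` (h ` K \<union> inside (h ` K)))" by (intro connected_continuous_image cont_k)
  then show "connected (fil K)" unfolding fil_def by (simp add: union_with_inside)
  show "nonsep (fil K)" unfolding nonsep_def eq
    using connected_outside[of "h ` K"] compact_imp_bounded[OF compact_h[OF assms(1,3)]] by simp
qed (use assms(4) fil_subset_W in auto)

text \<open>Otherwise the exterior of \<open>K\<close> would contain \<open>x\<close>. Being
  unbounded in the chart it is not confined to the compact ball, and being connected it would have
  to cross the sphere, which lies in \<open>K\<close>.\<close>

lemma sphere_encloses:
  assumes x: "x \<in> W" and K: "compact K" "K \<subseteq> W" "{w. dist x w = R} \<subseteq> K" "compact (cball x R)" "cball x R \<subseteq> W"
    and R: "0 \<le> R"
  shows "x \<in> fil K"
proof (rule ccontr)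
  assume "x \<notin> fil K"
  then have "x \<in> ext K" using x by (simp add: fil_eq)
  have bK: "bounded (h ` K)" by (rule compact_imp_bounded[OF compact_h[OF K(1,2)]])
  have "connected (ext K)" unfolding ext_def
    by (intro connected_continuous_image cont_k connected_outside bK) auto
  moreover have "\<not> ext K \<subseteq> cball x R"
  proof
    assume "ext K \<subseteq> cball x R"
    then have "outside (h ` K) \<subseteq> h ` cball x R"
    proof -
      assume "ext K \<subseteq> cball x R"
      then have "h ` k ` outside (h ` K) \<subseteq> h ` cball x R" unfolding ext_def by (rule image_mono)
      then show ?thesis by (simp add: image_image)
    qed
    then have "bounded (outside (h ` K))"
      using compact_imp_bounded[OF compact_h[OF K(4,5)]] bounded_subset by blast
    then show False using unbounded_outside[OF bK] by blast
  qed
  then obtain y where "y \<in> ext K" "y \<notin> cball x R" by blast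
  then have y: "y \<in> ext K" "R < dist x y" by auto
  ultimately have "connected ((\<lambda>v. dist x v) ` ext K)"
    by (intro connected_continuous_image continuous_intros)
  moreover have "dist x x \<in> (dist x) ` ext K" "dist x y \<in> (dist x) ` ext K" using \<open>x \<in> ext K\<close> y by blast+
  ultimately have "{dist x x..dist x y} \<subseteq> (dist x) ` ext K" by (rule connected_contains_Icc)
  moreover have "R \<in> {dist x x..dist x y}" using y R by simp
  ultimately obtain w where "w \<in> ext K" "dist x w = R" by (metis (no_types, opaque_lifting) imageE subsetD)
  then have "w \<in> K" using K(3) by auto
  then show False using \<open>w \<in> ext K\<close> subset_fil[OF K(2)] ext_fil_disjoint by blast
qed

section \<open>Points enclosed at a given scale\<close>

text \<open>Small enough that a chunk of size \<open>\<epsilon> * g\<close> cannot contain both ends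
  of a crosscut whose centre is \<open>g / 4\<close> away from its ends, and that an
  \<open>L\<close>-biLipschitz image of a chunk of size \<open>\<epsilon> * s\<close> is short
  compared with \<open>s / L\<close>.\<close>

definition \<epsilon> :: real where "\<epsilon> = 1 / (200 * L\<^sup>2)"

lemma eps: "0 < \<epsilon>" "\<epsilon> \<le> 1 / 200"
  using L2_ge by (auto simp: \<epsilon>_def intro!: divide_left_mono)

text \<open>Every size is measured in units of \<open>s\<close>: inner radius 1, outer radius
  \<open>\<Lambda>\<close>, tile size \<open>\<epsilon>\<close>. Hence \<open>n\<close> and
  \<open>\<Lambda>\<close> can be kept while the scale shrinks.\<close>

definition enclosed :: "nat \<Rightarrow> real \<Rightarrow> real \<Rightarrow> 'a \<Rightarrow> 'a set \<Rightarrow> bool" where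
  "enclosed n \<Lambda> s y K \<longleftrightarrow> 0 < s \<and> tiled n (\<epsilon> * s) K \<and> K \<subseteq> cball y (\<Lambda> * s) \<and> y \<in> fil K \<and> (\<forall>q\<in>K. s \<le> dist y q)"

lemma enclosed_mono:
  assumes "enclosed n \<Lambda> s y K" "n \<le> m" "\<Lambda> \<le> \<Lambda>'" shows "enclosed m \<Lambda>' s y K"
proof -
  have "\<Lambda> * s \<le> \<Lambda>' * s" using assms by (intro mult_right_mono) (auto simp: enclosed_def)
  then have "cball y (\<Lambda> * s) \<subseteq> cball y (\<Lambda>' * s)" by (rule subset_cball)
  moreover have "tiled m (\<epsilon> * s) K"
    using assms tiled_mono[of n "\<epsilon> * s" K m "\<epsilon> * s"] by (simp add: enclosed_def)
  ultimately show ?thesis using assms unfolding enclosed_def by blast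
qed

text \<open>Chosen so that a ball of radius \<open>16 * \<rho> * s\<close> has its filling within
  \<open>\<epsilon> * s / 4\<close> of the centre, since
  \<open>Cf * 16 * \<rho> = \<epsilon> / 4\<close>; the filled ball is then a tile for scale
  \<open>s\<close>.\<close>

definition \<rho> :: real where "\<rho> = \<epsilon> / (64 * Cf)"

lemma rho: "0 < \<rho>" "\<rho> \<le> 1 / 64"
proof -
  show "0 < \<rho>" using eps Cf_ge by (simp add: \<rho>_def)
  have "\<epsilon> / (64 * Cf) \<le> 1 / 64" using eps Cf_ge by (simp add: field_simps)
  then show "\<rho> \<le> 1 / 64" by (simp add: \<rho>_def)
qed

text \<open>Balls around a maximal separated subset of the sphere of radius \<open>3 * s\<close>
  cover the sphere; their fillings are chunks and together enclose \<open>x\<close>. With at most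
  \<open>n\<close> of them this would be an enclosing set at scale \<open>s\<close>. Radius
  \<open>3 * s\<close> leaves room for the fillings between radii \<open>s\<close> and
  \<open>4 * s\<close>.\<close>

lemma sphere_packing:
  assumes x: "x \<in> ball x0 (r1 / 2)" and s: "0 < s" "8 * s < r1" and none: "\<And>K. \<not> enclosed n 4 s x K"
  obtains F where "finite F" "card F = n + 1" "F \<subseteq> {w. dist x w = 3 * s}" "separated (16 * \<rho> * s) F"
proof -
  define S where "S = {w. dist x w = 3 * s}"
  define \<delta> where "\<delta> = 16 * \<rho> * s"
  have \<delta>: "0 < \<delta>" "Cf * \<delta> = \<epsilon> * s / 4"
  proof -
    show "0 < \<delta>" using rho s by (simp add: \<delta>_def)
    show "Cf * \<delta> = \<epsilon> * s / 4" using Cf_ge by (simp add: \<delta>_def \<rho>_def field_simps)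
  qed
  have \<delta>s: "\<delta> \<le> s" using rho s unfolding \<delta>_def by (simp add: mult_left_le_one_le)
  have xx: "x \<in> ball x0 (2 * r1)" using x r1 by auto
  have cb: "compact (cball x (4 * s))" "cball x (4 * s) \<subseteq> W" "cball x (3 * s) \<subseteq> W" "compact (cball x (3 * s))"
    using small_cball[OF xx] s by auto
  have "S \<subseteq> cball x (3 * s)" by (auto simp: S_def)
  moreover have "closed S" unfolding S_def by (intro closed_Collect_eq continuous_intros)
  ultimately have cS: "compact S" using cb closed_Int_compact by (metis inf.absorb_iff1)
  have "\<exists>F. F \<subseteq> S \<and> separated \<delta> F \<and> n + 1 \<le> card F \<and> finite F"
  proof (rule ccontr)
    assume no: "\<not> ?thesis"
    obtain N where N: "\<And>F. F \<subseteq> S \<Longrightarrow> separated \<delta> F \<Longrightarrow> finite F \<and> card F \<le> N"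
      using compact_separated_bound[OF cS \<delta>(1)] by metis
    obtain F where F: "F \<subseteq> S" "separated \<delta> F" "finite F" "\<And>x. x \<in> S \<Longrightarrow> \<exists>w\<in>F. dist x w < \<delta>"
      using maximal_separated[OF N \<delta>(1)] by metis
    have cardF: "card F \<le> n" using no F by (metis not_less_eq_eq Suc_eq_plus1)
    define K where "K = (\<Union>w\<in>F. fil (cball w \<delta>))"
    have w: "w \<in> ball x0 r1" if "w \<in> F" for w
    proof -
      have "dist x w = 3 * s" using that F(1) by (auto simp: S_def)
      then show ?thesis using x s dist_triangle[of x0 w x] by auto
    qed
    have wc: "compact (cball w \<delta>)" "cball w \<delta> \<subseteq> W" if "w \<in> F" for w
      using small_cball[of w \<delta>] w[OF that] \<delta>s s by auto
    have wf: "fil (cball w \<delta>) \<subseteq> ball w (\<epsilon> * s / 4)" if "w \<in> F" for w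
      using fil_cball[OF w[OF that] \<delta>(1) _ wc(1)[OF that] order_refl] \<delta> \<delta>s s by simp
    have ch: "chunk (\<epsilon> * s) (fil (cball w \<delta>))" if "w \<in> F" for w
    proof (rule chunk_fil[OF wc(1)[OF that] connected_cball wc(2)[OF that]])
      fix p q assume "p \<in> fil (cball w \<delta>)" "q \<in> fil (cball w \<delta>)"
      then have "dist w p < \<epsilon> * s / 4" "dist w q < \<epsilon> * s / 4" using wf[OF that] by auto
      moreover have "0 < \<epsilon> * s" using eps s by simp
      ultimately show "dist p q \<le> \<epsilon> * s" using dist_triangle3[of p q w] by linarith
    qed
    have "tiled n (\<epsilon> * s) K" unfolding tiled_def
    proof (intro exI[of _ "(\<lambda>w. fil (cball w \<delta>)) ` F"] conjI ballI)
      show "card ((\<lambda>w. fil (cball w \<delta>)) ` F) \<le> n" using card_image_le[OF F(3)] cardF order_trans by blast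
    qed (use F ch in \<open>auto simp: K_def\<close>)
    have es: "\<epsilon> * s / 4 \<le> s / 4" using eps s by simp
    have near: "\<bar>dist x q - 3 * s\<bar> \<le> s" if qK: "q \<in> K" for q
    proof -
      obtain w where "w \<in> F" "q \<in> fil (cball w \<delta>)" using qK unfolding K_def by blast
      then have "q \<in> ball w (\<epsilon> * s / 4)" "dist x w = 3 * s"
        using wf[of w] F(1) unfolding S_def by blast+
      then have "dist w q < \<epsilon> * s / 4" "dist x w = 3 * s" by auto
      then show ?thesis using dist_triangle[of x q w] dist_triangle[of x w q] es s
        unfolding dist_commute[of q w] by linarith
    qed
    have SK: "S \<subseteq> K"
    proof
      fix v assume "v \<in> S"
      then obtain w where "w \<in> F" "dist v w < \<delta>" using F(4) by blast
      then have "v \<in> cball w \<delta>" by (auto simp: dist_commute)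
      then show "v \<in> K" using subset_fil[OF wc(2)[OF \<open>w \<in> F\<close>]] \<open>w \<in> F\<close> unfolding K_def by blast
    qed
    have "x \<in> fil K"
      using tiledD[OF \<open>tiled n (\<epsilon> * s) K\<close>] SK cb s
      by (intro sphere_encloses[of x K "3 * s"]) (auto simp: S_def subset_iff)
    moreover have "K \<subseteq> cball x (4 * s)"
    proof
      fix q assume "q \<in> K" then show "q \<in> cball x (4 * s)" using near[of q] by simp
    qed
    moreover have "\<forall>q\<in>K. s \<le> dist x q" using near s by force
    ultimately have "enclosed n 4 s x K" using \<open>tiled n (\<epsilon> * s) K\<close> s by (simp add: enclosed_def)
    then show False using none by blast
  qed
  then obtain F G where "F \<subseteq> S" "separated \<delta> F" "finite F" "G \<subseteq> F" "card G = n + 1"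
    by (metis obtain_subset_with_card_n)
  then show thesis using that[of G] separated_subset[of \<delta> F G] finite_subset[of G F]
    by (auto simp: S_def \<delta>_def)
qed

text \<open>Each of the \<open>n + 1\<close> points on the sphere of radius \<open>3 * s\<close> is
  the centre of the same construction at scale \<open>\<rho> * s\<close>. Their separation
  \<open>16 * \<rho> * s\<close> keeps the balls of radius \<open>4 * \<rho> * s\<close> around them
  apart by \<open>8 * \<rho> * s\<close>, so the generations multiply.\<close>

lemma packing_growth:
  assumes "0 < s" "dist x0 x + 8 * s < r1 / 4"
    and none: "\<And>i y K. i < J \<Longrightarrow> y \<in> ball x (8 * s) \<Longrightarrow> \<not> enclosed n 4 (\<rho> ^ i * s) y K"
  shows "\<exists>F. finite F \<and> (n + 1) ^ J \<le> card F \<and> F \<subseteq> ball x (4 * s) \<and> separated (4 * \<rho> ^ J * s) F"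
  using assms
proof (induction J arbitrary: x s)
  case 0
  then show ?case by (intro exI[of _ "{x}"]) (auto simp: separated_def)
next
  case (Suc J)
  have \<rho>s: "0 < \<rho> * s" "\<rho> * s \<le> s / 64"
    using rho Suc.prems(1) mult_right_mono[OF rho(2), of s] by auto
  have x: "x \<in> ball x0 (r1 / 2)" "8 * s < r1"
    using Suc.prems(1,2) r1 zero_le_dist[of x0 x] unfolding mem_ball by linarith+
  have none0: "\<not> enclosed n 4 s x K" for K using Suc.prems(3)[of 0 x K] Suc.prems(1) by simp
  obtain F where F: "finite F" "card F = n + 1" "F \<subseteq> {w. dist x w = 3 * s}" "separated (16 * \<rho> * s) F"
    using sphere_packing[OF x(1) Suc.prems(1) x(2) none0] by blast
  have "\<exists>G. finite G \<and> (n + 1) ^ J \<le> card G \<and> G \<subseteq> ball w (4 * (\<rho> * s)) \<and> separated (4 * \<rho> ^ J * (\<rho> * s)) G"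
    if w: "w \<in> F" for w
  proof (rule Suc.IH[OF \<rho>s(1)])
    have xw: "dist x w = 3 * s" using w F(3) by auto
    then show "dist x0 w + 8 * (\<rho> * s) < r1 / 4"
      using dist_triangle[of x0 w x] \<rho>s Suc.prems(1,2) by linarith
    fix i y K assume i: "i < J" "y \<in> ball w (8 * (\<rho> * s))"
    then have "y \<in> ball x (8 * s)"
      using xw dist_triangle[of x y w] \<rho>s Suc.prems(1) unfolding mem_ball by linarith
    then have "\<not> enclosed n 4 (\<rho> ^ Suc i * s) y K"
      using Suc.prems(3)[of "Suc i" y K] i by blast
    then show "\<not> enclosed n 4 (\<rho> ^ i * (\<rho> * s)) y K" by (simp add: mult_ac)
  qed
  then obtain G where G: "\<And>w. w \<in> F \<Longrightarrow> finite (G w) \<and> (n + 1) ^ J \<le> card (G w) \<and> G w \<subseteq> ball w (4 * (\<rho> * s)) \<and> separated (4 * \<rho> ^ J * (\<rho> * s)) (G w)"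
    by metis
  have pow: "4 * \<rho> ^ J * (\<rho> * s) \<le> 4 * (\<rho> * s)"
    using rho \<rho>s(1) power_le_one[of \<rho> J] by (simp add: mult_left_le_one_le)
  have apart: "8 * (\<rho> * s) \<le> dist p q" if "w \<in> F" "v \<in> F" "w \<noteq> v" "p \<in> G w" "q \<in> G v" for w v p q
  proof -
    have "16 * \<rho> * s \<le> dist w v" using F(4) that by (auto simp: separated_def)
    moreover have "dist w p < 4 * (\<rho> * s)" "dist v q < 4 * (\<rho> * s)" using G that by (auto simp: subset_iff)
    moreover have "dist w v \<le> dist w p + dist p q + dist v q"
      using dist_triangle[of w v p] dist_triangle[of p v q] by (simp add: dist_commute)
    ultimately show ?thesis by simp
  qed
  define H where "H = (\<Union>w\<in>F. G w)"
  have "card H = (\<Sum>w\<in>F. card (G w))" unfolding H_def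
  proof (rule card_UN_disjoint[OF F(1)])
    show "\<forall>i\<in>F. \<forall>j\<in>F. i \<noteq> j \<longrightarrow> G i \<inter> G j = {}"
    proof (intro ballI impI equals0I)
      fix w v p assume "w \<in> F" "v \<in> F" "w \<noteq> v" "p \<in> G w \<inter> G v"
      then have "8 * (\<rho> * s) \<le> dist p p" using apart by blast
      then show False using \<rho>s(1) unfolding dist_self by linarith
    qed
  qed (use G in auto)
  also have "\<dots> \<ge> (\<Sum>w\<in>F. (n + 1) ^ J)" using G by (intro sum_mono) auto
  finally have "(n + 1) ^ Suc J \<le> card H" using F(2) by simp
  moreover have "finite H" using F G by (auto simp: H_def)
  moreover have "H \<subseteq> ball x (4 * s)"
  proof
    fix p assume "p \<in> H"
    then obtain w where "w \<in> F" "dist w p < 4 * (\<rho> * s)" using G by (fastforce simp: H_def)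
    moreover have "dist x w = 3 * s" using \<open>w \<in> F\<close> F by auto
    ultimately show "p \<in> ball x (4 * s)" using dist_triangle[of x p w] \<rho>s Suc.prems(1) unfolding mem_ball by linarith
  qed
  moreover have "separated (4 * \<rho> ^ Suc J * s) H"
    unfolding separated_def
  proof (intro ballI impI)
    fix p q assume pq: "p \<in> H" "q \<in> H" "p \<noteq> q"
    then obtain w v where wv: "w \<in> F" "v \<in> F" "p \<in> G w" "q \<in> G v" by (auto simp: H_def)
    have "4 * \<rho> ^ J * (\<rho> * s) \<le> dist p q"
    proof (cases "w = v")
      case True
      then show ?thesis using G[OF wv(1)] wv pq by (auto simp: separated_def)
    next
      case False
      then show ?thesis using apart[OF wv(1,2) False wv(3,4)] pow \<rho>s(1) by linarith
    qed
    then show "4 * \<rho> ^ Suc J * s \<le> dist p q" by (simp add: mult_ac)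
  qed
  ultimately show ?case by blast
qed


section \<open>Loops between two nearby arcs\<close>

lemma L_powers: "L \<le> L^2" "1 \<le> L^2" "L^2 \<le> L^4" "L^3 \<le> L^4" "1 \<le> L^4" "L^4 \<le> L^8" "1 \<le> L^8"
  using L power_increasing[of 1 2 L] power_increasing[of 2 4 L] power_increasing[of 3 4 L]
    power_increasing[of 4 8 L] by (auto simp: one_le_power)

text \<open>The bridge is a geodesic from \<open>\<sigma> t\<close> to a nearest point of the second
  arc. It avoids \<open>\<sigma> ts\<close> for one of two reasons: either \<open>t\<close> is so
  far from \<open>ts\<close> that a bridge of length at most \<open>2 * g\<close> cannot come back,
  or the bridge has length at most \<open>g / 4\<close> and stays near the second arc, whose
  distance from \<open>\<sigma> ts\<close> is \<open>g\<close>.\<close>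

lemma connector:
  assumes \<sigma>: "bilip L \<sigma> {u1..u2}" and \<sigma>': "bilip L \<sigma>' {v1..v2}" "v1 \<le> v2"
    and ts: "u1 \<le> ts" "ts \<le> u2" and t: "u1 \<le> t" "t \<le> u2" and g: "0 < g"
    and gap: "infdist (\<sigma> ts) (\<sigma>' ` {v1..v2}) = g"
    and near: "\<bar>t - ts\<bar> \<le> 6 * L * g" "infdist (\<sigma> t) (\<sigma>' ` {v1..v2}) \<le> 2 * g"
    and ends: "\<bar>t - ts\<bar> = 6 * L * g \<or> infdist (\<sigma> t) (\<sigma>' ` {v1..v2}) \<le> g / 4"
    and sub: "cball (\<sigma> ts) (24 * L^4 * g) \<subseteq> W" and m: "16 * L^4 * g \<le> real m * d" "1 \<le> m"
  obtains C r where "v1 \<le> r" "r \<le> v2" "\<sigma> t \<in> C" "\<sigma>' r \<in> C" "connected C" "tiled m d C"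
    "\<And>q. q \<in> C \<Longrightarrow> g / 2 \<le> dist (\<sigma> ts) q" "\<And>q. q \<in> C \<Longrightarrow> dist (\<sigma> t) q \<le> 2 * g"
    "\<And>q. q \<in> C \<Longrightarrow> dist (\<sigma> ts) q \<le> 8 * L\<^sup>2 * g"
proof -
  have "compact (\<sigma>' ` {v1..v2})" by (intro compact_continuous_image bilip_cont[OF \<sigma>'(1)]) auto
  moreover have "\<sigma>' ` {v1..v2} \<noteq> {}" using \<sigma>'(2) by auto
  ultimately obtain p where p: "p \<in> \<sigma>' ` {v1..v2}" "dist (\<sigma> t) p = infdist (\<sigma> t) (\<sigma>' ` {v1..v2})"
    using infdist_compact_attains by blast
  then obtain r where r: "p = \<sigma>' r" "v1 \<le> r" "r \<le> v2" by auto
  define e where "e = dist (\<sigma> t) p"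
  obtain c where c: "geodesic_arc c e" "c 0 = \<sigma> t" "c e = p" using geodesics[of "\<sigma> t" p] by (auto simp: e_def)
  have e: "0 \<le> e" "e \<le> 2 * g" "\<bar>t - ts\<bar> = 6 * L * g \<or> e \<le> g / 4"
    using near(2) ends zero_le_dist[of "\<sigma> t" p] unfolding e_def p(2) by blast+
  have bl: "bilip L c {0..e}" by (rule geodesic_arc_bilip[OF c(1) L])
  have d0: "dist (\<sigma> t) (c v) = v" if "0 \<le> v" "v \<le> e" for v
    using c(1,2) that unfolding geodesic_arc_def by force
  have d1: "dist p (c v) = e - v" if "0 \<le> v" "v \<le> e" for v
    using c(1,3) that e(1) unfolding geodesic_arc_def by force
  have tst: "dist (\<sigma> ts) (\<sigma> t) \<le> L * \<bar>t - ts\<bar>" "\<bar>t - ts\<bar> \<le> L * dist (\<sigma> ts) (\<sigma> t)"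
    using bilipD[OF \<sigma>, of t ts] t ts by (auto simp: dist_commute)
  have "L * \<bar>t - ts\<bar> \<le> L * (6 * L * g)" by (intro mult_left_mono near) auto
  then have "dist (\<sigma> ts) (\<sigma> t) \<le> L * (6 * L * g)" using tst(1) by linarith
  then have tst2: "dist (\<sigma> ts) (\<sigma> t) \<le> 6 * L\<^sup>2 * g" by (simp add: power2_eq_square mult_ac)
  have far: "dist (\<sigma> ts) (c v) \<le> 8 * L\<^sup>2 * g" if "0 \<le> v" "v \<le> e" for v
  proof -
    have "dist (\<sigma> ts) (c v) \<le> 6 * L\<^sup>2 * g + 2 * g"
      using dist_triangle[of "\<sigma> ts" "c v" "\<sigma> t"] tst2 d0[OF that] that e by linarith
    moreover have "1 * g \<le> L\<^sup>2 * g" using L_powers(2) g by (intro mult_right_mono) auto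
    ultimately show ?thesis by simp
  qed
  have gp: "g \<le> dist (\<sigma> ts) p" using gap infdist_le[OF p(1), of "\<sigma> ts"] by simp
  show thesis
  proof (rule that[of r "c ` {0..e}"])
    show "\<sigma> t \<in> c ` {0..e}" using c(2) e(1) by force
    show "\<sigma>' r \<in> c ` {0..e}" using c(3) e(1) r(1) by force
    show "connected (c ` {0..e})" by (intro connected_continuous_image bilip_cont[OF bl]) auto
    show "tiled m d (c ` {0..e})"
    proof (rule tiled_curve[OF bl])
      have "8 * L\<^sup>2 * g \<le> 24 * L^4 * g" using L_powers g by (intro mult_right_mono) auto
      then have "cball (\<sigma> ts) (8 * L\<^sup>2 * g) \<subseteq> W" using subset_cball sub by blast
      then show "c ` {0..e} \<subseteq> W" using far by (auto simp: image_subset_iff subset_iff)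
      have "L * (e - 0) \<le> L * (2 * g)" using e by (intro mult_left_mono) auto
      also have "\<dots> = (2 * L) * g" by simp
      also have "\<dots> \<le> (16 * L^4) * g" using L_powers g by (intro mult_right_mono) auto
      finally show "L * (e - 0) \<le> real m * d" using m by simp
    qed (use e m in auto)
    fix q assume "q \<in> c ` {0..e}"
    then obtain v where v: "q = c v" "0 \<le> v" "v \<le> e" by auto
    show "dist (\<sigma> t) q \<le> 2 * g" using d0 v e by simp
    show "dist (\<sigma> ts) q \<le> 8 * L\<^sup>2 * g" using far v by simp
    show "g / 2 \<le> dist (\<sigma> ts) q"
      using e(3)
    proof
      assume "\<bar>t - ts\<bar> = 6 * L * g"
      then have "L * (6 * g) \<le> L * dist (\<sigma> ts) (\<sigma> t)" using tst(2) by simp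
      then have "6 * g \<le> dist (\<sigma> ts) (\<sigma> t)" using mult_le_cancel_left_pos[of L] by simp
      then show ?thesis using dist_triangle[of "\<sigma> ts" "\<sigma> t" q] d0[of v] v e g by (simp add: dist_commute)
    next
      assume "e \<le> g / 4"
      then show ?thesis using dist_triangle[of "\<sigma> ts" p q] d1[of v] v gp g by (simp add: dist_commute)
    qed
  qed (use r in auto)
qed

text \<open>The loop consists of a window of \<open>\<sigma>\<close> of half-width at most
  \<open>6 * L * g\<close> about \<open>ts\<close>, a bridge at each end of the window, and the part
  of the second arc between the feet of the bridges. All but the window stays \<open>g / 2\<close>
  away from \<open>\<sigma> ts\<close>, so \<open>loop_encloses\<close> yields the scale
  \<open>g / (32 * L^4)\<close>. The loop lies within \<open>24 * L^4 * g\<close> of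
  \<open>\<sigma> ts\<close>, which is \<open>768 * L^8\<close> in units of the new scale; the bound
  on \<open>m\<close> provides enough tiles of relative size \<open>\<epsilon>\<close>.\<close>

lemma fat_window:
  assumes \<sigma>: "bilip L \<sigma> {u1..u2}" and \<sigma>': "bilip L \<sigma>' {v1..v2}" "v1 \<le> v2"
    and ts: "u1 \<le> ts" "ts \<le> u2" and g: "0 < g"
    and gap: "infdist (\<sigma> ts) (\<sigma>' ` {v1..v2}) = g"
    and near: "\<And>t. u1 \<le> t \<Longrightarrow> t \<le> u2 \<Longrightarrow> \<bar>t - ts\<bar> \<le> 6 * L * g \<Longrightarrow> infdist (\<sigma> t) (\<sigma>' ` {v1..v2}) \<le> 2 * g"
    and e1: "u1 \<le> ts - 6 * L * g \<or> infdist (\<sigma> u1) (\<sigma>' ` {v1..v2}) \<le> g / 4"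
    and e2: "ts + 6 * L * g \<le> u2 \<or> infdist (\<sigma> u2) (\<sigma>' ` {v1..v2}) \<le> g / 4"
    and loc: "\<sigma> ts \<in> ball x0 r1" "24 * L^4 * g < r1" and m: "512 * L^8 / \<epsilon> \<le> real m"
  shows "\<exists>y K. enclosed (4 * m) ((Cf + 1) * 768 * L^8) (g / (32 * L^4)) y K \<and> dist (\<sigma> ts) y \<le> Cf * (24 * L^4 * g)"
proof -
  define s where "s = g / (32 * L^4)"
  have Lg: "0 < L * g" using g by simp
  have s: "0 < s" using g by (simp add: s_def)
  have m1: "1 \<le> m"
  proof -
    have "0 < 512 * L^8 / \<epsilon>" using eps by simp
    then show ?thesis using m by (cases m) auto
  qed
  have md: "16 * L^4 * g \<le> real m * (\<epsilon> * s)"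
  proof -
    have "512 * L^8 / \<epsilon> * (\<epsilon> * s) \<le> real m * (\<epsilon> * s)" using m eps s by (intro mult_right_mono) auto
    moreover have "512 * L^8 / \<epsilon> * (\<epsilon> * s) = 16 * L^4 * g" using eps(1) L
      by (simp add: s_def field_simps power_add[symmetric])
    ultimately show ?thesis by simp
  qed
  define R where "R = 24 * L^4 * g"
  have R24: "R = 24 * (L^4 * g)" by (simp add: R_def)
  have R: "0 < R" "R < r1" using g loc by (auto simp: R_def)
  have sub: "cball (\<sigma> ts) R \<subseteq> W" using small_cball(3)[of "\<sigma> ts" R] loc R r1 by auto
  \<comment> \<open>The window is cut off at the ends of the arc \<open>\<sigma>\<close>; where this
    happens, \<open>e1\<close> or \<open>e2\<close> supplies a short bridge instead of a distant
    one.\<close>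
  define t1 t2 where "t1 = max u1 (ts - 6 * L * g)" and "t2 = min u2 (ts + 6 * L * g)"
  have t1: "u1 \<le> t1" "t1 \<le> ts" "\<bar>t1 - ts\<bar> \<le> 6 * L * g" and t2: "t2 \<le> u2" "ts \<le> t2" "\<bar>t2 - ts\<bar> \<le> 6 * L * g"
    using ts Lg by (auto simp: t1_def t2_def)
  have en1: "\<bar>t1 - ts\<bar> = 6 * L * g \<or> infdist (\<sigma> t1) (\<sigma>' ` {v1..v2}) \<le> g / 4"
    using e1 Lg by (cases "u1 \<le> ts - 6 * L * g") (auto simp: t1_def max_def)
  have en2: "\<bar>t2 - ts\<bar> = 6 * L * g \<or> infdist (\<sigma> t2) (\<sigma>' ` {v1..v2}) \<le> g / 4"
    using e2 Lg by (cases "ts + 6 * L * g \<le> u2") (auto simp: t2_def min_def)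
  obtain C1 p1 where C1: "v1 \<le> p1" "p1 \<le> v2" "\<sigma> t1 \<in> C1" "\<sigma>' p1 \<in> C1" "connected C1" "tiled m (\<epsilon> * s) C1"
    "\<And>q. q \<in> C1 \<Longrightarrow> g / 2 \<le> dist (\<sigma> ts) q" "\<And>q. q \<in> C1 \<Longrightarrow> dist (\<sigma> t1) q \<le> 2 * g"
    "\<And>q. q \<in> C1 \<Longrightarrow> dist (\<sigma> ts) q \<le> 8 * L\<^sup>2 * g"
  proof (rule connector[OF \<sigma> \<sigma>' ts t1(1) _ g gap t1(3) near en1 sub[unfolded R_def] md m1])
    show "t1 \<le> u2" "t1 \<le> u2" "u1 \<le> t1" "\<bar>t1 - ts\<bar> \<le> 6 * L * g" using t1 t2 by auto
  qed (rule that; assumption)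
  obtain C2 p2 where C2: "v1 \<le> p2" "p2 \<le> v2" "\<sigma> t2 \<in> C2" "\<sigma>' p2 \<in> C2" "connected C2" "tiled m (\<epsilon> * s) C2"
    "\<And>q. q \<in> C2 \<Longrightarrow> g / 2 \<le> dist (\<sigma> ts) q" "\<And>q. q \<in> C2 \<Longrightarrow> dist (\<sigma> t2) q \<le> 2 * g"
    "\<And>q. q \<in> C2 \<Longrightarrow> dist (\<sigma> ts) q \<le> 8 * L\<^sup>2 * g"
  proof (rule connector[OF \<sigma> \<sigma>' ts _ t2(1) g gap t2(3) near en2 sub[unfolded R_def] md m1])
    show "u1 \<le> t2" "u1 \<le> t2" "t2 \<le> u2" "\<bar>t2 - ts\<bar> \<le> 6 * L * g" using t1 t2 by auto
  qed (rule that; assumption)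
  define pa pb where "pa = min p1 p2" and "pb = max p1 p2"
  have pab: "v1 \<le> pa" "pa \<le> pb" "pb \<le> v2" "p1 \<in> {pa..pb}" "p2 \<in> {pa..pb}" "pb - pa = \<bar>p1 - p2\<bar>"
    using C1 C2 by (auto simp: pa_def pb_def)
  have bls: "bilip L \<sigma>' {pa..pb}" using \<sigma>'(1) pab by (auto elim: bilip_subset)
  have bl: "bilip L \<sigma> {t1..t2}" using \<sigma> t1 t2 by (auto elim: bilip_subset)
  have g2: "g \<le> L\<^sup>2 * g" "L\<^sup>2 * g \<le> L^4 * g"
    using mult_right_mono[OF L_powers(2), of g] mult_right_mono[OF L_powers(3), of g] g by auto
  have "L * \<bar>t1 - t2\<bar> \<le> L * (12 * L * g)"
    using t1 t2 by (intro mult_left_mono) auto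
  then have Lt: "L * \<bar>t1 - t2\<bar> \<le> 12 * (L\<^sup>2 * g)" by (simp add: power2_eq_square mult_ac)
  have "dist (\<sigma>' p1) (\<sigma>' p2) \<le> 16 * (L\<^sup>2 * g)"
  proof -
    have "dist (\<sigma> t1) (\<sigma> t2) \<le> 12 * (L\<^sup>2 * g)"
      using bilipD(2)[OF bl, of t1 t2] Lt t1 t2 by auto
    moreover have "dist (\<sigma> t1) (\<sigma>' p1) \<le> 2 * g" "dist (\<sigma> t2) (\<sigma>' p2) \<le> 2 * g" using C1 C2 by auto
    moreover have "dist (\<sigma>' p1) (\<sigma>' p2) \<le> dist (\<sigma> t1) (\<sigma>' p1) + dist (\<sigma> t1) (\<sigma> t2) + dist (\<sigma> t2) (\<sigma>' p2)"
      using dist_triangle[of "\<sigma>' p1" "\<sigma>' p2" "\<sigma> t1"] dist_triangle[of "\<sigma> t1" "\<sigma>' p2" "\<sigma> t2"]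
      by (simp add: dist_commute)
    ultimately show ?thesis using g2 by linarith
  qed
  then have "L * dist (\<sigma>' p1) (\<sigma>' p2) \<le> L * (16 * (L\<^sup>2 * g))" by (intro mult_left_mono) auto
  then have "pb - pa \<le> L * (16 * (L\<^sup>2 * g))" using bilipD(1)[OF bls pab(4,5)] pab(6) by linarith
  then have "L * (pb - pa) \<le> L * (L * (16 * (L\<^sup>2 * g)))" by (intro mult_left_mono) auto
  then have Lp: "L * (pb - pa) \<le> 16 * L^4 * g" by (simp add: power2_eq_square eval_nat_numeral mult_ac)
  have dp: "dist (\<sigma> ts) (\<sigma>' p) \<le> R" if "p \<in> {pa..pb}" for p
  proof -
    have "dist (\<sigma>' p1) (\<sigma>' p) \<le> L * \<bar>p1 - p\<bar>" by (rule bilipD(2)[OF bls pab(4) that])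
    also have "\<dots> \<le> L * (pb - pa)" using that pab(4) by (intro mult_left_mono) auto
    finally have "dist (\<sigma>' p1) (\<sigma>' p) \<le> 16 * (L^4 * g)" using Lp by simp
    moreover have "dist (\<sigma> ts) (\<sigma>' p1) \<le> 8 * (L\<^sup>2 * g)" using C1(9)[OF C1(4)] by simp
    ultimately show ?thesis using dist_triangle[of "\<sigma> ts" "\<sigma>' p" "\<sigma>' p1"] g2 g R24 by linarith
  qed
  have dt: "dist (\<sigma> ts) (\<sigma> t) \<le> R" if "t \<in> {t1..t2}" for t
  proof -
    have "dist (\<sigma> ts) (\<sigma> t) \<le> L * \<bar>ts - t\<bar>" using bilipD(2)[OF bl, of ts t] that t1 t2 by auto
    also have "\<dots> \<le> L * \<bar>t1 - t2\<bar>" using that t1 t2 by (intro mult_left_mono) auto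
    also have "\<dots> \<le> 12 * (L\<^sup>2 * g)" by (rule Lt)
    finally show ?thesis using g2 g R24 by linarith
  qed
  define M where "M = C1 \<union> \<sigma>' ` {pa..pb} \<union> C2"
  define K where "K = \<sigma> ` {t1..t2} \<union> M"
  have cM: "connected M" unfolding M_def
  proof (intro connected_Un C1 C2 connected_continuous_image bilip_cont[OF bls])
    show "C1 \<inter> \<sigma>' ` {pa..pb} \<noteq> {}" using C1(4) pab(4) by blast
    show "(C1 \<union> \<sigma>' ` {pa..pb}) \<inter> C2 \<noteq> {}" using C2(4) pab(5) by blast
  qed auto
  have sW: "\<sigma>' ` {pa..pb} \<subseteq> W" "\<sigma> ` {t1..t2} \<subseteq> W" using dp dt sub by auto
  have ts1: "tiled m (\<epsilon> * s) (\<sigma>' ` {pa..pb})"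
    using Lp md pab m1 sW by (intro tiled_curve bls) auto
  have ts2: "tiled m (\<epsilon> * s) (\<sigma> ` {t1..t2})"
  proof (rule tiled_curve[OF bl sW(2)])
    have "12 * (L\<^sup>2 * g) \<le> 16 * L^4 * g" using g2 g by simp
    moreover have "\<bar>t1 - t2\<bar> = t2 - t1" using t1 t2 by simp
    ultimately show "L * (t2 - t1) \<le> real m * (\<epsilon> * s)" using Lt md by (metis order_trans)
  qed (use t1 t2 m1 in auto)
  have tM: "tiled (m + m + m) (\<epsilon> * s) M" unfolding M_def by (intro tiled_Un C1 C2 ts1)
  have tK: "tiled (4 * m) (\<epsilon> * s) K" unfolding K_def
    by (rule tiled_mono[OF tiled_Un[OF ts2 tM]]) auto
  have MW: "compact M" "M \<subseteq> W" using tiledD[OF tM] by auto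
  have gM: "g / 2 \<le> dist (\<sigma> ts) q" if "q \<in> M" for q
  proof -
    consider "q \<in> C1" | "q \<in> C2" | "q \<in> \<sigma>' ` {v1..v2}" using \<open>q \<in> M\<close> pab unfolding M_def by force
    then show ?thesis
    proof cases
      case 3 then show ?thesis using gap infdist_le[OF 3, of "\<sigma> ts"] g by simp
    qed (use C1 C2 in auto)
  qed
  obtain y where y: "y \<in> fil K" "\<And>q. q \<in> K \<Longrightarrow> (g / 2) / (16 * L^4) < dist y q"
    unfolding K_def
    using loop_encloses[OF L bl sW(2) t1(2) t2(2) MW(1) cM MW(2) _ _ _ gM] C1(3) C2(3) g
    unfolding M_def by auto
  have KR: "K \<subseteq> cball (\<sigma> ts) R"
  proof
    fix q assume "q \<in> K"
    then consider "q \<in> \<sigma> ` {t1..t2}" | "q \<in> C1 \<or> q \<in> C2" | "q \<in> \<sigma>' ` {pa..pb}" unfolding K_def M_def by blast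
    then show "q \<in> cball (\<sigma> ts) R"
    proof cases
      case 2
      then have "dist (\<sigma> ts) q \<le> 8 * (L\<^sup>2 * g)" using C1(9)[of q] C2(9)[of q] by auto
      then have "dist (\<sigma> ts) q \<le> R" using g2 g R24 by linarith
      then show ?thesis by simp
    qed (use dt dp in auto)
  qed
  have fK: "fil K \<subseteq> ball (\<sigma> ts) (Cf * R)" by (rule fil_cball[OF loc(1) R tiledD(1)[OF tK] KR])
  have Ls: "(Cf + 1) * 768 * L^8 * s = (Cf + 1) * R"
    using L by (simp add: s_def R_def field_simps power_add[symmetric])
  have "enclosed (4 * m) ((Cf + 1) * 768 * L^8) s y K"
    unfolding enclosed_def
  proof (intro conjI ballI)
    show "K \<subseteq> cball y ((Cf + 1) * 768 * L ^ 8 * s)"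
    proof
      fix q assume "q \<in> K"
      then have "dist (\<sigma> ts) q \<le> R" "dist (\<sigma> ts) y < Cf * R" using KR fK y by auto
      then have "dist y q \<le> (Cf + 1) * R" using dist_triangle3[of y q "\<sigma> ts"] by (simp add: algebra_simps)
      then show "q \<in> cball y ((Cf + 1) * 768 * L ^ 8 * s)" unfolding Ls by simp
    qed
    show "s \<le> dist y q" if "q \<in> K" for q using y(2)[OF that] by (simp add: s_def)
  qed (use s tK y in auto)
  moreover have "dist (\<sigma> ts) y \<le> Cf * (24 * L^4 * g)" using fK y by (auto simp: R_def)
  ultimately show ?thesis unfolding s_def by blast
qed

end

section \<open>Descent to smaller scales\<close>

lemma first_hit:
  fixes \<sigma> :: "real \<Rightarrow> 'a::t2_space"
  assumes "continuous_on {0..b} \<sigma>" "closed Q" "\<sigma> 0 \<notin> Q" "\<sigma> b \<in> Q" "0 \<le> b"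
  obtains u where "0 < u" "u \<le> b" "\<sigma> u \<in> Q" "\<And>t. 0 \<le> t \<Longrightarrow> t < u \<Longrightarrow> \<sigma> t \<notin> Q"
proof -
  define S where "S = {0..b} \<inter> \<sigma> -` Q"
  have "closed S" unfolding S_def by (intro continuous_closed_preimage assms) auto
  then have "compact S" by (simp add: S_def compact_eq_bounded_closed bounded_Int)
  moreover have "b \<in> S" using assms by (simp add: S_def)
  ultimately obtain u where u: "u \<in> S" "\<And>t. t \<in> S \<Longrightarrow> u \<le> t" using compact_attains_inf[of S] by blast
  show thesis
  proof (rule that[of u])
    show "u \<le> b" "\<sigma> u \<in> Q" using u(1) by (auto simp: S_def)
    show "0 < u" using u(1) assms(3) by (cases "u = 0") (auto simp: S_def)
    fix t assume t: "0 \<le> t" "t < u"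
    show "\<sigma> t \<notin> Q"
    proof
      assume "\<sigma> t \<in> Q"
      then have "t \<in> S" using t u(1) by (simp add: S_def)
      then show False using u(2) t by fastforce
    qed
  qed
qed

lemma pigeonhole_fiber:
  assumes "finite T" "f ` Z \<subseteq> T" "finite Z" "card T * q < card Z"
  shows "\<exists>x\<in>T. q < card {z \<in> Z. f z = x}"
proof (rule ccontr)
  assume "\<not> ?thesis"
  then have le: "card {z \<in> Z. f z = x} \<le> q" if "x \<in> T" for x
    using that by (meson not_le)
  have "Z = (\<Union>x\<in>T. {z \<in> Z. f z = x})" using assms(2) by auto
  then have "card Z \<le> (\<Sum>x\<in>T. card {z \<in> Z. f z = x})" using card_UN_le[OF assms(1)] by metis
  also have "\<dots> \<le> (\<Sum>x\<in>T. q)" using le by (rule sum_mono)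
  finally show False using assms(4) by simp
qed

text \<open>The parameter interval is cut into cells of length \<open>d / (2 * L)\<close>. Two
  points attached to the same cell are closer than \<open>d / 4 + d / 2 + d / 4 = d\<close>, so each
  cell accounts for at most one point.\<close>

lemma bilip_near_count:
  assumes c: "bilip L c {a..b}" and L: "1 \<le> L" and ab: "a \<le> b" and d: "0 < d"
    and F: "separated d F" "\<And>x. x \<in> F \<Longrightarrow> \<exists>t\<in>{a..b}. dist x (c t) < d / 4"
  shows "finite F \<and> real (card F) \<le> 2 * L * (b - a) / d + 1"
proof -
  define l where "l = d / (2 * L)"
  have l: "0 < l" "L * l = d / 2" using d L by (auto simp: l_def)
  define m where "m = nat \<lfloor>(b - a) / l\<rfloor>"
  define B where "B i = {x. \<exists>t\<in>{a..b}. real i * l \<le> t - a \<and> t - a < (real i + 1) * l \<and> dist x (c t) < d / 4}" for i :: nat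
  have "finite F \<and> card F \<le> card {..m}"
  proof (rule card_separated_le_cover[OF F(1)])
    show "F \<subseteq> (\<Union>i\<in>{..m}. B i)"
    proof
      fix x assume "x \<in> F"
      then obtain t where t: "t \<in> {a..b}" "dist x (c t) < d / 4" using F(2) by blast
      define i where "i = nat \<lfloor>(t - a) / l\<rfloor>"
      have nn: "0 \<le> (t - a) / l" using t l by simp
      have "real i = of_int \<lfloor>(t - a) / l\<rfloor>" using nn by (simp add: i_def)
      then have "real i \<le> (t - a) / l" "(t - a) / l < real i + 1" by linarith+
      then have "real i * l \<le> t - a" "t - a < (real i + 1) * l" using l(1) by (simp_all add: field_simps)
      moreover have "i \<le> m"
        unfolding i_def m_def using t l by (intro nat_mono floor_mono divide_right_mono) auto
      ultimately show "x \<in> (\<Union>i\<in>{..m}. B i)" using t unfolding B_def by blast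
    qed
    fix i x y assume "x \<in> B i" "y \<in> B i"
    then obtain t u where tu: "t \<in> {a..b}" "u \<in> {a..b}" "real i * l \<le> t - a" "t - a < (real i + 1) * l"
      "real i * l \<le> u - a" "u - a < (real i + 1) * l" "dist x (c t) < d / 4" "dist y (c u) < d / 4"
      unfolding B_def by blast
    have "\<bar>t - u\<bar> \<le> l" using tu by (simp add: algebra_simps)
    then have "dist (c t) (c u) \<le> L * l"
      using bilipD(2)[OF c tu(1,2)] L by (meson mult_left_mono order_trans zero_le_one)
    then show "dist x y < d"
      using tu l(2) dist_triangle[of x y "c t"] dist_triangle[of "c t" y "c u"] by (simp add: dist_commute)
  qed simp
  moreover have "real m \<le> (b - a) / l" using ab l by (simp add: m_def)
  moreover have "(b - a) / l = 2 * L * (b - a) / d" using L d by (simp add: l_def)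
  ultimately show ?thesis by simp
qed

text \<open>Suppose that some point is enclosed at scale \<open>g\<close> but none at scales between a fixed fraction of
  \<open>g\<close> and \<open>g / 2\<close>. Then spheres carry many separated points, so two crosscuts of an admissible set \<open>K\<close>
  end in the same chunks without being close. The loop they form encloses a point at a scale comparable
  to their largest gap, so this scale must exceed \<open>g / 2\<close>, and the loop with the two chunks is itself
  admissible and has fewer deep points than \<open>K\<close>. Infinite descent.\<close>

locale descent = hom_surface W h k x0 A L \<tau> r1
  for W :: "'a::metric_space set" and h :: "'a \<Rightarrow> complex" and k x0 A L \<tau> r1 +
  fixes n m m' J N :: nat and \<Lambda> D g :: real and y0 :: 'a and K0 :: "'a set"
  assumes m: "512 * L^8 / \<epsilon> \<le> real m" and nm: "4 * m \<le> n" and n\<rho>: "2 / \<rho> \<le> real (n + 1)"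
    and \<Lambda>: "(Cf + 1) * 768 * L^8 \<le> \<Lambda>"
    and m': "2 * L\<^sup>2 * Cf * \<Lambda> / \<epsilon> \<le> real m'"
    and N_def: "N = max n (2 * m' + 2)"
    and J: "real (N * N) * (64 * L\<^sup>2 * Cf * \<Lambda> + 2) < 2 ^ J"
    and D_def: "D = Cf * \<Lambda> + 400 * Cf * L^8"
    and enc: "enclosed n \<Lambda> g y0 K0"
    and none: "\<And>s y K. \<rho> ^ J * g / (2048 * L^4) \<le> s \<Longrightarrow> s \<le> g / 2 \<Longrightarrow> dist y0 y \<le> D * g \<Longrightarrow> \<not> enclosed n \<Lambda> s y K"
    and loc: "dist x0 y0 + 2 * D * g < r1 / 4"
begin

lemma g: "0 < g" using enc by (simp add: enclosed_def)

lemma Lam4: "4 \<le> \<Lambda>"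
proof -
  have "4 \<le> (Cf + 1) * 768 * 1" using Cf_ge by simp
  also have "\<dots> \<le> (Cf + 1) * 768 * L^8" using L_powers Cf_ge by (intro mult_left_mono) auto
  finally show ?thesis using \<Lambda> by simp
qed

lemma D_ge: "Cf * \<Lambda> * g \<le> D * g" "2000 * L^8 * g \<le> D * g" "2000 * g \<le> D * g" "\<Lambda> * g \<le> D * g"
  "Cf * \<Lambda> * g + g \<le> D * g" "Cf * \<Lambda> * g + 384 * Cf * L^8 * g \<le> D * g"
proof -
  have a: "0 \<le> Cf * \<Lambda>" "0 \<le> Cf * L^8" using Cf_ge Lam4 by auto
  have b: "5 * L^8 \<le> Cf * L^8" using Cf_ge by (intro mult_right_mono) auto
  have c: "1 * \<Lambda> \<le> Cf * \<Lambda>" using Cf_ge Lam4 by (intro mult_right_mono) auto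
  note L8 = L_powers(7)
  have "Cf * \<Lambda> \<le> D" "2000 * L^8 \<le> D" "2000 \<le> D" "\<Lambda> \<le> D" "Cf * \<Lambda> + 1 \<le> D" "Cf * \<Lambda> + 384 * Cf * L^8 \<le> D"
    using a b c L8 unfolding D_def by linarith+
  from this[THEN mult_right_mono[where c = g]] g
  show "Cf * \<Lambda> * g \<le> D * g" "2000 * L^8 * g \<le> D * g" "2000 * g \<le> D * g" "\<Lambda> * g \<le> D * g"
    "Cf * \<Lambda> * g + g \<le> D * g" "Cf * \<Lambda> * g + 384 * Cf * L^8 * g \<le> D * g"
    by (simp_all add: algebra_simps)
qed

lemma Dg: "0 < D * g" "D * g < r1 / 8" "dist x0 y0 < r1 / 4"
proof -
  have "dist x0 y0 + 2 * (D * g) < r1 / 4" using loc by (simp add: mult.assoc)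
  then show "0 < D * g" "D * g < r1 / 8" "dist x0 y0 < r1 / 4"
    using D_ge(3) g zero_le_dist[of x0 y0] by linarith+
qed

lemma y0: "y0 \<in> ball x0 r1" using Dg r1 by auto

lemma K0: "compact K0" "K0 \<subseteq> W" "K0 \<subseteq> cball y0 (\<Lambda> * g)" "fil K0 \<subseteq> ball y0 (Cf * (\<Lambda> * g))"
  "tiled n (\<epsilon> * g) K0" "y0 \<in> fil K0"
proof -
  show K: "tiled n (\<epsilon> * g) K0" "K0 \<subseteq> cball y0 (\<Lambda> * g)" "y0 \<in> fil K0" using enc by (auto simp: enclosed_def)
  show c: "compact K0" "K0 \<subseteq> W" using tiledD[OF K(1)] .
  show "fil K0 \<subseteq> ball y0 (Cf * (\<Lambda> * g))"
  proof (rule fil_cball[OF y0 _ _ c(1) K(2)])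
    show "0 < \<Lambda> * g" using g Lam4 by simp
    show "\<Lambda> * g < r1" using D_ge(4) Dg r1 by linarith
  qed
qed

text \<open>Weaker thresholds than in \<open>enclosed\<close>, with inner radius
  \<open>g / 2\<close> and count \<open>N\<close>, so that both the initial set and every later loop
  qualify: a loop is two arcs of \<open>m'\<close> chunks each and two old chunks, and
  \<open>N \<ge> 2 * m' + 2\<close>.\<close>

definition admissible :: "'a set \<Rightarrow> bool" where
  "admissible K \<longleftrightarrow> K \<subseteq> fil K0 \<and> tiled N (\<epsilon> * g) K \<and> (\<exists>y\<in>fil K. \<forall>q\<in>K. g / 2 \<le> dist y q)"

text \<open>The closure matters: the points of a newly attached arc do not belong to the exterior
  but are limits of it, and they must stay away from deep points.\<close>

definition deep :: "'a set \<Rightarrow> 'a set" where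
  "deep K = {w. ball w (g / 4) \<subseteq> W - closure (ext K)}"

lemma admissible_K0: "admissible K0"
proof -
  have "tiled N (\<epsilon> * g) K0" using K0(5) N_def by (auto elim: tiled_mono)
  moreover have "\<forall>q\<in>K0. g / 2 \<le> dist y0 q" using enc g by (force simp: enclosed_def)
  ultimately show ?thesis using K0(6) subset_fil[OF K0(2)] by (auto simp: admissible_def)
qed

lemma fil_K0_diam:
  assumes "p \<in> fil K0" "q \<in> fil K0"
  shows "dist p q \<le> 2 * Cf * \<Lambda> * g"
proof -
  have "dist y0 p < Cf * (\<Lambda> * g)" "dist y0 q < Cf * (\<Lambda> * g)" using assms K0(4) by auto
  then show ?thesis using dist_triangle3[of p q y0] by simp
qed

lemma fil_K0_near:
  assumes "p \<in> fil K0" shows "dist y0 p \<le> Cf * \<Lambda> * g" "p \<in> ball x0 r1" "dist x0 p + g < r1 / 4"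
proof -
  show 1: "dist y0 p \<le> Cf * \<Lambda> * g" using assms K0(4) by (auto simp: mult_ac)
  show "p \<in> ball x0 r1" using 1 dist_triangle[of x0 p y0] D_ge(1) Dg r1 unfolding mem_ball by linarith
  show "dist x0 p + g < r1 / 4"
    using 1 dist_triangle[of x0 p y0] D_ge(5) loc unfolding mult.assoc[of 2 D g] using Dg(1) by linarith
qed

lemma admissibleD:
  assumes "admissible K"
  shows "compact K" "K \<subseteq> W" "K \<subseteq> fil K0" "fil K \<subseteq> fil K0" "K \<subseteq> ball x0 (4 * r1)"
proof -
  have t: "tiled N (\<epsilon> * g) K" using assms by (simp add: admissible_def)
  show c: "compact K" "K \<subseteq> W" using tiledD[OF t] by auto
  show c3: "K \<subseteq> fil K0" using assms by (simp add: admissible_def)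
  show "fil K \<subseteq> fil K0" by (rule fil_mono[OF K0(1,2) c(1) c3])
  show "K \<subseteq> ball x0 (4 * r1)"
  proof
    fix x assume "x \<in> K" then have "x \<in> ball x0 r1" using c3 fil_K0_near(2) by blast
    then show "x \<in> ball x0 (4 * r1)" using r1 by auto
  qed
qed

lemma deep_sub: "admissible K \<Longrightarrow> deep K \<subseteq> fil K0"
proof
  fix w assume K: "admissible K" and "w \<in> deep K"
  then have "w \<in> W - closure (ext K)" using g by (force simp: deep_def)
  then have "w \<in> fil K" using closure_subset by (auto simp: fil_eq)
  then show "w \<in> fil K0" using admissibleD(4)[OF K] by blast
qed

text \<open>The generations start at scale \<open>g / 32\<close>, for which \<open>none\<close>
  covers all \<open>J\<close> of them; then each point is moved to \<open>A\<close>. The separation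
  \<open>\<rho> ^ J * g / 8\<close> of the packing is four times the allowed displacement
  \<open>e\<close>, so half of it survives. The count \<open>(n + 1) ^ J\<close> is at least
  \<open>2 ^ J / \<rho> ^ J\<close>, and \<open>J\<close> makes this exceed the stated
  number.\<close>

lemma many_points:
  assumes K: "admissible K" and y: "y \<in> fil K" "\<And>q. q \<in> K \<Longrightarrow> g / 2 \<le> dist y q"
  obtains Z where "finite Z" "Z \<subseteq> A" "Z \<subseteq> ball y (g / 4)" "separated (\<rho> ^ J * g / 16) Z"
    "real (N * N) * ((64 * L\<^sup>2 * Cf * \<Lambda> + 2) / \<rho> ^ J) < real (card Z)"
proof -
  have yK: "y \<in> fil K0" using y admissibleD(4)[OF K] by blast
  have \<rho>J: "0 < \<rho> ^ J" "\<rho> ^ J \<le> 1" using rho by (auto simp: power_le_one)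
  have exF: "\<exists>F. finite F \<and> (n + 1) ^ J \<le> card F \<and> F \<subseteq> ball y (4 * (g / 32)) \<and> separated (4 * \<rho> ^ J * (g / 32)) F"
  proof (rule packing_growth)
    show "0 < g / 32" using g by simp
    show "dist x0 y + 8 * (g / 32) < r1 / 4"
      using fil_K0_near(3)[OF yK] g by linarith
    fix i y' K' assume i: "i < J" and "y' \<in> ball y (8 * (g / 32))"
    then have "dist y y' < g / 4" by simp
    then have "dist y0 y' \<le> D * g"
      using dist_triangle[of y0 y' y] fil_K0_near(1)[OF yK] D_ge(5) g by linarith
    moreover have "\<rho> ^ J * g / (2048 * L^4) \<le> \<rho> ^ i * (g / 32)"
    proof -
      have "\<rho> ^ J \<le> \<rho> ^ i" using i rho by (intro power_decreasing) auto
      then have "\<rho> ^ J * g / (2048 * L^4) \<le> \<rho> ^ i * g / 32"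
        using g L_powers(5) rho by (intro frac_le mult_right_mono) auto
      then show ?thesis by simp
    qed
    moreover have "\<rho> ^ i * (g / 32) \<le> g / 2"
    proof -
      have "\<rho> ^ i \<le> 1" using rho by (intro power_le_one) auto
      then have "\<rho> ^ i * (g / 32) \<le> 1 * (g / 32)" using g by (intro mult_right_mono) auto
      then show ?thesis using g by simp
    qed
    ultimately have "\<not> enclosed n \<Lambda> (\<rho> ^ i * (g / 32)) y' K'" by (intro none)
    then show "\<not> enclosed n 4 (\<rho> ^ i * (g / 32)) y' K'" using enclosed_mono[OF _ order_refl Lam4] by blast
  qed
  obtain F where F: "finite F" "(n + 1) ^ J \<le> card F" "F \<subseteq> ball y (g / 8)" "separated (\<rho> ^ J * g / 8) F"
  proof -
    have "4 * \<rho> ^ J * (g / 32) = \<rho> ^ J * g / 8" "4 * (g / 32) = g / 8" by simp_all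
    then show ?thesis using that exF by (simp only:) blast
  qed
  define e where "e = \<rho> ^ J * g / 32"
  have e: "0 < e" "e \<le> g / 32" using \<rho>J g by (auto simp: e_def mult_left_le_one_le)
  have "\<exists>a\<in>A. dist x a < e" if "x \<in> F" for x
  proof (rule dense)
    have "dist y x < g / 8" using F(3) that by auto
    then have "dist x0 x < r1" using dist_triangle[of x0 x y] fil_K0_near(3)[OF yK] g r1 by linarith
    moreover have "r1 \<le> \<tau> / (4 * L)"
    proof -
      have "4 * L * r1 \<le> 16 * L\<^sup>2 * r1" using L_powers(1,2) r1 by (intro mult_right_mono, linarith) auto
      then have "4 * L * r1 \<le> \<tau>" using r1_\<tau> by linarith
      then show ?thesis by (simp add: field_simps)
    qed
    ultimately show "x \<in> ball x0 (\<tau> / (4 * L))" by simp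
  qed (rule e)
  then obtain a where a: "\<And>x. x \<in> F \<Longrightarrow> a x \<in> A \<and> dist x (a x) < e" by metis
  have apart: "2 * e \<le> dist (a x) (a v)" if "x \<in> F" "v \<in> F" "x \<noteq> v" for x v
  proof -
    have "\<rho> ^ J * g / 8 \<le> dist x v" using F(4) that unfolding separated_def by blast
    then have "4 * e \<le> dist x v" unfolding e_def by argo
    moreover have "dist x v \<le> dist x (a x) + dist (a x) (a v) + dist v (a v)"
      using dist_triangle[of x v "a x"] dist_triangle[of "a x" v "a v"] by (simp add: dist_commute)
    ultimately show ?thesis using a[OF that(1)] a[OF that(2)] by linarith
  qed
  have inj: "inj_on a F" using apart e by (intro inj_onI) (fastforce simp: not_le)
  show thesis
  proof (rule that[of "a ` F"])
    show "a ` F \<subseteq> A" using a by auto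
    show "a ` F \<subseteq> ball y (g / 4)"
    proof (rule image_subsetI)
      fix x assume x: "x \<in> F"
      then have "dist y x < g / 8" using F(3) by auto
      then have "dist y (a x) < g / 4" using dist_triangle[of y "a x" x] a[OF x] e by linarith
      then show "a x \<in> ball y (g / 4)" by simp
    qed
    show "separated (\<rho> ^ J * g / 16) (a ` F)"
    proof -
      have eq: "\<rho> ^ J * g / 16 = 2 * e" unfolding e_def by argo
      show ?thesis using apart unfolding separated_def eq by blast
    qed
    have "2 ^ J / \<rho> ^ J = (2 / \<rho>) ^ J" by (simp add: power_divide)
    also have "\<dots> \<le> real (n + 1) ^ J" using rho n\<rho> by (intro power_mono) auto
    also have "\<dots> \<le> real (card F)" using F(2) by (metis of_nat_le_iff of_nat_power)
    finally have "2 ^ J / \<rho> ^ J \<le> real (card (a ` F))" using inj by (simp add: card_image)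
    moreover have "real (N * N) * (64 * L\<^sup>2 * Cf * \<Lambda> + 2) / \<rho> ^ J < 2 ^ J / \<rho> ^ J"
      using J \<rho>J by (intro divide_strict_right_mono) auto
    ultimately show "real (N * N) * ((64 * L\<^sup>2 * Cf * \<Lambda> + 2) / \<rho> ^ J) < real (card (a ` F))" by simp
  qed (use F in auto)
qed

text \<open>Pigeonhole: there are many more separated points of \<open>A\<close> than pairs of chunks, and only few of
  them can lie near any one crosscut.\<close>

lemma two_crosscuts:
  assumes K: "admissible K" and y: "y \<in> fil K" "\<And>q. q \<in> K \<Longrightarrow> g / 2 \<le> dist y q"
  obtains z \<sigma> a b z' \<sigma>' a' b' S T where "z \<in> ball y (g / 4)" "z' \<in> ball y (g / 4)"
    "crosscut K z \<sigma> a b" "crosscut K z' \<sigma>' a' b'"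
    "chunk (\<epsilon> * g) S" "chunk (\<epsilon> * g) T" "S \<subseteq> K" "T \<subseteq> K"
    "\<sigma> a \<in> S" "\<sigma>' a' \<in> S" "\<sigma> b \<in> T" "\<sigma>' b' \<in> T"
    "\<rho> ^ J * g / 64 \<le> infdist z (\<sigma>' ` {a'..b'})"
proof -
  obtain Z where Z: "finite Z" "Z \<subseteq> A" "Z \<subseteq> ball y (g / 4)" "separated (\<rho> ^ J * g / 16) Z"
    "real (N * N) * ((64 * L\<^sup>2 * Cf * \<Lambda> + 2) / \<rho> ^ J) < real (card Z)"
    using many_points[OF K y] by blast
  have KF: "compact K" "K \<subseteq> W" "K \<subseteq> fil K0" "fil K \<subseteq> fil K0" "K \<subseteq> ball x0 (4 * r1)" using admissibleD[OF K] .
  have by2: "ball y (g / 2) \<inter> K = {}" using y(2) by force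
  have ballfil: "ball y (g / 2) \<subseteq> fil K"
  proof (rule connected_subset_fil[OF KF(1,2) connected_ball _ by2])
    have "y \<in> ball y (g / 2)" using g by simp
    then show "ball y (g / 2) \<inter> fil K \<noteq> {}" using y(1) by blast
  qed
  have Zin: "z \<in> fil K - K" if "z \<in> Z" for z
  proof -
    have "z \<in> ball y (g / 2)" using Z(3) that g by auto
    then show ?thesis using ballfil by2 by blast
  qed
  have "\<exists>\<sigma> a b. crosscut K z \<sigma> a b" if "z \<in> Z" for z
    using ex_crosscut[OF KF(1,5)] Z(2) Zin[OF that] that by (metis subsetD)
  then obtain sg al be where cc: "\<And>z. z \<in> Z \<Longrightarrow> crosscut K z (sg z) (al z) (be z)" by metis
  obtain T where T: "finite T" "card T \<le> N" "\<Union>T = K" "\<And>S. S \<in> T \<Longrightarrow> chunk (\<epsilon> * g) S"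
    using K by (auto simp: admissible_def tiled_def)
  have "\<exists>S S'. S \<in> T \<and> S' \<in> T \<and> sg z (al z) \<in> S \<and> sg z (be z) \<in> S'" if "z \<in> Z" for z
    using cc[OF that] T(3) unfolding crosscut_def by blast
  then obtain c1 c2 where c12: "\<And>z. z \<in> Z \<Longrightarrow> c1 z \<in> T \<and> c2 z \<in> T \<and> sg z (al z) \<in> c1 z \<and> sg z (be z) \<in> c2 z"
    by metis
  \<comment> \<open>A \<open>d\<close>-separated set with \<open>d = \<rho> ^ J * g / 16\<close>
    lying within \<open>d / 4\<close> of one crosscut has at most
    \<open>64 * L^2 * Cf * \<Lambda> / \<rho> ^ J + 1\<close> points, since the crosscut has
    parameter length at most \<open>2 * L * Cf * \<Lambda> * g\<close>. \<open>Qr\<close> exceeds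
    this by at least 1, which absorbs the rounding in \<open>q\<close>.\<close>
  define Qr where "Qr = (64 * L\<^sup>2 * Cf * \<Lambda> + 2) / \<rho> ^ J"
  define q where "q = nat \<lfloor>Qr\<rfloor>"
  have \<rho>J: "0 < \<rho> ^ J" "\<rho> ^ J \<le> 1" using rho by (auto simp: power_le_one)
  have Qr0: "0 \<le> Qr" unfolding Qr_def using \<rho>J Cf_ge Lam4 by (intro divide_nonneg_pos add_nonneg_nonneg) auto
  have q: "real q \<le> Qr" using Qr0 by (simp add: q_def)
  have "card (T \<times> T) * q < card Z"
  proof -
    have "real (card (T \<times> T) * q) \<le> real (N * N) * Qr"
    proof -
      have "card (T \<times> T) \<le> N * N" using T(2) by (simp add: card_cartesian_product mult_le_mono)
      then have "real (card (T \<times> T)) \<le> real (N * N)" by (rule of_nat_mono)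
      then show ?thesis unfolding of_nat_mult[of "card (T \<times> T)"] using q Qr0 by (intro mult_mono) auto
    qed
    then show ?thesis using Z(5) unfolding Qr_def by linarith
  qed
  moreover have "(\<lambda>z. (c1 z, c2 z)) ` Z \<subseteq> T \<times> T" using c12 by auto
  ultimately obtain x where x: "x \<in> T \<times> T" "q < card {z \<in> Z. (c1 z, c2 z) = x}"
    using pigeonhole_fiber[OF finite_cartesian_product[OF T(1) T(1)] _ Z(1)] by blast
  obtain S S' where "x = (S, S')" by (cases x)
  then have SS: "(S, S') \<in> T \<times> T" "q < card {z \<in> Z. (c1 z, c2 z) = (S, S')}" using x by auto
  define G where "G = {z \<in> Z. (c1 z, c2 z) = (S, S')}"
  have G: "G \<subseteq> Z" "q < card G" "\<And>z. z \<in> G \<Longrightarrow> c1 z = S \<and> c2 z = S'" using SS by (auto simp: G_def)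
  have "G \<noteq> {}" using G(2) by auto
  then obtain z' where z': "z' \<in> G" by blast
  define d where "d = \<rho> ^ J * g / 16"
  have d: "0 < d" using \<rho>J g by (simp add: d_def)
  define \<Sigma> where "\<Sigma> = sg z' ` {al z'..be z'}"
  have cc': "bilip L (sg z') {al z'..be z'}" "al z' < 0" "0 < be z'" "sg z' (al z') \<in> K" "sg z' (be z') \<in> K"
    using cc[of z'] z' G(1) by (auto simp: crosscut_def)
  have c\<Sigma>: "compact \<Sigma>" "\<Sigma> \<noteq> {}" unfolding \<Sigma>_def
    using cc' by (auto intro!: compact_continuous_image bilip_cont[OF cc'(1)])
  have "\<exists>z\<in>G. d / 4 \<le> infdist z \<Sigma>"
  proof (rule ccontr)
    assume no: "\<not> ?thesis"
    have "\<exists>t\<in>{al z'..be z'}. dist z (sg z' t) < d / 4" if "z \<in> G" for z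
    proof -
      have "infdist z \<Sigma> < d / 4" using no that by force
      moreover obtain p where "p \<in> \<Sigma>" "dist z p = infdist z \<Sigma>" using infdist_compact_attains[OF c\<Sigma>] by blast
      ultimately have "\<exists>p\<in>\<Sigma>. dist z p < d / 4" by (intro bexI[of _ p]) auto
      then show ?thesis by (simp add: \<Sigma>_def)
    qed
    then have le: "real (card G) \<le> 2 * L * (be z' - al z') / d + 1"
    proof -
      have "separated d G" using separated_subset[OF Z(4) G(1)] by (simp add: d_def)
      moreover have "al z' \<le> be z'" using cc' by simp
      ultimately show ?thesis using bilip_near_count[OF cc'(1) L _ d, of G] \<open>\<And>z. z \<in> G \<Longrightarrow> \<exists>t\<in>{al z'..be z'}. dist z (sg z' t) < d / 4\<close> by blast
    qed
    have "be z' - al z' \<le> L * dist (sg z' (al z')) (sg z' (be z'))"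
      using bilipD(1)[OF cc'(1), of "al z'" "be z'"] cc' by auto
    also have "\<dots> \<le> L * (2 * Cf * \<Lambda> * g)" using fil_K0_diam KF(3) cc' by (intro mult_left_mono) auto
    finally have "2 * L * (be z' - al z') / d \<le> 2 * L * (L * (2 * Cf * \<Lambda> * g)) / d"
      using d by (intro divide_right_mono mult_left_mono) auto
    also have "\<dots> = 64 * L\<^sup>2 * Cf * \<Lambda> / \<rho> ^ J" using g \<rho>J by (simp add: d_def field_simps power2_eq_square)
    finally have "real (card G) \<le> 64 * L\<^sup>2 * Cf * \<Lambda> / \<rho> ^ J + 1" using le by simp
    moreover have "2 \<le> 2 / \<rho> ^ J" using \<rho>J by (simp add: field_simps)
    ultimately have "real (card G) \<le> Qr - 1" by (simp add: Qr_def add_divide_distrib)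
    moreover have "Qr < real q + 1" using Qr0 by (simp add: q_def)
    ultimately have "real (card G) < real q" by simp
    then show False using G(2) by simp
  qed
  then obtain z where z: "z \<in> G" "d / 4 \<le> infdist z \<Sigma>" by blast
  have zZ: "z \<in> Z" "z' \<in> Z" using z z' G(1) by auto
  show thesis
  proof (rule that[of z z' "sg z" "al z" "be z" "sg z'" "al z'" "be z'" S S'])
    show "z \<in> ball y (g / 4)" "z' \<in> ball y (g / 4)" using zZ Z(3) by auto
    show "crosscut K z (sg z) (al z) (be z)" "crosscut K z' (sg z') (al z') (be z')" using cc zZ by auto
    show "chunk (\<epsilon> * g) S" "chunk (\<epsilon> * g) S'" "S \<subseteq> K" "S' \<subseteq> K" using SS T by auto
    show "sg z (al z) \<in> S" "sg z' (al z') \<in> S" "sg z (be z) \<in> S'" "sg z' (be z') \<in> S'"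
      using c12 zZ G(3) z(1) z' by auto
    show "\<rho> ^ J * g / 64 \<le> infdist z (sg z' ` {al z'..be z'})" using z(2) by (simp add: d_def \<Sigma>_def)
  qed
qed

text \<open>The gain: \<open>z\<close>, the centre of the new arc, is deep in \<open>K\<close>, but
  by \<open>attached_arc_accessible\<close> it lies in the closure of the exterior of
  \<open>K1\<close>. So any separated family of deep points of \<open>K1\<close> can be enlarged by
  \<open>z\<close> within \<open>deep K\<close>.\<close>

lemma descent_step:
  assumes K: "admissible K"
  obtains K1 z where "admissible K1" "deep K1 \<subseteq> deep K" "z \<in> deep K" "\<And>w. w \<in> deep K1 \<Longrightarrow> g / 4 \<le> dist w z"
proof -
  obtain y where y: "y \<in> fil K" "\<And>q. q \<in> K \<Longrightarrow> g / 2 \<le> dist y q"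
    using K by (auto simp: admissible_def)
  have KF: "compact K" "K \<subseteq> W" "K \<subseteq> fil K0" "fil K \<subseteq> fil K0" "K \<subseteq> ball x0 (4 * r1)" using admissibleD[OF K] .
  have KK: "K \<subseteq> fil K" by (rule subset_fil[OF KF(2)])
  have by2: "ball y (g / 2) \<inter> K = {}" using y(2) by force
  have ballfil: "ball y (g / 2) \<subseteq> fil K"
  proof (rule connected_subset_fil[OF KF(1,2) connected_ball _ by2])
    have "y \<in> ball y (g / 2)" using g by simp
    then show "ball y (g / 2) \<inter> fil K \<noteq> {}" using y(1) by blast
  qed
  obtain z \<sigma> a b z' \<sigma>' a' b' S T where
    zs: "z \<in> ball y (g / 4)" "z' \<in> ball y (g / 4)" and cc: "crosscut K z \<sigma> a b" "crosscut K z' \<sigma>' a' b'" and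
    ST: "chunk (\<epsilon> * g) S" "chunk (\<epsilon> * g) T" "S \<subseteq> K" "T \<subseteq> K"
      "\<sigma> a \<in> S" "\<sigma>' a' \<in> S" "\<sigma> b \<in> T" "\<sigma>' b' \<in> T" and
    far: "\<rho> ^ J * g / 64 \<le> infdist z (\<sigma>' ` {a'..b'})"
    by (rule two_crosscuts[OF K y])
  have c: "\<sigma> 0 = z" "bilip L \<sigma> {a..b}" "a < 0" "0 < b" "\<sigma> a \<in> K" "\<sigma> b \<in> K"
    "\<And>t. a < t \<Longrightarrow> t < b \<Longrightarrow> \<sigma> t \<in> fil K - K" using cc(1) unfolding crosscut_def by blast+
  have c': "\<sigma>' 0 = z'" "bilip L \<sigma>' {a'..b'}" "a' < 0" "0 < b'" "\<sigma>' a' \<in> K" "\<sigma>' b' \<in> K"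
    "\<And>t. a' < t \<Longrightarrow> t < b' \<Longrightarrow> \<sigma>' t \<in> fil K - K" using cc(2) unfolding crosscut_def by blast+
  have eg: "0 < \<epsilon> * g" "L\<^sup>2 * (\<epsilon> * g) = g / 200" using eps g by (auto simp: \<epsilon>_def)
  have zfar: "g / 4 \<le> dist z q" "g / 4 \<le> dist z' q" if "q \<in> K" for q
    using y(2)[OF that] zs dist_triangle[of y q z] dist_triangle[of y q z'] by auto
  have long: "g / 4 \<le> L * \<bar>t\<bar>" if "t \<in> {a..b}" "\<sigma> t \<in> K" for t
    using zfar(1)[OF that(2)] bilipD(2)[OF c(2) _ that(1), of 0] c by auto
  have long': "g / 4 \<le> L * \<bar>t\<bar>" if "t \<in> {a'..b'}" "\<sigma>' t \<in> K" for t
    using zfar(2)[OF that(2)] bilipD(2)[OF c'(2) _ that(1), of 0] c' by auto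
  define \<Sigma> where "\<Sigma> = \<sigma>' ` {a'..b'}"
  have cont': "continuous_on {a'..b'} \<sigma>'" by (rule bilip_cont[OF c'(2)])
  have \<Sigma>: "compact \<Sigma>" "connected \<Sigma>" "\<Sigma> \<noteq> {}" unfolding \<Sigma>_def
    using c'(3,4) cont' by (auto intro!: compact_continuous_image connected_continuous_image)
  have \<Sigma>sub: "\<Sigma> \<subseteq> fil K"
  proof
    fix q assume "q \<in> \<Sigma>"
    then obtain t where t: "q = \<sigma>' t" "a' \<le> t" "t \<le> b'" by (auto simp: \<Sigma>_def)
    then consider "t = a'" | "t = b'" | "a' < t" "t < b'" by linarith
    then show "q \<in> fil K" using c'(5,6,7) KK t(1) by cases auto
  qed
  have \<Sigma>W: "\<Sigma> \<subseteq> W" using \<Sigma>sub fil_subset_W by blast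
  have \<Sigma>K: "q = \<sigma>' a' \<or> q = \<sigma>' b'" if q: "q \<in> \<Sigma>" "q \<in> K" for q
  proof -
    obtain t where t: "q = \<sigma>' t" "a' \<le> t" "t \<le> b'" using q(1) by (auto simp: \<Sigma>_def)
    then have "\<not> (a' < t \<and> t < b')" using c'(7) q(2) by blast
    then have "t = a' \<or> t = b'" using t(2,3) by linarith
    then show ?thesis using t(1) by blast
  qed
  \<comment> \<open>Both halves of the crosscut have parameter length at least
    \<open>g / (4 * L)\<close>. So its ends are too far apart for a chain of two chunks, and
    \<open>S\<close> and \<open>T\<close> are disjoint.\<close>
  have ends_far: "2 * (\<epsilon> * g) < dist (\<sigma>' a') (\<sigma>' b')"
  proof -
    have "g / 2 \<le> L * (b' - a')" using long'[of a'] long'[of b'] c' by (simp add: algebra_simps)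
    also have "\<dots> \<le> L * (L * dist (\<sigma>' a') (\<sigma>' b'))"
      using bilipD(1)[OF c'(2), of a' b'] c' by (intro mult_left_mono) auto
    finally have "g / 2 \<le> L\<^sup>2 * dist (\<sigma>' a') (\<sigma>' b')" by (simp add: power2_eq_square mult.assoc)
    then have "L\<^sup>2 * (2 * (\<epsilon> * g)) < L\<^sup>2 * dist (\<sigma>' a') (\<sigma>' b')"
      using eg(2) g unfolding mult.left_commute[of "L\<^sup>2" 2] by linarith
    then show ?thesis by simp
  qed
  have dS: "dist p q \<le> \<epsilon> * g" if "p \<in> S" "q \<in> S" for p q using ST(1) that by (auto simp: chunk_def)
  have dT: "dist p q \<le> \<epsilon> * g" if "p \<in> T" "q \<in> T" for p q using ST(2) that by (auto simp: chunk_def)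
  have "S \<inter> T = {}"
  proof (rule ccontr)
    assume "S \<inter> T \<noteq> {}"
    then obtain p where "p \<in> S" "p \<in> T" by blast
    then show False using dS[OF ST(6), of p] dT[OF ST(8), of p] dist_triangle2[of "\<sigma>' a'" "\<sigma>' b'" p] ends_far by linarith
  qed
  define Q where "Q = \<Sigma> \<union> S \<union> T"
  have S: "compact S" "connected S" "nonsep S" "S \<subseteq> W" and T: "compact T" "connected T" "nonsep T" "T \<subseteq> W"
    using ST(1,2) by (auto simp: chunk_def)
  have iS: "\<Sigma> \<inter> S = {\<sigma>' a'}" and iT: "(\<Sigma> \<union> S) \<inter> T = {\<sigma>' b'}"
  proof -
    have aS: "\<sigma>' a' \<in> \<Sigma>" "\<sigma>' b' \<in> \<Sigma>" using c'(3,4) by (auto simp: \<Sigma>_def)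
    have "\<sigma>' b' \<notin> S" "\<sigma>' a' \<notin> T" using ST(6,8) \<open>S \<inter> T = {}\<close> by auto
    then show "\<Sigma> \<inter> S = {\<sigma>' a'}" "(\<Sigma> \<union> S) \<inter> T = {\<sigma>' b'}"
      using \<Sigma>K ST(3,4,6,8) aS \<open>S \<inter> T = {}\<close> by blast+
  qed
  have n\<Sigma>: "nonsep \<Sigma>" unfolding \<Sigma>_def
    using c'(3,4) \<Sigma>W by (intro nonsep_arc cont' bilip_inj[OF c'(2)]) (auto simp: \<Sigma>_def)
  have nQ1: "nonsep (\<Sigma> \<union> S)" by (rule nonsep_Un[OF \<Sigma>(1) \<Sigma>W S(1,4) n\<Sigma> S(3)]) (simp add: iS)
  have nQ: "nonsep Q" unfolding Q_def
    by (rule nonsep_Un[OF _ _ T(1,4) nQ1 T(3)]) (use \<Sigma> S \<Sigma>W iT in auto)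
  have Q: "compact Q" "Q \<subseteq> W" "Q \<subseteq> fil K"
    using \<Sigma> S T \<Sigma>W \<Sigma>sub ST(3,4) KK by (auto simp: Q_def)
  have cQ: "connected Q"
  proof -
    have "connected (\<Sigma> \<union> S)" by (rule connected_Un[OF \<Sigma>(2) S(2)]) (use iS in auto)
    then show ?thesis unfolding Q_def by (rule connected_Un[OF _ T(2)]) (use iT in auto)
  qed
  have \<rho>J: "0 < \<rho> ^ J" using rho by simp
  have z0: "0 < infdist z \<Sigma>" using far \<rho>J g by (intro less_le_trans[OF _ far[folded \<Sigma>_def]]) simp
  have zK: "z \<notin> K" using zfar(1)[of z] g by auto
  have zQ: "z \<notin> Q"
  proof
    assume "z \<in> Q"
    then have "z \<in> \<Sigma>" using zK ST(3,4) by (auto simp: Q_def)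
    then show False using z0 by simp
  qed
  have cont: "continuous_on {a..b} \<sigma>" by (rule bilip_cont[OF c(2)])
  have Qcl: "closed Q" by (rule compact_imp_closed[OF Q(1)])
  have Qab: "\<sigma> 0 \<notin> Q" "\<sigma> a \<in> Q" "\<sigma> b \<in> Q" using zQ c(1) ST(5,7) by (simp_all add: Q_def)
  \<comment> \<open>The crosscut \<open>\<sigma>\<close> is cut at its first meetings with
    \<open>Q\<close> on either side of \<open>z\<close>, so that the new arc touches
    \<open>Q\<close> only with its ends. The cut may occur on \<open>\<Sigma>\<close>, before
    \<open>S\<close> or \<open>T\<close> is reached.\<close>
  obtain u2 where u2: "0 < u2" "u2 \<le> b" "\<sigma> u2 \<in> Q" "\<And>t. 0 \<le> t \<Longrightarrow> t < u2 \<Longrightarrow> \<sigma> t \<notin> Q"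
  proof (rule first_hit[OF _ Qcl Qab(1,3)])
    show "continuous_on {0..b} \<sigma>" using c(3) by (intro continuous_on_subset[OF cont]) auto
    show "0 \<le> b" using c(4) by simp
  qed (rule that)
  obtain v1 where v1: "0 < v1" "v1 \<le> - a" "\<sigma> (- v1) \<in> Q" "\<And>t. 0 \<le> t \<Longrightarrow> t < v1 \<Longrightarrow> \<sigma> (- t) \<notin> Q"
  proof (rule first_hit[of "- a" "\<lambda>t. \<sigma> (- t)" Q])
    show "continuous_on {0..- a} (\<lambda>t. \<sigma> (- t))"
      using c(4) by (intro continuous_on_compose2[OF cont]) (auto intro!: continuous_intros)
    show "\<sigma> (- 0) \<notin> Q" "\<sigma> (- (- a)) \<in> Q" "0 \<le> - a" using Qab c(3) by simp_all
    show "closed Q" by (rule Qcl)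
  qed (rule that)
  define u1 where "u1 = - v1"
  have u1: "u1 < 0" "a \<le> u1" "\<sigma> u1 \<in> Q" using v1 by (auto simp: u1_def)
  have uQ: "\<sigma> t \<notin> Q" if "u1 < t" "t < u2" for t
    using v1(4)[of "-t"] u2(4)[of t] that by (cases "t \<ge> 0") (auto simp: u1_def)
  have bl: "bilip L \<sigma> {u1..u2}" using c(2) u1 u2 by (auto elim: bilip_subset)
  have contu: "continuous_on {u1..u2} \<sigma>" by (rule bilip_cont[OF bl])
  have inner: "\<sigma> t \<in> fil K - K" if "u1 < t" "t < u2" for t using c(7) that u1 u2 by auto
  have \<sigma>sub: "\<sigma> ` {u1..u2} \<subseteq> fil K"
  proof
    fix q assume "q \<in> \<sigma> ` {u1..u2}"
    then obtain t where t: "q = \<sigma> t" "u1 \<le> t" "t \<le> u2" by auto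
    then consider "t = u1" | "t = u2" | "u1 < t" "t < u2" by linarith
    then show "q \<in> fil K" using inner Q(3) u1(3) u2(3) t(1) by cases auto
  qed
  have \<sigma>W: "\<sigma> ` {u1..u2} \<subseteq> W" using \<sigma>sub fil_subset_W by blast
  define gap where "gap t = infdist (\<sigma> t) \<Sigma>" for t
  \<comment> \<open>A plain maximum of the gap could lie far from \<open>z\<close>. The penalty of
    slope \<open>1 / (6 * L)\<close> forces the parameter \<open>ts\<close> to lie within
    \<open>6 * L * G\<close> of 0, at the price that the gap is bounded only by \<open>2 * G\<close>
    in the window about \<open>ts\<close>.\<close>
  define \<psi> where "\<psi> t = gap t - \<bar>t\<bar> / (6 * L)" for t
  have "continuous_on {u1..u2} \<psi>" unfolding \<psi>_def gap_def
    by (intro continuous_intros contu) auto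
  then obtain ts where ts: "ts \<in> {u1..u2}" "\<And>t. t \<in> {u1..u2} \<Longrightarrow> \<psi> t \<le> \<psi> ts"
    using continuous_attains_sup[of "{u1..u2}" \<psi>] u1 u2 by auto
  define G where "G = gap ts"
  have abs0: "0 \<le> \<bar>ts\<bar> / (6 * L)" by simp
  have chi0: "gap 0 \<le> G - \<bar>ts\<bar> / (6 * L)" using ts(2)[of 0] u1 u2 by (simp add: \<psi>_def G_def)
  have gap0: "\<rho> ^ J * g / 64 \<le> gap 0" "0 < gap 0" using far z0 c(1) by (auto simp: gap_def \<Sigma>_def)
  have G: "\<rho> ^ J * g / 64 \<le> G" "0 < G" using chi0 gap0 abs0 by linarith+
  have ts6: "\<bar>ts\<bar> \<le> 6 * L * G"
  proof -
    have "\<bar>ts\<bar> / (6 * L) \<le> G" using chi0 gap0 by linarith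
    then show ?thesis by (simp add: field_simps)
  qed
  have near: "gap t \<le> 2 * G" if "u1 \<le> t" "t \<le> u2" "\<bar>t - ts\<bar> \<le> 6 * L * G" for t
  proof -
    have "\<psi> t \<le> \<psi> ts" using ts(2)[of t] that by auto
    then have "gap t \<le> G + (\<bar>t\<bar> / (6 * L) - \<bar>ts\<bar> / (6 * L))" unfolding \<psi>_def G_def by linarith
    also have "\<dots> = G + (\<bar>t\<bar> - \<bar>ts\<bar>) / (6 * L)" by (simp only: diff_divide_distrib)
    also have "\<dots> \<le> G + (6 * L * G) / (6 * L)"
    proof (intro add_left_mono divide_right_mono)
      show "\<bar>t\<bar> - \<bar>ts\<bar> \<le> 6 * L * G" by (rule order_trans[OF abs_triangle_ineq2 that(3)])
    qed simp
    also have "\<dots> = 2 * G" by simp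
    finally show ?thesis .
  qed
  have Qend: "gap u = 0 \<or> (\<sigma> u \<in> K \<and> gap u \<le> \<epsilon> * g)" if uinQ: "\<sigma> u \<in> Q" for u
  proof -
    have s: "\<sigma>' a' \<in> \<Sigma>" "\<sigma>' b' \<in> \<Sigma>" using c'(3,4) by (auto simp: \<Sigma>_def)
    consider "\<sigma> u \<in> \<Sigma>" | "\<sigma> u \<in> S" | "\<sigma> u \<in> T" using uinQ unfolding Q_def by blast
    then show ?thesis
    proof cases
      case 1 then show ?thesis by (simp add: gap_def)
    next
      case 2
      then show ?thesis using infdist_le2[OF s(1) dS[OF 2 ST(6)]] ST(3) by (auto simp: gap_def)
    next
      case 3
      then show ?thesis using infdist_le2[OF s(2) dT[OF 3 ST(8)]] ST(4) by (auto simp: gap_def)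
    qed
  qed
  \<comment> \<open>An end of the arc inside the window lies on \<open>\<Sigma>\<close> or on
    \<open>K\<close>. In the second case it is far from \<open>z\<close>, so
    \<open>g \<le> 48 * L^2 * G\<close>; the gap there is at most the chunk size
    \<open>\<epsilon> * g\<close>, and the 200 in \<open>\<epsilon>\<close> makes this at most
    \<open>G / 4\<close>.\<close>
  have small_end: "gap u \<le> G / 4" if u: "u = u1 \<or> u = u2" and ut: "\<bar>u - ts\<bar> \<le> 6 * L * G" for u
  proof -
    have uq: "\<sigma> u \<in> Q" "u \<in> {a..b}" using u u1 u2 by auto
    show ?thesis
    proof (cases "gap u = 0")
      case False
      then have uK: "\<sigma> u \<in> K" "gap u \<le> \<epsilon> * g" using Qend[OF uq(1)] by auto
      have "g / 4 \<le> L * \<bar>u\<bar>" using long[OF uq(2) uK(1)] .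
      also have "\<dots> \<le> L * (12 * L * G)" using ut ts6 by (intro mult_left_mono) auto
      finally have "g \<le> L\<^sup>2 * (48 * G)" by (simp add: power2_eq_square mult_ac)
      then have "L\<^sup>2 * (\<epsilon> * g) \<le> L\<^sup>2 * (G / 4)"
      proof -
        assume "g \<le> L\<^sup>2 * (48 * G)"
        moreover have "0 < L\<^sup>2 * G" using G L2_ge by simp
        ultimately show ?thesis unfolding eg(2) by simp
      qed
      then show ?thesis using uK(2) by simp
    qed (use G in simp)
  qed
  have tsK: "\<sigma> ts \<in> fil K0" using \<sigma>sub ts(1) KF(4) by blast
  \<comment> \<open>\<open>G / (32 * L^4)\<close> is the scale at which either loop below encloses a
    point. In the first case \<open>none\<close> forbids it; in the second it exceeds
    \<open>g / 2\<close>, which is what admissibility of \<open>K1\<close> asks for.\<close>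
  show thesis
  proof (cases "G / (32 * L^4) \<le> g / 2")
    case True
    have L4: "0 < 32 * L^4" by simp
    have "G \<le> g / 2 * (32 * L^4)" using True unfolding pos_divide_le_eq[OF L4] .
    then have G16: "G \<le> 16 * L^4 * g" by (simp add: mult_ac)
    have "24 * L^4 * G \<le> 24 * L^4 * (16 * L^4 * g)" using G16 by (intro mult_left_mono) auto
    moreover have "L^8 = L^4 * L^4" using power_add[of L 4 4] by simp
    moreover have "24 * L^4 * (16 * L^4 * g) = 384 * (L^4 * L^4) * g" by simp
    ultimately have LG: "24 * L^4 * G \<le> 384 * L^8 * g" by metis
    have "\<exists>y' K'. enclosed (4 * m) ((Cf + 1) * 768 * L^8) (G / (32 * L^4)) y' K' \<and> dist (\<sigma> ts) y' \<le> Cf * (24 * L^4 * G)"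
    proof (rule fat_window[OF bl c'(2) _ _ _ G(2)])
      show "infdist (\<sigma> ts) (\<sigma>' ` {a'..b'}) = G" by (simp add: G_def gap_def \<Sigma>_def)
      show "infdist (\<sigma> t) (\<sigma>' ` {a'..b'}) \<le> 2 * G" if "u1 \<le> t" "t \<le> u2" "\<bar>t - ts\<bar> \<le> 6 * L * G" for t
        using near[OF that] by (simp add: gap_def \<Sigma>_def)
      show "u1 \<le> ts - 6 * L * G \<or> infdist (\<sigma> u1) (\<sigma>' ` {a'..b'}) \<le> G / 4"
      proof (cases "u1 \<le> ts - 6 * L * G")
        case False
        then have "\<bar>u1 - ts\<bar> \<le> 6 * L * G" using ts(1) unfolding atLeastAtMost_iff by linarith
        then show ?thesis using small_end[of u1] unfolding gap_def \<Sigma>_def by blast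
      qed simp
      show "ts + 6 * L * G \<le> u2 \<or> infdist (\<sigma> u2) (\<sigma>' ` {a'..b'}) \<le> G / 4"
      proof (cases "ts + 6 * L * G \<le> u2")
        case False
        then have "\<bar>u2 - ts\<bar> \<le> 6 * L * G" using ts(1) unfolding atLeastAtMost_iff by linarith
        then show ?thesis using small_end[of u2] unfolding gap_def \<Sigma>_def by blast
      qed simp
      show "\<sigma> ts \<in> ball x0 r1" by (rule fil_K0_near(2)[OF tsK])
      have "0 < L^8 * g" using g by simp
      then show "24 * L^4 * G < r1" using LG D_ge(2) Dg r1 by linarith
      show "a' \<le> b'" using c'(3,4) by linarith
      show "u1 \<le> ts" "ts \<le> u2" using ts(1) by simp_all
    qed (rule m)
    then obtain y' K' where yK: "enclosed (4 * m) ((Cf + 1) * 768 * L^8) (G / (32 * L^4)) y' K'"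
      "dist (\<sigma> ts) y' \<le> Cf * (24 * L^4 * G)" by blast
    have "enclosed n \<Lambda> (G / (32 * L^4)) y' K'" by (rule enclosed_mono[OF yK(1) nm \<Lambda>])
    moreover have "\<rho> ^ J * g / (2048 * L^4) \<le> G / (32 * L^4)"
    proof -
      have "(\<rho> ^ J * g / 64) / (32 * L^4) \<le> G / (32 * L^4)" using G by (intro divide_right_mono) auto
      then show ?thesis by simp
    qed
    moreover have "dist y0 y' \<le> D * g"
    proof -
      have "Cf * (24 * L^4 * G) \<le> Cf * (384 * L^8 * g)" using LG Cf_ge by (intro mult_left_mono) auto
      then have "dist (\<sigma> ts) y' \<le> 384 * Cf * L^8 * g" using yK(2) by (simp add: mult_ac)
      then show ?thesis using dist_triangle[of y0 y' "\<sigma> ts"] fil_K0_near(1)[OF tsK] D_ge(6) by linarith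
    qed
    ultimately show thesis using none True by blast
  next
    case False
    have L4: "0 < 32 * L^4" by simp
    have "g / 2 * (32 * L^4) < G" using False unfolding not_le pos_less_divide_eq[OF L4] .
    then have G16: "16 * L^4 * g < G" by (simp add: mult_ac)
    have gG: "2 * (\<epsilon> * g) \<le> G"
    proof -
      have "1 * g \<le> L^4 * g" using L_powers g by (intro mult_right_mono) auto
      moreover have "\<epsilon> * g \<le> 1 * g" using eps g by (intro mult_right_mono) auto
      ultimately show ?thesis using G16 g by linarith
    qed
    define K1 where "K1 = Q \<union> \<sigma> ` {u1..u2}"
    have QG: "G / 2 \<le> dist (\<sigma> ts) q" if qQ: "q \<in> Q" for q
    proof -
      have \<Sigma>G: "G \<le> dist (\<sigma> ts) p" if "p \<in> \<Sigma>" for p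
        using infdist_le[OF that, of "\<sigma> ts"] by (simp add: G_def gap_def)
      have s: "\<sigma>' a' \<in> \<Sigma>" "\<sigma>' b' \<in> \<Sigma>" using c'(3,4) by (auto simp: \<Sigma>_def)
      consider "q \<in> \<Sigma>" | "q \<in> S" | "q \<in> T" using qQ unfolding Q_def by blast
      then show ?thesis
      proof cases
        case 1 then show ?thesis using \<Sigma>G[OF 1] G by simp
      next
        case 2
        then show ?thesis using \<Sigma>G[OF s(1)] dS[OF 2 ST(6)] dist_triangle[of "\<sigma> ts" "\<sigma>' a'" q] gG by linarith
      next
        case 3
        then show ?thesis using \<Sigma>G[OF s(2)] dT[OF 3 ST(8)] dist_triangle[of "\<sigma> ts" "\<sigma>' b'" q] gG by linarith
      qed
    qed
    obtain y1 where y1: "y1 \<in> fil (\<sigma> ` {u1..u2} \<union> Q)" "\<And>q. q \<in> \<sigma> ` {u1..u2} \<union> Q \<Longrightarrow> (G / 2) / (16 * L^4) < dist y1 q"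
      using loop_encloses[OF L bl \<sigma>W _ _ Q(1) cQ Q(2) u1(3) u2(3) _ QG] ts(1) G by auto
    have eqK1: "\<sigma> ` {u1..u2} \<union> Q = K1" by (auto simp: K1_def)
    have pieces: "tiled m' (\<epsilon> * g) (c ` {s..t})" if "bilip L c {s..t}" "s \<le> t" "c ` {s..t} \<subseteq> fil K" for c s t
    proof (rule tiled_curve[OF that(1)])
      show "c ` {s..t} \<subseteq> W" using that(3) fil_subset_W by blast
      have "dist (c s) (c t) \<le> 2 * Cf * \<Lambda> * g"
      proof (rule fil_K0_diam)
        have "c s \<in> c ` {s..t}" "c t \<in> c ` {s..t}" using that(2) by auto
        then show "c s \<in> fil K0" "c t \<in> fil K0" using that(3) KF(4) by blast+
      qed
      then have "L * dist (c s) (c t) \<le> L * (2 * Cf * \<Lambda> * g)" by (intro mult_left_mono) auto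
      then have "t - s \<le> L * (2 * Cf * \<Lambda> * g)"
      proof -
        have "\<bar>s - t\<bar> \<le> L * dist (c s) (c t)" using bilipD(1)[OF that(1), of s t] that(2) by auto
        then show ?thesis using \<open>L * dist (c s) (c t) \<le> L * (2 * Cf * \<Lambda> * g)\<close> that(2) by linarith
      qed
      then have "L * (t - s) \<le> L * (L * (2 * Cf * \<Lambda> * g))" by (intro mult_left_mono) auto
      also have "\<dots> = 2 * L\<^sup>2 * Cf * \<Lambda> / \<epsilon> * (\<epsilon> * g)" using eps by (simp add: power2_eq_square)
      also have "\<dots> \<le> real m' * (\<epsilon> * g)" using m' eg by (intro mult_right_mono) auto
      finally show "L * (t - s) \<le> real m' * (\<epsilon> * g)" .
      have "0 < 2 * L\<^sup>2 * Cf * \<Lambda> / \<epsilon>" using eps Cf_ge Lam4 by simp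
      then show "1 \<le> m'" using m' by (cases m') auto
    qed (rule that(2))
    \<comment> \<open>Only the two arcs and the two chunks are counted, not the tiling of
      \<open>K\<close>, so the count does not grow from step to step.\<close>
    have "tiled (m' + (m' + 1 + 1)) (\<epsilon> * g) (\<sigma> ` {u1..u2} \<union> Q)"
      unfolding Q_def using ST(1,2) u1 u2 c' \<sigma>sub \<Sigma>sub unfolding \<Sigma>_def
      by (intro tiled_Un tiled_chunk pieces bl c'(2)) auto
    then have "tiled N (\<epsilon> * g) K1" unfolding eqK1 by (rule tiled_mono) (auto simp: N_def)
    moreover have K1f: "K1 \<subseteq> fil K" using Q \<sigma>sub by (auto simp: K1_def)
    moreover have "\<forall>q\<in>K1. g / 2 \<le> dist y1 q"
    proof
      fix q assume "q \<in> K1"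
      then have "(G / 2) / (16 * L^4) < dist y1 q" using y1(2) eqK1 by blast
      then show "g / 2 \<le> dist y1 q" using False by simp
    qed
    ultimately have adm: "admissible K1" using y1(1) KF(4) unfolding admissible_def eqK1 by blast
    have ext: "ext K \<subseteq> ext K1" by (rule ext_mono[OF KF(1,2) admissibleD(1)[OF adm] K1f])
    show thesis
    proof (rule that[OF adm])
      show "deep K1 \<subseteq> deep K" using closure_mono[OF ext] unfolding deep_def by blast
      show "z \<in> deep K"
      proof -
        have "ball z (g / 4) \<subseteq> ball y (g / 2)"
        proof
          fix w assume "w \<in> ball z (g / 4)"
          then show "w \<in> ball y (g / 2)" using zs(1) dist_triangle[of y w z] by simp
        qed
        moreover have "ball y (g / 2) \<subseteq> W" using ballfil fil_subset_W by blast
        moreover have "ball y (g / 2) \<inter> ext K = {}" using ballfil ext_fil_disjoint by blast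
        then have "ball y (g / 2) \<inter> closure (ext K) = {}" by (simp add: open_Int_closure_eq_empty)
        ultimately show ?thesis unfolding deep_def by blast
      qed
      fix w assume w: "w \<in> deep K1"
      have "\<sigma> 0 \<in> closure (ext (Q \<union> \<sigma> ` {u1..u2}))"
        by (rule attached_arc_accessible[OF Q(1,2) nQ contu bilip_inj[OF bl] \<sigma>W u1(3) u2(3) uQ u1(1) u2(1)])
      then have "z \<notin> ball w (g / 4)" using w c(1) unfolding deep_def K1_def by blast
      then show "g / 4 \<le> dist w z" by simp
    qed
  qed
qed

text \<open>Among all admissible sets take one whose bound \<open>M\<close> on separated families of
  deep points is least; one more step would lower it.\<close>

lemma contradiction: False
proof -
  obtain N0 where N0: "\<And>F. F \<subseteq> fil K0 \<Longrightarrow> separated (g / 4) F \<Longrightarrow> finite F \<and> card F \<le> N0"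
    using compact_separated_bound[OF compact_fil[OF K0(1,2)], of "g / 4"] g by auto
  define P where "P n \<longleftrightarrow> (\<exists>K. admissible K \<and> (\<forall>F. F \<subseteq> deep K \<longrightarrow> separated (g / 4) F \<longrightarrow> finite F \<and> card F \<le> n))" for n
  have "P N0" unfolding P_def using admissible_K0 deep_sub[OF admissible_K0] N0 by (intro exI[of _ K0]) blast
  then have least: "P (LEAST n. P n)" "\<And>j. P j \<Longrightarrow> (LEAST n. P n) \<le> j" by (auto intro: LeastI Least_le)
  define M where "M = (LEAST n. P n)"
  obtain K where K: "admissible K" "\<And>F. F \<subseteq> deep K \<Longrightarrow> separated (g / 4) F \<Longrightarrow> finite F \<and> card F \<le> M"
    using least(1) unfolding M_def P_def by blast
  obtain K1 z where K1: "admissible K1" "deep K1 \<subseteq> deep K" "z \<in> deep K" "\<And>w. w \<in> deep K1 \<Longrightarrow> g / 4 \<le> dist w z"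
    by (rule descent_step[OF K(1)]) blast
  have step: "finite F \<and> Suc (card F) \<le> M" if F: "F \<subseteq> deep K1" "separated (g / 4) F" for F
  proof -
    have "separated (g / 4) (insert z F)" using F K1(4) by (auto simp: separated_def dist_commute)
    moreover have "insert z F \<subseteq> deep K" using F K1(2,3) by blast
    ultimately have "finite (insert z F)" "card (insert z F) \<le> M" using K(2)[of "insert z F"] by simp_all
    moreover have "z \<notin> F" using K1(4)[of z] F(1) g by auto
    ultimately show ?thesis by simp
  qed
  have "1 \<le> M" using step[of "{}"] by (simp add: separated_def)
  moreover have "P (M - 1)" unfolding P_def
  proof (intro exI[of _ K1] conjI allI impI)
    fix F assume F: "F \<subseteq> deep K1" "separated (g / 4) F"
    show "finite F" "card F \<le> M - 1" using step[OF F] by auto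
  qed (rule K1(1))
  then have "M \<le> M - 1" using least(2) by (simp add: M_def)
  ultimately show False by simp
qed

end

section \<open>Uniform packing bounds\<close>

text \<open>A packing form of doubling. It passes at once to subsets and, with
  \<open>\<Lambda>\<close> enlarged, to biLipschitz images, because the separated points already lie
  in the set and no centres have to be moved.\<close>

definition packing_bounded :: "'a::metric_space set \<Rightarrow> bool" where
  "packing_bounded S \<longleftrightarrow> (\<forall>\<Lambda>>0. \<exists>N::nat. \<forall>x\<in>S. \<forall>R>0. \<forall>F. F \<subseteq> S \<inter> ball x (\<Lambda> * R) \<longrightarrow> separated R F \<longrightarrow>
     finite F \<and> card F \<le> N)"

context hom_surface
begin

definition \<Lambda>0 :: real where "\<Lambda>0 = (Cf + 1) * 768 * L^8"

definition D0 :: real where "D0 = Cf * \<Lambda>0 + 400 * Cf * L^8"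

lemma Lam0: "4 \<le> \<Lambda>0" "1 \<le> D0"
proof -
  have "4 \<le> (Cf + 1) * 768 * 1" using Cf_ge by simp
  also have "\<dots> \<le> (Cf + 1) * 768 * L^8" using L_powers Cf_ge by (intro mult_left_mono) auto
  finally show l: "4 \<le> \<Lambda>0" by (simp add: \<Lambda>0_def)
  have "0 \<le> Cf * L^8" using Cf_ge by simp
  moreover have "5 * 4 \<le> Cf * \<Lambda>0" using Cf_ge l by (intro mult_mono) auto
  ultimately show "1 \<le> D0" unfolding D0_def by linarith
qed

text \<open>The failure of the conclusion is the assumption \<open>none\<close> of
  \<open>descent\<close>. The ratio \<open>B\<close> depends on \<open>n\<close> through
  \<open>J\<close>, while \<open>n\<close> has only lower bounds; so \<open>n\<close> can be fixed
  first and then serves all scales.\<close>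

lemma smaller_scale:
  assumes m: "512 * L^8 / \<epsilon> \<le> real m" and nm: "4 * m \<le> n" and n\<rho>: "2 / \<rho> \<le> real (n + 1)"
  obtains B where "2 \<le> B"
    "\<And>g y0 K0. enclosed n \<Lambda>0 g y0 K0 \<Longrightarrow> dist x0 y0 + 2 * D0 * g < r1 / 4 \<Longrightarrow>
       \<exists>s y K. g / B \<le> s \<and> s \<le> g / 2 \<and> dist y0 y \<le> D0 * g \<and> enclosed n \<Lambda>0 s y K"
proof -
  obtain m' :: nat where m': "2 * L\<^sup>2 * Cf * \<Lambda>0 / \<epsilon> \<le> real m'" using real_arch_simple by blast
  define N where "N = max n (2 * m' + 2)"
  obtain J :: nat where J: "real (N * N) * (64 * L\<^sup>2 * Cf * \<Lambda>0 + 2) < 2 ^ J" using ex_pow2 by blast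
  have \<rho>J: "0 < \<rho> ^ J" "\<rho> ^ J \<le> 1" using rho by (auto simp: power_le_one)
  define B where "B = 2048 * L^4 / \<rho> ^ J"
  have "2 \<le> B"
  proof -
    have "2 * \<rho> ^ J \<le> 2048 * L^4" using \<rho>J(2) L_powers(5) by linarith
    then show ?thesis using \<rho>J(1) by (simp add: B_def field_simps)
  qed
  then show thesis
  proof (rule that)
    fix g y0 K0 assume en: "enclosed n \<Lambda>0 g y0 K0" and loc: "dist x0 y0 + 2 * D0 * g < r1 / 4"
    show "\<exists>s y K. g / B \<le> s \<and> s \<le> g / 2 \<and> dist y0 y \<le> D0 * g \<and> enclosed n \<Lambda>0 s y K"
    proof (rule ccontr)
      assume no: "\<not> ?thesis"
      have "descent W h k x0 A L \<tau> r1 n m m' J N \<Lambda>0 D0 g y0 K0"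
      proof (intro descent.intro hom_surface_axioms descent_axioms.intro)
        fix s y K assume s: "\<rho> ^ J * g / (2048 * L ^ 4) \<le> s" "s \<le> g / 2" "dist y0 y \<le> D0 * g"
        have "g / B \<le> s" using s(1) by (simp add: B_def mult_ac)
        then show "\<not> enclosed n \<Lambda>0 s y K" using no s by blast
      qed (use m nm n\<rho> m' J en loc in \<open>auto simp: \<Lambda>0_def D0_def N_def\<close>)
      then show False by (rule descent.contradiction)
    qed
  qed
qed

text \<open>At the top scale an enclosing set exists because the compact sphere of radius
  \<open>3 * g0\<close> does not hold \<open>n + 1\<close> separated points. From there each step at
  least halves the scale and divides it by at most \<open>B\<close>, so every interval from
  \<open>t / B\<close> to \<open>t\<close> is hit.\<close>

lemma good_scales:
  obtains n :: nat and B g0 :: real where "2 \<le> B" "0 < g0"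
    "\<And>t. 0 < t \<Longrightarrow> t \<le> g0 \<Longrightarrow> \<exists>s y K. t / B \<le> s \<and> s \<le> t \<and> dist x0 y < r1 / 8 \<and> enclosed n \<Lambda>0 s y K"
proof -
  define g0 where "g0 = r1 / (64 * D0)"
  have g0: "0 < g0" "64 * (D0 * g0) = r1" using Lam0 r1 by (auto simp: g0_def)
  have "1 * g0 \<le> D0 * g0" using Lam0 g0 by (intro mult_right_mono) auto
  then have g0r: "64 * g0 \<le> r1" using g0 by linarith
  define S where "S = {w. dist x0 w = 3 * g0}"
  have "closed S" unfolding S_def by (intro closed_Collect_eq continuous_intros)
  moreover have "S \<subseteq> ball x0 (4 * r1)" using g0 g0r r1 by (auto simp: S_def)
  ultimately have "compact S" using compact_small by blast
  moreover have "0 < 16 * \<rho> * g0" using rho g0 by simp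
  ultimately obtain N1 :: nat where N1: "\<And>F. F \<subseteq> S \<Longrightarrow> separated (16 * \<rho> * g0) F \<Longrightarrow> finite F \<and> card F \<le> N1"
    using compact_separated_bound by metis
  obtain m :: nat where m: "512 * L^8 / \<epsilon> \<le> real m" using real_arch_simple by blast
  obtain p :: nat where p: "2 / \<rho> \<le> real p" using real_arch_simple by blast
  define n where "n = N1 + 4 * m + p"
  obtain B where B: "2 \<le> B"
    "\<And>g y0 K0. enclosed n \<Lambda>0 g y0 K0 \<Longrightarrow> dist x0 y0 + 2 * D0 * g < r1 / 4 \<Longrightarrow>
       \<exists>s y K. g / B \<le> s \<and> s \<le> g / 2 \<and> dist y0 y \<le> D0 * g \<and> enclosed n \<Lambda>0 s y K"
    using smaller_scale[OF m, of n] p by (auto simp: n_def)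
  \<comment> \<open>The enclosed point moves by at most \<open>D0 * s\<close> per step, while
    \<open>s\<close> at least halves. The reserve \<open>4 * (D0 * s)\<close> pays for the move and
    for the new reserve, so the points never leave the ball of radius \<open>r1 / 8\<close>.\<close>
  define I where "I s \<longleftrightarrow> (\<exists>y K. enclosed n \<Lambda>0 s y K \<and> dist x0 y + 4 * (D0 * s) < r1 / 8)" for s
  have I0: "I g0"
  proof -
    have "\<exists>K. enclosed n 4 g0 x0 K"
    proof (rule ccontr)
      assume "\<nexists>K. enclosed n 4 g0 x0 K"
      then obtain F where F: "finite F" "card F = n + 1" "F \<subseteq> {w. dist x0 w = 3 * g0}" "separated (16 * \<rho> * g0) F"
        using sphere_packing[of x0 g0 n] g0 g0r r1 by auto
      then have "n + 1 \<le> N1" using N1[of F] by (simp add: S_def)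
      then show False by (simp add: n_def)
    qed
    then have "\<exists>K. enclosed n \<Lambda>0 g0 x0 K" using enclosed_mono[OF _ order_refl Lam0(1)] by blast
    then show ?thesis unfolding I_def using g0 r1 by (intro exI[of _ x0]) auto
  qed
  have step: "\<exists>s'. s / B \<le> s' \<and> s' \<le> s / 2 \<and> I s'" if Is: "I s" for s
  proof -
    obtain y K where y: "enclosed n \<Lambda>0 s y K" "dist x0 y + 4 * (D0 * s) < r1 / 8" using Is unfolding I_def by blast
    then have "0 < s" by (simp add: enclosed_def)
    then have Ds: "0 < D0 * s" using Lam0 by simp
    then have "dist x0 y + 2 * D0 * s < r1 / 4" using y(2) r1 unfolding mult.assoc by linarith
    then obtain s' y' K' where s': "s / B \<le> s'" "s' \<le> s / 2" "dist y y' \<le> D0 * s" "enclosed n \<Lambda>0 s' y' K'"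
      using B(2)[OF y(1)] by blast
    have "D0 * s' \<le> D0 * (s / 2)" using s'(2) Lam0 by (intro mult_left_mono) auto
    then have "dist x0 y' + 4 * (D0 * s') < r1 / 8"
      using dist_triangle[of x0 y' y] s'(3) y(2) Ds by simp
    then show ?thesis using s' unfolding I_def by blast
  qed
  have down: "s \<le> 2 ^ j * t \<Longrightarrow> t \<le> s \<Longrightarrow> I s \<Longrightarrow> 0 < t \<Longrightarrow> \<exists>s'. t / B \<le> s' \<and> s' \<le> t \<and> I s'" for j s t
  proof (induction j arbitrary: s)
    case 0
    then have "s = t" by simp
    moreover have "t / B \<le> t" using B(1) 0 by (simp add: field_simps)
    ultimately show ?case using 0 by blast
  next
    case (Suc j)
    obtain s' where s': "s / B \<le> s'" "s' \<le> s / 2" "I s'" using step[OF Suc.prems(3)] by blast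
    show ?case
    proof (cases "s' \<le> t")
      case True
      have "t / B \<le> s / B" using Suc.prems B by (intro divide_right_mono) auto
      then show ?thesis using s' True by (intro exI[of _ s']) auto
    next
      case False
      show ?thesis by (rule Suc.IH[OF _ _ s'(3) Suc.prems(4)]) (use s' Suc.prems False in auto)
    qed
  qed
  show thesis
  proof (rule that[OF B(1) g0(1)])
    fix t assume t: "0 < t" "t \<le> g0"
    obtain j where "g0 / t < 2 ^ j" using ex_pow2 by blast
    then have "g0 \<le> 2 ^ j * t" using t by (simp add: field_simps)
    then obtain s where s: "t / B \<le> s" "s \<le> t" "I s" using down[OF _ t(2) I0 t(1)] by blast
    then obtain y K where y: "enclosed n \<Lambda>0 s y K" "dist x0 y + 4 * (D0 * s) < r1 / 8" unfolding I_def by blast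
    then have "0 \<le> D0 * s" using Lam0 by (simp add: enclosed_def)
    then show "\<exists>s y K. t / B \<le> s \<and> s \<le> t \<and> dist x0 y < r1 / 8 \<and> enclosed n \<Lambda>0 s y K"
      using s y by (intro exI[of _ s] exI[of _ y] exI[of _ K]) auto
  qed
qed

section \<open>Covering balls layer by layer\<close>

lemma dense': "dist x0 x < 4 * r1 \<Longrightarrow> 0 < e \<Longrightarrow> \<exists>a\<in>A. dist x a < e"
proof (rule dense)
  assume "dist x0 x < 4 * r1"
  moreover have "L * r1 \<le> L\<^sup>2 * r1" using L_powers(1) r1 by (intro mult_right_mono) auto
  then have "4 * r1 * (4 * L) \<le> \<tau>" using r1_\<tau> by argo
  then have "4 * r1 \<le> \<tau> / (4 * L)" by (subst pos_le_divide_eq) auto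
  ultimately show "x \<in> ball x0 (\<tau> / (4 * L))" by simp
qed

text \<open>One layer: a biLipschitz map carries the enclosed region to a neighbourhood of any point \<open>c\<close>
  of \<open>A\<close>; its boundary is covered by boundedly many small balls, and a geodesic leaving the region
  crosses the boundary after a definite length.\<close>

lemma layer:
  assumes en: "enclosed n \<Lambda>0 s y K" and y: "dist x0 y < r1 / 8" and s: "16 * L * Cf * \<Lambda>0 * s < r1"
    and c: "c \<in> A" "dist x0 c < r1"
  obtains C where "finite C" "card C \<le> n" "C \<subseteq> A"
    "\<And>c'. c' \<in> C \<Longrightarrow> dist c c' \<le> 2 * L * Cf * \<Lambda>0 * s + s"
    "\<And>q w. dist c q < s / (4 * L) \<Longrightarrow> dist q w + s / (4 * L) < \<tau> / L \<Longrightarrow> dist c w \<le> 2 * L * Cf * \<Lambda>0 * s \<or>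
       (\<exists>c'\<in>C. \<exists>q1. dist c' q1 < s / (4 * L) \<and> dist q1 w \<le> dist q w - s / (4 * L))"
proof -
  have s0: "0 < s" and K: "tiled n (\<epsilon> * s) K" "K \<subseteq> cball y (\<Lambda>0 * s)" "y \<in> fil K" "\<And>q. q \<in> K \<Longrightarrow> s \<le> dist y q"
    using en by (auto simp: enclosed_def)
  define R where "R = 2 * Cf * \<Lambda>0 * s"
  have CL: "20 \<le> Cf * \<Lambda>0" using mult_mono[of 5 Cf 4 \<Lambda>0] Cf_ge Lam0 by simp
  have R: "0 < R" "40 * s \<le> R" "R \<le> L * R" "8 * (L * R) < r1"
  proof -
    have "20 * s \<le> Cf * \<Lambda>0 * s" using CL s0 by (intro mult_right_mono) auto
    then show "40 * s \<le> R" unfolding R_def by linarith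
    then show "0 < R" using s0 by simp
    then show "R \<le> L * R" using L by simp
    show "8 * (L * R) < r1" using s by (simp add: R_def mult_ac)
  qed
  have Kc: "compact K" "K \<subseteq> W" using tiledD[OF K(1)] by auto
  have fK: "fil K \<subseteq> ball y (Cf * (\<Lambda>0 * s))"
  proof (rule fil_cball[OF _ _ _ Kc(1) K(2)])
    show "y \<in> ball x0 r1" using y r1 by simp
    show "0 < \<Lambda>0 * s" using Lam0 s0 by simp
    have "1 * (\<Lambda>0 * s) \<le> Cf * (\<Lambda>0 * s)" using Cf_ge Lam0 s0 by (intro mult_right_mono) auto
    then show "\<Lambda>0 * s < r1" using R r1 by (simp add: R_def)
  qed
  \<comment> \<open>Homogeneity maps join points of \<open>A\<close> only, so the enclosed point is
    replaced by \<open>y'\<close>, at the cost of half the inner radius.\<close>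
  have "\<exists>a\<in>A. dist y a < s / 2" using y r1 s0 by (intro dense') auto
  then obtain y' where y': "y' \<in> A" "dist y y' < s / 2" by blast
  have sub: "ball y s \<subseteq> fil K" "ball y s \<inter> K = {}"
  proof -
    show 1: "ball y s \<inter> K = {}" using K(4) by force
    show "ball y s \<subseteq> fil K"
    proof (rule connected_subset_fil[OF Kc connected_ball _ 1])
      show "ball y s \<inter> fil K \<noteq> {}" using K(3) s0 by (force intro!: exI[of _ y])
    qed
  qed
  have y'K: "s / 2 \<le> dist y' q" if "q \<in> K" for q
    using K(4)[OF that] y'(2) dist_triangle[of y q y'] by simp
  have fR: "dist y' w < R" if "w \<in> fil K" for w
  proof -
    have "dist y w < Cf * \<Lambda>0 * s" using fK that by (auto simp: mult_ac)
    then show ?thesis using y'(2) dist_triangle3[of y' w y] R(2) s0 unfolding R_def by linarith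
  qed
  have KR: "dist y' w < R" if "w \<in> K" for w using fR subset_fil[OF Kc(2)] that by blast
  have "r1 \<le> L\<^sup>2 * r1" using mult_right_mono[OF L_powers(2), of r1] r1 by simp
  then have R\<tau>: "R < \<tau>" using R(3,4) r1_\<tau> r1 R(1) by linarith
  obtain f where f: "f y' = c" "ball c (\<tau> / L) \<subseteq> f ` ball y' \<tau>"
    "\<And>u v. u \<in> ball y' \<tau> \<Longrightarrow> v \<in> ball y' \<tau> \<Longrightarrow> dist u v \<le> L * dist (f u) (f v)"
    "\<And>u v. u \<in> ball y' \<tau> \<Longrightarrow> v \<in> ball y' \<tau> \<Longrightarrow> dist (f u) (f v) \<le> L * dist u v"
    using homog[OF y'(1) c(1)] by blast
  have y'in: "y' \<in> ball y' \<tau>" using \<tau> by simp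
  have Kin: "q \<in> ball y' \<tau>" if "q \<in> K" for q using KR[OF that] R\<tau> by simp
  have fKR: "dist c (f q) \<le> L * R" if "q \<in> K" for q
  proof -
    have "dist (f y') (f q) \<le> L * dist y' q" using f(4)[OF y'in Kin[OF that]] .
    also have "\<dots> \<le> L * R" using KR[OF that] by (intro mult_left_mono) auto
    finally show ?thesis using f(1) by simp
  qed
  obtain T where T: "finite T" "card T \<le> n" "\<Union>T = K" "\<And>S. S \<in> T \<Longrightarrow> chunk (\<epsilon> * s) S"
    using K(1) unfolding tiled_def by auto
  have s8: "0 < s / (8 * L)" "s / (8 * L) \<le> s" "s / (4 * L) \<le> s" using s0 L by (auto simp: field_simps)
  have ex: "\<exists>a\<in>A. dist (f q) a < s / (8 * L)" if "q \<in> K" for q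
  proof (rule dense')
    show "dist x0 (f q) < 4 * r1" using fKR[OF that] c(2) dist_triangle[of x0 "f q" c] R r1 by linarith
  qed (rule s8)
  have "\<forall>S\<in>T - {{}}. \<exists>a\<in>A. \<exists>q\<in>S. dist (f q) a < s / (8 * L)"
  proof
    fix S assume "S \<in> T - {{}}"
    then obtain q where "q \<in> S" "q \<in> K" using T(3) by blast
    then show "\<exists>a\<in>A. \<exists>q\<in>S. dist (f q) a < s / (8 * L)" using ex[of q] by blast
  qed
  \<comment> \<open>One point of \<open>A\<close> for each nonempty chunk, close to the image of the
    chunk; these are the centres of the next layer.\<close>
  then obtain cs where cs: "\<And>S. S \<in> T - {{}} \<Longrightarrow> cs S \<in> A \<and> (\<exists>q\<in>S. dist (f q) (cs S) < s / (8 * L))" by metis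
  define C where "C = cs ` (T - {{}})"
  have Le: "L * (\<epsilon> * s) \<le> s / (16 * L)"
  proof -
    have "L * (\<epsilon> * s) = s / (200 * L)" using L by (simp add: \<epsilon>_def power2_eq_square)
    also have "\<dots> \<le> s / (16 * L)" using s0 L by (intro divide_left_mono) auto
    finally show ?thesis .
  qed
  show thesis
  proof (rule that[of C])
    show "finite C" using T by (simp add: C_def)
    have "card C \<le> card (T - {{}})" unfolding C_def using T by (intro card_image_le) auto
    also have "\<dots> \<le> card T" using T by (intro card_mono) auto
    finally show "card C \<le> n" using T by simp
    show "C \<subseteq> A" using cs by (auto simp: C_def)
    show "dist c c' \<le> 2 * L * Cf * \<Lambda>0 * s + s" if c': "c' \<in> C" for c'
    proof -
      obtain S q where "S \<in> T" "q \<in> S" "dist (f q) c' < s / (8 * L)" using c' cs unfolding C_def by blast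
      moreover have "dist c (f q) \<le> L * R" using fKR T(3) calculation by blast
      ultimately have "dist c c' \<le> L * R + s" using dist_triangle[of c c' "f q"] s8 by linarith
      then show ?thesis by (simp add: R_def mult_ac)
    qed
    fix q w assume q: "dist c q < s / (4 * L)" and w: "dist q w + s / (4 * L) < \<tau> / L"
    obtain \<gamma> where \<gamma>: "geodesic_arc \<gamma> (dist q w)" "\<gamma> 0 = q" "\<gamma> (dist q w) = w" using geodesics[of q w] by blast
    have g0: "dist q (\<gamma> t) = t" "dist (\<gamma> t) w = dist q w - t" if "t \<in> {0..dist q w}" for t
    proof -
      have "dist (\<gamma> 0) (\<gamma> t) = t" "dist (\<gamma> t) (\<gamma> (dist q w)) = dist q w - t"
        using \<gamma>(1) that unfolding geodesic_arc_def by auto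
      then show "dist q (\<gamma> t) = t" "dist (\<gamma> t) w = dist q w - t" using \<gamma>(2,3) by simp_all
    qed
    have im: "\<gamma> t \<in> f ` ball y' \<tau>" if "t \<in> {0..dist q w}" for t
    proof -
      have "dist c (\<gamma> t) < \<tau> / L" using dist_triangle[of c "\<gamma> t" q] q w g0(1)[OF that] that by auto
      then show ?thesis using f(2) by auto
    qed
    \<comment> \<open>The geodesic from \<open>q\<close> to \<open>w\<close> is pulled back by the
      inverse of \<open>f\<close>, and the pullback starts inside \<open>fil K\<close>. Either it
      also ends there, which bounds \<open>dist c w\<close>, or it meets \<open>K\<close>.\<close>
    define \<eta> where "\<eta> t = inv_into (ball y' \<tau>) f (\<gamma> t)" for t
    have \<eta>: "\<eta> t \<in> ball y' \<tau>" "f (\<eta> t) = \<gamma> t" if "t \<in> {0..dist q w}" for t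
      unfolding \<eta>_def by (rule inv_into_into[OF im[OF that]], rule f_inv_into_f[OF im[OF that]])
    have cont\<gamma>: "continuous_on {0..dist q w} \<gamma>" by (rule bilip_cont[OF geodesic_arc_bilip[OF \<gamma>(1) order_refl]])
    have cont: "continuous_on {0..dist q w} \<eta>"
    proof (rule continuous_onI)
      fix t e :: real assume t: "t \<in> {0..dist q w}" and e: "0 < e"
      have "dist (\<eta> u) (\<eta> t) \<le> e" if "u \<in> {0..dist q w}" "dist u t < e / L" for u
      proof -
        have "dist (\<eta> u) (\<eta> t) \<le> L * dist (\<gamma> u) (\<gamma> t)" using f(3)[OF \<eta>(1)[OF that(1)] \<eta>(1)[OF t]] \<eta>(2) that t by simp
        also have "dist (\<gamma> u) (\<gamma> t) = \<bar>u - t\<bar>" using \<gamma>(1) that t unfolding geodesic_arc_def by blast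
        also have "L * \<bar>u - t\<bar> \<le> L * (e / L)" using that(2) by (intro mult_left_mono) (auto simp: dist_real_def)
        finally show ?thesis by simp
      qed
      moreover have "0 < e / L" using e by simp
      ultimately show "\<exists>d>0. \<forall>x'\<in>{0..dist q w}. dist x' t < d \<longrightarrow> dist (\<eta> x') (\<eta> t) \<le> e" by blast
    qed
    have m0: "0 \<in> {0..dist q w}" "dist q w \<in> {0..dist q w}" by auto
    have "dist y' (\<eta> 0) \<le> L * dist c q" using f(3)[OF y'in \<eta>(1)[OF m0(1)]] \<eta>(2)[OF m0(1)] f(1) \<gamma>(2) by simp
    also have "\<dots> < L * (s / (4 * L))" using q by (intro mult_strict_left_mono) auto
    finally have "dist y' (\<eta> 0) < s / 4" by simp
    then have "\<eta> 0 \<in> ball y s" using y'(2) dist_triangle[of y "\<eta> 0" y'] s0 by simp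
    then have \<eta>0: "\<eta> 0 \<in> fil K" using sub by blast
    show "dist c w \<le> 2 * L * Cf * \<Lambda>0 * s \<or>
       (\<exists>c'\<in>C. \<exists>q1. dist c' q1 < s / (4 * L) \<and> dist q1 w \<le> dist q w - s / (4 * L))"
    proof (cases "\<eta> (dist q w) \<in> fil K")
      case True
      have "dist (f y') (f (\<eta> (dist q w))) \<le> L * dist y' (\<eta> (dist q w))" by (rule f(4)[OF y'in \<eta>(1)[OF m0(2)]])
      also have "\<dots> \<le> L * R" using fR[OF True] by (intro mult_left_mono) auto
      finally have "dist c w \<le> L * R" using f(1) \<eta>(2)[OF m0(2)] \<gamma>(3) by simp
      then show ?thesis by (simp add: R_def mult_ac)
    next
      case False
      have "\<eta> ` {0..dist q w} \<inter> K \<noteq> {}"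
      proof (rule connected_meets[OF Kc connected_continuous_image[OF cont]])
        show "\<eta> ` {0..dist q w} \<inter> fil K \<noteq> {}" using \<eta>0 m0(1) by blast
        show "\<not> \<eta> ` {0..dist q w} \<subseteq> fil K" using False m0(2) by blast
      qed simp
      then obtain t where t: "t \<in> {0..dist q w}" "\<eta> t \<in> K" by blast
      have "s / 2 \<le> L * dist c (\<gamma> t)"
        using y'K[OF t(2)] f(3)[OF y'in \<eta>(1)[OF t(1)]] f(1) \<eta>(2)[OF t(1)] by simp
      then have "s / (2 * L) \<le> dist c (\<gamma> t)" by (simp add: field_simps)
      then have tt: "s / (4 * L) \<le> t"
      proof -
        have "s / (2 * L) = s / (4 * L) + s / (4 * L)" by (simp add: field_simps)
        then show ?thesis using \<open>s / (2 * L) \<le> dist c (\<gamma> t)\<close> dist_triangle[of c "\<gamma> t" q] q g0(1)[OF t(1)] by linarith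
      qed
      obtain S where S: "S \<in> T" "\<eta> t \<in> S" using t(2) T(3) by blast
      then have Sn: "S \<in> T - {{}}" by blast
      obtain q' where q': "q' \<in> S" "dist (f q') (cs S) < s / (8 * L)" using cs[OF Sn] by blast
      have "dist (f q') (f (\<eta> t)) \<le> L * dist q' (\<eta> t)" using f(4)[of q' "\<eta> t"] Kin[of q'] \<eta>(1)[OF t(1)] q'(1) S T(3) by blast
      also have "\<dots> \<le> L * (\<epsilon> * s)" using T(4)[OF S(1)] q'(1) S(2) unfolding chunk_def by (intro mult_left_mono) auto
      finally have "dist (f q') (\<gamma> t) \<le> s / (16 * L)" using Le \<eta>(2)[OF t(1)] by simp
      moreover have "s / (8 * L) + s / (16 * L) < s / (4 * L)" using s0 L by (simp add: field_simps)
      ultimately have "dist (cs S) (\<gamma> t) < s / (4 * L)"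
        using q'(2) dist_triangle3[of "cs S" "\<gamma> t" "f q'"] by linarith
      moreover have "dist (\<gamma> t) w \<le> dist q w - s / (4 * L)" using g0(2)[OF t(1)] tt by linarith
      moreover have "cs S \<in> C" using Sn by (simp add: C_def)
      ultimately show ?thesis by blast
    qed
  qed
qed

primrec layer_count :: "nat \<Rightarrow> nat \<Rightarrow> nat" where
  "layer_count n 0 = 0"
| "layer_count n (Suc j) = 1 + n * layer_count n j"

text \<open>Each crossing brings the target closer by at least \<open>s / (4 * L)\<close>, so
  \<open>j\<close> layers reach all points within \<open>j * s / (4 * L)\<close>, and their number
  does not depend on the scale. The start \<open>q\<close> is quantified along with \<open>w\<close>
  because the next centre lies only near the geodesic, not on it.\<close>

lemma layers:
  assumes en: "enclosed n \<Lambda>0 s y K" and y: "dist x0 y < r1 / 8" and s: "16 * L * Cf * \<Lambda>0 * s < r1"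
    and j: "(real j + 1) * s < \<tau>"
  shows "c \<in> A \<Longrightarrow> dist x0 c + real j * (2 * L * Cf * \<Lambda>0 * s + s) < r1 \<Longrightarrow>
    \<exists>T. finite T \<and> card T \<le> layer_count n j \<and>
      (\<forall>q w. dist c q < s / (4 * L) \<longrightarrow> dist q w < real j * (s / (4 * L)) \<longrightarrow> (\<exists>c'\<in>T. dist c' w \<le> 2 * L * Cf * \<Lambda>0 * s))"
  using j
proof (induction j arbitrary: c)
  case 0
  have "\<not> dist q w < 0" for q w :: 'a by (simp add: not_less)
  then show ?case by (intro exI[of _ "{}"]) simp
next
  case (Suc j)
  define E where "E = 2 * L * Cf * \<Lambda>0 * s + s"
  have s0: "0 < s" using en by (simp add: enclosed_def)
  have "0 \<le> Cf * \<Lambda>0 * s" using Cf_ge Lam0 s0 by simp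
  then have "0 \<le> L * (Cf * \<Lambda>0 * s)" by simp
  then have E: "0 \<le> E" using s0 by (simp add: E_def mult_ac)
  have jE: "dist x0 c + real j * E + E < r1" using Suc.prems(2) unfolding E_def[symmetric] by (simp add: algebra_simps)
  have c1: "dist x0 c < r1"
  proof -
    have "0 \<le> real j * E" using E by simp
    then show ?thesis using jE E by linarith
  qed
  obtain C where C: "finite C" "card C \<le> n" "C \<subseteq> A" "\<And>c'. c' \<in> C \<Longrightarrow> dist c c' \<le> E"
    "\<And>q w. dist c q < s / (4 * L) \<Longrightarrow> dist q w + s / (4 * L) < \<tau> / L \<Longrightarrow> dist c w \<le> 2 * L * Cf * \<Lambda>0 * s \<or>
       (\<exists>c'\<in>C. \<exists>q1. dist c' q1 < s / (4 * L) \<and> dist q1 w \<le> dist q w - s / (4 * L))"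
    using layer[OF en y s Suc.prems(1) c1] unfolding E_def by metis
  have "\<forall>c'\<in>C. \<exists>T. finite T \<and> card T \<le> layer_count n j \<and>
      (\<forall>q w. dist c' q < s / (4 * L) \<longrightarrow> dist q w < real j * (s / (4 * L)) \<longrightarrow> (\<exists>c''\<in>T. dist c'' w \<le> 2 * L * Cf * \<Lambda>0 * s))"
  proof
    fix c' assume c': "c' \<in> C"
    show "\<exists>T. finite T \<and> card T \<le> layer_count n j \<and>
      (\<forall>q w. dist c' q < s / (4 * L) \<longrightarrow> dist q w < real j * (s / (4 * L)) \<longrightarrow> (\<exists>c''\<in>T. dist c'' w \<le> 2 * L * Cf * \<Lambda>0 * s))"
    proof (rule Suc.IH)
      show "c' \<in> A" using c' C(3) by blast
      show "dist x0 c' + real j * (2 * L * Cf * \<Lambda>0 * s + s) < r1"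
        unfolding E_def[symmetric] using jE C(4)[OF c'] dist_triangle[of x0 c' c] by linarith
      show "(real j + 1) * s < \<tau>" using Suc.prems(3) s0 by (simp add: algebra_simps)
    qed
  qed
  then obtain T where T: "\<And>c'. c' \<in> C \<Longrightarrow> finite (T c') \<and> card (T c') \<le> layer_count n j \<and>
      (\<forall>q w. dist c' q < s / (4 * L) \<longrightarrow> dist q w < real j * (s / (4 * L)) \<longrightarrow> (\<exists>c''\<in>T c'. dist c'' w \<le> 2 * L * Cf * \<Lambda>0 * s))"
    by metis
  define U where "U = insert c (\<Union>c'\<in>C. T c')"
  have "card (\<Union>c'\<in>C. T c') \<le> (\<Sum>c'\<in>C. card (T c'))" by (rule card_UN_le[OF C(1)])
  also have "\<dots> \<le> (\<Sum>c'\<in>C. layer_count n j)" using T by (intro sum_mono) auto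
  also have "\<dots> \<le> n * layer_count n j" using C(2) by simp
  finally have "card U \<le> layer_count n (Suc j)" unfolding U_def
    using card_insert_le_m1 by (auto intro: order_trans[OF card_insert_le_m1] simp: card_insert_if C T)
  moreover have "finite U" using C T by (simp add: U_def)
  moreover have "\<exists>c'\<in>U. dist c' w \<le> 2 * L * Cf * \<Lambda>0 * s"
    if q: "dist c q < s / (4 * L)" and w: "dist q w < real (Suc j) * (s / (4 * L))" for q w
  proof -
    have "dist q w + s / (4 * L) < (real (Suc j) + 1) * s / (4 * L)" using w by (simp add: algebra_simps add_divide_distrib)
    also have "\<dots> \<le> \<tau> / (4 * L)" using Suc.prems(3) by (intro divide_right_mono) auto
    also have "\<dots> \<le> \<tau> / L" using \<tau> by (intro divide_left_mono) auto
    finally consider "dist c w \<le> 2 * L * Cf * \<Lambda>0 * s"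
      | c' q1 where "c' \<in> C" "dist c' q1 < s / (4 * L)" "dist q1 w \<le> dist q w - s / (4 * L)"
      using C(5)[OF q] by blast
    then show ?thesis
    proof cases
      case 1
      then show ?thesis by (auto simp: U_def)
    next
      case 2
      have "dist q1 w < real j * (s / (4 * L))" using 2(3) w by (simp add: algebra_simps add_divide_distrib)
      then show ?thesis using T[OF 2(1)] 2(1,2) unfolding U_def by blast
    qed
  qed
  ultimately show ?case by blast
qed

text \<open>For large \<open>R\<close> compactness suffices. For small \<open>R\<close> take an
  enclosing set at a scale \<open>s\<close> between \<open>R / (3 * E * B)\<close> and
  \<open>R / (3 * E)\<close>: the final balls of radius \<open>E * s\<close> hold at most one point
  each of an \<open>R\<close>-separated set, and a fixed number \<open>j\<close> of layers covers
  the distance \<open>(\<Lambda> + 1) * R\<close>.\<close>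

lemma packing_bounded_ball:
  "packing_bounded (ball x0 (r1 / 4))"
  unfolding packing_bounded_def
proof (intro allI impI)
  fix \<Lambda> :: real assume \<Lambda>: "0 < \<Lambda>"
  obtain n :: nat and B g0 :: real where G: "2 \<le> B" "0 < g0"
    "\<And>t. 0 < t \<Longrightarrow> t \<le> g0 \<Longrightarrow> \<exists>s y K. t / B \<le> s \<and> s \<le> t \<and> dist x0 y < r1 / 8 \<and> enclosed n \<Lambda>0 s y K"
    using good_scales by metis
  define E where "E = 2 * L * Cf * \<Lambda>0"
  have E: "1 \<le> E"
  proof -
    have "1 * 20 \<le> L * (Cf * \<Lambda>0)" using L mult_mono[of 5 Cf 4 \<Lambda>0] Cf_ge Lam0 by (intro mult_mono) auto
    then show ?thesis by (simp add: E_def mult_ac)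
  qed
  obtain j :: nat where j: "(\<Lambda> + 1) * (3 * E * B) * (4 * L) \<le> real j" using real_arch_simple by blast
  define t0 where "t0 = min g0 (min (r1 / (16 * E)) (min (r1 / (8 * (real j + 1) * (E + 1))) (min (\<tau> / (2 * (real j + 1))) (r1 / (8 * E)))))"
  have t0: "0 < t0" "t0 \<le> g0" "t0 \<le> r1 / (16 * E)" "t0 \<le> r1 / (8 * (real j + 1) * (E + 1))" "t0 \<le> \<tau> / (2 * (real j + 1))" "t0 \<le> r1 / (8 * E)"
    using G r1 E \<tau> unfolding t0_def by auto
  have "compact (cball x0 (r1 / 4))" using small_cball(2)[of x0 "r1 / 4"] r1 by auto
  moreover have "0 < 3 * E * t0" using t0 E by simp
  ultimately obtain N2 :: nat where N2: "\<And>F. F \<subseteq> cball x0 (r1 / 4) \<Longrightarrow> separated (3 * E * t0) F \<Longrightarrow> finite F \<and> card F \<le> N2"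
    using compact_separated_bound by metis
  show "\<exists>N::nat. \<forall>x\<in>ball x0 (r1 / 4). \<forall>R>0. \<forall>F. F \<subseteq> ball x0 (r1 / 4) \<inter> ball x (\<Lambda> * R) \<longrightarrow> separated R F \<longrightarrow>
     finite F \<and> card F \<le> N"
  proof (intro exI[of _ "max N2 (layer_count n j)"] ballI allI impI)
    fix x R F assume x: "x \<in> ball x0 (r1 / 4)" and R: "0 < R"
      and F: "F \<subseteq> ball x0 (r1 / 4) \<inter> ball x (\<Lambda> * R)" "separated R F"
    show "finite F \<and> card F \<le> max N2 (layer_count n j)"
    proof (cases "3 * E * t0 \<le> R")
      case True
      have "F \<subseteq> cball x0 (r1 / 4)" using F by auto
      then have "finite F \<and> card F \<le> N2" using separated_mono[OF F(2) True] N2 by blast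
      then show ?thesis by auto
    next
      case False
      define t where "t = R / (3 * E)"
      have t: "0 < t" "t \<le> t0" "3 * E * t = R" using False R E by (auto simp: t_def field_simps)
      obtain s y K where s: "t / B \<le> s" "s \<le> t" "dist x0 y < r1 / 8" "enclosed n \<Lambda>0 s y K"
        using G(3)[of t] t t0 by auto
      have s0: "0 < s" using s(4) by (simp add: enclosed_def)
      have st: "s \<le> t0" using s t by linarith
      have "dist x0 x < 4 * r1" using x r1 by auto
      then obtain c where c: "c \<in> A" "dist x c < min R (r1 / 4)" using dense'[of x "min R (r1 / 4)"] R r1 by auto
      have cr: "dist x0 c < r1 / 2" using x c dist_triangle[of x0 c x] by auto
      have Es: "E * s \<le> r1 / 16" "(real j + 1) * ((E + 1) * s) \<le> r1 / 8" "(real j + 1) * s \<le> \<tau> / 2"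
      proof -
        have "s \<le> r1 / (16 * E)" "s \<le> r1 / (8 * (real j + 1) * (E + 1))" "s \<le> \<tau> / (2 * (real j + 1))" using st t0 by linarith+
        moreover have "0 < 16 * E" "0 < 8 * (real j + 1) * (E + 1)" "0 < 2 * (real j + 1)" using E by auto
        ultimately have "s * (16 * E) \<le> r1" "s * (8 * (real j + 1) * (E + 1)) \<le> r1" "s * (2 * (real j + 1)) \<le> \<tau>"
          by (simp_all only: pos_le_divide_eq)
        then show "E * s \<le> r1 / 16" "(real j + 1) * ((E + 1) * s) \<le> r1 / 8" "(real j + 1) * s \<le> \<tau> / 2"
          by argo+
      qed
      have "\<exists>T. finite T \<and> card T \<le> layer_count n j \<and>
        (\<forall>q w. dist c q < s / (4 * L) \<longrightarrow> dist q w < real j * (s / (4 * L)) \<longrightarrow> (\<exists>c'\<in>T. dist c' w \<le> 2 * L * Cf * \<Lambda>0 * s))"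
      proof (rule layers[OF s(4,3) _ _ c(1)])
        have "16 * L * Cf * \<Lambda>0 * s = 8 * (E * s)" by (simp add: E_def)
        then show "16 * L * Cf * \<Lambda>0 * s < r1" using Es(1) r1 by linarith
        show "(real j + 1) * s < \<tau>" using Es(3) \<tau> by linarith
        have "real j * ((E + 1) * s) \<le> (real j + 1) * ((E + 1) * s)" using E s0 by (intro mult_right_mono) auto
        then have "real j * ((E + 1) * s) \<le> r1 / 8" using Es(2) by linarith
        moreover have "2 * L * Cf * \<Lambda>0 * s + s = (E + 1) * s" by (simp add: E_def algebra_simps)
        ultimately have "real j * (2 * L * Cf * \<Lambda>0 * s + s) \<le> r1 / 8" by simp
        then show "dist x0 c + real j * (2 * L * Cf * \<Lambda>0 * s + s) < r1" using cr r1 by linarith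
      qed
      then obtain T where T: "finite T" "card T \<le> layer_count n j"
        "\<And>q w. dist c q < s / (4 * L) \<Longrightarrow> dist q w < real j * (s / (4 * L)) \<Longrightarrow> (\<exists>c'\<in>T. dist c' w \<le> E * s)"
        unfolding E_def by blast
      have "finite F \<and> card F \<le> card T"
      proof (rule card_separated_le_cover[OF F(2) T(1)])
        show "F \<subseteq> (\<Union>c'\<in>T. cball c' (E * s))"
        proof
          fix w assume "w \<in> F"
          then have "dist x w < \<Lambda> * R" using F(1) by auto
          then have "dist c w < (\<Lambda> + 1) * R" using c(2) dist_triangle3[of c w x] by (simp add: algebra_simps)
          also have "\<dots> = (\<Lambda> + 1) * (3 * E * B) * (4 * L) * ((t / B) / (4 * L))" using G(1) unfolding t(3)[symmetric] by simp
          also have "\<dots> \<le> real j * (s / (4 * L))" using j s(1) s0 \<Lambda> E G(1) t(1) by (intro mult_mono divide_right_mono) auto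
          finally have "dist c w < real j * (s / (4 * L))" .
          then obtain c' where "c' \<in> T" "dist c' w \<le> E * s" using T(3)[of c w] s0 by auto
          then show "w \<in> (\<Union>c'\<in>T. cball c' (E * s))" by auto
        qed
        fix c' u v assume "u \<in> cball c' (E * s)" "v \<in> cball c' (E * s)"
        then have "dist u v \<le> 2 * (E * s)" using dist_triangle3[of u v c'] by simp
        also have "E * s \<le> E * t" using s(2) E by (intro mult_left_mono) auto
        then have "2 * (E * s) < 3 * (E * t)" using E t(1) by (simp add: mult_pos_pos)
        also have "\<dots> = R" using t(3) by simp
        finally show "dist u v < R" .
      qed
      then show ?thesis using T(2) by auto
    qed
  qed
qed

end

section \<open>Hausdorff measure\<close>

definition hausdorff_premeasure :: "real \<Rightarrow> real \<Rightarrow> 'a::metric_space set \<Rightarrow> ennreal" where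
  "hausdorff_premeasure s \<delta> A = (INF C \<in> {C :: nat \<Rightarrow> 'a set.
      A \<subseteq> (\<Union>i. C i) \<and> (\<forall>i. bounded (C i) \<and> diameter (C i) \<le> \<delta>)}. \<Sum>i. diameter_power s (C i))"

lemma hausdorff_measure_eq: "hausdorff_measure s A = (SUP \<delta>\<in>{0<..}. hausdorff_premeasure s \<delta> A)"
  by (simp add: hausdorff_measure_def hausdorff_premeasure_def)

lemma premeasure_le_measure: "0 < \<delta> \<Longrightarrow> hausdorff_premeasure s \<delta> A \<le> hausdorff_measure s A"
  unfolding hausdorff_measure_eq by (rule SUP_upper) simp

lemma premeasure_le:
  assumes "A \<subseteq> (\<Union>i. C i)" "\<And>i. bounded (C i)" "\<And>i. diameter (C i) \<le> \<delta>"
  shows "hausdorff_premeasure s \<delta> A \<le> (\<Sum>i. diameter_power s (C i))"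
  unfolding hausdorff_premeasure_def using assms by (intro INF_lower) auto

lemma diameter_le_metric:
  fixes S :: "'a::metric_space set"
  assumes "0 \<le> d" "\<And>x y. x \<in> S \<Longrightarrow> y \<in> S \<Longrightarrow> dist x y \<le> d"
  shows "diameter S \<le> d" "bounded S"
proof -
  show "diameter S \<le> d" unfolding diameter_def using assms by (auto intro!: cSUP_least)
  show "bounded S"
  proof (cases "S = {}")
    case False
    then obtain x where "x \<in> S" by blast
    then show ?thesis unfolding bounded_def using assms(2) by blast
  qed simp
qed

lemma hausdorff_measure_mono: "A \<subseteq> B \<Longrightarrow> hausdorff_measure s A \<le> hausdorff_measure s B"
  unfolding hausdorff_measure_eq hausdorff_premeasure_def
  by (intro SUP_mono' INF_superset_mono) auto

lemma diameter_power_lipschitz: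
  assumes f: "M-lipschitz_on S f" and M: "0 < M" and s: "0 \<le> s" and C: "bounded C"
  shows "bounded (f ` (C \<inter> S))" "diameter (f ` (C \<inter> S)) \<le> M * diameter C"
    "diameter_power s (f ` (C \<inter> S)) \<le> ennreal (M powr s) * diameter_power s C"
proof -
  have d0: "0 \<le> diameter C" using diameter_ge_0[OF C] .
  have d: "dist x y \<le> M * diameter C" if xy: "x \<in> f ` (C \<inter> S)" "y \<in> f ` (C \<inter> S)" for x y
  proof -
    obtain a b where ab: "x = f a" "y = f b" "a \<in> C \<inter> S" "b \<in> C \<inter> S" using xy by blast
    then have "dist x y \<le> M * dist a b" using lipschitz_onD[OF f] by blast
    also have "\<dots> \<le> M * diameter C" using ab M by (intro mult_left_mono diameter_bounded_bound[OF C]) auto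
    finally show ?thesis .
  qed
  have D: "0 \<le> M * diameter C" using d0 M by simp
  show b: "bounded (f ` (C \<inter> S))" "diameter (f ` (C \<inter> S)) \<le> M * diameter C" using diameter_le_metric[OF D d] by auto
  have "diameter (f ` (C \<inter> S)) powr s \<le> M powr s * diameter C powr s"
    using powr_mono2[OF s diameter_ge_0[OF b(1)] b(2)] M d0 by (simp add: powr_mult)
  moreover have "C \<inter> S = {}" if "C = {}" using that by simp
  ultimately show "diameter_power s (f ` (C \<inter> S)) \<le> ennreal (M powr s) * diameter_power s C"
    using M by (auto simp: diameter_power_def ennreal_mult[symmetric] intro!: ennreal_leI)
qed

lemma hausdorff_measure_lipschitz:
  assumes f: "M-lipschitz_on S f" and M: "0 < M" and s: "0 \<le> s"
  shows "hausdorff_measure s (f ` S) \<le> ennreal (M powr s) * hausdorff_measure s S"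
  unfolding hausdorff_measure_eq[of s "f ` S"]
proof (rule SUP_least)
  fix \<delta> :: real assume "\<delta> \<in> {0<..}"
  then have \<delta>: "0 < \<delta> / M" using M by simp
  have "hausdorff_premeasure s \<delta> (f ` S) \<le> ennreal (M powr s) * hausdorff_premeasure s (\<delta> / M) S"
  proof -
    have "hausdorff_premeasure s \<delta> (f ` S) / ennreal (M powr s) \<le> hausdorff_premeasure s (\<delta> / M) S"
      unfolding hausdorff_premeasure_def[of s "\<delta> / M"]
    proof (rule INF_greatest)
      fix C :: "nat \<Rightarrow> 'a set" assume "C \<in> {C. S \<subseteq> (\<Union>i. C i) \<and> (\<forall>i. bounded (C i) \<and> diameter (C i) \<le> \<delta> / M)}"
      then have C: "S \<subseteq> (\<Union>i. C i)" "\<And>i. bounded (C i)" "\<And>i. diameter (C i) \<le> \<delta> / M" by auto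
      have "hausdorff_premeasure s \<delta> (f ` S) \<le> (\<Sum>i. diameter_power s (f ` (C i \<inter> S)))"
      proof (rule premeasure_le)
        show "f ` S \<subseteq> (\<Union>i. f ` (C i \<inter> S))" using C(1) by blast
        fix i
        show "bounded (f ` (C i \<inter> S))" by (rule diameter_power_lipschitz(1)[OF f M s C(2)])
        have "M * diameter (C i) \<le> \<delta>" using C(3)[of i] M by (simp add: field_simps)
        then show "diameter (f ` (C i \<inter> S)) \<le> \<delta>" using diameter_power_lipschitz(2)[OF f M s C(2)[of i]] by linarith
      qed
      also have "\<dots> \<le> (\<Sum>i. ennreal (M powr s) * diameter_power s (C i))"
        using diameter_power_lipschitz(3)[OF f M s C(2)] by (intro suminf_le) auto
      also have "\<dots> = ennreal (M powr s) * (\<Sum>i. diameter_power s (C i))" by simp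
      finally show "hausdorff_premeasure s \<delta> (f ` S) / ennreal (M powr s) \<le> (\<Sum>i. diameter_power s (C i))"
        using M by (intro divide_le_posI_ennreal) (auto simp: mult.commute)
    qed
    then have "ennreal (M powr s) * (hausdorff_premeasure s \<delta> (f ` S) / ennreal (M powr s))
        \<le> ennreal (M powr s) * hausdorff_premeasure s (\<delta> / M) S" by (rule mult_left_mono) simp
    moreover have "ennreal (M powr s) * (hausdorff_premeasure s \<delta> (f ` S) / ennreal (M powr s)) = hausdorff_premeasure s \<delta> (f ` S)"
      using M mult_divide_eq_ennreal[of "ennreal (M powr s)" "hausdorff_premeasure s \<delta> (f ` S)"]
      by (simp add: ennreal_times_divide mult.commute)
    ultimately show ?thesis by simp
  qed
  also have "\<dots> \<le> ennreal (M powr s) * hausdorff_measure s S"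
    by (intro mult_left_mono premeasure_le_measure \<delta>) simp
  finally show "hausdorff_premeasure s \<delta> (f ` S) \<le> ennreal (M powr s) * hausdorff_measure s S"
    unfolding hausdorff_measure_eq[symmetric] .
qed

lemma hausdorff_null_lipschitz:
  assumes f: "M-lipschitz_on S f" and "0 \<le> s" "hausdorff_measure s S = 0"
  shows "hausdorff_measure s (f ` S) = 0"
proof -
  have "(M + 1)-lipschitz_on S f" using f by (rule lipschitz_on_le) simp
  then have "hausdorff_measure s (f ` S) \<le> ennreal ((M + 1) powr s) * hausdorff_measure s S"
    using assms lipschitz_on_nonneg[OF f] by (intro hausdorff_measure_lipschitz) auto
  then show ?thesis using assms by simp
qed

lemma hausdorff_null_iff:
  "hausdorff_measure s A = 0 \<longleftrightarrow> (\<forall>\<delta>>0. \<forall>e>0. \<exists>C :: nat \<Rightarrow> 'a::metric_space set.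
     A \<subseteq> (\<Union>i. C i) \<and> (\<forall>i. bounded (C i) \<and> diameter (C i) \<le> \<delta>) \<and> (\<Sum>i. diameter_power s (C i)) < ennreal e)" (is "?L = ?R")
proof
  assume l: ?L
  show ?R
  proof (intro allI impI)
    fix \<delta> e :: real assume "0 < \<delta>" "0 < e"
    then have "hausdorff_premeasure s \<delta> A < ennreal e" using premeasure_le_measure[of \<delta> s A] l by simp
    then show "\<exists>C :: nat \<Rightarrow> 'a set. A \<subseteq> (\<Union>i. C i) \<and> (\<forall>i. bounded (C i) \<and> diameter (C i) \<le> \<delta>) \<and> (\<Sum>i. diameter_power s (C i)) < ennreal e"
      unfolding hausdorff_premeasure_def by (auto simp: INF_less_iff)
  qed
next
  assume r: ?R
  have "hausdorff_premeasure s \<delta> A = 0" if \<delta>: "0 < \<delta>" for \<delta>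
  proof (rule ccontr)
    assume "\<not> ?thesis"
    then obtain e where e: "0 < e" "ennreal e < hausdorff_premeasure s \<delta> A"
    proof (cases "hausdorff_premeasure s \<delta> A")
      case (real x)
      then have "0 < x" using \<open>hausdorff_premeasure s \<delta> A \<noteq> 0\<close> by (cases "x = 0") auto
      then show thesis using that[of "x / 2"] real by (simp add: ennreal_less_iff)
    next
      case top
      then show thesis using that[of 1] by simp
    qed
    obtain C :: "nat \<Rightarrow> 'a set" where C: "A \<subseteq> (\<Union>i. C i)" "\<And>i. bounded (C i)" "\<And>i. diameter (C i) \<le> \<delta>" "(\<Sum>i. diameter_power s (C i)) < ennreal e"
      using r[rule_format, OF \<delta> e(1)] by blast
    show False using le_less_trans[OF premeasure_le[OF C(1-3), of s] C(4)] e(2) by (rule less_asym)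
  qed
  then have "hausdorff_measure s A \<le> 0" unfolding hausdorff_measure_eq by (intro SUP_least) simp
  then show ?L by simp
qed

lemma hausdorff_null_UN:
  fixes A :: "nat \<Rightarrow> 'a::metric_space set"
  assumes "\<And>n. hausdorff_measure s (A n) = 0"
  shows "hausdorff_measure s (\<Union>n. A n) = 0"
  unfolding hausdorff_null_iff
proof (intro allI impI)
  fix \<delta> e :: real assume \<delta>: "0 < \<delta>" and e: "0 < e"
  have "\<exists>C :: nat \<Rightarrow> 'a set. A n \<subseteq> (\<Union>i. C i) \<and> (\<forall>i. bounded (C i) \<and> diameter (C i) \<le> \<delta>) \<and>
      (\<Sum>i. diameter_power s (C i)) < ennreal (e / 2 * (1 / 2) ^ Suc n)" for n
    using assms[of n] \<delta> e unfolding hausdorff_null_iff by simp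
  then obtain C :: "nat \<Rightarrow> nat \<Rightarrow> 'a set" where C: "\<And>n. A n \<subseteq> (\<Union>i. C n i)" "\<And>n i. bounded (C n i)" "\<And>n i. diameter (C n i) \<le> \<delta>"
    "\<And>n. (\<Sum>i. diameter_power s (C n i)) < ennreal (e / 2 * (1 / 2) ^ Suc n)" by metis
  define D where "D = (\<lambda>p. C (fst (prod_decode p)) (snd (prod_decode p)))"
  have D: "D (prod_encode (n, i)) = C n i" for n i by (simp add: D_def)
  have "(\<Sum>i. diameter_power s (D i)) = (\<Sum>n. \<Sum>i. diameter_power s (C n i))"
    using suminf_ennreal_2dimen[of "\<lambda>n. \<Sum>i. diameter_power s (C n i)" "\<lambda>p. diameter_power s (C (fst p) (snd p))"] by (simp add: D_def)
  also have "\<dots> \<le> (\<Sum>n. ennreal (e / 2 * (1 / 2) ^ Suc n))" using C(4) by (intro suminf_le) (auto intro: less_imp_le)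
  also have "\<dots> = ennreal (e / 2)"
    using e by (intro suminf_ennreal_eq) (auto intro!: sums_mult[OF power_half_series, of "e / 2", simplified])
  also have "\<dots> < ennreal e" using e by (simp add: ennreal_less_iff)
  finally have "(\<Sum>i. diameter_power s (D i)) < ennreal e" .
  moreover have "(\<Union>n. A n) \<subseteq> (\<Union>i. D i)"
  proof
    fix x assume "x \<in> (\<Union>n. A n)"
    then obtain n i where "x \<in> C n i" using C(1) by blast
    then show "x \<in> (\<Union>i. D i)" unfolding D[symmetric] by blast
  qed
  moreover have "bounded (D i) \<and> diameter (D i) \<le> \<delta>" for i using C by (simp add: D_def)
  ultimately show "\<exists>C :: nat \<Rightarrow> 'a set. (\<Union>n. A n) \<subseteq> (\<Union>i. C i) \<and> (\<forall>i. bounded (C i) \<and> diameter (C i) \<le> \<delta>) \<and> (\<Sum>i. diameter_power s (C i)) < ennreal e"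
    by blast
qed

section \<open>From packing bounds to doubling and finite dimension\<close>

lemma packing_bounded_subset: "packing_bounded S \<Longrightarrow> T \<subseteq> S \<Longrightarrow> packing_bounded T"
proof -
  assume S: "packing_bounded S" and T: "T \<subseteq> S"
  show "packing_bounded T"
    unfolding packing_bounded_def
  proof (intro allI impI)
    fix \<Lambda> :: real assume "0 < \<Lambda>"
    then obtain N :: nat where N: "\<forall>x\<in>S. \<forall>R>0. \<forall>F. F \<subseteq> S \<inter> ball x (\<Lambda> * R) \<longrightarrow> separated R F \<longrightarrow> finite F \<and> card F \<le> N"
      using S unfolding packing_bounded_def by blast
    show "\<exists>N::nat. \<forall>x\<in>T. \<forall>R>0. \<forall>F. F \<subseteq> T \<inter> ball x (\<Lambda> * R) \<longrightarrow> separated R F \<longrightarrow> finite F \<and> card F \<le> N"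
    proof (intro exI[of _ N] ballI allI impI)
      fix x R F assume "x \<in> T" and R: "0 < (R::real)" and F: "F \<subseteq> T \<inter> ball x (\<Lambda> * R)" "separated R F"
      then have "x \<in> S" "F \<subseteq> S \<inter> ball x (\<Lambda> * R)" using T by auto
      then show "finite F \<and> card F \<le> N" using N R F(2) by simp
    qed
  qed
qed

lemma packing_boundedD:
  assumes "packing_bounded S" "0 < \<Lambda>"
  shows "\<exists>N::nat. \<forall>x R F. x \<in> S \<longrightarrow> 0 < R \<longrightarrow> F \<subseteq> S \<inter> ball x (\<Lambda> * R) \<longrightarrow> separated R F \<longrightarrow> finite F \<and> card F \<le> N"
  using assms(1)[unfolded packing_bounded_def, rule_format, OF assms(2)] unfolding Ball_def by simp

lemma packing_bounded_net:
  assumes "packing_bounded S"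
  obtains N :: nat where "\<And>x R. x \<in> S \<Longrightarrow> 0 < R \<Longrightarrow>
    \<exists>C. C \<subseteq> S \<and> finite C \<and> card C \<le> N \<and> S \<inter> ball x (2 * R) \<subseteq> (\<Union>c\<in>C. ball c R)"
proof -
  obtain N :: nat where N: "\<And>x R F. x \<in> S \<Longrightarrow> 0 < R \<Longrightarrow> F \<subseteq> S \<inter> ball x (2 * R) \<Longrightarrow> separated R F \<Longrightarrow> finite F \<and> card F \<le> N"
    using packing_boundedD[OF assms zero_less_numeral[of "num.Bit0 num.One"]] by blast
  show thesis
  proof (rule that)
    fix x R assume x: "x \<in> S" "0 < (R::real)"
    obtain F where F: "F \<subseteq> S \<inter> ball x (2 * R)" "separated R F" "finite F" "\<And>y. y \<in> S \<inter> ball x (2 * R) \<Longrightarrow> \<exists>w\<in>F. dist y w < R"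
    proof (rule maximal_separated[OF _ x(2)])
      show "finite F \<and> card F \<le> N" if "F \<subseteq> S \<inter> ball x (2 * R)" "separated R F" for F by (rule N[OF x that])
    qed (rule that)
    have "card F \<le> N" using N[OF x F(1,2)] by blast
    moreover have "S \<inter> ball x (2 * R) \<subseteq> (\<Union>c\<in>F. ball c R)"
    proof
      fix y assume "y \<in> S \<inter> ball x (2 * R)"
      then obtain w where "w \<in> F" "dist y w < R" using F(4) by blast
      then show "y \<in> (\<Union>c\<in>F. ball c R)" by (auto simp: dist_commute)
    qed
    ultimately show "\<exists>C. C \<subseteq> S \<and> finite C \<and> card C \<le> N \<and> S \<inter> ball x (2 * R) \<subseteq> (\<Union>c\<in>C. ball c R)"
      using F(1,3) by blast
  qed
qed

lemma packing_bounded_imp_doubling: assumes "packing_bounded S" shows "doubling S"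
proof -
  obtain N :: nat where N: "\<And>x R. x \<in> S \<Longrightarrow> 0 < R \<Longrightarrow>
    \<exists>C. C \<subseteq> S \<and> finite C \<and> card C \<le> N \<and> S \<inter> ball x (2 * R) \<subseteq> (\<Union>c\<in>C. ball c R)"
    using packing_bounded_net[OF assms] by blast
  show ?thesis unfolding doubling_def
  proof (intro exI[of _ N] ballI allI impI)
    fix x R assume x: "x \<in> S" "0 < (R::real)"
    obtain C where C: "C \<subseteq> S" "finite C" "card C \<le> N" "S \<inter> ball x (2 * R) \<subseteq> (\<Union>c\<in>C. ball c R)" using N[OF x] by blast
    then have "ball x (2 * R) \<inter> S \<subseteq> (\<Union>c\<in>C. ball c R \<inter> S)" by blast
    then show "\<exists>C\<subseteq>S. finite C \<and> card C \<le> N \<and> ball x (2 * R) \<inter> S \<subseteq> (\<Union>c\<in>C. ball c R \<inter> S)" using C(1-3) by blast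
  qed
qed

lemma packing_bounded_image:
  assumes S: "packing_bounded S" and M: "0 < M"
    and f: "\<And>x y. x \<in> S \<Longrightarrow> y \<in> S \<Longrightarrow> dist x y \<le> M * dist (f x) (f y) \<and> dist (f x) (f y) \<le> M * dist x y"
  shows "packing_bounded (f ` S)"
  unfolding packing_bounded_def
proof (intro allI impI)
  fix \<Lambda> :: real assume "0 < \<Lambda>"
  then have "0 < M * M * \<Lambda>" using M by simp
  then obtain N :: nat where N: "\<And>x R F. x \<in> S \<Longrightarrow> 0 < R \<Longrightarrow> F \<subseteq> S \<inter> ball x (M * M * \<Lambda> * R) \<Longrightarrow> separated R F \<Longrightarrow> finite F \<and> card F \<le> N"
    using packing_boundedD[OF S] by blast
  show "\<exists>N::nat. \<forall>x\<in>f ` S. \<forall>R>0. \<forall>F. F \<subseteq> f ` S \<inter> ball x (\<Lambda> * R) \<longrightarrow> separated R F \<longrightarrow> finite F \<and> card F \<le> N"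
  proof (intro exI[of _ N] ballI allI impI)
    fix x R F assume x: "x \<in> f ` S" and R: "0 < R" and F: "F \<subseteq> f ` S \<inter> ball x (\<Lambda> * R)" "separated R F"
    obtain a where a: "a \<in> S" "x = f a" using x by blast
    define G where "G = {u \<in> S. f u \<in> F}"
    have FG: "F = f ` G" using F(1) by (auto simp: G_def)
    have "separated (R / M) G" unfolding separated_def
    proof (intro ballI impI)
      fix u v assume uv: "u \<in> G" "v \<in> G" "u \<noteq> v"
      have "f u \<noteq> f v" using f[of u v] uv by (auto simp: G_def)
      then have "R \<le> dist (f u) (f v)" using F(2) uv unfolding separated_def G_def by blast
      also have "\<dots> \<le> M * dist u v" using f uv by (auto simp: G_def)
      finally show "R / M \<le> dist u v" using M by (simp add: field_simps)
    qed
    moreover have "G \<subseteq> S \<inter> ball a (M * M * \<Lambda> * (R / M))"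
    proof
      fix u assume u: "u \<in> G"
      have "dist a u \<le> M * dist (f a) (f u)" using f a u by (auto simp: G_def)
      also have "\<dots> < M * (\<Lambda> * R)" using M u F(1) a unfolding G_def by (intro mult_strict_left_mono) auto
      finally show "u \<in> S \<inter> ball a (M * M * \<Lambda> * (R / M))" using u M by (simp add: G_def mult_ac)
    qed
    ultimately have "finite G \<and> card G \<le> N" using N[OF a(1), of "R / M"] R M by simp
    then show "finite F \<and> card F \<le> N" unfolding FG using card_image_le order_trans by blast
  qed
qed

text \<open>Iterating the net gives \<open>N ^ j\<close> balls of radius \<open>D / 2 ^ j\<close>.
  The exponent \<open>s = N + 1\<close> is a crude choice with \<open>N < 2 powr s\<close>, so the
  sums \<open>N ^ j * (2 * D / 2 ^ j) powr s\<close> tend to 0.\<close>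

lemma packing_bounded_null:
  assumes S: "packing_bounded S" "bounded S"
  obtains s where "0 < s" "hausdorff_measure s S = 0"
proof (cases "S = {}")
  case True
  have "hausdorff_measure 1 S = 0" unfolding hausdorff_null_iff
    by (intro allI impI exI[of _ "\<lambda>_. {}"]) (simp add: True diameter_power_def)
  then show ?thesis using that[of 1] by simp
next
  case False
  then obtain x where x: "x \<in> S" by blast
  obtain D where D: "0 < D" "S \<subseteq> ball x D" using bounded_subset_ballD[OF S(2)] by blast
  obtain N :: nat where N: "\<And>x R. x \<in> S \<Longrightarrow> 0 < R \<Longrightarrow>
    \<exists>C. C \<subseteq> S \<and> finite C \<and> card C \<le> N \<and> S \<inter> ball x (2 * R) \<subseteq> (\<Union>c\<in>C. ball c R)"
    using packing_bounded_net[OF S(1)] by blast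
  have cov: "\<exists>C. C \<subseteq> S \<and> finite C \<and> card C \<le> N ^ j \<and> S \<subseteq> (\<Union>c\<in>C. ball c (D / 2 ^ j))" for j
  proof (induction j)
    case 0
    show ?case using x D by (intro exI[of _ "{x}"]) auto
  next
    case (Suc j)
    then obtain C where C: "C \<subseteq> S" "finite C" "card C \<le> N ^ j" "S \<subseteq> (\<Union>c\<in>C. ball c (D / 2 ^ j))" by blast
    have "\<exists>E. E \<subseteq> S \<and> finite E \<and> card E \<le> N \<and> S \<inter> ball c (D / 2 ^ j) \<subseteq> (\<Union>e\<in>E. ball e (D / 2 ^ Suc j))" if "c \<in> C" for c
      using N[of c "D / 2 ^ Suc j"] that C(1) D(1) by auto
    then obtain E where E: "\<And>c. c \<in> C \<Longrightarrow> E c \<subseteq> S \<and> finite (E c) \<and> card (E c) \<le> N \<and> S \<inter> ball c (D / 2 ^ j) \<subseteq> (\<Union>e\<in>E c. ball e (D / 2 ^ Suc j))"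
      by metis
    have "card (\<Union>c\<in>C. E c) \<le> (\<Sum>c\<in>C. card (E c))" by (rule card_UN_le[OF C(2)])
    also have "\<dots> \<le> (\<Sum>c\<in>C. N)" using E by (intro sum_mono) auto
    also have "\<dots> \<le> N ^ Suc j" using C(3) by (simp add: mult.commute)
    finally have 1: "card (\<Union>c\<in>C. E c) \<le> N ^ Suc j" .
    have 2: "S \<subseteq> (\<Union>e\<in>(\<Union>c\<in>C. E c). ball e (D / 2 ^ Suc j))"
    proof
      fix y assume y: "y \<in> S"
      then obtain c where c: "c \<in> C" "y \<in> ball c (D / 2 ^ j)" using C(4) by blast
      then show "y \<in> (\<Union>e\<in>(\<Union>c\<in>C. E c). ball e (D / 2 ^ Suc j))" using E[OF c(1)] y by blast
    qed
    have 3: "finite (\<Union>c\<in>C. E c)" "(\<Union>c\<in>C. E c) \<subseteq> S" using E C(2) by auto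
    show ?case by (rule exI[of _ "\<Union>c\<in>C. E c"]) (use 1 2 3 in blast)
  qed
  define s where "s = real N + 1"
  have s: "0 < s" by (simp add: s_def)
  have "real N < 2 ^ (N + 1)" using order_less_le_trans[OF of_nat_less_two_power[of N], of "2 ^ (N + 1)"] by simp
  moreover have "2 powr s = 2 ^ (N + 1)" unfolding s_def using powr_realpow[of 2 "N + 1"] by (simp add: add.commute)
  ultimately have q: "real N / 2 powr s < 1" "0 \<le> real N / 2 powr s" by auto
  have "hausdorff_measure s S = 0" unfolding hausdorff_null_iff
  proof (intro allI impI)
    fix \<delta> e :: real assume \<delta>: "0 < \<delta>" and e: "0 < e"
    have "(\<lambda>j. (real N / 2 powr s) ^ j * (2 * D) powr s) \<longlonglongrightarrow> 0 * (2 * D) powr s"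
      using q by (intro tendsto_mult tendsto_const LIMSEQ_power_zero) auto
    then have "\<forall>\<^sub>F j in sequentially. (real N / 2 powr s) ^ j * (2 * D) powr s < e" using e by (intro order_tendstoD) auto
    moreover have "(\<lambda>j. 2 * D * (1 / 2) ^ j) \<longlonglongrightarrow> 2 * D * 0" by (intro tendsto_mult tendsto_const LIMSEQ_power_zero) auto
    then have "\<forall>\<^sub>F j in sequentially. 2 * D * (1 / 2) ^ j < \<delta>" using \<delta> by (intro order_tendstoD) auto
    ultimately have "\<forall>\<^sub>F j in sequentially. (real N / 2 powr s) ^ j * (2 * D) powr s < e \<and> 2 * D * (1 / 2) ^ j < \<delta>" by (rule eventually_conj)
    then obtain j where j: "(real N / 2 powr s) ^ j * (2 * D) powr s < e" "2 * D * (1 / 2) ^ j < \<delta>"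
      using eventually_happens'[OF sequentially_bot] by blast
    define R where "R = D / 2 ^ j"
    have R: "0 < R" "2 * R < \<delta>" using D j by (auto simp: R_def power_one_over field_simps)
    obtain C where C: "C \<subseteq> S" "finite C" "card C \<le> N ^ j" "S \<subseteq> (\<Union>c\<in>C. ball c R)" using cov[of j] unfolding R_def by blast
    obtain b where b: "bij_betw b {0..<card C} C" using ex_bij_betw_nat_finite[OF C(2)] by blast
    define B where "B i = (if i < card C then ball (b i) R else {})" for i
    have Bd: "bounded (B i)" "diameter (B i) \<le> 2 * R" for i
    proof -
      have "dist u v \<le> 2 * R" if "u \<in> B i" "v \<in> B i" for u v
        using that dist_triangle3[of u v "b i"] by (auto simp: B_def split: if_splits)
      then show "bounded (B i)" "diameter (B i) \<le> 2 * R" using diameter_le_metric[of "2 * R" "B i"] R by auto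
    qed
    have "diameter_power s (B i) \<le> ennreal ((2 * R) powr s)" for i
      using s powr_mono2[OF _ diameter_ge_0[OF Bd(1)] Bd(2), of s i] by (auto simp: diameter_power_def intro!: ennreal_leI)
    then have "(\<Sum>i<card C. diameter_power s (B i)) \<le> (\<Sum>i<card C. ennreal ((2 * R) powr s))" by (intro sum_mono) auto
    also have "\<dots> = ennreal (real (card C) * (2 * R) powr s)" by (simp add: ennreal_mult ennreal_of_nat_eq_real_of_nat)
    also have "\<dots> \<le> ennreal (real N ^ j * (2 * R) powr s)"
      using C(3) by (intro ennreal_leI mult_right_mono) (auto simp flip: of_nat_power)
    also have "real N ^ j * (2 * R) powr s = (real N / 2 powr s) ^ j * (2 * D) powr s"
    proof -
      have "(2 * R) powr s = (2 * D) powr s / (2 ^ j) powr s" unfolding R_def using D by (simp add: powr_divide powr_mult)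
      also have "(2 ^ j) powr s = (2 powr s) ^ j" by (simp add: powr_realpow[symmetric] powr_powr mult.commute)
      finally show ?thesis by (simp add: power_divide)
    qed
    also have "ennreal \<dots> < ennreal e" using j e by (simp add: ennreal_lessI)
    finally have "(\<Sum>i<card C. diameter_power s (B i)) < ennreal e" .
    moreover have "(\<Sum>i. diameter_power s (B i)) = (\<Sum>i<card C. diameter_power s (B i))"
      by (rule suminf_finite) (auto simp: B_def diameter_power_def)
    moreover have "S \<subseteq> (\<Union>i. B i)"
    proof
      fix y assume "y \<in> S"
      then obtain c where c: "c \<in> C" "y \<in> ball c R" using C(4) by blast
      then obtain i where "i < card C" "b i = c" using b unfolding bij_betw_def by force
      then show "y \<in> (\<Union>i. B i)" using c by (auto simp: B_def intro!: exI[of _ i])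
    qed
    moreover have "bounded (B i) \<and> diameter (B i) \<le> \<delta>" for i using Bd[of i] R by auto
    ultimately show "\<exists>C :: nat \<Rightarrow> 'a set. S \<subseteq> (\<Union>i. C i) \<and> (\<forall>i. bounded (C i) \<and> diameter (C i) \<le> \<delta>) \<and> (\<Sum>i. diameter_power s (C i)) < ennreal e"
      by (intro exI[of _ B]) auto
  qed
  then show ?thesis using that s by blast
qed

text \<open>Eilenberg's inequality for the distance function from \<open>x0\<close>: the total diameter of the pieces
  meeting the sphere of radius \<open>t\<close> is integrated over \<open>t\<close>.\<close>

lemma hausdorff_2_spheres:
  fixes x0 :: "'a::metric_space"
  assumes \<kappa>: "0 < \<kappa>" and r: "0 < r" "r \<le> r0"
    and K: "\<And>t. 0 < t \<Longrightarrow> t < r0 \<Longrightarrow> \<exists>K p q. connected K \<and> K \<subseteq> {w. dist x0 w = t} \<and> p \<in> K \<and> q \<in> K \<and> \<kappa> * t \<le> dist p q"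
  shows "ennreal (\<kappa> * r\<^sup>2 / 16) \<le> hausdorff_measure 2 (ball x0 r)"
proof -
  have "ennreal (\<kappa> * r\<^sup>2 / 16) \<le> hausdorff_premeasure 2 1 (ball x0 r)"
    unfolding hausdorff_premeasure_def
  proof (rule INF_greatest)
    fix C :: "nat \<Rightarrow> 'a set" assume "C \<in> {C. ball x0 r \<subseteq> (\<Union>i. C i) \<and> (\<forall>i. bounded (C i) \<and> diameter (C i) \<le> 1)}"
    then have C: "ball x0 r \<subseteq> (\<Union>i. C i)" "\<And>i. bounded (C i)" by auto
    define d where "d i = diameter (C i)" for i
    have d0: "0 \<le> d i" for i using diameter_ge_0[OF C(2)] by (simp add: d_def)
    define w where "w i = (SOME w. w \<in> C i)" for i
    have w: "dist (w i) u \<le> d i" if "u \<in> C i" for i u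
    proof -
      have "w i \<in> C i" unfolding w_def using that by (rule someI)
      then show ?thesis unfolding d_def using that by (intro diameter_bounded_bound C(2))
    qed
    \<comment> \<open>All radii \<open>t\<close> whose sphere meets \<open>C i\<close> lie in
      \<open>J i\<close>, an interval of length \<open>2 * d i\<close>. Working with intervals about
      a chosen point \<open>w i\<close> avoids any measurability question for the pieces.\<close>
    define J where "J i = (if C i = {} then {} else cball (dist x0 (w i)) (d i))" for i
    have cb: "emeasure lborel (cball a (d i)) = ennreal (2 * d i)" for a :: real and i
      using d0 by (simp add: cball_eq_atLeastAtMost)
    have slice: "ennreal (\<kappa> * r / 2) * indicator {r/2<..<r} t \<le> (\<Sum>i. ennreal (2 * d i) * indicator (J i) t)" for t :: real
    proof (cases "t \<in> {r/2<..<r}")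
      case True
      then have t: "0 < t" "t < r0" "t < r" "r / 2 < t" using r by auto
      obtain K p q where K': "connected K" "K \<subseteq> {w. dist x0 w = t}" "p \<in> K" "q \<in> K" "\<kappa> * t \<le> dist p q" using K[OF t(1,2)] by blast
      \<comment> \<open>The distance from \<open>p\<close> maps the continuum onto a set containing
        \<open>{0..dist p q}\<close>; the images of the pieces lie in the intervals
        \<open>I i\<close> of length \<open>2 * d i\<close>, which therefore cover it.\<close>
      define I where "I i = (if t \<in> J i then cball (dist p (w i)) (d i) else {})" for i
      have "{0..dist p q} \<subseteq> (\<Union>i. I i)"
      proof
        fix a assume a: "a \<in> {0..dist p q}"
        have "connected (dist p ` K)" using K'(1) by (intro connected_continuous_image continuous_intros)
        moreover have "0 \<in> dist p ` K" "dist p q \<in> dist p ` K" using K' by force+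
        ultimately have "a \<in> dist p ` K" using a by (meson atLeastAtMost_iff connectedD_interval)
        then obtain u where u: "u \<in> K" "a = dist p u" by blast
        then have "u \<in> ball x0 r" using K'(2) t by auto
        then obtain i where i: "u \<in> C i" using C(1) by blast
        have "\<bar>t - dist x0 (w i)\<bar> \<le> d i" "\<bar>a - dist p (w i)\<bar> \<le> d i"
          using w[OF i] u K'(2) dist_triangle2[of x0 u "w i"] dist_triangle[of x0 "w i" u] dist_triangle2[of p u "w i"] dist_triangle[of p "w i" u]
          by (auto simp: abs_le_iff dist_commute)
        then show "a \<in> (\<Union>i. I i)" using i by (auto simp: I_def J_def dist_real_def abs_minus_commute intro!: exI[of _ i])
      qed
      then have "emeasure lborel {0..dist p q} \<le> emeasure lborel (\<Union>i. I i)" by (intro emeasure_mono) (auto simp: I_def)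
      also have "\<dots> \<le> (\<Sum>i. emeasure lborel (I i))" by (rule emeasure_subadditive_countably) (auto simp: I_def)
      also have "\<dots> = (\<Sum>i. ennreal (2 * d i) * indicator (J i) t)" by (intro suminf_cong) (simp add: I_def cb)
      finally have "ennreal (dist p q) \<le> (\<Sum>i. ennreal (2 * d i) * indicator (J i) t)" by simp
      moreover have "\<kappa> * r / 2 \<le> dist p q" using K'(5) mult_strict_left_mono[OF t(4) \<kappa>] by simp
      ultimately show ?thesis using True by (auto intro: order_trans[OF ennreal_leI])
    qed simp
    have "ennreal (\<kappa> * r / 2 * (r / 2)) = ennreal (\<kappa> * r / 2) * emeasure lborel {r/2<..<r}"
      using \<kappa> r by (simp add: ennreal_mult[symmetric])
    also have "\<dots> = (\<integral>\<^sup>+ t. ennreal (\<kappa> * r / 2) * indicator {r/2<..<r} t \<partial>lborel)" by (simp add: nn_integral_cmult_indicator)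
    also have "\<dots> \<le> (\<integral>\<^sup>+ t. (\<Sum>i. ennreal (2 * d i) * indicator (J i) t) \<partial>lborel)" by (intro nn_integral_mono slice)
    also have "\<dots> = (\<Sum>i. \<integral>\<^sup>+ t. ennreal (2 * d i) * indicator (J i) t \<partial>lborel)" by (rule nn_integral_suminf) (simp add: J_def)
    also have "\<dots> = (\<Sum>i. ennreal (2 * d i) * emeasure lborel (J i))" by (intro suminf_cong nn_integral_cmult_indicator) (simp add: J_def)
    also have "\<dots> \<le> (\<Sum>i. ennreal 4 * diameter_power 2 (C i))"
    proof (intro suminf_le)
      fix i
      show "ennreal (2 * d i) * emeasure lborel (J i) \<le> ennreal 4 * diameter_power 2 (C i)"
        using d0[of i] by (simp add: J_def cb diameter_power_def ennreal_mult[symmetric] powr_numeral power2_eq_square del: ennreal_numeral flip: d_def)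
    qed auto
    also have "\<dots> = ennreal 4 * (\<Sum>i. diameter_power 2 (C i))" by simp
    finally have "ennreal (\<kappa> * r / 2 * (r / 2)) \<le> ennreal 4 * (\<Sum>i. diameter_power 2 (C i))" .
    moreover have "ennreal (\<kappa> * r / 2 * (r / 2)) = ennreal 4 * ennreal (\<kappa> * r\<^sup>2 / 16)"
      using \<kappa> r by (simp add: ennreal_mult[symmetric] power2_eq_square del: ennreal_numeral)
    ultimately show "ennreal (\<kappa> * r\<^sup>2 / 16) \<le> (\<Sum>i. diameter_power 2 (C i))"
      by (simp add: ennreal_mult_le_mult_iff del: ennreal_numeral)
  qed
  also have "\<dots> \<le> hausdorff_measure 2 (ball x0 r)" by (rule premeasure_le_measure) simp
  finally show ?thesis .
qed

section \<open>Area of small balls: continua in spheres\<close>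

text \<open>If a compact plane set separates two points, one of its components does. This is needed
  because a metric sphere is in general not connected.\<close>

lemma (in planar_chart) component_encloses:
  assumes S: "compact S" "S \<subseteq> W" "x \<in> fil S" "x \<notin> S"
  obtains K where "K \<subseteq> S" "compact K" "connected K" "x \<in> fil K"
proof -
  have cS: "compact (h ` S)" by (rule compact_h[OF S(1,2)])
  have "outside (h ` S) \<noteq> {}" using outside_bounded_nonempty[OF compact_imp_bounded[OF cS]] .
  then obtain b where b: "b \<in> outside (h ` S)" by blast
  have a: "x \<in> W" "h x \<notin> outside (h ` S)" using S(3) by (auto simp: mem_fil)
  have "\<not> connected_component (- h ` S) (h x) b"
  proof
    assume "connected_component (- h ` S) (h x) b"
    then have "connected_component (- h ` S) b (h x)" by (rule connected_component_sym)
    then show False using outside_same_component[OF _ b] a(2) by blast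
  qed
  then obtain C where C: "C \<in> components (h ` S)" "\<not> connected_component (- C) (h x) b"
    using separation_by_component_closed_pointwise[OF compact_imp_closed[OF cS]] by blast
  have C': "compact C" "connected C" "C \<subseteq> h ` S"
    using C(1) compact_components[OF cS] in_components_connected in_components_subset by blast+
  have "h x \<notin> outside C"
  proof
    assume hx: "h x \<in> outside C"
    have "b \<in> outside C" using b outside_mono[OF C'(3)] by blast
    moreover have "connected (outside C)" using connected_outside[OF compact_imp_bounded[OF C'(1)]] by simp
    ultimately have "connected_component (- C) (h x) b"
      unfolding connected_component_def using hx outside_no_overlap[of C] by (intro exI[of _ "outside C"]) blast
    then show False using C(2) by blast
  qed
  moreover have "h ` (k ` C) = C" by (simp add: image_image)
  ultimately have "x \<in> fil (k ` C)" using a(1) by (simp add: mem_fil)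
  moreover have "k ` C \<subseteq> S"
  proof
    fix y assume "y \<in> k ` C"
    then obtain u where "u \<in> S" "y = k (h u)" using C'(3) by blast
    then show "y \<in> S" using S(2) by auto
  qed
  moreover have "compact (k ` C)" "connected (k ` C)" using C' cont_k by (auto intro: compact_continuous_image connected_continuous_image)
  ultimately show thesis using that by blast
qed

context hom_surface
begin

text \<open>The arc through \<open>x0\<close> leaves through \<open>K\<close> on both sides, after a
  parameter length of at least \<open>t / L\<close> each, so the two exits are at least
  \<open>2 * t / L^2\<close> apart.\<close>

lemma sphere_continuum:
  assumes t: "0 < t" "t < r1"
  shows "\<exists>K p q. connected K \<and> K \<subseteq> {w. dist x0 w = t} \<and> p \<in> K \<and> q \<in> K \<and> 2 / L\<^sup>2 * t \<le> dist p q"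
proof -
  define S where "S = {w. dist x0 w = t}"
  have "closed S" unfolding S_def by (intro closed_Collect_eq continuous_intros)
  moreover have Sb: "S \<subseteq> ball x0 (4 * r1)"
  proof
    fix w assume "w \<in> S"
    then have "dist x0 w = t" by (simp add: S_def)
    then have "dist x0 w < 4 * r1" using t r1 by linarith
    then show "w \<in> ball x0 (4 * r1)" by simp
  qed
  ultimately have S: "compact S" "S \<subseteq> W" using compact_small by auto
  have xW: "x0 \<in> W" and cb: "compact (cball x0 t)" "cball x0 t \<subseteq> W" using small_cball[of x0 t] t r1 by auto
  have "x0 \<in> fil S" using t by (intro sphere_encloses[OF xW S _ cb]) (auto simp: S_def)
  moreover have "x0 \<notin> S" using t by (simp add: S_def)
  ultimately obtain K where K: "K \<subseteq> S" "compact K" "connected K" "x0 \<in> fil K" using component_encloses[OF S] by blast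
  have "x0 \<in> fil K - K" using K(1,4) \<open>x0 \<notin> S\<close> by blast
  moreover have "K \<subseteq> ball x0 (4 * r1)" using K(1) Sb by blast
  ultimately obtain \<sigma> a b where "crosscut K x0 \<sigma> a b" using ex_crosscut[OF K(2) _ x0A] by blast
  then have c: "\<sigma> 0 = x0" "bilip L \<sigma> {a..b}" "a < 0" "0 < b" "\<sigma> a \<in> K" "\<sigma> b \<in> K" unfolding crosscut_def by blast+
  have "dist x0 (\<sigma> b) = t" "dist (\<sigma> a) x0 = t" using c(5,6) K(1) by (auto simp: S_def dist_commute)
  then have "t \<le> L * b" "t \<le> L * (- a)"
    using bilipD(2)[OF c(2), of 0 b] bilipD(2)[OF c(2), of a 0] c by auto
  then have "2 * t \<le> L * (b - a)" by (simp add: algebra_simps)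
  also have "\<dots> \<le> L * (L * dist (\<sigma> a) (\<sigma> b))" using bilipD(1)[OF c(2), of a b] c(3,4) by (intro mult_left_mono) auto
  finally have "2 / L\<^sup>2 * t \<le> dist (\<sigma> a) (\<sigma> b)" by (simp add: field_simps power2_eq_square)
  then show ?thesis using K(1,3) c(5,6) unfolding S_def by blast
qed

lemma hausdorff_2_ball: "0 < r \<Longrightarrow> r \<le> r1 \<Longrightarrow> ennreal (1 / (8 * L\<^sup>2) * r\<^sup>2) \<le> hausdorff_measure 2 (ball x0 r)"
  using hausdorff_2_spheres[OF _ _ _ sphere_continuum, of r] L by simp

end

section \<open>BiLipschitz circles and Lipschitz retractions\<close>

lemma sin_ge_quarter:
  fixes x :: real
  assumes "0 \<le> x" "x \<le> pi / 2"
  shows "x / 4 \<le> sin x"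
proof (cases "x \<le> pi / 3")
  case True
  have "sin 0 - 0 / 2 \<le> sin x - x / 2"
  proof (rule DERIV_nonneg_imp_nondecreasing[OF assms(1), of "\<lambda>x. sin x - x / 2"])
    fix u assume u: "0 \<le> u" "u \<le> x"
    have "cos (pi / 3) \<le> cos u" using u True by (intro cos_monotone_0_pi_le) auto
    then show "\<exists>y. ((\<lambda>x. sin x - x / 2) has_real_derivative y) (at u) \<and> 0 \<le> y"
      by (intro exI[of _ "cos u - 1 / 2"]) (auto intro!: derivative_eq_intros simp: cos_60)
  qed
  then show ?thesis using assms by simp
next
  case False
  have "sin (pi / 6) \<le> sin x" using assms False by (intro sin_monotone_2pi_le) auto
  then show ?thesis using assms pi_less_4 by (simp add: sin_30)
qed

text \<open>The arc-length metric of a circle of circumference \<open>T\<close>, on parameters in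
  \<open>{0..T}\<close> with the two ends identified.\<close>

definition loop_dist :: "real \<Rightarrow> real \<Rightarrow> real \<Rightarrow> real" where
  "loop_dist T s u = min \<bar>s - u\<bar> (T - \<bar>s - u\<bar>)"

definition loop_point :: "real \<Rightarrow> real \<Rightarrow> complex" where "loop_point T t = cis (2 * pi * t / T)"

lemma dist_cis: "dist (cis a) (cis b) = 2 * \<bar>sin ((a - b) / 2)\<bar>"
proof -
  have "cis a - cis b = cis b * (exp (\<i> * of_real (a - b)) - 1)"
    by (simp add: cis_conv_exp exp_diff algebra_simps)
  then show ?thesis using dist_exp_i_1[of "a - b"] by (simp add: dist_norm norm_mult)
qed

lemma loop_point_dist:
  assumes T: "0 < T" and su: "s \<in> {0..T}" "u \<in> {0..T}"
  shows "loop_dist T s u \<le> T * dist (loop_point T s) (loop_point T u)"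
    "T * dist (loop_point T s) (loop_point T u) \<le> 8 * loop_dist T s u"
proof -
  define x where "x = pi * \<bar>s - u\<bar> / T"
  have x: "0 \<le> x" "x \<le> pi" using T su by (auto simp: x_def field_simps abs_if)
  have eq: "dist (loop_point T s) (loop_point T u) = 2 * sin x"
  proof -
    have "(2 * pi * s / T - 2 * pi * u / T) / 2 = pi * (s - u) / T" using T by (simp add: field_simps)
    then have "dist (loop_point T s) (loop_point T u) = 2 * \<bar>sin (pi * (s - u) / T)\<bar>"
      unfolding loop_point_def dist_cis by (simp only:)
    also have "\<bar>sin (pi * (s - u) / T)\<bar> = \<bar>sin x\<bar>" by (cases "u \<le> s") (auto simp: x_def algebra_simps diff_divide_distrib abs_if sin_diff)
    finally show ?thesis using sin_ge_zero[OF x] by simp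
  qed
  have lo: "min x (pi - x) / 4 \<le> sin x"
  proof (cases "x \<le> pi / 2")
    case True
    then show ?thesis using sin_ge_quarter[OF x(1)] by (simp add: min_def)
  next
    case False
    then have "(pi - x) / 4 \<le> sin (pi - x)" using x by (intro sin_ge_quarter) auto
    then show ?thesis using False by (simp add: min_def)
  qed
  have hi: "sin x \<le> min x (pi - x)" using sin_x_le_x[OF x(1)] sin_x_le_x[of "pi - x"] x by simp
  have ld: "pi * loop_dist T s u = T * min x (pi - x)"
    using T by (auto simp: loop_dist_def x_def min_def field_simps)
  have l0: "0 \<le> loop_dist T s u" using su by (auto simp: loop_dist_def)
  have "2 * loop_dist T s u \<le> pi * loop_dist T s u" "pi * loop_dist T s u \<le> 4 * loop_dist T s u"
    using l0 pi_gt3 pi_less_4 by (auto intro: mult_right_mono)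
  moreover have "T * (min x (pi - x) / 4) \<le> T * sin x" "T * sin x \<le> T * min x (pi - x)"
    using lo hi T by (auto intro: mult_left_mono)
  ultimately show "loop_dist T s u \<le> T * dist (loop_point T s) (loop_point T u)"
    "T * dist (loop_point T s) (loop_point T u) \<le> 8 * loop_dist T s u"
    unfolding eq ld by simp_all
qed

text \<open>McShane's formula: the extension is the infimum of the cones
  \<open>f g + M * dist y g\<close>.\<close>

lemma lipschitz_extension:
  fixes f :: "'a::metric_space \<Rightarrow> real"
  assumes G: "G \<noteq> {}" and M: "0 \<le> M" and f: "\<And>x y. x \<in> G \<Longrightarrow> y \<in> G \<Longrightarrow> \<bar>f x - f y\<bar> \<le> M * dist x y"
  obtains F where "\<And>x. x \<in> G \<Longrightarrow> F x = f x" "\<And>x y. \<bar>F x - F y\<bar> \<le> M * dist x y"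
proof -
  define F where "F y = (INF g\<in>G. f g + M * dist y g)" for y
  obtain g0 where g0: "g0 \<in> G" using G by blast
  have bd: "bdd_below ((\<lambda>g. f g + M * dist y g) ` G)" for y
  proof (rule bdd_belowI2)
    fix g assume g: "g \<in> G"
    have "M * dist g0 g \<le> M * (dist y g0 + dist y g)" using M dist_triangle3[of g0 g y] by (intro mult_left_mono)
    then show "f g0 - M * dist y g0 \<le> f g + M * dist y g" using f[OF g0 g] by (simp add: algebra_simps)
  qed
  have le: "F y \<le> F z + M * dist y z" for y z
  proof -
    have "F y - M * dist y z \<le> F z"
      unfolding F_def[of z]
    proof (rule cINF_greatest[OF G])
      fix g assume g: "g \<in> G"
      have "F y \<le> f g + M * dist y g" unfolding F_def by (rule cINF_lower[OF bd g])
      also have "\<dots> \<le> f g + M * (dist y z + dist z g)" using M dist_triangle[of y g z] by (intro add_left_mono mult_left_mono)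
      finally show "F y - M * dist y z \<le> f g + M * dist z g" by (simp add: algebra_simps)
    qed
    then show ?thesis by simp
  qed
  show thesis
  proof (rule that)
    show "F x = f x" if x: "x \<in> G" for x
    proof (rule antisym)
      show "F x \<le> f x" using cINF_lower[OF bd x, of x] by (simp add: F_def)
      show "f x \<le> F x" unfolding F_def
      proof (rule cINF_greatest[OF G])
        fix g assume "g \<in> G"
        then show "f x \<le> f g + M * dist x g" using f[OF x, of g] by simp
      qed
    qed
    show "\<bar>F x - F y\<bar> \<le> M * dist x y" for x y using le[of x y] le[of y x] by (simp add: dist_commute)
  qed
qed

text \<open>Radial projection moves \<open>z\<close> by \<open>\<bar>1 - norm z\<bar>\<close>, which
  is at most the distance from \<open>z\<close> to any point of the unit circle.\<close>

lemma norm_sgn_diff_le: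
  fixes z w :: complex
  assumes "norm w = 1" "z \<noteq> 0"
  shows "norm (sgn z - w) \<le> 2 * norm (z - w)"
proof -
  have "sgn z - z = of_real (1 - norm z) * sgn z" using assms(2) by (simp add: sgn_div_norm scaleR_conv_of_real field_simps)
  then have "norm (sgn z - z) = \<bar>1 - norm z\<bar>" using assms(2) by (simp add: norm_mult norm_sgn del: of_real_diff)
  also have "\<dots> \<le> norm (z - w)" using norm_triangle_ineq3[of w z] assms(1) by (simp add: norm_minus_commute)
  finally show ?thesis using norm_triangle_ineq[of "sgn z - z" "z - w"] by simp
qed

text \<open>A bi-Lipschitz circle is parametrized by the unit circle; extend the inverse of the
  parametrization to a Lipschitz map into the plane and project radially.\<close>

lemma loop_retract:
  fixes g :: "real \<Rightarrow> 'a::metric_space"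
  assumes T: "0 < T" and M: "0 < M"
    and lo: "\<And>s u. s \<in> {0..T} \<Longrightarrow> u \<in> {0..T} \<Longrightarrow> loop_dist T s u \<le> M * dist (g s) (g u)"
    and hi: "\<And>s u. s \<in> {0..T} \<Longrightarrow> u \<in> {0..T} \<Longrightarrow> dist (g s) (g u) \<le> M * loop_dist T s u"
  obtains r \<delta> C where "0 < \<delta>" "0 < C" "continuous_on {y. infdist y (g ` {0..T}) < \<delta>} r"
    "\<And>y. r y \<in> g ` {0..T}" "\<And>x. x \<in> g ` {0..T} \<Longrightarrow> r x = x"
    "\<And>x y. x \<in> g ` {0..T} \<Longrightarrow> infdist y (g ` {0..T}) < \<delta> \<Longrightarrow> dist (r y) x \<le> C * dist y x"
proof -
  define G where "G = g ` {0..T}"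
  have Gne: "G \<noteq> {}" using T by (auto simp: G_def)
  \<comment> \<open>The two ends of \<open>{0..T}\<close> parametrize the same point by
    \<open>hi\<close>; which of them is chosen does not matter, as their \<open>loop_dist\<close> is
    0.\<close>
  define p where "p x = (SOME t. t \<in> {0..T} \<and> g t = x)" for x
  have p: "p x \<in> {0..T}" "g (p x) = x" if x: "x \<in> G" for x
  proof -
    have "\<exists>t. t \<in> {0..T} \<and> g t = x" using x by (auto simp: G_def)
    from someI_ex[OF this] show "p x \<in> {0..T}" "g (p x) = x" unfolding p_def by auto
  qed
  define f where "f x = loop_point T (p x)" for x
  define B where "B = 8 * M / T"
  have B: "0 < B" using M T by (simp add: B_def)
  have f: "dist (f x) (f y) \<le> B * dist x y" if "x \<in> G" "y \<in> G" for x y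
  proof -
    have "T * dist (f x) (f y) \<le> 8 * loop_dist T (p x) (p y)" unfolding f_def by (rule loop_point_dist(2)[OF T p(1)[OF that(1)] p(1)[OF that(2)]])
    also have "\<dots> \<le> 8 * (M * dist x y)" using lo[OF p(1)[OF that(1)] p(1)[OF that(2)]] p(2) that by simp
    finally show ?thesis using T by (simp add: B_def field_simps)
  qed
  have f1: "norm (f x) = 1" for x by (simp add: f_def loop_point_def)
  define c where "c z = T * Arg2pi z / (2 * pi)" for z
  have c: "c z \<in> {0..T}" for z using Arg2pi[of z] T by (simp add: c_def field_simps)
  have lc: "loop_point T (c z) = z" if "norm z = 1" for z
  proof -
    have "2 * pi * c z / T = Arg2pi z" using T by (simp add: c_def)
    then show ?thesis using Arg2pi_eq[of z] that by (simp add: loop_point_def cis_conv_exp)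
  qed
  have cl: "dist (g (c z)) (g (c w)) \<le> M * T * dist z w" if "norm z = 1" "norm w = 1" for z w
  proof -
    have "loop_dist T (c z) (c w) \<le> T * dist z w" using loop_point_dist(1)[OF T c c, of z w] lc that by simp
    then have "M * loop_dist T (c z) (c w) \<le> M * (T * dist z w)" using M by (intro mult_left_mono) auto
    then show ?thesis using hi[OF c c, of z w] by (simp add: mult_ac)
  qed
  have cf: "g (c (f x)) = x" if x: "x \<in> G" for x
  proof -
    have "loop_dist T (c (f x)) (p x) \<le> T * dist (loop_point T (c (f x))) (f x)" unfolding f_def[of x] by (rule loop_point_dist(1)[OF T c p(1)[OF x]])
    then have "loop_dist T (c (f x)) (p x) \<le> 0" by (simp add: lc[OF f1])
    then have "M * loop_dist T (c (f x)) (p x) \<le> 0" using M by (simp add: mult_le_0_iff)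
    then have "dist (g (c (f x))) (g (p x)) \<le> 0" using hi[OF c p(1)[OF x]] by (rule order_trans[rotated])
    then show ?thesis using p(2)[OF x] by simp
  qed
  have "\<bar>Re (f x) - Re (f y)\<bar> \<le> B * dist x y" "\<bar>Im (f x) - Im (f y)\<bar> \<le> B * dist x y" if "x \<in> G" "y \<in> G" for x y
    using f[OF that] abs_Re_le_cmod[of "f x - f y"] abs_Im_le_cmod[of "f x - f y"] by (auto simp: dist_norm)
  then obtain F1 F2 where F1: "\<And>x. x \<in> G \<Longrightarrow> F1 x = Re (f x)" "\<And>x y. \<bar>F1 x - F1 y\<bar> \<le> B * dist x y"
    and F2: "\<And>x. x \<in> G \<Longrightarrow> F2 x = Im (f x)" "\<And>x y. \<bar>F2 x - F2 y\<bar> \<le> B * dist x y"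
    using lipschitz_extension[OF Gne less_imp_le[OF B], of "\<lambda>x. Re (f x)"] lipschitz_extension[OF Gne less_imp_le[OF B], of "\<lambda>x. Im (f x)"] by metis
  define F where "F x = Complex (F1 x) (F2 x)" for x
  have FG: "F x = f x" if "x \<in> G" for x using F1(1) F2(1) that by (simp add: F_def complex_eq_iff)
  have FL: "norm (F x - F y) \<le> 2 * B * dist x y" for x y
    using cmod_le[of "F x - F y"] F1(2)[of x y] F2(2)[of x y] by (simp add: F_def)
  have contF: "continuous_on S F" for S
  proof -
    have "(2 * B)-lipschitz_on S F" using FL B by (intro lipschitz_onI) (auto simp: dist_norm)
    then show ?thesis by (rule lipschitz_on_continuous_on)
  qed
  \<comment> \<open>Within \<open>\<delta>\<close> of \<open>G\<close> the map \<open>F\<close>,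
    which is \<open>2 * B\<close>-Lipschitz, stays within 1/2 of the unit circle and so avoids
    0.\<close>
  define \<delta> where "\<delta> = 1 / (4 * B)"
  have \<delta>: "0 < \<delta>" using B by (simp add: \<delta>_def)
  define N where "N = {y. infdist y G < \<delta>}"
  have FN: "F y \<noteq> 0" if y: "y \<in> N" for y
  proof -
    have "\<exists>x\<in>G. dist y x < \<delta>"
    proof (rule ccontr)
      assume "\<not> ?thesis"
      then have "\<delta> \<le> infdist y G" using Gne by (auto simp: infdist_def not_less intro!: cINF_greatest)
      then show False using y by (simp add: N_def)
    qed
    then obtain x where x: "x \<in> G" "dist y x < \<delta>" by blast
    have "norm (F y - F x) \<le> 2 * B * dist y x" by (rule FL)
    also have "\<dots> < 2 * B * \<delta>" using x B by (intro mult_strict_left_mono) auto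
    also have "\<dots> = 1 / 2" using B by (simp add: \<delta>_def)
    finally show ?thesis using f1[of x] FG[OF x(1)] by auto
  qed
  define r where "r y = g (c (sgn (F y)))" for y
  show thesis
  proof (rule that[of \<delta> "4 * M * T * B" r, unfolded G_def[symmetric] N_def[symmetric]])
    show "0 < \<delta>" by fact
    show "0 < 4 * M * T * B" using M T B by simp
    have "continuous_on {z. norm z = 1} (\<lambda>z. g (c z))"
    proof -
      have "(M * T)-lipschitz_on {z. norm z = 1} (\<lambda>z. g (c z))" using cl M T by (intro lipschitz_onI) auto
      then show ?thesis by (rule lipschitz_on_continuous_on)
    qed
    moreover have "continuous_on N (\<lambda>y. sgn (F y))" using contF FN by (intro continuous_on_sgn) auto
    ultimately show "continuous_on N r" unfolding r_def by (rule continuous_on_compose2) (use FN in \<open>auto simp: norm_sgn\<close>)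
    show "r y \<in> G" for y using c by (simp add: r_def G_def)
    show "r x = x" if "x \<in> G" for x
    proof -
      have "sgn (f x) = f x" using f1[of x] by (simp add: sgn_div_norm)
      then show ?thesis using cf[OF that] FG[OF that] by (simp add: r_def)
    qed
    show "dist (r y) x \<le> 4 * M * T * B * dist y x" if x: "x \<in> G" and y: "infdist y G < \<delta>" for x y
    proof -
      have Fy: "F y \<noteq> 0" using FN y by (simp add: N_def)
      have "dist (r y) x = dist (g (c (sgn (F y)))) (g (c (f x)))" using cf[OF x] by (simp add: r_def)
      also have "\<dots> \<le> M * T * dist (sgn (F y)) (f x)" using Fy f1 by (intro cl) (auto simp: norm_sgn)
      also have "\<dots> \<le> M * T * (2 * norm (F y - f x))" using norm_sgn_diff_le[OF f1 Fy, of x] M T by (intro mult_left_mono) (auto simp: dist_norm)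
      also have "\<dots> \<le> M * T * (2 * (2 * B * dist y x))" using FL[of y x] FG[OF x] M T by (intro mult_left_mono) auto
      finally show ?thesis by (simp add: mult_ac)
    qed
  qed
qed

text \<open>Transversality at the joint: as \<open>e t\<close> is at distance at least
  \<open>\<eta> * t\<close> from the old arc, \<open>t\<close> is controlled by the distance of the
  two points, and by the triangle inequality so is the remaining way through the joint.\<close>

lemma bilip_append:
  fixes c e :: "real \<Rightarrow> 'a::metric_space"
  assumes c: "bilip M c {0..l}" and M: "1 \<le> M" and l: "0 \<le> l" and e: "geodesic_arc e m" and m: "0 \<le> m"
    and join: "e 0 = c l" and \<eta>: "0 < \<eta>"
    and far: "\<And>s t. s \<in> {0..l} \<Longrightarrow> t \<in> {0..m} \<Longrightarrow> \<eta> * t \<le> dist (e t) (c s)"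
  shows "bilip (M * (1 + 1 / \<eta>) + 1 / \<eta>) (\<lambda>t. if t \<le> l then c t else e (t - l)) {0..l + m}"
proof -
  define g where "g t = (if t \<le> l then c t else e (t - l))" for t
  define M' where "M' = M * (1 + 1 / \<eta>) + 1 / \<eta>"
  have i: "0 < 1 / \<eta>" using \<eta> by simp
  have "M * 1 \<le> M * (1 + 1 / \<eta>)" using M i by (intro mult_left_mono) auto
  then have M': "M \<le> M'" "1 \<le> M'" using M i unfolding M'_def by linarith+
  have gc: "g s = c s" if "s \<le> l" for s using that by (simp add: g_def)
  have ge: "g s = e (s - l)" if "l \<le> s" for s using that join by (cases "s = l") (auto simp: g_def)
  have main: "\<bar>s - u\<bar> \<le> M' * dist (g s) (g u) \<and> dist (g s) (g u) \<le> M' * \<bar>s - u\<bar>" if su: "s \<in> {0..l + m}" "u \<in> {0..l + m}" "s \<le> u" for s u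
  proof -
    consider "u \<le> l" | "l \<le> s" | "s < l" "l < u" by linarith
    then show ?thesis
    proof cases
      case 1
      then have r: "s \<in> {0..l}" "u \<in> {0..l}" using su by auto
      have "M * dist (c s) (c u) \<le> M' * dist (c s) (c u)" "M * \<bar>s - u\<bar> \<le> M' * \<bar>s - u\<bar>" using M' by (auto intro: mult_right_mono)
      then show ?thesis using bilipD[OF c r] gc 1 su by auto
    next
      case 2
      then have "dist (g s) (g u) = \<bar>s - u\<bar>" using e su ge by (auto simp: geodesic_arc_def)
      then show ?thesis using M' by (auto simp: mult_le_cancel_right1)
    next
      case 3
      define t where "t = u - l"
      have t: "t \<in> {0..m}" "0 < t" "u = l + t" using 3 su by (auto simp: t_def)
      define d where "d = dist (g s) (g u)"
      have d: "d = dist (c s) (e t)" using gc[of s] ge[of u] 3 t by (simp add: d_def)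
      have sl: "s \<in> {0..l}" "l \<in> {0..l}" using 3 su l by auto
      have et: "dist (c l) (e t) = t"
      proof -
        have "dist (e 0) (e t) = \<bar>0 - t\<bar>" using e t(1) m unfolding geodesic_arc_def by auto
        then show ?thesis using join t by simp
      qed
      have td: "t \<le> d / \<eta>" using far[OF sl(1) t(1)] \<eta> by (simp add: d field_simps dist_commute)
      have "dist (c s) (c l) \<le> d + t" using dist_triangle2[of "c s" "c l" "e t"] d et by simp
      then have "dist (c s) (c l) \<le> d * (1 + 1 / \<eta>)" using td by (simp add: algebra_simps)
      then have "M * dist (c s) (c l) \<le> M * (d * (1 + 1 / \<eta>))" using M by (intro mult_left_mono) auto
      then have "l - s \<le> M * (d * (1 + 1 / \<eta>))" using bilipD(1)[OF c sl] 3 by simp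
      then have 1: "\<bar>s - u\<bar> \<le> M' * d" using td t 3 by (simp add: M'_def algebra_simps)
      have "d \<le> M * (l - s) + t" using dist_triangle[of "c s" "e t" "c l"] bilipD(2)[OF c sl] 3 d et by simp
      also have "\<dots> \<le> M' * (l - s) + M' * t" using M' 3 t by (intro add_mono mult_right_mono) (auto simp: mult_le_cancel_right1)
      also have "\<dots> = M' * (u - s)" using t(3) by (simp add: algebra_simps)
      also have "u - s = \<bar>s - u\<bar>" using su by simp
      finally show ?thesis using 1 unfolding d_def by blast
    qed
  qed
  show ?thesis unfolding bilip_def g_def[symmetric] M'_def[symmetric]
  proof (intro ballI)
    fix s u assume "s \<in> {0..l + m}" "u \<in> {0..l + m}"
    then show "\<bar>s - u\<bar> \<le> M' * dist (g s) (g u) \<and> dist (g s) (g u) \<le> M' * \<bar>s - u\<bar>"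
      using main[of s u] main[of u s] by (cases "s \<le> u") (auto simp: dist_commute abs_minus_commute)
  qed
qed

text \<open>The piece \<open>e\<close> is transverse to \<open>c\<close> at both of its ends, so
  points on different pieces are compared through the joint nearer to the point of \<open>e\<close>.
  Measured in \<open>loop_dist\<close> the closed curve becomes a biLipschitz circle, to which
  \<open>loop_retract\<close> applies.\<close>

lemma loop_close:
  fixes c e :: "real \<Rightarrow> 'a::metric_space"
  assumes c: "bilip M c {0..l}" and M: "1 \<le> M" and l: "0 < l" and e: "geodesic_arc e m" and m: "0 < m"
    and join: "e 0 = c l" "e m = c 0" and \<eta>: "0 < \<eta>"
    and far: "\<And>s t. s \<in> {0..l} \<Longrightarrow> t \<in> {0..m} \<Longrightarrow> \<eta> * min t (m - t) \<le> dist (e t) (c s)"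
  obtains r \<delta> C where "0 < \<delta>" "0 < C" "continuous_on {y. infdist y (c ` {0..l} \<union> e ` {0..m}) < \<delta>} r"
    "\<And>y. r y \<in> c ` {0..l} \<union> e ` {0..m}" "\<And>x. x \<in> c ` {0..l} \<union> e ` {0..m} \<Longrightarrow> r x = x"
    "\<And>x y. x \<in> c ` {0..l} \<union> e ` {0..m} \<Longrightarrow> infdist y (c ` {0..l} \<union> e ` {0..m}) < \<delta> \<Longrightarrow> dist (r y) x \<le> C * dist y x"
proof -
  define g where "g t = (if t \<le> l then c t else e (t - l))" for t
  define M' where "M' = M * (1 + 1 / \<eta>) + 1 / \<eta>"
  define T where "T = l + m"
  have T: "0 < T" using l m by (simp add: T_def)
  have i: "0 < 1 / \<eta>" using \<eta> by simp
  have "M * 1 \<le> M * (1 + 1 / \<eta>)" using M i by (intro mult_left_mono) auto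
  then have M': "M \<le> M'" "1 \<le> M'" using M i unfolding M'_def by linarith+
  have gc: "g s = c s" if "s \<le> l" for s using that by (simp add: g_def)
  have ge: "g s = e (s - l)" if "l \<le> s" for s using that join by (cases "s = l") (auto simp: g_def)
  have geo: "dist (e s) (e t) = \<bar>s - t\<bar>" if "s \<in> {0..m}" "t \<in> {0..m}" for s t using e that unfolding geodesic_arc_def by blast
  have lip: "dist (g s) (g u) \<le> M' * (u - s)" if su: "0 \<le> s" "s \<le> u" "u \<le> T" for s u
  proof -
    consider "u \<le> l" | "l \<le> s" | "s < l" "l < u" by linarith
    then show ?thesis
    proof cases
      case 1
      have "M * (u - s) \<le> M' * (u - s)" using M' su by (auto intro: mult_right_mono)
      then show ?thesis using bilipD(2)[OF c, of s u] gc 1 su by auto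
    next
      case 2
      then have "dist (g s) (g u) = u - s" using geo[of "s - l" "u - l"] su ge by (auto simp: T_def)
      then show ?thesis using M' su by (auto simp: mult_le_cancel_right1)
    next
      case 3
      have "dist (c s) (c l) \<le> M * (l - s)" using bilipD(2)[OF c, of s l] 3 su l by auto
      moreover have "dist (e 0) (e (u - l)) = u - l" using geo[of 0 "u - l"] 3 su m by (auto simp: T_def)
      ultimately have "dist (g s) (g u) \<le> M * (l - s) + (u - l)"
        using gc[of s] ge[of u] 3 join dist_triangle[of "c s" "e (u - l)" "c l"] by simp
      also have "\<dots> \<le> M' * (l - s) + M' * (u - l)" using M' 3 by (intro add_mono mult_right_mono) (auto simp: mult_le_cancel_right1)
      finally show ?thesis by (simp add: algebra_simps)
    qed
  qed
  have g0T: "g 0 = g T" using gc[of 0] ge[of T] join l m by (simp add: T_def)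
  have hi': "dist (g s) (g u) \<le> M' * loop_dist T s u" if su: "0 \<le> s" "s \<le> u" "u \<le> T" for s u
  proof -
    have "dist (g s) (g u) \<le> dist (g 0) (g s) + dist (g u) (g T)" using g0T dist_triangle3[of "g s" "g u" "g 0"] by (simp add: dist_commute)
    also have "\<dots> \<le> M' * (s - 0) + M' * (T - u)" using su by (intro add_mono lip) auto
    finally have "dist (g s) (g u) \<le> M' * (T - (u - s))" by (simp add: algebra_simps)
    then show ?thesis using lip[OF su] su by (auto simp: loop_dist_def min_def)
  qed
  have lo': "loop_dist T s u \<le> M' * dist (g s) (g u)" if su: "0 \<le> s" "s \<le> u" "u \<le> T" for s u
  proof -
    consider "u \<le> l" | "l \<le> s" | "s < l" "l < u" by linarith
    then show ?thesis
    proof cases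
      case 1
      have "M * dist (c s) (c u) \<le> M' * dist (c s) (c u)" using M' by (auto intro: mult_right_mono)
      moreover have "loop_dist T s u \<le> u - s" using su by (simp add: loop_dist_def)
      ultimately show ?thesis using bilipD(1)[OF c, of s u] gc 1 su by auto
    next
      case 2
      then have "dist (g s) (g u) = u - s" using geo[of "s - l" "u - l"] su ge by (auto simp: T_def)
      moreover have "loop_dist T s u \<le> u - s" using su by (simp add: loop_dist_def)
      moreover have "1 * (u - s) \<le> M' * (u - s)" using M' su by (intro mult_right_mono) auto
      ultimately show ?thesis by simp
    next
      case 3
      define t where "t = u - l"
      have t: "t \<in> {0..m}" "u = l + t" using 3 su by (auto simp: t_def T_def)
      define d where "d = dist (g s) (g u)"
      have d: "d = dist (c s) (e t)" using gc[of s] ge[of u] 3 t by (simp add: d_def)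
      have sl: "s \<in> {0..l}" "l \<in> {0..l}" "0 \<in> {0..l}" using 3 su l by auto
      have e0: "dist (e 0) (e t) = t" "dist (e t) (e m) = m - t" using geo[of 0 t] geo[of t m] t m by auto
      show ?thesis
      proof (cases "t \<le> m - t")
        case True
        have td: "t \<le> d / \<eta>" using far[OF sl(1) t(1)] True \<eta> by (simp add: d field_simps dist_commute)
        have "dist (c s) (c l) \<le> d + t" using dist_triangle2[of "c s" "c l" "e t"] d e0 join by simp
        then have "dist (c s) (c l) \<le> d * (1 + 1 / \<eta>)" using td by (simp add: algebra_simps)
        then have "M * dist (c s) (c l) \<le> M * (d * (1 + 1 / \<eta>))" using M by (intro mult_left_mono) auto
        then have "l - s \<le> M * (d * (1 + 1 / \<eta>))" using bilipD(1)[OF c sl(1,2)] 3 by simp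
        then have "u - s \<le> M' * d" using td t 3 by (simp add: M'_def algebra_simps)
        moreover have "loop_dist T s u \<le> u - s" using su by (simp add: loop_dist_def)
        ultimately show ?thesis by (simp add: d_def)
      next
        case False
        have td: "m - t \<le> d / \<eta>" using far[OF sl(1) t(1)] False \<eta> by (simp add: d field_simps dist_commute)
        have "dist (c s) (c 0) \<le> d + (m - t)" using dist_triangle[of "c s" "c 0" "e t"] d e0 join by simp
        then have "dist (c s) (c 0) \<le> d * (1 + 1 / \<eta>)" using td by (simp add: algebra_simps)
        then have "M * dist (c s) (c 0) \<le> M * (d * (1 + 1 / \<eta>))" using M by (intro mult_left_mono) auto
        then have "s \<le> M * (d * (1 + 1 / \<eta>))" using bilipD(1)[OF c sl(1,3)] su by simp
        then have "s + (m - t) \<le> M' * d" using td by (simp add: M'_def algebra_simps)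
        moreover have "loop_dist T s u \<le> s + (m - t)" using su t by (simp add: loop_dist_def T_def)
        ultimately show ?thesis by (simp add: d_def)
      qed
    qed
  qed
  have sym: "loop_dist T s u = loop_dist T u s" for s u by (simp add: loop_dist_def abs_minus_commute)
  have img: "g ` {0..T} = c ` {0..l} \<union> e ` {0..m}"
  proof -
    have "{0..T} = {0..l} \<union> (+) l ` {0..m}" using l m by (auto simp: T_def)
    then have "g ` {0..T} = g ` {0..l} \<union> (\<lambda>t. g (l + t)) ` {0..m}" by (simp only: image_Un image_image)
    moreover have "g ` {0..l} = c ` {0..l}" using gc by (intro image_cong) auto
    moreover have "(\<lambda>t. g (l + t)) ` {0..m} = e ` {0..m}" using ge by (intro image_cong) auto
    ultimately show ?thesis by simp
  qed
  show thesis
  proof (rule loop_retract[of T M' g, unfolded img])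
    show "0 < T" "0 < M'" using T M' by auto
    fix s u assume "s \<in> {0..T}" "u \<in> {0..T}"
    then show "loop_dist T s u \<le> M' * dist (g s) (g u)" "dist (g s) (g u) \<le> M' * loop_dist T s u"
      using lo'[of s u] lo'[of u s] hi'[of s u] hi'[of u s] sym[of s u] by (cases "s \<le> u"; simp add: dist_commute)+
  qed (rule that)
qed

section \<open>Small biLipschitz circles\<close>

text \<open>The hull is open, because its complement is a component of a closed set; it is connected
  and has no holes, hence is simply connected, and by the Riemann mapping theorem it is
  contractible.\<close>

lemma fill_open:
  fixes B :: "complex set"
  assumes B: "open B" "connected B" "bounded B"
  shows "contractible (- outside B)" "B \<subseteq> - outside B"
proof -
  show sub: "B \<subseteq> - outside B" using outside_no_overlap[of B] by blast
  have co: "connected (outside B)" and un: "\<not> bounded (outside B)"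
    using connected_outside[OF B(3)] unbounded_outside[OF B(3)] by auto
  obtain b where b: "b \<in> outside B" using outside_bounded_nonempty[OF B(3)] by blast
  have bB: "b \<in> - B" using b sub by blast
  have eq: "outside B = connected_component_set (- B) b"
  proof
    show "outside B \<subseteq> connected_component_set (- B) b" using b co sub by (intro connected_component_maximal) auto
    then have "\<not> bounded (connected_component_set (- B) b)" using un bounded_subset by blast
    moreover have "connected_component_set (- B) b \<inter> B = {}" using connected_component_subset[of "- B" b] by blast
    ultimately show "connected_component_set (- B) b \<subseteq> outside B"
      by (intro outside_unbounded_connected connected_connected_component)
  qed
  have op: "open (- outside B)" unfolding eq using B(1) by (intro open_Compl closed_connected_component closed_Compl)
  have con: "connected (- outside B)"
    using bB unfolding eq by (intro component_complement_connected[OF B(2)]) (auto simp: components_def)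
  have "inside (- outside B) = {}"
  proof -
    have "outside B \<subseteq> outside (- outside B)" by (rule outside_unbounded_connected[OF co un]) blast
    then show ?thesis using inside_Int_outside[of "- outside B"] inside_no_overlap[of "- outside B"] by blast
  qed
  then have "simply_connected (- outside B)" using simply_connected_eq_empty_inside[OF op] con by blast
  then show "contractible (- outside B)" using contractible_eq_simply_connected_2d[OF op] by blast
qed

text \<open>In a pod with the maximal number of arms, the centre is never the nearest point to a point \<open>q\<close>
  outside: the geodesic from the centre to \<open>q\<close> would be a further arm.\<close>

definition pod :: "'a::metric_space \<Rightarrow> nat \<Rightarrow> real \<Rightarrow> (nat \<Rightarrow> real \<Rightarrow> 'a) \<Rightarrow> bool" where
  "pod v n l arm \<longleftrightarrow> (\<forall>i<n. geodesic_arc (arm i) l \<and> arm i 0 = v) \<and>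
     (\<forall>i<n. \<forall>j<n. i \<noteq> j \<longrightarrow> (\<forall>s\<in>{0..l}. \<forall>t\<in>{0..l}. s \<le> 2 * dist (arm i s) (arm j t) \<and> t \<le> 2 * dist (arm i s) (arm j t)))"

lemma geodesic_arc_subset: "geodesic_arc c d \<Longrightarrow> e \<le> d \<Longrightarrow> geodesic_arc c e"
  by (simp add: geodesic_arc_def)

lemma geodesic_arc_rev: "geodesic_arc c d \<Longrightarrow> e \<le> d \<Longrightarrow> geodesic_arc (\<lambda>t. c (e - t)) e"
  by (auto simp: geodesic_arc_def)

context hom_surface
begin

text \<open>The loop follows \<open>c0\<close>, then the two geodesics from its ends towards \<open>q\<close>, and crosses from one to
  the other along a geodesic. Minimizing a weighted length over the crossing points makes all corners
  transverse.\<close>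

lemma feet_loop:
  fixes c0 :: "real \<Rightarrow> 'a"
  assumes c0: "bilip M0 c0 {0..l0}" "1 \<le> M0" "0 < l0"
    and q: "dist q (c0 0) = D" "dist q (c0 l0) = D" "\<And>s. s \<in> {0..l0} \<Longrightarrow> D \<le> dist q (c0 s)" "0 < D"
  obtains c e :: "real \<Rightarrow> 'a" and M l m \<eta> where "bilip M c {0..l}" "1 \<le> M" "0 < l" "geodesic_arc e m" "0 < m"
    "e 0 = c l" "e m = c 0" "0 < \<eta>" "\<And>s t. s \<in> {0..l} \<Longrightarrow> t \<in> {0..m} \<Longrightarrow> \<eta> * min t (m - t) \<le> dist (e t) (c s)"
    "c ` {0..l} \<union> e ` {0..m} \<subseteq> c0 ` {0..l0} \<union> cball q (2 * D)"
proof -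
  define \<Delta> where "\<Delta> = dist (c0 0) (c0 l0)"
  have "l0 \<le> M0 * \<Delta>" using bilipD(1)[OF c0(1), of 0 l0] c0 by (simp add: \<Delta>_def)
  then have \<Delta>: "0 < \<Delta>" using c0(2,3) by (metis \<Delta>_def less_eq_real_def mult_zero_right not_le zero_le_dist)
  have \<Delta>D: "\<Delta> \<le> 2 * D" using dist_triangle3[of "c0 0" "c0 l0" q] q by (simp add: \<Delta>_def)
  obtain p where p: "geodesic_arc p D" "p 0 = c0 0" "p D = q" using geodesics[of "c0 0" q] q(1) by (metis dist_commute)
  obtain pp where pp: "geodesic_arc pp D" "pp 0 = c0 l0" "pp D = q" using geodesics[of "c0 l0" q] q(2) by (metis dist_commute)
  have pd: "dist (p s) (p t) = \<bar>s - t\<bar>" "dist (pp s) (pp t) = \<bar>s - t\<bar>" if "s \<in> {0..D}" "t \<in> {0..D}" for s t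
    using p pp that unfolding geodesic_arc_def by blast+
  have pf: "t \<le> dist (p t) (c0 s)" "t \<le> dist (pp t) (c0 s)" if "t \<in> {0..D}" "s \<in> {0..l0}" for s t
    using pd[OF that(1), of D] p(3) pp(3) q(3)[OF that(2)] dist_triangle[of q "c0 s" "p t"] dist_triangle[of q "c0 s" "pp t"] that(1)
    by (auto simp: dist_commute)
  \<comment> \<open>Crossing costs \<open>lm\<close> per unit of length, walking along the two
    geodesics costs 1. Comparison with walking all the way to \<open>q\<close>, at cost
    \<open>2 * D\<close>, makes the crossing at most \<open>\<Delta> / 6\<close> long, so it takes
    place well away from the feet.\<close>
  define lm where "lm = 12 * D / \<Delta> + 2"
  have lam: "2 \<le> lm" "12 * D \<le> lm * \<Delta>" using \<Delta> q(4) by (auto simp: lm_def field_simps)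
  define F where "F = (\<lambda>z. lm * dist (p (fst z)) (pp (snd z)) + fst z + snd z)"
  have "continuous_on {0..D} p" "continuous_on {0..D} pp" using geodesic_arc_bilip[of _ D 1] bilip_cont p(1) pp(1) by blast+
  then have "continuous_on ({0..D} \<times> {0..D}) (\<lambda>z. p (fst z))" "continuous_on ({0..D} \<times> {0..D}) (\<lambda>z. pp (snd z))"
    by (auto intro!: continuous_on_compose2[of "{0..D}"] continuous_intros)
  then have cF: "continuous_on ({0..D} \<times> {0..D}) F" unfolding F_def by (intro continuous_intros)
  have "compact ({0..D} \<times> {0..D})" by (intro compact_Times compact_Icc)
  moreover have "{0..D} \<times> {0..D} \<noteq> {}" using q(4) by simp
  ultimately have "\<exists>z\<in>{0..D} \<times> {0..D}. \<forall>w\<in>{0..D} \<times> {0..D}. F z \<le> F w" using cF by (rule continuous_attains_inf)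
  then obtain z where z: "z \<in> {0..D} \<times> {0..D}" "\<And>w. w \<in> {0..D} \<times> {0..D} \<Longrightarrow> F z \<le> F w" by blast
  define \<alpha> \<beta> where "\<alpha> = fst z" and "\<beta> = snd z"
  have ab: "\<alpha> \<in> {0..D}" "\<beta> \<in> {0..D}" using z(1) by (auto simp: \<alpha>_def \<beta>_def)
  have mn: "lm * dist (p \<alpha>) (pp \<beta>) + \<alpha> + \<beta> \<le> lm * dist (p s) (pp t) + s + t" if "s \<in> {0..D}" "t \<in> {0..D}" for s t
    using z(2)[of "(s, t)"] that by (simp add: F_def \<alpha>_def \<beta>_def)
  define m where "m = dist (p \<alpha>) (pp \<beta>)"
  have m0: "0 \<le> m" by (simp add: m_def)
  have "lm * m + \<alpha> + \<beta> \<le> 2 * D" using mn[of D D] q(4) p(3) pp(3) by (simp add: m_def)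
  moreover have "0 \<le> \<alpha>" "0 \<le> \<beta>" using ab by auto
  ultimately have "6 * (lm * m) \<le> lm * \<Delta>" using lam(2) by linarith
  then have "lm * (6 * m) \<le> lm * \<Delta>" by (simp only: mult.left_commute)
  then have m6: "6 * m \<le> \<Delta>" using lam(1) by (subst (asm) mult_le_cancel_left_pos) auto
  have "\<Delta> \<le> \<alpha> + m + \<beta>"
    using dist_triangle[of "c0 0" "c0 l0" "p \<alpha>"] dist_triangle[of "p \<alpha>" "c0 l0" "pp \<beta>"] pd(1)[of 0 \<alpha>] pd(2)[of \<beta> 0] p(2) pp(2) ab q(4)
    by (simp add: \<Delta>_def m_def)
  moreover have "\<alpha> \<le> m + \<beta>" "\<beta> \<le> m + \<alpha>"
  proof -
    have "\<alpha> \<le> dist (p \<alpha>) (c0 l0)" "\<beta> \<le> dist (pp \<beta>) (c0 0)" using pf ab c0 by auto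
    then show "\<alpha> \<le> m + \<beta>" "\<beta> \<le> m + \<alpha>"
      using dist_triangle[of "p \<alpha>" "c0 l0" "pp \<beta>"] dist_triangle[of "pp \<beta>" "c0 0" "p \<alpha>"] pd(1)[of 0 \<alpha>] pd(2)[of \<beta> 0] p(2) pp(2) ab q(4)
      by (auto simp: m_def dist_commute)
  qed
  \<comment> \<open>Both crossing points are at least \<open>2 * m\<close> beyond the feet; hence
    the crossing keeps clear of \<open>c0\<close>.\<close>
  ultimately have abm: "2 * m \<le> \<alpha>" "2 * m \<le> \<beta>" "0 < \<alpha>" "0 < \<beta>" using m6 \<Delta> by auto
  obtain \<kappa> where k: "geodesic_arc \<kappa> m" "\<kappa> 0 = pp \<beta>" "\<kappa> m = p \<alpha>" using geodesics[of "pp \<beta>" "p \<alpha>"] by (metis m_def dist_commute)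
  have kd: "dist (\<kappa> s) (\<kappa> t) = \<bar>s - t\<bar>" if "s \<in> {0..m}" "t \<in> {0..m}" for s t
    using k that unfolding geodesic_arc_def by blast
  have ke: "dist (pp \<beta>) (\<kappa> t) = t" "dist (\<kappa> t) (p \<alpha>) = m - t" if "t \<in> {0..m}" for t
    using kd[of 0 t] kd[of t m] that k by auto
  \<comment> \<open>Transversality at the corners is read off from minimality: moving one crossing
    point towards its foot saves walking, so it cannot shorten the crossing; and points of the two
    geodesics short of the crossing are at least \<open>(\<alpha> - a) / lm\<close> apart.\<close>
  have X1: "t \<le> dist (\<kappa> t) (pp b)" if t: "t \<in> {0..m}" and b: "b \<in> {0..\<beta>}" for t b
  proof -
    have "lm * m \<le> lm * dist (p \<alpha>) (pp b)" using mn[of \<alpha> b] ab b by (simp add: m_def)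
    then have "m \<le> dist (p \<alpha>) (pp b)" using lam by simp
    then show ?thesis using dist_triangle[of "p \<alpha>" "pp b" "\<kappa> t"] ke[OF t] by (simp add: dist_commute)
  qed
  have X2: "t \<le> dist (\<kappa> t) (c0 s)" if t: "t \<in> {0..m}" and s: "s \<in> {0..l0}" for t s
    using pf(2)[OF ab(2) s] dist_triangle[of "pp \<beta>" "c0 s" "\<kappa> t"] ke(1)[OF t] abm t by simp
  have Y2: "(\<alpha> - a) / lm \<le> dist (p a) (pp b)" if a: "a \<in> {0..\<alpha>}" and b: "b \<in> {0..\<beta>}" for a b
  proof -
    have "\<alpha> - a \<le> lm * dist (p a) (pp b)"

    proof -
      have "0 \<le> lm * m" using lam m0 by simp
      moreover have "a \<in> {0..D}" "b \<in> {0..D}" "b \<le> \<beta>" using a b ab by auto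
      ultimately show ?thesis using mn[of a b] unfolding m_def[symmetric] by linarith
    qed
    then show ?thesis using lam by (simp add: field_simps)
  qed
  have Y3: "(\<alpha> - a) / 2 \<le> dist (p a) (\<kappa> u)" if u: "u \<in> {0..m}" and a: "a \<in> {0..\<alpha>}" for u a
  proof -
    have "lm * m \<le> lm * dist (p a) (pp \<beta>)" using mn[of a \<beta>] ab a by (simp add: m_def)
    then have "m \<le> dist (p a) (pp \<beta>)" using lam by simp
    then have "m - u \<le> dist (p a) (\<kappa> u)" using dist_triangle[of "p a" "pp \<beta>" "\<kappa> u"] ke(1)[OF u] by (simp add: dist_commute)
    moreover have "dist (p a) (p \<alpha>) = \<alpha> - a" using pd(1)[of a \<alpha>] a ab by auto
    ultimately show ?thesis using dist_triangle[of "p a" "p \<alpha>" "\<kappa> u"] ke(2)[OF u] by simp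
  qed
  define c1 where "c1 t = (if t \<le> l0 then c0 t else pp (t - l0))" for t
  define M1 where "M1 = M0 * (1 + 1 / 1) + 1 / 1"
  have pp\<beta>: "geodesic_arc pp \<beta>" by (rule geodesic_arc_subset[OF pp(1)]) (use ab in auto)
  have c1: "bilip M1 c1 {0..l0 + \<beta>}" unfolding c1_def M1_def
  proof (rule bilip_append[OF c0(1,2) less_imp_le[OF c0(3)] pp\<beta> less_imp_le[OF abm(4)] pp(2)])
    fix s t assume "s \<in> {0..l0}" "t \<in> {0..\<beta>}"
    then show "1 * t \<le> dist (pp t) (c0 s)" using pf(2)[of t s] ab by auto
  qed simp
  have c1i: "(\<exists>s'\<in>{0..l0}. c1 s = c0 s') \<or> (\<exists>b\<in>{0..\<beta>}. c1 s = pp b)" if s: "s \<in> {0..l0 + \<beta>}" for s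
  proof (cases "s \<le> l0")
    case True
    then show ?thesis using s by (intro disjI1 bexI[of _ s]) (auto simp: c1_def)
  next
    case False
    then show ?thesis using s by (intro disjI2 bexI[of _ "s - l0"]) (auto simp: c1_def)
  qed
  \<comment> \<open>\<open>m\<close> may be 0, when the two geodesics meet; the crossing then
    degenerates to a point and the estimates remain valid.\<close>
  define l where "l = l0 + \<beta> + m"
  define c where "c t = (if t \<le> l0 + \<beta> then c1 t else \<kappa> (t - (l0 + \<beta>)))" for t
  define M where "M = M1 * (1 + 1 / 1) + 1 / 1"
  have M1: "1 \<le> M1" "1 \<le> M" using c0(2) by (auto simp: M1_def M_def)
  have c1e: "\<kappa> 0 = c1 (l0 + \<beta>)" using k(2) abm by (simp add: c1_def)
  have c: "bilip M c {0..l}" unfolding c_def M_def l_def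
  proof (rule bilip_append[OF c1 M1(1) _ k(1) m0 c1e])
    show "0 \<le> l0 + \<beta>" using c0 abm by simp
    fix s t assume s: "s \<in> {0..l0 + \<beta>}" and t: "t \<in> {0..m}"
    show "1 * t \<le> dist (\<kappa> t) (c1 s)" using c1i[OF s] X1[OF t] X2[OF t] by auto
  qed simp
  have ci: "(\<exists>s'\<in>{0..l0}. c s = c0 s') \<or> (\<exists>b\<in>{0..\<beta>}. c s = pp b) \<or> (\<exists>u\<in>{0..m}. c s = \<kappa> u)" if s: "s \<in> {0..l}" for s
  proof (cases "s \<le> l0 + \<beta>")
    case True
    then show ?thesis using s c1i[of s] by (auto simp: c_def)
  next
    case False
    then show ?thesis using s by (intro disjI2 bexI[of _ "s - (l0 + \<beta>)"]) (auto simp: c_def l_def)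
  qed
  define e where "e t = p (\<alpha> - t)" for t
  have e: "geodesic_arc e \<alpha>" unfolding e_def by (rule geodesic_arc_rev[OF p(1)]) (use ab in auto)
  show thesis
  proof (rule that[of M c l e \<alpha> "1 / lm"])
    show "bilip M c {0..l}" "1 \<le> M" "geodesic_arc e \<alpha>" "0 < \<alpha>" by fact+
    show "0 < l" using c0 abm m0 by (simp add: l_def)
    show "e 0 = c l"
    proof (cases "m = 0")
      case True
      then show ?thesis using c1e k by (simp add: c_def e_def l_def)
    next
      case False
      then show ?thesis using m0 k by (simp add: c_def e_def l_def)
    qed
    show "e \<alpha> = c 0" using p c0 abm by (simp add: e_def c_def c1_def)
    show "0 < 1 / lm" using lam by simp
    show "1 / lm * min t (\<alpha> - t) \<le> dist (e t) (c s)" if s: "s \<in> {0..l}" and t: "t \<in> {0..\<alpha>}" for s t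
    proof -
      define a where "a = \<alpha> - t"
      have a: "a \<in> {0..\<alpha>}" "a \<in> {0..D}" "e t = p a" "t = \<alpha> - a" using t ab by (auto simp: a_def e_def)
      have mm: "min t (\<alpha> - t) / lm \<le> (\<alpha> - a) / lm" using lam a by (intro divide_right_mono) auto
      have "min t (\<alpha> - t) / lm \<le> min t (\<alpha> - t) / 2" using lam t by (intro divide_left_mono) auto
      moreover have "min t (\<alpha> - t) / 2 \<le> (\<alpha> - a) / 2" "min t (\<alpha> - t) / 2 \<le> a" using a t by auto
      ultimately have "min t (\<alpha> - t) / lm \<le> (\<alpha> - a) / 2" "min t (\<alpha> - t) / lm \<le> a" by linarith+
      then have "min t (\<alpha> - t) / lm \<le> dist (p a) (c s)"

      proof -
        consider s' where "s' \<in> {0..l0}" "c s = c0 s'" | b where "b \<in> {0..\<beta>}" "c s = pp b" | u where "u \<in> {0..m}" "c s = \<kappa> u"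
          using ci[OF s] by blast
        then show ?thesis
        proof cases
          case 1
          then show ?thesis using pf(1)[OF a(2) 1(1)] \<open>min t (\<alpha> - t) / lm \<le> a\<close> by simp
        next
          case 2
          then show ?thesis using Y2[OF a(1) 2(1)] mm by simp
        next
          case 3
          then show ?thesis using Y3[OF 3(1) a(1)] \<open>min t (\<alpha> - t) / lm \<le> (\<alpha> - a) / 2\<close> unfolding 3(2) by linarith
        qed
      qed
      then show ?thesis using a(3) by simp
    qed
    have pq: "dist q (p s) \<le> 2 * D" "dist q (pp s) \<le> 2 * D" if "s \<in> {0..D}" for s
      using pd[OF that, of D] that p(3) pp(3) by (auto simp: dist_commute)
    have kq: "dist q (\<kappa> u) \<le> 2 * D" if "u \<in> {0..m}" for u
    proof -
      have "dist q (pp \<beta>) \<le> D" using pd(2)[of D \<beta>] ab q(4) pp(3) by simp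
      then show ?thesis using dist_triangle[of q "\<kappa> u" "pp \<beta>"] ke(1)[OF that] that m6 \<Delta>D q(4) by simp
    qed
    show "c ` {0..l} \<union> e ` {0..\<alpha>} \<subseteq> c0 ` {0..l0} \<union> cball q (2 * D)"
    proof (rule Un_least)
      show "c ` {0..l} \<subseteq> c0 ` {0..l0} \<union> cball q (2 * D)"
      proof
        fix x assume "x \<in> c ` {0..l}"
        then obtain s where s: "s \<in> {0..l}" "x = c s" by blast
        consider s' where "s' \<in> {0..l0}" "c s = c0 s'" | b where "b \<in> {0..\<beta>}" "c s = pp b" | u where "u \<in> {0..m}" "c s = \<kappa> u"
          using ci[OF s(1)] by blast
        then show "x \<in> c0 ` {0..l0} \<union> cball q (2 * D)"
        proof cases
          case 1
          then show ?thesis using s by blast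
        next
          case 2
          then have "b \<in> {0..D}" using ab by auto
          from pq(2)[OF this] show ?thesis using s 2 by simp
        next
          case 3
          then show ?thesis using s kq[OF 3(1)] by simp
        qed
      qed
      show "e ` {0..\<alpha>} \<subseteq> c0 ` {0..l0} \<union> cball q (2 * D)"
      proof
        fix x assume "x \<in> e ` {0..\<alpha>}"
        then obtain t where "t \<in> {0..\<alpha>}" "x = e t" by blast
        then have t: "\<alpha> - t \<in> {0..D}" "x = p (\<alpha> - t)" using ab by (auto simp: e_def)
        from pq(1)[OF this(1)] show "x \<in> c0 ` {0..l0} \<union> cball q (2 * D)" using t(2) by simp
      qed
    qed
  qed
qed


section \<open>Maximal pods and loops of arbitrarily small size\<close>

text \<open>The tips of the arms are \<open>l / 2\<close> apart in a ball of radius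
  \<open>2 * l\<close>; here the packing bound enters the construction of circles.\<close>

lemma pod_bound:
  obtains N where "\<And>v n l arm. dist x0 v < r1 / 16 \<Longrightarrow> 0 < l \<Longrightarrow> l \<le> r1 / 16 \<Longrightarrow> pod v n l arm \<Longrightarrow> n \<le> N"
proof -
  obtain N :: nat where N: "\<forall>x R F. x \<in> ball x0 (r1 / 4) \<longrightarrow> 0 < R \<longrightarrow> F \<subseteq> ball x0 (r1 / 4) \<inter> ball x (4 * R) \<longrightarrow> separated R F \<longrightarrow> finite F \<and> card F \<le> N"
    using packing_boundedD[OF packing_bounded_ball, of 4] by auto
  show thesis
  proof (rule that)
    fix v n l arm assume v: "dist x0 v < r1 / 16" and l: "0 < l" "l \<le> r1 / 16" and p: "pod v n l arm"
    have g: "dist (arm i 0) (arm i l) = l" "arm i 0 = v" if "i < n" for i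
      using p that l unfolding pod_def geodesic_arc_def by auto
    have s: "l \<le> 2 * dist (arm i l) (arm j l)" if "i < n" "j < n" "i \<noteq> j" for i j
      using p that l unfolding pod_def by auto
    define F where "F = (\<lambda>i. arm i l) ` {..<n}"
    have "inj_on (\<lambda>i. arm i l) {..<n}"
    proof (rule inj_onI, rule ccontr)
      fix i j assume "i \<in> {..<n}" "j \<in> {..<n}" "arm i l = arm j l" "i \<noteq> j"
      then show False using s[of i j] l by simp
    qed
    then have "card F = n" by (simp add: F_def card_image)
    moreover have "separated (l / 2) F"
      unfolding separated_def F_def
    proof (intro ballI impI)
      fix a b assume "a \<in> (\<lambda>i. arm i l) ` {..<n}" "b \<in> (\<lambda>i. arm i l) ` {..<n}" "a \<noteq> b"
      then obtain i j where "i < n" "j < n" "i \<noteq> j" "a = arm i l" "b = arm j l" by auto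
      then show "l / 2 \<le> dist a b" using s[of i j] by simp
    qed
    moreover have "F \<subseteq> ball x0 (r1 / 4) \<inter> ball v (4 * (l / 2))"
    proof
      fix a assume "a \<in> F"
      then obtain i where "i < n" "a = arm i l" by (auto simp: F_def)
      then have "dist v a = l" using g[of i] by simp
      then show "a \<in> ball x0 (r1 / 4) \<inter> ball v (4 * (l / 2))" using v l r1 dist_triangle[of x0 a v] by simp
    qed
    ultimately show "n \<le> N" using N[rule_format, of v "l / 2" F] v l r1 by simp
  qed
qed

text \<open>A point \<open>q\<close> equidistant from one arm and from the union of the others has
  nearest points on two different arms. Maximality keeps these feet away from \<open>v\<close>, so
  the path from one foot through \<open>v\<close> to the other is a biLipschitz arc of positive
  length, and \<open>feet_loop\<close> closes it.\<close>

lemma small_loop: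
  fixes \<gamma> :: "real \<Rightarrow> 'a"
  assumes \<gamma>: "geodesic_arc \<gamma> d" "0 < d" "v = \<gamma> (d / 2)" and v: "dist x0 v < r1 / 16" and \<zeta>: "0 < \<zeta>"
  obtains c e :: "real \<Rightarrow> 'a" and M l m \<eta> where "bilip M c {0..l}" "1 \<le> M" "0 < l" "geodesic_arc e m" "0 < m"
    "e 0 = c l" "e m = c 0" "0 < \<eta>" "\<And>s t. s \<in> {0..l} \<Longrightarrow> t \<in> {0..m} \<Longrightarrow> \<eta> * min t (m - t) \<le> dist (e t) (c s)"
    "c ` {0..l} \<union> e ` {0..m} \<subseteq> ball v \<zeta>"
proof -
  obtain N where N: "\<And>n l arm. 0 < l \<Longrightarrow> l \<le> r1 / 16 \<Longrightarrow> pod v n l arm \<Longrightarrow> n \<le> N"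
    using pod_bound v by metis
  define l0 where "l0 = min (r1 / 16) (min (d / 2) (\<zeta> / 4))"
  have l0: "0 < l0" "l0 \<le> r1 / 16" "l0 \<le> d / 2" "l0 \<le> \<zeta> / 4" using r1 \<gamma> \<zeta> by (auto simp: l0_def)
  \<comment> \<open>The length of the arms is left free below \<open>l0\<close>, since a further arm
    is found only with a smaller length; the maximum is over the number of arms alone.\<close>
  define Q where "Q n \<longleftrightarrow> (\<exists>l arm. 0 < l \<and> l \<le> l0 \<and> pod v n l arm)" for n
  have QN: "n \<le> N" if "Q n" for n using that N l0 unfolding Q_def by (metis order_trans)
  have Q2: "Q 2"
  proof -
    define arm where "arm i t = (if i = 0 then \<gamma> (d / 2 - t) else \<gamma> (d / 2 + t))" for i :: nat and t
    have gd: "dist (\<gamma> s) (\<gamma> t) = \<bar>s - t\<bar>" if "s \<in> {0..d}" "t \<in> {0..d}" for s t using \<gamma> that unfolding geodesic_arc_def by blast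
    have "pod v 2 l0 arm" unfolding pod_def
    proof (intro conjI allI impI ballI)
      fix i :: nat
      show "geodesic_arc (arm i) l0" unfolding geodesic_arc_def arm_def using l0 by (auto simp: gd)
      show "arm i 0 = v" by (simp add: arm_def \<gamma>)
    next
      fix i j :: nat and s t assume ij: "i < 2" "j < 2" "i \<noteq> j" and st: "s \<in> {0..l0}" "t \<in> {0..l0}"
      then have "dist (arm i s) (arm j t) = s + t" using l0 by (auto simp: arm_def gd)
      then show "s \<le> 2 * dist (arm i s) (arm j t)" "t \<le> 2 * dist (arm i s) (arm j t)" using st by auto
    qed
    then show ?thesis using l0 unfolding Q_def by blast
  qed
  have "\<exists>n\<ge>2. Q n \<and> \<not> Q (Suc n)"
  proof (rule ccontr)
    assume no: "\<not> ?thesis"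
    have "Q (2 + k)" for k
    proof (induction k)
      case 0
      then show ?case using Q2 by simp
    next
      case (Suc k)
      then show ?case using no by (metis add_Suc_right le_add1)
    qed
    then show False using QN[of "2 + N"] by simp
  qed
  then obtain n where n: "2 \<le> n" "Q n" "\<not> Q (Suc n)" by blast
  then obtain l arm where l: "0 < l" "l \<le> l0" and p: "pod v n l arm" unfolding Q_def by blast
  have g: "geodesic_arc (arm i) l" "arm i 0 = v" if "i < n" for i using p that unfolding pod_def by auto
  have gd: "dist (arm i s) (arm i t) = \<bar>s - t\<bar>" if "i < n" "s \<in> {0..l}" "t \<in> {0..l}" for i s t
    using g(1)[OF that(1)] that(2,3) unfolding geodesic_arc_def by blast
  have gv: "dist v (arm i t) = t" if "i < n" "t \<in> {0..l}" for i t
    using gd[OF that(1) _ that(2), of 0] g(2)[OF that(1)] that l by auto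
  have sp: "s \<le> 2 * dist (arm i s) (arm j t)" "t \<le> 2 * dist (arm i s) (arm j t)"
    if "i < n" "j < n" "i \<noteq> j" "s \<in> {0..l}" "t \<in> {0..l}" for i j s t
    using p that unfolding pod_def by blast+
  have vW: "v \<in> W" using small_cball(3)[of v 0] v r1 by auto
  have "isCont k (h v)" using cont_k[of UNIV] by (simp add: continuous_on_eq_continuous_at)
  then obtain \<eta> where \<eta>: "0 < \<eta>" "\<And>z. dist z (h v) < \<eta> \<Longrightarrow> dist (k z) v < l"
    using l(1) vW unfolding continuous_at_eps_delta by (auto simp: dist_commute)
  \<comment> \<open>A punctured disc is connected, unlike a punctured interval; by the intermediate
    value theorem on \<open>P\<close> the equidistant point \<open>q\<close> can be found different
    from \<open>v\<close>.\<close>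
  define P where "P = k ` (ball (h v) \<eta> - {h v})"
  have Pl: "dist v q < l" "q \<noteq> v" if qP: "q \<in> P" for q
  proof -
    obtain z where z: "z \<in> ball (h v) \<eta>" "z \<noteq> h v" "q = k z" using qP unfolding P_def by blast
    show "dist v q < l" using \<eta>(2)[of z] z by (simp add: dist_commute)
    show "q \<noteq> v"
    proof
      assume "q = v"
      then have "h (k z) = h v" using z by simp
      then show False using z(2) by simp
    qed
  qed
  have Pc: "connected P" unfolding P_def
  proof (intro connected_continuous_image cont_k connected_punctured_convex convex_ball)
    have "aff_dim (ball (h v) \<eta>) = 2" using aff_dim_open[OF open_ball, of "h v" \<eta>] \<eta>(1) by simp
    then show "aff_dim (ball (h v) \<eta>) \<noteq> 1" by simp
  qed
  have "open (k ` ball (h v) \<eta>)" by (rule open_k) simp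
  moreover have "v \<in> k ` ball (h v) \<eta>" using \<eta>(1) vW by (intro image_eqI[of _ _ "h v"]) auto
  ultimately obtain \<epsilon>' where e': "0 < \<epsilon>'" "ball v \<epsilon>' \<subseteq> k ` ball (h v) \<eta>" by (metis openE)
  define t0 where "t0 = min (\<epsilon>' / 2) l"
  have t0: "0 < t0" "t0 < \<epsilon>'" "t0 \<in> {0..l}" using e' l by (auto simp: t0_def)
  have armP: "arm i t0 \<in> P" if "i < n" for i
  proof -
    have d: "dist v (arm i t0) = t0" by (rule gv[OF that t0(3)])
    then have "arm i t0 \<in> k ` ball (h v) \<eta>" using e'(2) t0 by auto
    then obtain z where "z \<in> ball (h v) \<eta>" "arm i t0 = k z" by blast
    moreover have "z \<noteq> h v" using d t0 vW calculation by auto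
    ultimately show ?thesis unfolding P_def by blast
  qed
  define Ar where "Ar i = arm i ` {0..l}" for i
  define B where "B = (\<Union>i\<in>{1..<n}. Ar i)"
  have Ac: "compact (Ar i)" "Ar i \<noteq> {}" if "i < n" for i
    unfolding Ar_def using bilip_cont[OF geodesic_arc_bilip[OF g(1)[OF that] order_refl]] l
    by (auto intro: compact_continuous_image)
  have Bc: "compact B" "B \<noteq> {}" unfolding B_def using Ac n(1) by (auto intro!: compact_UN)
  have n01: "0 < n" "1 < n" using n(1) by auto
  define \<phi> where "\<phi> q = infdist q (Ar 0) - infdist q B" for q
  have "connected (\<phi> ` P)" unfolding \<phi>_def by (intro connected_continuous_image Pc continuous_intros)
  moreover have "\<phi> (arm 0 t0) \<le> 0"
  proof -
    have "arm 0 t0 \<in> Ar 0" using t0 by (auto simp: Ar_def)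
    then show ?thesis by (simp add: \<phi>_def infdist_nonneg)
  qed
  moreover have "0 \<le> \<phi> (arm 1 t0)"
  proof -
    have "arm 1 t0 \<in> Ar 1" using t0 by (auto simp: Ar_def)
    then have "arm 1 t0 \<in> B" unfolding B_def using n01 by (intro UN_I[of 1]) auto
    then show ?thesis by (simp add: \<phi>_def infdist_nonneg)
  qed
  ultimately have "0 \<in> \<phi> ` P" using connectedD_interval[of "\<phi> ` P"] armP n01 by blast
  then obtain q where q: "q \<in> P" "infdist q (Ar 0) = infdist q B" by (auto simp: \<phi>_def)
  define D where "D = infdist q B"
  have Dle: "D \<le> dist q (arm i t)" if "i < n" "t \<in> {0..l}" for i t
  proof (cases "i = 0")
    case True
    have "arm i t \<in> Ar 0" using True that by (auto simp: Ar_def)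
    from infdist_le[OF this, of q] show ?thesis using q by (simp add: D_def)
  next
    case False
    have "arm i t \<in> Ar i" using that by (auto simp: Ar_def)
    then have "arm i t \<in> B" unfolding B_def using False that(1) by (intro UN_I[of i]) auto
    from infdist_le[OF this, of q] show ?thesis by (simp add: D_def)
  qed
  obtain a where "a \<in> Ar 0" "dist q a = infdist q (Ar 0)" using infdist_compact_attains[OF Ac(1,2)[OF n01(1)]] by blast
  then obtain s where s: "s \<in> {0..l}" "dist q (arm 0 s) = D" using q by (auto simp: Ar_def D_def)
  obtain b where "b \<in> B" "dist q b = infdist q B" using infdist_compact_attains[OF Bc] by blast
  then obtain j t where j: "j < n" "j \<noteq> 0" "t \<in> {0..l}" "dist q (arm j t) = D" by (auto simp: Ar_def B_def D_def)
  have Dv: "D < dist q v"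
  proof (rule ccontr)
    assume "\<not> ?thesis"
    moreover have "D \<le> dist q v" using Dle[OF n01(1), of 0] g(2)[OF n01(1)] l by simp
    ultimately have D: "D = dist q v" by simp
    then have D0: "0 < D" "D < l" using Pl[OF q(1)] by (auto simp: dist_commute)
    obtain e where e: "geodesic_arc e D" "e 0 = v" "e D = q" using geodesics[of v q] D by (metis dist_commute)
    define arm' where "arm' i = (if i < n then arm i else e)" for i
    \<comment> \<open>Every point of an arm is at distance at least \<open>D\<close> from
      \<open>q\<close>, hence at least \<open>u\<close> from \<open>e u\<close>, which is
      \<open>D - u\<close> away from \<open>q\<close>. So \<open>e\<close> would qualify as a
      further arm.\<close>
    have ee: "u \<le> 2 * dist (e u) (arm i w)" "w \<le> 2 * dist (e u) (arm i w)" if iu: "i < n" "u \<in> {0..D}" "w \<in> {0..D}" for i u w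
    proof -
      have wl: "w \<in> {0..l}" using iu D0 by auto
      have "dist (e u) (e D) = D - u" "dist (e 0) (e u) = u" using e(1) iu D0 unfolding geodesic_arc_def by auto
      then have "u \<le> dist (e u) (arm i w)" "w \<le> dist (e u) (arm i w) + u"
        using dist_triangle[of q "arm i w" "e u"] dist_triangle[of v "arm i w" "e u"] Dle[OF iu(1) wl] gv[OF iu(1) wl] e(2,3) by (auto simp: dist_commute)
      then show "u \<le> 2 * dist (e u) (arm i w)" "w \<le> 2 * dist (e u) (arm i w)" using iu by auto
    qed
    have "pod v (Suc n) D arm'" unfolding pod_def
    proof (intro conjI allI impI ballI)
      fix i assume "i < Suc n"
      then show "geodesic_arc (arm' i) D" "arm' i 0 = v" using g e geodesic_arc_subset[of "arm i" l D] D0 by (auto simp: arm'_def)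
    next
      fix i j u w assume ij: "i < Suc n" "j < Suc n" "i \<noteq> j" and uw: "u \<in> {0..D}" "w \<in> {0..D}"
      then have uw': "u \<in> {0..l}" "w \<in> {0..l}" using D0 by auto
      consider "i < n" "j < n" | "i < n" "j = n" | "i = n" "j < n" using ij by linarith
      then have "u \<le> 2 * dist (arm' i u) (arm' j w) \<and> w \<le> 2 * dist (arm' i u) (arm' j w)"
      proof cases
        case 1
        then show ?thesis using sp[OF 1 ij(3) uw'] by (simp add: arm'_def)
      next
        case 2
        then show ?thesis using ee[OF 2(1) uw(2,1)] by (simp add: arm'_def dist_commute)
      next
        case 3
        then show ?thesis using ee[OF 3(2) uw] by (simp add: arm'_def)
      qed
      then show "u \<le> 2 * dist (arm' i u) (arm' j w)" "w \<le> 2 * dist (arm' i u) (arm' j w)" by auto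
    qed
    then have "Q (Suc n)" unfolding Q_def using D0 l by (intro exI[of _ D] exI[of _ arm']) auto
    then show False using n(3) by blast
  qed
  have s0: "0 < s" using s Dv g(2)[OF n01(1)] by (cases "s = 0") auto
  have t0': "0 < t" using j Dv g(2)[OF j(1)] by (cases "t = 0") auto
  have D0: "0 < D"
  proof (rule ccontr)
    assume "\<not> 0 < D"
    then have "dist q (arm 0 s) \<le> 0" "dist q (arm j t) \<le> 0" using s j by auto
    then have "arm 0 s = arm j t" by simp
    then show False using sp(1)[OF n01(1) j(1) _ s(1) j(3)] j(2) s0 by simp
  qed
  have Dl: "D < l" using Dv Pl(1)[OF q(1)] by (simp add: dist_commute)
  define c0 where "c0 u = (if u \<le> s then arm 0 (s - u) else arm j (u - s))" for u
  define M0 :: real where "M0 = 1 * (1 + 1 / (1 / 2)) + 1 / (1 / 2)"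
  have c0: "bilip M0 c0 {0..s + t}" unfolding c0_def M0_def
  proof (rule bilip_append)
    show "bilip 1 (\<lambda>u. arm 0 (s - u)) {0..s}" using s by (intro geodesic_arc_bilip geodesic_arc_rev[OF g(1)[OF n01(1)]]) auto
    show "geodesic_arc (arm j) t" using j by (intro geodesic_arc_subset[OF g(1)[OF j(1)]]) auto
    show "arm j 0 = arm 0 (s - s)" using g(2) j(1) n01 by simp
    fix u w assume "u \<in> {0..s}" "w \<in> {0..t}"
    then show "1 / 2 * w \<le> dist (arm j w) (arm 0 (s - u))" using sp(1)[OF j(1) n01(1) j(2), of w "s - u"] s j by auto
  qed (use s0 t0' in auto)
  have c0i: "\<exists>i<n. \<exists>w\<in>{0..l}. c0 u = arm i w" if u: "u \<in> {0..s + t}" for u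
  proof (cases "u \<le> s")
    case True
    then show ?thesis using u s n01 by (intro exI[of _ 0] conjI bexI[of _ "s - u"]) (auto simp: c0_def)
  next
    case False
    then show ?thesis using u j s0 by (intro exI[of _ j] conjI bexI[of _ "u - s"]) (auto simp: c0_def)
  qed
  show thesis
  proof (rule feet_loop[OF c0, of q D])
    show "1 \<le> M0" by (simp add: M0_def)
    show "0 < s + t" using s0 t0' by simp
    show "dist q (c0 0) = D" using s s0 by (simp add: c0_def)
    show "dist q (c0 (s + t)) = D" using j t0' by (simp add: c0_def)
    show "D \<le> dist q (c0 u)" if "u \<in> {0..s + t}" for u using c0i[OF that] Dle by force
    show "0 < D" by fact
    fix c e :: "real \<Rightarrow> 'a" and M l' m \<eta>
    assume H: "bilip M c {0..l'}" "1 \<le> M" "0 < l'" "geodesic_arc e m" "0 < m"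
      "e 0 = c l'" "e m = c 0" "0 < \<eta>" "\<And>s t. s \<in> {0..l'} \<Longrightarrow> t \<in> {0..m} \<Longrightarrow> \<eta> * min t (m - t) \<le> dist (e t) (c s)"
      "c ` {0..l'} \<union> e ` {0..m} \<subseteq> c0 ` {0..s + t} \<union> cball q (2 * D)"
    have "c0 ` {0..s + t} \<union> cball q (2 * D) \<subseteq> ball v \<zeta>"
    proof
      fix x assume "x \<in> c0 ` {0..s + t} \<union> cball q (2 * D)"
      then consider u where "u \<in> {0..s + t}" "x = c0 u" | "dist q x \<le> 2 * D" by auto
      then have "dist v x < 4 * l"
      proof cases
        case 1
        then obtain i w where "i < n" "w \<in> {0..l}" "x = arm i w" using c0i by blast
        then show ?thesis using gv[of i w] l by simp
      next
        case 2
        then show ?thesis using dist_triangle[of v x q] Pl(1)[OF q(1)] Dl l by simp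
      qed
      then show "x \<in> ball v \<zeta>" using l l0 by simp
    qed
    then have "c ` {0..l'} \<union> e ` {0..m} \<subseteq> ball v \<zeta>" using H(10) by blast
    then show thesis using that[OF H(1-9)] by blast
  qed
qed

end

section \<open>Local linear contractibility\<close>

lemma locally_linearly_contractible_image:
  fixes f :: "'a::metric_space \<Rightarrow> 'b::metric_space"
  assumes S: "locally_linearly_contractible S" and M: "1 \<le> M"
    and f: "\<And>x y. x \<in> S \<Longrightarrow> y \<in> S \<Longrightarrow> dist x y \<le> M * dist (f x) (f y) \<and> dist (f x) (f y) \<le> M * dist x y"
  shows "locally_linearly_contractible (f ` S)"
proof -
  obtain C where C: "1 \<le> C" "\<And>x R. x \<in> S \<Longrightarrow> 0 < R \<Longrightarrow> R < inverse C \<Longrightarrow>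
    \<exists>a. homotopic_with_canon (\<lambda>_. True) (ball x R \<inter> S) (ball x (C * R) \<inter> S) (\<lambda>y. y) (\<lambda>_. a)"
    using S unfolding locally_linearly_contractible_def by blast
  define g where "g = inv_into S f"
  have "inj_on f S"
  proof (rule inj_onI)
    fix x y assume "x \<in> S" "y \<in> S" "f x = f y"
    then show "x = y" using f[of x y] by simp
  qed
  then have gf: "g (f x) = x" if "x \<in> S" for x using that by (simp add: g_def)
  have MC: "1 \<le> M * M" "1 \<le> M * M * C" using M C(1) mult_mono[of 1 M 1 M] mult_mono[of 1 "M * M" 1 C] by auto
  have cf: "continuous_on S f"
  proof -
    have "M-lipschitz_on S f" using f M by (intro lipschitz_onI) auto
    then show ?thesis by (rule lipschitz_on_continuous_on)
  qed
  have cg: "continuous_on (f ` S) g"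
  proof -
    have "M-lipschitz_on (f ` S) g" using f M gf by (intro lipschitz_onI) auto
    then show ?thesis by (rule lipschitz_on_continuous_on)
  qed
  show ?thesis
    unfolding locally_linearly_contractible_def
  proof (intro exI[of _ "M * M * C"] conjI ballI allI impI MC(2))
    fix x' R assume x': "x' \<in> f ` S" and R: "0 < R \<and> R < inverse (M * M * C)"
    obtain x where x: "x \<in> S" "x' = f x" using x' by blast
    have "M * R < M * inverse (M * M * C)" using M R by (intro mult_strict_left_mono) auto
    also have "\<dots> = inverse M * inverse C" using M C(1) by (simp add: field_simps)
    also have "\<dots> \<le> 1 * inverse C" using M C(1) by (intro mult_right_mono) (auto simp: inverse_le_1_iff)
    finally have "M * R < inverse C" by simp
    moreover have "0 < M * R" using M R by simp
    ultimately obtain a where a: "homotopic_with_canon (\<lambda>_. True) (ball x (M * R) \<inter> S) (ball x (C * (M * R)) \<inter> S) (\<lambda>y. y) (\<lambda>_. a)"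
      using C(2)[OF x(1)] by blast
    have gi: "g \<in> ball x' R \<inter> f ` S \<rightarrow> ball x (M * R) \<inter> S"
    proof
      fix y assume "y \<in> ball x' R \<inter> f ` S"
      then obtain u where u: "u \<in> S" "y = f u" "dist (f x) (f u) < R" using x by auto
      have "dist x u \<le> M * dist (f x) (f u)" using f x u by blast
      also have "\<dots> < M * R" using u M by (intro mult_strict_left_mono) auto
      finally show "g y \<in> ball x (M * R) \<inter> S" using u gf by simp
    qed
    have fi: "f \<in> ball x (C * (M * R)) \<inter> S \<rightarrow> ball x' (M * M * C * R) \<inter> f ` S"
    proof
      fix u assume u: "u \<in> ball x (C * (M * R)) \<inter> S"
      have "dist (f x) (f u) \<le> M * dist x u" using f x u by blast
      also have "\<dots> < M * (C * (M * R))" using u M by (intro mult_strict_left_mono) auto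
      finally show "f u \<in> ball x' (M * M * C * R) \<inter> f ` S" using u x by (simp add: mult_ac)
    qed
    have "homotopic_with_canon (\<lambda>_. True) (ball x' R \<inter> f ` S) (ball x (C * (M * R)) \<inter> S) ((\<lambda>y. y) \<circ> g) ((\<lambda>_. a) \<circ> g)"
      by (rule homotopic_with_compose_continuous_right[OF a _ gi]) (rule continuous_on_subset[OF cg], blast)
    then have "homotopic_with_canon (\<lambda>_. True) (ball x' R \<inter> f ` S) (ball x' (M * M * C * R) \<inter> f ` S) (f \<circ> ((\<lambda>y. y) \<circ> g)) (f \<circ> ((\<lambda>_. a) \<circ> g))"
      by (rule homotopic_with_compose_continuous_left[OF _ _ fi]) (rule continuous_on_subset[OF cf], blast)
    then have "homotopic_with_canon (\<lambda>_. True) (ball x' R \<inter> f ` S) (ball x' (M * M * C * R) \<inter> f ` S) (\<lambda>y. y) (\<lambda>_. f a)"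
      by (rule homotopic_with_eq) (auto simp: gf)
    then show "\<exists>a. homotopic_with_canon (\<lambda>_. True) (ball x' R \<inter> f ` S) (ball x' (M * M * C * R) \<inter> f ` S) (\<lambda>y. y) (\<lambda>_. a)" by blast
  qed
qed

context hom_surface
begin

text \<open>The ball itself may have holes. Its hull has none, and by \<open>fil_cball\<close> it is
  larger only by the factor \<open>Cf\<close>.\<close>

lemma ball_fill:
  assumes x: "x \<in> ball x0 r1" and R: "0 < R" "R < r1"
  obtains E :: "complex set" where "contractible E" "h ` ball x R \<subseteq> E" "k ` E \<subseteq> ball x (Cf * R)"
proof -
  have cb: "compact (cball x R)" "cball x R \<subseteq> W" using small_cball[of x R] x R r1 by auto
  have bW: "ball x R \<subseteq> W" using cb(2) ball_subset_cball by blast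
  define B where "B = h ` ball x R"
  have "B = k -` ball x R" using h_image_eq[OF bW] unfolding B_def vimage_def by blast
  moreover have "open (k -` ball x R)" using cont_k[of UNIV] by (simp add: open_vimage)
  ultimately have "open B" by simp
  moreover have "connected B" unfolding B_def by (intro connected_continuous_image cont_h bW connected_ball)
  moreover have "bounded B" unfolding B_def
    by (rule bounded_subset[OF compact_imp_bounded[OF compact_h[OF cb]]]) (use ball_subset_cball in blast)
  ultimately have E: "contractible (- outside B)" "B \<subseteq> - outside B" using fill_open by auto
  have "outside (h ` cball x R) \<subseteq> outside B" unfolding B_def by (intro outside_mono image_mono ball_subset_cball)
  then have "k ` (- outside B) \<subseteq> fil (cball x R)" unfolding fil_def by (intro image_mono) auto
  also have "\<dots> \<subseteq> ball x (Cf * R)" by (rule fil_cball[OF x R cb(1) order_refl])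
  finally show thesis using that[OF E(1)] E(2) unfolding B_def by blast
qed

text \<open>The retraction of a neighbourhood of \<open>G\<close> onto \<open>G\<close>, applied outside \<open>fil G\<close>, turns contractions
  in the ambient surface into contractions inside \<open>fil G\<close>.\<close>

lemma locally_linearly_contractible_fil:
  assumes G: "compact G" "G \<subseteq> W" "fil G \<subseteq> ball x0 (r1 / 2)"
    and \<delta>: "0 < \<delta>" and C: "0 < C" and r: "continuous_on {y. infdist y G < \<delta>} r" "\<And>y. r y \<in> G" "\<And>x. x \<in> G \<Longrightarrow> r x = x"
      "\<And>x y. x \<in> G \<Longrightarrow> infdist y G < \<delta> \<Longrightarrow> dist (r y) x \<le> C * dist y x"
  shows "locally_linearly_contractible (fil G)"
proof -
  \<comment> \<open>The first summand absorbs the filling of the ball and the displacement by the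
    retraction. The other two force \<open>R < r1\<close> and \<open>Cf * R < \<delta>\<close>, so
    that \<open>ball_fill\<close> applies and the part of the filled ball outside
    \<open>fil G\<close> lies where \<open>r\<close> is continuous.\<close>
  define K where "K = (C + 1) * Cf + 2 / r1 + Cf / \<delta>"
  have p: "0 \<le> C * Cf" "0 < 2 / r1" "0 < Cf / \<delta>" using C Cf_ge r1 \<delta> by auto
  then have K: "1 \<le> K" "(C + 1) * Cf \<le> K" "2 / r1 \<le> K" "Cf / \<delta> \<le> K" using Cf_ge unfolding K_def ring_distribs by linarith+
  have cG: "G \<subseteq> fil G" by (rule subset_fil[OF G(2)])
  define rr where "rr y = (if y \<in> fil G then y else r y)" for y
  show ?thesis
    unfolding locally_linearly_contractible_def
  proof (intro exI[of _ K] conjI ballI allI impI K(1))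
    fix x R assume x: "x \<in> fil G" and R: "0 < R \<and> R < inverse K"
    have KR: "K * R < 1" using R K(1) by (simp add: field_simps)
    have "2 / r1 * R \<le> K * R" "Cf / \<delta> * R \<le> K * R" "(C + 1) * Cf * R \<le> K * R"
      using K R by (intro mult_right_mono; simp)+
    then have "2 / r1 * R < 1" "Cf / \<delta> * R < 1" using KR by linarith+
    then have R': "0 < R" "R < r1" "Cf * R < \<delta>" using R r1 \<delta> by (auto simp: field_simps)
    have xb: "x \<in> ball x0 r1" using x G(3) r1 by auto
    obtain E :: "complex set" where E: "contractible E" "h ` ball x R \<subseteq> E" "k ` E \<subseteq> ball x (Cf * R)"
      by (rule ball_fill[OF xb R'(1,2)])
    \<comment> \<open>A geodesic from \<open>x\<close> to a point outside \<open>fil G\<close>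
      crosses \<open>G\<close>. The estimate for \<open>r\<close> relative to the crossing point
      then becomes one relative to \<open>x\<close>, with \<open>C + 1\<close> in place of
      \<open>C\<close>.\<close>
    have near: "\<exists>g\<in>G. dist x g \<le> dist x y \<and> dist g y \<le> dist x y" if y: "y \<notin> fil G" for y
    proof -
      obtain \<gamma> where \<gamma>: "geodesic_arc \<gamma> (dist x y)" "\<gamma> 0 = x" "\<gamma> (dist x y) = y" using geodesics[of x y] by blast
      have m0: "0 \<in> {0..dist x y}" "dist x y \<in> {0..dist x y}" by auto
      have "\<gamma> ` {0..dist x y} \<inter> G \<noteq> {}"
      proof (rule connected_meets[OF G(1,2) connected_continuous_image[OF bilip_cont[OF geodesic_arc_bilip[OF \<gamma>(1) order_refl]]]])
        have "x \<in> \<gamma> ` {0..dist x y}" "y \<in> \<gamma> ` {0..dist x y}" using imageI[OF m0(1), of \<gamma>] imageI[OF m0(2), of \<gamma>] \<gamma>(2,3) by simp_all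
        then show "\<gamma> ` {0..dist x y} \<inter> fil G \<noteq> {}" "\<not> \<gamma> ` {0..dist x y} \<subseteq> fil G" using x y by blast+
      qed simp
      then obtain t where t: "t \<in> {0..dist x y}" "\<gamma> t \<in> G" by blast
      have "dist (\<gamma> 0) (\<gamma> t) = t" "dist (\<gamma> t) (\<gamma> (dist x y)) = dist x y - t" using \<gamma>(1) t(1) unfolding geodesic_arc_def by auto
      then show ?thesis using t \<gamma>(2,3) by (intro bexI[of _ "\<gamma> t"]) auto
    qed
    define V where "V = k ` E"
    have cont: "continuous_on V rr"
    proof -
      define T where "T = V - (fil G - G)"
      have opn: "open (fil G - G)" by (rule open_fil_minus[OF G(1,2)])
      have VT: "V = (V \<inter> fil G) \<union> T" by (auto simp: T_def)
      have "continuous_on ((V \<inter> fil G) \<union> T) rr" unfolding rr_def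
      proof (rule continuous_on_cases_local)
        show "closedin (top_of_set (V \<inter> fil G \<union> T)) (V \<inter> fil G)" unfolding VT[symmetric]
          using compact_imp_closed[OF compact_fil[OF G(1,2)]] by (simp add: closedin_closed_Int)
        show "closedin (top_of_set (V \<inter> fil G \<union> T)) T" unfolding VT[symmetric]

        proof -
          have "T = V \<inter> - (fil G - G)" by (auto simp: T_def)
          then show "closedin (top_of_set V) T" using closedin_closed_Int[OF closed_Compl[OF opn], of V] by simp
        qed
        show "continuous_on (V \<inter> fil G) (\<lambda>y. y)" by simp
        show "continuous_on T r"
        proof (rule continuous_on_subset[OF r(1)])
          show "T \<subseteq> {y. infdist y G < \<delta>}"
          proof
            fix y assume y: "y \<in> T"
            show "y \<in> {y. infdist y G < \<delta>}"
            proof (cases "y \<in> G")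
              case True
              then show ?thesis using \<delta> by simp
            next
              case False
              then have "y \<notin> fil G" "y \<in> V" using y by (auto simp: T_def)
              then obtain g where "g \<in> G" "dist g y \<le> dist x y" using near by blast
              moreover have "dist x y < Cf * R" using \<open>y \<in> V\<close> E(3) by (auto simp: V_def)
              ultimately have "infdist y G < \<delta>" using infdist_le[of g G y] R'(3) by (simp add: dist_commute)
              then show ?thesis by simp
            qed
          qed
        qed
        show "y = r y" if "y \<in> V \<inter> fil G \<and> y \<notin> fil G \<or> y \<in> T \<and> y \<in> fil G" for y
          using that r(3)[of y] by (auto simp: T_def)
      qed
      then show ?thesis unfolding VT[symmetric] .
    qed
    have rV: "rr y \<in> ball x (K * R) \<inter> fil G" if y: "y \<in> V" for y
    proof -
      have d: "dist x y < Cf * R" using y E(3) by (auto simp: V_def)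
      have "(C + 1) * dist x y < (C + 1) * (Cf * R)" using d C by (intro mult_strict_left_mono) auto
      also have "\<dots> \<le> K * R" using \<open>(C + 1) * Cf * R \<le> K * R\<close> by (simp add: mult_ac)
      finally have dd: "(C + 1) * dist x y < K * R" .
      show ?thesis
      proof (cases "y \<in> fil G")
        case True
        have "1 * dist x y \<le> (C + 1) * dist x y" using C by (intro mult_right_mono) auto
        then show ?thesis using True dd by (simp add: rr_def)
      next
        case False
        then obtain g where g: "g \<in> G" "dist x g \<le> dist x y" "dist g y \<le> dist x y" using near by blast
        have "infdist y G < \<delta>" using infdist_le[OF g(1), of y] g(3) d R'(3) by (simp add: dist_commute)
        then have "dist (r y) g \<le> C * dist y g" by (rule r(4)[OF g(1)])
        also have "\<dots> \<le> C * dist x y" using g(3) C by (intro mult_left_mono) (auto simp: dist_commute)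
        finally have "dist x (r y) \<le> (C + 1) * dist x y" using g(2) dist_triangle[of x "r y" g] by (simp add: dist_commute algebra_simps)
        then show ?thesis using dd False r(2) cG by (auto simp: rr_def)
      qed
    qed
    have bW: "ball x R \<inter> fil G \<subseteq> W" using fil_subset_W by blast
    \<comment> \<open>The inclusion factors as \<open>h\<close> into the contractible set
      \<open>E\<close> followed by the retracted inverse chart, so it is null-homotopic in the
      target.\<close>
    obtain a where a: "homotopic_with_canon (\<lambda>_. True) (ball x R \<inter> fil G) (ball x (K * R) \<inter> fil G) ((\<lambda>z. rr (k z)) \<circ> h) (\<lambda>_. a)"
    proof (rule nullhomotopic_through_contractible[OF cont_h[OF bW] _ _ _ E(1)])
      show "h \<in> ball x R \<inter> fil G \<rightarrow> E" using E(2) by blast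
      show "continuous_on E (\<lambda>z. rr (k z))" by (rule continuous_on_compose2[OF cont cont_k]) (simp add: V_def)
      show "(\<lambda>z. rr (k z)) \<in> E \<rightarrow> ball x (K * R) \<inter> fil G" using rV unfolding V_def by blast
    qed (rule that)
    have "homotopic_with_canon (\<lambda>_. True) (ball x R \<inter> fil G) (ball x (K * R) \<inter> fil G) (\<lambda>y. y) (\<lambda>_. a)"
      using a by (rule homotopic_with_eq) (use bW in \<open>auto simp: rr_def\<close>)
    then show "\<exists>a. homotopic_with_canon (\<lambda>_. True) (ball x R \<inter> fil G) (ball x (K * R) \<inter> fil G) (\<lambda>y. y) (\<lambda>_. a)" by blast
  qed
qed

text \<open>Small circles arise at midpoints of geodesics, not at \<open>x0\<close> itself. A filled
  circle contains a ball, hence a point of \<open>A\<close> in its interior, and a homogeneity map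
  carries it to a neighbourhood of \<open>x0\<close>.\<close>

lemma contractible_neighbourhood:
  assumes \<zeta>: "0 < \<zeta>"
  shows "\<exists>U. x0 \<in> interior U \<and> U \<subseteq> ball x0 \<zeta> \<and> locally_linearly_contractible U"
proof -
  obtain \<sigma> where \<sigma>: "\<sigma> 0 = x0" "bilip L \<sigma> {-\<tau>..\<tau>}" using arcs[OF x0A] by blast
  define t where "t = min \<tau> (r1 / (32 * L))"
  have t: "0 < t" "t \<le> \<tau>" "t \<le> r1 / (32 * L)" using \<tau> r1 by (auto simp: t_def)
  have t': "L * t \<le> r1 / 32" using t(3) by (simp add: field_simps)
  define d where "d = dist x0 (\<sigma> t)"
  have "t \<le> L * d" "d \<le> L * t" using bilipD[OF \<sigma>(2), of 0 t] t \<tau> \<sigma>(1) by (auto simp: d_def)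
  then have d: "0 < d" "d \<le> r1 / 32" using t(1) t' zero_less_mult_pos[of L d] by auto
  obtain \<gamma> where \<gamma>: "geodesic_arc \<gamma> d" "\<gamma> 0 = x0" using geodesics[of x0 "\<sigma> t"] d_def by blast
  define v where "v = \<gamma> (d / 2)"
  have "dist (\<gamma> 0) (\<gamma> (d / 2)) = \<bar>0 - d / 2\<bar>" using \<gamma>(1) d unfolding geodesic_arc_def by auto
  then have v: "dist x0 v < r1 / 16" using \<gamma>(2) d r1 by (simp add: v_def)
  \<comment> \<open>Room for the filling, a factor \<open>Cf\<close>, and for the homogeneity map, a
    factor \<open>L\<close>.\<close>
  define \<zeta>' where "\<zeta>' = min (r1 / (8 * Cf)) (\<zeta> / (4 * L * Cf))"
  have Cf0: "0 < Cf" using Cf_ge by simp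
  have z': "0 < \<zeta>'" "\<zeta>' \<le> r1 / (8 * Cf)" "\<zeta>' \<le> \<zeta> / (4 * L * Cf)" using r1 \<zeta> Cf0 by (auto simp: \<zeta>'_def)
  have z2: "Cf * \<zeta>' \<le> r1 / 8" "4 * L * (Cf * \<zeta>') \<le> \<zeta>" using z' Cf0 by (auto simp: field_simps)
  have "1 * \<zeta>' \<le> Cf * \<zeta>'" using Cf_ge z' by (intro mult_right_mono) auto
  then have z3: "\<zeta>' \<le> r1 / 8" using z2 by simp
  obtain c e :: "real \<Rightarrow> 'a" and M l m \<eta> where H: "bilip M c {0..l}" "1 \<le> M" "0 < l" "geodesic_arc e m" "0 < m"
    "e 0 = c l" "e m = c 0" "0 < \<eta>" "\<And>s t. s \<in> {0..l} \<Longrightarrow> t \<in> {0..m} \<Longrightarrow> \<eta> * min t (m - t) \<le> dist (e t) (c s)"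
    "c ` {0..l} \<union> e ` {0..m} \<subseteq> ball v \<zeta>'"
    by (rule small_loop[OF \<gamma>(1) d(1) v_def v z'(1)]) (rule that)
  define G where "G = c ` {0..l} \<union> e ` {0..m}"
  have ce: "continuous_on {0..m} e" by (rule bilip_cont[OF geodesic_arc_bilip[OF H(4) order_refl]])
  have E: "compact (e ` {0..m})" "connected (e ` {0..m})" using ce by (auto intro: compact_continuous_image connected_continuous_image)
  have Gc: "compact G" unfolding G_def
    by (intro compact_Un E compact_continuous_image bilip_cont[OF H(1)] compact_Icc)
  have vb: "v \<in> ball x0 r1" using v r1 by simp
  have Gb: "G \<subseteq> cball v \<zeta>'" using H(10) by (auto simp: G_def)
  have cb: "cball v \<zeta>' \<subseteq> W" using small_cball(3)[of v \<zeta>'] v z3 r1 by auto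
  have GW: "G \<subseteq> W" using Gb cb by blast
  have fG: "fil G \<subseteq> ball v (Cf * \<zeta>')"
    by (rule fil_cball[OF vb z'(1) _ Gc Gb]) (use z3 r1 in auto)
  have fGx: "dist x0 u < r1 / 4" if u: "u \<in> fil G" for u
  proof -
    have "dist v u < Cf * \<zeta>'" using u fG by auto
    then show ?thesis using z2(1) v r1 dist_triangle[of x0 u v] by linarith
  qed
  obtain r \<delta> C where R: "0 < \<delta>" "0 < C" "continuous_on {y. infdist y G < \<delta>} r"
    "\<And>y. r y \<in> G" "\<And>x. x \<in> G \<Longrightarrow> r x = x" "\<And>x y. x \<in> G \<Longrightarrow> infdist y G < \<delta> \<Longrightarrow> dist (r y) x \<le> C * dist y x"
    by (rule loop_close[OF H(1-8), folded G_def], rule H(9), assumption, assumption) (rule that)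
  have fb: "fil G \<subseteq> ball x0 (r1 / 2)" using fGx r1 by force
  have llc: "locally_linearly_contractible (fil G)" by (rule locally_linearly_contractible_fil[OF Gc GW fb R])
  \<comment> \<open>Transversality lets \<open>e\<close> meet \<open>c\<close> only at their common
    ends, so the middle of \<open>c\<close> has a positive distance \<open>ri\<close> from
    \<open>e\<close>; \<open>loop_encloses\<close> then gives a ball inside
    \<open>fil G\<close>.\<close>
  have notin: "c (l / 2) \<notin> e ` {0..m}"
  proof
    assume "c (l / 2) \<in> e ` {0..m}"
    then obtain t where t: "t \<in> {0..m}" "e t = c (l / 2)" by force
    have "\<eta> * min t (m - t) \<le> 0" using H(9)[of "l / 2" t] t H(3) by simp
    then have "t = 0 \<or> t = m" using H(8) t(1) by (auto simp: mult_le_0_iff min_def split: if_splits)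
    then have "c (l / 2) = c l \<or> c (l / 2) = c 0" using H(6,7) t(2) by auto
    then show False using inj_onD[OF bilip_inj[OF H(1)], of "l / 2" l] inj_onD[OF bilip_inj[OF H(1)], of "l / 2" 0] H(3) by auto
  qed
  have Ene: "e ` {0..m} \<noteq> {}" using H(5) by auto
  define ri where "ri = infdist (c (l / 2)) (e ` {0..m})"
  have ri: "0 < ri" using notin infdist_pos_not_in_closed[OF compact_imp_closed[OF E(1)] Ene] by (simp add: ri_def)
  obtain y where y: "y \<in> fil G" "\<And>q. q \<in> G \<Longrightarrow> ri / (16 * M^4) < dist y q"
  proof (rule loop_encloses[of M c 0 l "l / 2" "e ` {0..m}" ri, folded G_def])
    show "1 \<le> M" "bilip M c {0..l}" "0 < ri" by fact+
    show "c ` {0..l} \<subseteq> W" "e ` {0..m} \<subseteq> W" using GW by (auto simp: G_def)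
    show "0 \<le> l / 2" "l / 2 \<le> l" using H(3) by auto
    show "compact (e ` {0..m})" "connected (e ` {0..m})" by fact+
    show "c 0 \<in> e ` {0..m}" using H(5) H(7)[symmetric] by auto
    show "c l \<in> e ` {0..m}" using H(5) H(6)[symmetric] by auto
    show "ri \<le> dist (c (l / 2)) q" if "q \<in> e ` {0..m}" for q unfolding ri_def by (rule infdist_le[OF that])
  qed (rule that)
  define \<rho>0 where "\<rho>0 = ri / (16 * M^4)"
  have \<rho>0: "0 < \<rho>0" using ri H(2) by (simp add: \<rho>0_def)
  have "ball y \<rho>0 \<inter> G = {}" using y(2) by (force simp: \<rho>0_def)
  moreover have "y \<in> ball y \<rho>0" using \<rho>0 by simp
  ultimately have ins: "ball y \<rho>0 \<subseteq> fil G"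
    using connected_subset_fil[OF Gc GW connected_ball[of y \<rho>0]] y(1) by blast
  obtain y' where y': "y' \<in> A" "dist y y' < \<rho>0" using dense'[of y \<rho>0] fGx[OF y(1)] r1 \<rho>0 by auto
  have y'f: "y' \<in> fil G" using ins y' by auto
  obtain f where f: "f y' = x0" "ball x0 (\<tau> / L) \<subseteq> f ` ball y' \<tau>"
    "\<And>u v. u \<in> ball y' \<tau> \<Longrightarrow> v \<in> ball y' \<tau> \<Longrightarrow> dist u v \<le> L * dist (f u) (f v) \<and> dist (f u) (f v) \<le> L * dist u v"
    using homog[OF y'(1) x0A] by blast
  have small: "dist y' u < 2 * (Cf * \<zeta>')" if u: "u \<in> fil G" for u
  proof -
    have "dist v u < Cf * \<zeta>'" "dist v y' < Cf * \<zeta>'" using u y'f fG by auto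
    then show ?thesis using dist_triangle3[of y' u v] by linarith
  qed
  have "16 * r1 \<le> 16 * L\<^sup>2 * r1" using mult_right_mono[OF L_powers(2), of r1] r1 by simp
  then have r1\<tau>: "r1 \<le> \<tau>" using r1_\<tau> r1 by linarith
  have dom: "fil G \<subseteq> ball y' \<tau>"
  proof
    fix u assume "u \<in> fil G"
    then show "u \<in> ball y' \<tau>" using small[of u] z2(1) r1\<tau> r1 by simp
  qed
  have y'd: "y' \<in> ball y' \<tau>" using \<tau> by simp
  show ?thesis
  proof (intro exI[of _ "f ` fil G"] conjI)
    show "locally_linearly_contractible (f ` fil G)"
    proof (rule locally_linearly_contractible_image[OF llc L])
      fix u w assume "u \<in> fil G" "w \<in> fil G"
      then show "dist u w \<le> L * dist (f u) (f w) \<and> dist (f u) (f w) \<le> L * dist u w" using f(3) dom by blast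
    qed
    show "f ` fil G \<subseteq> ball x0 \<zeta>"
    proof
      fix w assume "w \<in> f ` fil G"
      then obtain u where u: "u \<in> fil G" "w = f u" by blast
      then have "dist x0 w \<le> L * dist y' u" using f(3)[OF y'd, of u] f(1) dom by auto
      also have "\<dots> \<le> L * (2 * (Cf * \<zeta>'))" using small[OF u(1)] by (intro mult_left_mono) auto
      also have "\<dots> < \<zeta>" using z2(2) \<zeta> by argo
      finally show "w \<in> ball x0 \<zeta>" by simp
    qed
    define \<rho>' where "\<rho>' = \<rho>0 - dist y y'"
    have \<rho>': "0 < \<rho>'" "ball y' \<rho>' \<subseteq> fil G"
    proof -
      show "0 < \<rho>'" using y' by (simp add: \<rho>'_def)
      have "ball y' \<rho>' \<subseteq> ball y \<rho>0"
      proof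
        fix u assume "u \<in> ball y' \<rho>'"
        then show "u \<in> ball y \<rho>0" using dist_triangle[of y u y'] by (simp add: \<rho>'_def)
      qed
      then show "ball y' \<rho>' \<subseteq> fil G" using ins by blast
    qed
    have "ball x0 (min (\<tau> / L) (\<rho>' / L)) \<subseteq> f ` fil G"
    proof
      fix w assume w: "w \<in> ball x0 (min (\<tau> / L) (\<rho>' / L))"
      then have "w \<in> f ` ball y' \<tau>" using f(2) by auto
      then obtain u where u: "u \<in> ball y' \<tau>" "w = f u" by blast
      have "dist y' u \<le> L * dist x0 w" using f(3)[OF y'd u(1)] f(1) u(2) by simp
      also have "\<dots> < L * (\<rho>' / L)" using w by (intro mult_strict_left_mono) auto
      finally have "u \<in> ball y' \<rho>'" by simp
      then show "w \<in> f ` fil G" using \<rho>'(2) u(2) by blast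
    qed
    moreover have "x0 \<in> ball x0 (min (\<tau> / L) (\<rho>' / L))" using \<tau> \<rho>' by simp
    ultimately show "x0 \<in> interior (f ` fil G)" using interior_maximal[OF _ open_ball] by blast
  qed
qed

end

section \<open>Uniform constants for local homogeneity\<close>

lemma path_length_three:
  assumes "0 \<le> s" "s \<le> t" "t \<le> (1::real)"
  shows "ennreal (dist (g 0) (g s) + dist (g s) (g t) + dist (g t) (g 1)) \<le> path_length g"
proof -
  define p where "p i = (if i = 0 then 0 else if i = 1 then s else if i = 2 then t else (1::real))" for i :: nat
  have "p 0 = 0 \<and> p 3 = 1 \<and> (\<forall>i<3. p i \<le> p (Suc i))" using assms by (auto simp: p_def less_Suc_eq numeral_3_eq_3)
  then have "(\<Sum>i<3. ennreal (dist (g (p (Suc i))) (g (p i)))) \<le> path_length g"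
    unfolding path_length_def by (intro SUP_upper2[of "(3, p)"]) auto
  moreover have "(\<Sum>i<3. ennreal (dist (g (p (Suc i))) (g (p i)))) = ennreal (dist (g 0) (g s) + dist (g s) (g t) + dist (g t) (g 1))"
    by (simp add: p_def numeral_3_eq_3 dist_commute flip: ennreal_plus)
  ultimately show ?thesis by simp
qed

text \<open>If the length equals the distance of the ends, the triangle inequality is an equality
  along the curve, so the distance from the start is an isometric parameter. Constant stretches
  disappear by choosing one time for each value of \<open>\<phi>\<close>.\<close>

lemma geodesic_space_arc:
  fixes x y :: "'a::metric_space"
  assumes "geodesic_space (UNIV :: 'a set)"
  shows "\<exists>c. geodesic_arc c (dist x y) \<and> c 0 = x \<and> c (dist x y) = y"
proof -
  obtain g where g: "path g" "g 0 = x" "g 1 = y" "path_length g = ennreal (dist x y)"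
    using assms unfolding geodesic_space_def rectifiable_def pathstart_def pathfinish_def by blast
  define \<phi> where "\<phi> t = dist x (g t)" for t
  have eq: "dist (g s) (g t) = \<phi> t - \<phi> s" if "0 \<le> s" "s \<le> t" "t \<le> 1" for s t
  proof -
    have "dist x (g s) + dist (g s) (g t) + dist (g t) y \<le> dist x y"
      using path_length_three[OF that, of g] unfolding g by (subst (asm) ennreal_le_iff) auto
    then show ?thesis using dist_triangle[of x y "g t"] dist_triangle[of x "g t" "g s"] by (simp add: \<phi>_def)
  qed
  have eq': "dist (g s) (g t) = \<bar>\<phi> s - \<phi> t\<bar>" if "s \<in> {0..1}" "t \<in> {0..1}" for s t
  proof (cases "s \<le> t")
    case True
    then show ?thesis using eq[of s t] that zero_le_dist[of "g s" "g t"] by simp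
  next
    case False
    then show ?thesis using eq[of t s] that zero_le_dist[of "g t" "g s"] by (simp add: dist_commute)
  qed
  have \<phi>: "\<phi> 0 = 0" "\<phi> 1 = dist x y" by (auto simp: \<phi>_def g)
  have "continuous_on {0..1} \<phi>" unfolding \<phi>_def using g(1) by (intro continuous_intros) (auto simp: path_def)
  then have "\<exists>t. t \<in> {0..1} \<and> \<phi> t = u" if "u \<in> {0..dist x y}" for u
    using IVT'[of \<phi> 0 u 1] \<phi> that by auto
  then obtain \<tau> where \<tau>: "\<And>u. u \<in> {0..dist x y} \<Longrightarrow> \<tau> u \<in> {0..1} \<and> \<phi> (\<tau> u) = u" by metis
  have e: "0 \<in> {0..dist x y}" "dist x y \<in> {0..dist x y}" by auto
  have "geodesic_arc (\<lambda>u. g (\<tau> u)) (dist x y)" unfolding geodesic_arc_def using \<tau> eq' by simp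
  moreover have "g (\<tau> 0) = x" using \<tau>[OF e(1)] by (simp add: \<phi>_def)
  moreover have "g (\<tau> (dist x y)) = y" using eq'[of "\<tau> (dist x y)" 1] \<tau>[OF e(2)] \<phi> g(3) by simp
  ultimately show ?thesis by blast
qed

lemma surface_chart:
  fixes T :: "'b topology" and p :: "'a::metric_space"
  assumes "surface T" "(euclidean :: 'a topology) homeomorphic_space T"
  obtains W h k where "open W" "p \<in> W" "homeomorphism W (UNIV :: complex set) h k"
proof -
  obtain f f' where f: "homeomorphic_maps (euclidean :: 'a topology) T f f'" using assms(2) unfolding homeomorphic_space_def by blast
  have fc: "continuous_map euclidean T f" and ff: "\<And>x. f' (f x) = x" "\<And>y. y \<in> topspace T \<Longrightarrow> f (f' y) = y"
    using f unfolding homeomorphic_maps_def by auto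
  have "f p \<in> topspace T" using fc by (simp add: continuous_map_def Pi_iff)
  then obtain U and V :: "(real^2) set" where U: "openin T U" "f p \<in> U" "open V" "subtopology T U homeomorphic_space top_of_set V"
    using assms(1) unfolding surface_def by meson
  define Q where "Q = {x. f x \<in> U}"
  have Q: "open Q" "p \<in> Q" using openin_continuous_map_preimage[OF fc U(1)] U(2) by (auto simp: Q_def)
  have "homeomorphic_maps (top_of_set Q) (subtopology T U) f f'"
  proof (rule homeomorphic_maps_subtopologies[OF f])
    show "f ` (topspace euclidean \<inter> Q) = topspace T \<inter> U"
    proof
      show "f ` (topspace euclidean \<inter> Q) \<subseteq> topspace T \<inter> U" using fc by (auto simp: Q_def continuous_map_def Pi_iff)
      show "topspace T \<inter> U \<subseteq> f ` (topspace euclidean \<inter> Q)"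
      proof
        fix y assume "y \<in> topspace T \<inter> U"
        then have "f (f' y) = y" "f' y \<in> Q" using ff(2) by (auto simp: Q_def)
        then show "y \<in> f ` (topspace euclidean \<inter> Q)" by (metis IntI UNIV_I image_eqI topspace_euclidean)
      qed
    qed
  qed
  then have "top_of_set Q homeomorphic_space top_of_set V"
    using homeomorphic_maps_imp_homeomorphic_space homeomorphic_space_trans U(4) by blast
  then obtain a b where ab: "homeomorphic_maps (top_of_set Q) (top_of_set V) a b" unfolding homeomorphic_space_def by blast
  then have a: "continuous_on Q a" "a ` Q \<subseteq> V" "continuous_on V b" "b ` V \<subseteq> Q" "\<And>x. x \<in> Q \<Longrightarrow> b (a x) = x" "\<And>y. y \<in> V \<Longrightarrow> a (b y) = y"
    unfolding homeomorphic_maps_def continuous_map_subtopology_eu by auto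
  have "homeomorphism Q V a b" using a by (intro homeomorphismI) auto
  have "a p \<in> V" using a(2) Q(2) by blast
  then obtain r where r: "0 < r" "ball (a p) r \<subseteq> V" using U(3) by (meson openE)
  define W where "W = {x \<in> Q. a x \<in> ball (a p) r}"
  have W: "open W" "p \<in> W"
  proof -
    show "open W" using continuous_open_preimage[OF a(1) Q(1) open_ball, of "a p" r] by (simp add: W_def vimage_def Int_def)
    show "p \<in> W" using Q(2) r(1) by (simp add: W_def)
  qed
  have "homeomorphism W (ball (a p) r) a b"
  proof (rule homeomorphismI)
    show "continuous_on W a" "continuous_on (ball (a p) r) b" using a(1,3) r(2) by (auto intro: continuous_on_subset simp: W_def)
    have "b y \<in> W" if y: "y \<in> ball (a p) r" for y
    proof -
      have "y \<in> V" using y r(2) by blast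
      then show ?thesis using a(4,6) y unfolding W_def by auto
    qed
    then show "b ` ball (a p) r \<subseteq> W" by blast
    show "a ` W \<subseteq> ball (a p) r" by (auto simp: W_def)
    show "b (a x) = x" if "x \<in> W" for x using that a(5) by (auto simp: W_def)
    show "a (b y) = y" if "y \<in> ball (a p) r" for y using that a(6) r(2) by blast
  qed
  then have 1: "W homeomorphic ball (a p) r" unfolding homeomorphic_def by blast
  have 2: "ball (a p) r homeomorphic (UNIV :: (real^2) set)" by (rule homeomorphic_ball_UNIV[OF r(1)])
  have 3: "(UNIV :: (real^2) set) homeomorphic (UNIV :: complex set)"
  proof -
    have d: "DIM(real^2) = DIM(complex)" by simp
    obtain F :: "real^2 \<Rightarrow> complex" and G where FG: "linear F" "linear G" "\<And>x. G (F x) = x" "\<And>y. F (G y) = y"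
      by (blast intro: isomorphisms_UNIV_UNIV [OF d])
    then have "homeomorphism UNIV UNIV F G"
      by (intro homeomorphismI) (auto intro: linear_continuous_on simp: linear_conv_bounded_linear)
    then show ?thesis unfolding homeomorphic_def by blast
  qed
  have "W homeomorphic (UNIV :: complex set)" using homeomorphic_trans[OF 1 homeomorphic_trans[OF 2 3]] .
  then obtain h k where "homeomorphism W (UNIV :: complex set) h k" unfolding homeomorphic_def by blast
  then show thesis using that W by blast
qed

text \<open>The covering claim holds at every radius \<open>s \<le> \<epsilon>\<close>, so that the
  domain can be shrunk later without losing control of the image.\<close>

lemma local_bilipschitz_map:
  fixes x y :: "'a::metric_space"
  assumes "locally_bilipschitz_homogeneous (UNIV :: 'a set)"
  obtains f M \<epsilon> where "1 \<le> M" "0 < \<epsilon>" "f x = y"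
    "\<And>u v. u \<in> ball x \<epsilon> \<Longrightarrow> v \<in> ball x \<epsilon> \<Longrightarrow> dist u v \<le> M * dist (f u) (f v) \<and> dist (f u) (f v) \<le> M * dist u v"
    "\<And>s. 0 < s \<Longrightarrow> s \<le> \<epsilon> \<Longrightarrow> ball y (s / M) \<subseteq> f ` ball x s"
proof -
  obtain U1 U2 f where U: "x \<in> interior U1" "y \<in> interior U2" "bilipschitz_homeomorphism U1 U2 f" "f x = y"
    using assms unfolding locally_bilipschitz_homogeneous_def neighbourhood_in_UNIV by blast
  obtain g L1 L2 where g: "homeomorphism U1 U2 f g" "L1-lipschitz_on U1 f" "L2-lipschitz_on U2 g"
    using U(3) unfolding bilipschitz_homeomorphism_def by blast
  define M where "M = max 1 (max L1 L2)"
  have M: "1 \<le> M" "M-lipschitz_on U1 f" "M-lipschitz_on U2 g"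
    using g(2,3) by (auto simp: M_def intro: lipschitz_on_le)
  obtain e1 where e1: "0 < e1" "ball x e1 \<subseteq> U1" using U(1) by (meson mem_interior)
  obtain e2 where e2: "0 < e2" "ball y e2 \<subseteq> U2" using U(2) by (meson mem_interior)
  have gf: "\<And>u. u \<in> U1 \<Longrightarrow> g (f u) = u" "\<And>w. w \<in> U2 \<Longrightarrow> f (g w) = w" "\<And>u. u \<in> U1 \<Longrightarrow> f u \<in> U2" "\<And>w. w \<in> U2 \<Longrightarrow> g w \<in> U1"
    using g(1) by (auto simp: homeomorphism_def)
  have x1: "x \<in> U1" using e1 by auto
  show thesis
  proof (rule that[of M "min e1 e2" f])
    show "1 \<le> M" "0 < min e1 e2" "f x = y" using M e1 e2 U by auto
    fix u v assume "u \<in> ball x (min e1 e2)" "v \<in> ball x (min e1 e2)"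
    then have uv: "u \<in> U1" "v \<in> U1" using e1(2) by auto
    have "dist (g (f u)) (g (f v)) \<le> M * dist (f u) (f v)" using lipschitz_onD[OF M(3)] gf(3) uv by blast
    then show "dist u v \<le> M * dist (f u) (f v) \<and> dist (f u) (f v) \<le> M * dist u v"
      using lipschitz_onD[OF M(2) uv] gf(1) uv by simp
  next
    fix s assume s: "0 < s" "s \<le> min e1 e2"
    show "ball y (s / M) \<subseteq> f ` ball x s"
    proof
      fix w assume w: "w \<in> ball y (s / M)"
      have "s / M \<le> s / 1" using M(1) s by (intro divide_left_mono) auto
      then have w2: "w \<in> U2" using w s e2(2) by auto
      have y2: "y \<in> U2" using e2 by auto
      have "dist (g y) (g w) \<le> M * dist y w" by (rule lipschitz_onD[OF M(3) y2 w2])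
      also have "\<dots> < M * (s / M)" using w M(1) by (intro mult_strict_left_mono) auto
      also have "\<dots> = s" using M(1) by simp
      finally have "dist x (g w) < s" using gf(1)[OF x1] U(4) by simp
      then show "w \<in> f ` ball x s" using gf(2)[OF w2] by (intro image_eqI[of _ _ "g w"]) auto
    qed
  qed
qed

text \<open>Baire's theorem in the chart, applied to the sets \<open>A n\<close> of points reached from \<open>p\<close> with
  constant \<open>n\<close>. These sets need not be closed, so only density in an open set is obtained.\<close>

lemma uniform_homogeneity:
  fixes p :: "'a::metric_space"
  assumes hom: "locally_bilipschitz_homogeneous (UNIV :: 'a set)"
    and W: "open W" "p \<in> W" "homeomorphism W (UNIV :: complex set) h k"
  obtains n :: nat and A O' :: "'a set" where "1 \<le> n" "open O'" "O' \<noteq> {}" "O' \<subseteq> W"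
    "\<And>Q. open Q \<Longrightarrow> Q \<subseteq> O' \<Longrightarrow> Q \<noteq> {} \<Longrightarrow> Q \<inter> A \<noteq> {}"
    "\<And>x. x \<in> A \<Longrightarrow> \<exists>f. f p = x \<and> ball x (1 / (real n)\<^sup>2) \<subseteq> f ` ball p (1 / real n) \<and>
       (\<forall>u\<in>ball p (1 / real n). \<forall>v\<in>ball p (1 / real n). dist u v \<le> real n * dist (f u) (f v) \<and> dist (f u) (f v) \<le> real n * dist u v)"
proof -
  interpret planar_chart W h k by standard (use W in auto)
  \<comment> \<open>One integer \<open>n\<close> serves as biLipschitz constant and as reciprocal of
    the radius, so countably many sets exhaust the space; \<open>1 / n^2\<close> is the radius of a
    ball that is sure to be covered.\<close>
  define A where "A n = {x::'a. \<exists>f. f p = x \<and> ball x (1 / (real n)\<^sup>2) \<subseteq> f ` ball p (1 / real n) \<and>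
       (\<forall>u\<in>ball p (1 / real n). \<forall>v\<in>ball p (1 / real n). dist u v \<le> real n * dist (f u) (f v) \<and> dist (f u) (f v) \<le> real n * dist u v)}" for n :: nat
  have cov: "\<exists>n\<ge>1. x \<in> A n" for x
  proof -
    obtain f M \<epsilon> where f: "1 \<le> M" "0 < \<epsilon>" "f p = x"
      "\<And>u v. u \<in> ball p \<epsilon> \<Longrightarrow> v \<in> ball p \<epsilon> \<Longrightarrow> dist u v \<le> M * dist (f u) (f v) \<and> dist (f u) (f v) \<le> M * dist u v"
      "\<And>s. 0 < s \<Longrightarrow> s \<le> \<epsilon> \<Longrightarrow> ball x (s / M) \<subseteq> f ` ball p s"
      by (rule local_bilipschitz_map[OF hom, of p x]) (rule that)
    obtain n :: nat where n: "max M (1 / \<epsilon>) \<le> real n" using real_arch_simple by blast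
    then have n': "M \<le> real n" "1 \<le> real n" "1 / real n \<le> \<epsilon>" using f(1,2) by (auto simp: field_simps)
    have "ball x (1 / (real n)\<^sup>2) \<subseteq> ball x (1 / real n / M)"
    proof (rule subset_ball)
      have "M * real n \<le> (real n)\<^sup>2" using n' by (simp add: power2_eq_square mult_right_mono)
      then have "1 / (real n)\<^sup>2 \<le> 1 / (M * real n)" using n' f(1) by (intro divide_left_mono) auto
      then show "1 / (real n)\<^sup>2 \<le> 1 / real n / M" by (simp add: mult.commute)
    qed
    also have "\<dots> \<subseteq> f ` ball p (1 / real n)" using n' by (intro f(5)) auto
    finally have 1: "ball x (1 / (real n)\<^sup>2) \<subseteq> f ` ball p (1 / real n)" .
    have "dist u v \<le> real n * dist (f u) (f v) \<and> dist (f u) (f v) \<le> real n * dist u v"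
      if "u \<in> ball p (1 / real n)" "v \<in> ball p (1 / real n)" for u v
    proof -
      have "u \<in> ball p \<epsilon>" "v \<in> ball p \<epsilon>" using that n' by auto
      then have "dist u v \<le> M * dist (f u) (f v)" "dist (f u) (f v) \<le> M * dist u v" using f(4) by auto
      moreover have "M * dist (f u) (f v) \<le> real n * dist (f u) (f v)" "M * dist u v \<le> real n * dist u v" using n' by (auto intro: mult_right_mono)
      ultimately show ?thesis by linarith
    qed
    then have "x \<in> A n" unfolding A_def using f(3) 1 by blast
    then show ?thesis using n'(2) by (intro exI[of _ n]) auto
  qed
  \<comment> \<open>If all closures had empty interior, their complements would be dense and open.
    Baire's theorem is used in the plane because the space itself is not assumed complete.\<close>
  define T where "T n = - closure (h ` (A n \<inter> W))" for n
  have "\<exists>n\<ge>1. interior (closure (h ` (A n \<inter> W))) \<noteq> {}"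
  proof (rule ccontr)
    assume no: "\<not> ?thesis"
    have "(UNIV :: complex set) \<subseteq> closure (\<Inter> (T ` {1..}))"
    proof (rule Baire)
      fix S assume "S \<in> T ` {1..}"
      then obtain n where n: "1 \<le> n" "S = T n" by auto
      have "open (T n)" by (simp add: T_def open_Compl)
      moreover have "closure (T n) = UNIV" using no n(1) unfolding T_def closure_complement by auto
      ultimately show "openin (top_of_set UNIV) S \<and> UNIV \<subseteq> closure S" using n by simp
    qed auto
    then have "\<Inter> (T ` {1..}) \<noteq> {}" by (metis UNIV_not_empty closure_empty subset_empty)
    then obtain z where z: "\<And>n. 1 \<le> n \<Longrightarrow> z \<in> T n" by auto
    obtain n where n: "1 \<le> n" "k z \<in> A n" using cov by blast
    then have "h (k z) \<in> h ` (A n \<inter> W)" by (intro imageI) auto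
    then have "h (k z) \<in> closure (h ` (A n \<inter> W))" by (rule subsetD[OF closure_subset])
    then have "z \<in> closure (h ` (A n \<inter> W))" by simp
    then show False using z[OF n(1)] by (simp add: T_def)
  qed
  then obtain n where n: "1 \<le> n" "interior (closure (h ` (A n \<inter> W))) \<noteq> {}" by blast
  define I where "I = interior (closure (h ` (A n \<inter> W)))"
  show thesis
  proof (rule that[of n "k ` I" "A n"])
    show "1 \<le> n" by fact
    show "open (k ` I)" by (intro open_k) (simp add: I_def)
    show "k ` I \<noteq> {}" using n(2) by (simp add: I_def)
    show "k ` I \<subseteq> W" by auto
    show "Q \<inter> A n \<noteq> {}" if Q: "open Q" "Q \<subseteq> k ` I" "Q \<noteq> {}" for Q
    proof -
      obtain w where w: "w \<in> I" "k w \<in> Q" using Q by blast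
      have "open (k -` Q)" using cont_k[of UNIV] Q(1) by (simp add: open_vimage)
      moreover have "w \<in> closure (h ` (A n \<inter> W))" using w(1) interior_subset by (auto simp: I_def)
      ultimately obtain v where "v \<in> h ` (A n \<inter> W)" "v \<in> k -` Q" using w(2) by (metis closure_iff_nhds_not_empty disjoint_iff order_refl vimageI)
      then show ?thesis by auto
    qed
    show "\<exists>f. f p = x \<and> ball x (1 / (real n)\<^sup>2) \<subseteq> f ` ball p (1 / real n) \<and>
       (\<forall>u\<in>ball p (1 / real n). \<forall>v\<in>ball p (1 / real n). dist u v \<le> real n * dist (f u) (f v) \<and> dist (f u) (f v) \<le> real n * dist u v)" if "x \<in> A n" for x
      using that unfolding A_def by blast
  qed
qed

text \<open>\<open>p\<close> is the midpoint of a geodesic, so it has a straight arc on both sides,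
  and the maps from \<open>p\<close> to the points of \<open>A\<close> transport this arc with
  uniform constants. The base point is then any point of \<open>A\<close> in the open set where
  \<open>A\<close> is dense.\<close>

lemma base_point:
  fixes T :: "'b topology"
  assumes geo: "geodesic_space (UNIV :: 'a::metric_space set)" and T: "surface T"
    "(euclidean :: 'a topology) homeomorphic_space T"
    and hom: "locally_bilipschitz_homogeneous (UNIV :: 'a set)"
  obtains x0 :: "'a::metric_space" and r c where "0 < r" "packing_bounded (ball x0 r)" "0 < c"
    "\<And>s. 0 < s \<Longrightarrow> s \<le> r \<Longrightarrow> ennreal (c * s\<^sup>2) \<le> hausdorff_measure 2 (ball x0 s)"
    "\<And>\<zeta>. 0 < \<zeta> \<Longrightarrow> \<exists>U. x0 \<in> interior U \<and> U \<subseteq> ball x0 \<zeta> \<and> locally_linearly_contractible U"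
proof -
  \<comment> \<open>A chart at an arbitrary point; it only serves to find two different points,
    hence a geodesic of positive length.\<close>
  obtain W0 h0 k0 where "homeomorphism (W0 :: 'a set) (UNIV :: complex set) h0 k0"
    using surface_chart[OF T, of undefined] by metis
  then have "h0 (k0 0) = 0" "h0 (k0 1) = 1" by (auto simp: homeomorphism_def)
  then have ne: "k0 0 \<noteq> k0 1" by force
  define d where "d = dist (k0 0) (k0 1)"
  have d: "0 < d" using ne by (simp add: d_def)
  obtain \<gamma> :: "real \<Rightarrow> 'a" where \<gamma>: "geodesic_arc \<gamma> d"
    unfolding d_def using geodesic_space_arc[OF geo, of "k0 0" "k0 1"] by blast
  define p where "p = \<gamma> (d / 2)"
  obtain W h k where W: "open W" "p \<in> W" "homeomorphism W (UNIV :: complex set) h k" using surface_chart[OF T, of p] by metis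
  obtain n :: nat and A O' where n: "1 \<le> n" and Op: "open O'" "O' \<noteq> {}" "O' \<subseteq> W"
    and den: "\<And>Q. open Q \<Longrightarrow> Q \<subseteq> O' \<Longrightarrow> Q \<noteq> {} \<Longrightarrow> Q \<inter> A \<noteq> {}"
    and A: "\<And>x. x \<in> A \<Longrightarrow> \<exists>f. f p = x \<and> ball x (1 / (real n)\<^sup>2) \<subseteq> f ` ball p (1 / real n) \<and>
       (\<forall>u\<in>ball p (1 / real n). \<forall>v\<in>ball p (1 / real n). dist u v \<le> real n * dist (f u) (f v) \<and> dist (f u) (f v) \<le> real n * dist u v)"
    by (rule uniform_homogeneity[OF hom W]) (rule that)
  obtain x0 where x0: "x0 \<in> O'" "x0 \<in> A" using den[OF Op(1) order_refl Op(2)] by blast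
  obtain \<rho>2 where \<rho>2: "0 < \<rho>2" "ball x0 \<rho>2 \<subseteq> O'" using Op(1) x0(1) by (meson openE)
  interpret planar_chart W h k by standard (use W in auto)
  \<comment> \<open>A map between two points of \<open>A\<close> goes back to \<open>p\<close> and
    out again, so the constant \<open>n\<close> is squared.\<close>
  define L where "L = (real n)\<^sup>2"
  have n1: "1 \<le> real n" "0 < real n" using n by auto
  have L: "1 \<le> L" "0 < L" "real n \<le> L" using n1 mult_mono[of 1 "real n" 1 "real n"] mult_left_mono[of 1 "real n" "real n"] unfolding L_def power2_eq_square by linarith+
  \<comment> \<open>Arcs of half-length \<open>\<tau>\<close> have to fit into the geodesic of
    length \<open>d\<close> and into the ball of radius \<open>1 / n\<close> about \<open>p\<close>,
    balls of radius \<open>\<tau>\<close> into the covered balls of radius \<open>1 / L\<close>, and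
    density is available within \<open>\<rho>2\<close>.\<close>
  define \<tau> where "\<tau> = min (1 / (2 * L)) (min (d / 2) \<rho>2)"
  have \<tau>: "0 < \<tau>" "\<tau> \<le> 1 / (2 * L)" "\<tau> \<le> d / 2" "\<tau> \<le> \<rho>2" using L d \<rho>2 by (auto simp: \<tau>_def)
  have \<tau>L: "\<tau> < 1 / L"
  proof -
    have "1 / (2 * L) < 1 / L" using L by (simp add: field_simps)
    then show ?thesis using \<tau>(2) by simp
  qed
  have "1 / L \<le> 1 / real n" using L n1 by (intro divide_left_mono) auto
  then have \<tau>n: "\<tau> < 1 / real n" using \<tau>L by simp
  have \<tau>4: "\<tau> / (4 * L) \<le> \<tau>" "0 < \<tau> / (4 * L)" using \<tau>(1) L by (auto simp: field_simps)
  have nn: "real n * (real n * e) = L * e" for e by (simp add: L_def power2_eq_square)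
  have x0W: "x0 \<in> W" using x0 Op by blast
  obtain \<rho>1 where \<rho>1: "0 < \<rho>1" "\<And>K. compact K \<Longrightarrow> K \<subseteq> ball x0 \<rho>1 \<Longrightarrow> fil K \<subseteq> ball x0 (\<tau> / (4 * L))"
    by (rule fil_small[OF x0W \<tau>4(2)]) (rule that)
  obtain \<rho>3 where \<rho>3: "0 < \<rho>3" "\<And>S. closed S \<Longrightarrow> S \<subseteq> ball x0 \<rho>3 \<Longrightarrow> compact S \<and> S \<subseteq> W"
    by (rule compact_nbhd[OF x0W]) (rule that)
  define r1 where "r1 = min (\<rho>1 / 4) (min (\<rho>3 / 4) (\<tau> / (16 * L\<^sup>2)))"
  have r1: "0 < r1" "4 * r1 \<le> \<rho>1" "4 * r1 \<le> \<rho>3" "r1 \<le> \<tau> / (16 * L\<^sup>2)" using \<rho>1 \<rho>3 \<tau> L by (auto simp: r1_def)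
  have hs: "hom_surface W h k x0 A L \<tau> r1"
  proof (intro hom_surface.intro hom_surface_axioms.intro planar_chart_axioms)
    show "\<exists>c. geodesic_arc c (dist x y) \<and> c 0 = x \<and> c (dist x y) = y" for x y :: 'a by (rule geodesic_space_arc[OF geo])
    show "1 \<le> L" "0 < \<tau>" "0 < r1" "x0 \<in> A" by fact+
    show "16 * L\<^sup>2 * r1 \<le> \<tau>" using r1(4) L by (simp add: field_simps)
    show "\<exists>a\<in>A. dist x a < e" if x: "x \<in> ball x0 (\<tau> / (4 * L))" and e: "0 < e" for x e
    proof -
      have "x \<in> ball x0 \<rho>2" using x \<tau>4 \<tau>(4) by auto
      then have "x \<in> ball x e \<inter> O'" using \<rho>2(2) e by auto
      then have "(ball x e \<inter> O') \<inter> A \<noteq> {}" using den[OF open_Int[OF open_ball Op(1)], of x e] by blast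
      then show ?thesis by auto
    qed
    show "compact S \<and> S \<subseteq> W" if "closed S" "S \<subseteq> ball x0 (4 * r1)" for S
    proof (rule \<rho>3(2)[OF that(1)])
      show "S \<subseteq> ball x0 \<rho>3" using that(2) subset_ball[OF r1(3)] by (rule order_trans)
    qed
    show "fil K \<subseteq> ball x0 (\<tau> / (4 * L))" if "compact K" "K \<subseteq> ball x0 (4 * r1)" for K
    proof (rule \<rho>1(2)[OF that(1)])
      show "K \<subseteq> ball x0 \<rho>1" using that(2) subset_ball[OF r1(2)] by (rule order_trans)
    qed
    show "\<exists>\<sigma>. \<sigma> 0 = z \<and> bilip L \<sigma> {-\<tau>..\<tau>}" if z: "z \<in> A" for z
    proof -
      obtain f where f1: "f p = z" and "\<forall>u\<in>ball p (1 / real n). \<forall>v\<in>ball p (1 / real n).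
        dist u v \<le> real n * dist (f u) (f v) \<and> dist (f u) (f v) \<le> real n * dist u v"
        using A[OF z] by (elim exE conjE) (rule that)
      then have f2: "dist u v \<le> real n * dist (f u) (f v) \<and> dist (f u) (f v) \<le> real n * dist u v"
        if "u \<in> ball p (1 / real n)" "v \<in> ball p (1 / real n)" for u v using that by simp
      have g: "dist (\<gamma> (d / 2 + s)) (\<gamma> (d / 2 + t)) = \<bar>s - t\<bar>" if "s \<in> {-\<tau>..\<tau>}" "t \<in> {-\<tau>..\<tau>}" for s t
      proof -
        have "d / 2 + s \<in> {0..d}" "d / 2 + t \<in> {0..d}" using that \<tau>(3) by auto
        then show ?thesis using \<gamma> unfolding geodesic_arc_def by force
      qed
      have gb: "\<gamma> (d / 2 + s) \<in> ball p (1 / real n)" if "s \<in> {-\<tau>..\<tau>}" for s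
        using g[of 0 s] that \<tau> \<tau>n by (auto simp: p_def)
      have "bilip L (\<lambda>t. f (\<gamma> (d / 2 + t))) {-\<tau>..\<tau>}" unfolding bilip_def
      proof (intro ballI)
        fix s t assume st: "s \<in> {-\<tau>..\<tau>}" "t \<in> {-\<tau>..\<tau>}"
        let ?D = "dist (f (\<gamma> (d / 2 + s))) (f (\<gamma> (d / 2 + t)))"
        have "\<bar>s - t\<bar> \<le> real n * ?D" "?D \<le> real n * \<bar>s - t\<bar>"
          using f2[OF gb[OF st(1)] gb[OF st(2)]] unfolding g[OF st] by auto
        moreover have "real n * ?D \<le> L * ?D" "real n * \<bar>s - t\<bar> \<le> L * \<bar>s - t\<bar>" using L by (auto intro: mult_right_mono)
        ultimately show "\<bar>s - t\<bar> \<le> L * ?D \<and> ?D \<le> L * \<bar>s - t\<bar>" by linarith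
      qed
      moreover have "f (\<gamma> (d / 2 + 0)) = z" using f1 by (simp add: p_def)
      ultimately show ?thesis by (intro exI[of _ "\<lambda>t. f (\<gamma> (d / 2 + t))"]) auto
    qed
    show "\<exists>f. f y = z \<and> ball z (\<tau> / L) \<subseteq> f ` ball y \<tau> \<and>
         (\<forall>u\<in>ball y \<tau>. \<forall>v\<in>ball y \<tau>. dist u v \<le> L * dist (f u) (f v) \<and> dist (f u) (f v) \<le> L * dist u v)"
      if yz: "y \<in> A" "z \<in> A" for y z
    proof -
      define P where "P = ball p (1 / real n)"
      obtain f where f: "f p = y" "ball y (1 / L) \<subseteq> f ` P"
        "\<forall>u\<in>P. \<forall>v\<in>P. dist u v \<le> real n * dist (f u) (f v) \<and> dist (f u) (f v) \<le> real n * dist u v"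
        using A[OF yz(1), folded P_def L_def] by (elim exE conjE) (rule that)
      note f3 = f(3)[rule_format]
      obtain g where g: "g p = z" "ball z (1 / L) \<subseteq> g ` P"
        "\<forall>u\<in>P. \<forall>v\<in>P. dist u v \<le> real n * dist (g u) (g v) \<and> dist (g u) (g v) \<le> real n * dist u v"
        using A[OF yz(2), folded P_def L_def] by (elim exE conjE) (rule that)
      note g3 = g(3)[rule_format]
      define f' where "f' = inv_into P f"
      have pP: "p \<in> P" using n1 by (simp add: P_def)
      have "inj_on f P"
      proof (rule inj_onI)
        fix u v assume "u \<in> P" "v \<in> P" "f u = f v"
        then show "u = v" using f3[of u v] by simp
      qed
      then have f'f: "f' (f u) = u" if "u \<in> P" for u using that by (simp add: f'_def)
      have ff': "f' v \<in> P" "f (f' v) = v" if "v \<in> ball y \<tau>" for v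
      proof -
        have "v \<in> f ` P" using that \<tau>L f(2) by auto
        then show "f' v \<in> P" "f (f' v) = v" unfolding f'_def by (rule inv_into_into, rule f_inv_into_f)
      qed
      have "g (f' y) = z" using f'f[OF pP] f(1) g(1) by simp
      moreover have "ball z (\<tau> / L) \<subseteq> (\<lambda>v. g (f' v)) ` ball y \<tau>"
      proof
        fix w assume w: "w \<in> ball z (\<tau> / L)"
        have "\<tau> / L \<le> \<tau> / 1" using \<tau>(1) L by (intro divide_left_mono) auto
        then have "w \<in> ball z (1 / L)" using w \<tau>L by auto
        then obtain u where u: "u \<in> P" "w = g u" using g(2) by blast
        have "dist p u \<le> real n * dist z w" using g3[OF pP u(1)] g(1) u(2) by simp
        then have "real n * dist p u \<le> real n * (real n * dist z w)" using n1 by (intro mult_left_mono) auto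
        moreover have "dist y (f u) \<le> real n * dist p u" using f3[OF pP u(1)] f(1) by simp
        ultimately have "dist y (f u) \<le> L * dist z w" unfolding nn by linarith
        also have "\<dots> < L * (\<tau> / L)" using w L by (intro mult_strict_left_mono) auto
        finally have "f u \<in> ball y \<tau>" using L by simp
        then show "w \<in> (\<lambda>v. g (f' v)) ` ball y \<tau>" using f'f[OF u(1)] u(2) by (intro image_eqI[of _ _ "f u"]) auto
      qed
      moreover have "dist u v \<le> L * dist (g (f' u)) (g (f' v)) \<and> dist (g (f' u)) (g (f' v)) \<le> L * dist u v"
        if uv: "u \<in> ball y \<tau>" "v \<in> ball y \<tau>" for u v
      proof -
        note U = ff'(1)[OF uv(1)] ff'(1)[OF uv(2)]
        have 1: "dist (f' u) (f' v) \<le> real n * dist u v" "dist u v \<le> real n * dist (f' u) (f' v)"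
          using f3[OF U] ff'(2) uv by auto
        have 2: "dist (f' u) (f' v) \<le> real n * dist (g (f' u)) (g (f' v))" "dist (g (f' u)) (g (f' v)) \<le> real n * dist (f' u) (f' v)"
          using g3[OF U] by auto
        have "real n * dist (f' u) (f' v) \<le> real n * (real n * dist u v)"
          "real n * dist (f' u) (f' v) \<le> real n * (real n * dist (g (f' u)) (g (f' v)))"
          using 1(1) 2(1) n1 by (auto intro: mult_left_mono)
        then show ?thesis using 1(2) 2(2) unfolding nn by linarith
      qed
      ultimately show ?thesis by (intro exI[of _ "\<lambda>v. g (f' v)"]) blast
    qed
  qed
  interpret hom_surface W h k x0 A L \<tau> r1 by (rule hs)
  show thesis
  proof (rule that[of "r1 / 4" x0 "1 / (8 * L\<^sup>2)"])
    show "0 < r1 / 4" "0 < 1 / (8 * L\<^sup>2)" using r1 L by auto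
    show "packing_bounded (ball x0 (r1 / 4))" by (rule packing_bounded_ball)
    show "ennreal (1 / (8 * L\<^sup>2) * s\<^sup>2) \<le> hausdorff_measure 2 (ball x0 s)" if "0 < s" "s \<le> r1 / 4" for s
      using that r1(1) by (intro hausdorff_2_ball) auto
    show "\<exists>U. x0 \<in> interior U \<and> U \<subseteq> ball x0 \<zeta> \<and> locally_linearly_contractible U" if "0 < \<zeta>" for \<zeta>
      by (rule contractible_neighbourhood[OF that])
  qed
qed

text \<open>Up to constants that may depend on the point, the local properties are invariant under
  local biLipschitz maps, so it suffices to know them at \<open>x0\<close>; the dimension follows
  from a countable cover by images of balls about \<open>x0\<close>.\<close>

theorem theorem1p1:
  fixes T :: "'b topology"
  assumes "geodesic_space (UNIV :: 'a::metric_space set)"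
    and "surface T"
    and "(euclidean :: 'a topology) homeomorphic_space T"
    and "locally_bilipschitz_homogeneous (UNIV :: 'a set)"
  shows "locally_doubling (UNIV :: 'a set)
    \<and> hausdorff_dimension (UNIV :: 'a set) < \<infinity>
    \<and> (\<forall>p::'a. \<exists>c>0. \<exists>rbar>0. \<forall>r. 0 < r \<and> r < rbar \<longrightarrow>
         ennreal (c * r\<^sup>2) \<le> hausdorff_measure 2 (ball p r))
    \<and> (\<forall>p::'a. \<exists>U. neighbourhood_in UNIV p U \<and> locally_linearly_contractible U)"
proof -
  obtain x0 :: 'a and r0 c0 where r0: "0 < r0" and pb: "packing_bounded (ball x0 r0)" and c0: "0 < c0"
    and H2: "\<And>s. 0 < s \<Longrightarrow> s \<le> r0 \<Longrightarrow> ennreal (c0 * s\<^sup>2) \<le> hausdorff_measure 2 (ball x0 s)"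
    and LLC: "\<And>\<zeta>. 0 < \<zeta> \<Longrightarrow> \<exists>U. x0 \<in> interior U \<and> U \<subseteq> ball x0 \<zeta> \<and> locally_linearly_contractible U"
    by (rule base_point[OF assms]) (rule that)
  have loc: "\<exists>f M \<epsilon>. 1 \<le> M \<and> 0 < \<epsilon> \<and> f x0 = p \<and>
    (\<forall>u\<in>ball x0 \<epsilon>. \<forall>v\<in>ball x0 \<epsilon>. dist u v \<le> M * dist (f u) (f v) \<and> dist (f u) (f v) \<le> M * dist u v) \<and>
    (\<forall>s. 0 < s \<longrightarrow> s \<le> \<epsilon> \<longrightarrow> ball p (s / M) \<subseteq> f ` ball x0 s)" for p :: 'a
    by (rule local_bilipschitz_map[OF assms(4), of x0 p]) blast
  then obtain f M \<epsilon> where M: "\<And>p. 1 \<le> M p" and \<epsilon>: "\<And>p. 0 < \<epsilon> p" and fp: "\<And>p. f p x0 = (p::'a)"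
    and f: "\<And>p u v. u \<in> ball x0 (\<epsilon> p) \<Longrightarrow> v \<in> ball x0 (\<epsilon> p) \<Longrightarrow> dist u v \<le> M p * dist (f p u) (f p v) \<and> dist (f p u) (f p v) \<le> M p * dist u v"
    and onto: "\<And>p s. 0 < s \<Longrightarrow> s \<le> \<epsilon> p \<Longrightarrow> ball p (s / M p) \<subseteq> f p ` ball x0 s"
    by metis
  define s where "s p = min (\<epsilon> p) r0" for p
  have s: "0 < s p" "s p \<le> \<epsilon> p" "s p \<le> r0" for p using \<epsilon>[of p] r0 by (auto simp: s_def)
  have sb: "ball x0 (s p) \<subseteq> ball x0 (\<epsilon> p)" "ball x0 (s p) \<subseteq> ball x0 r0" for p using s by (auto intro!: subset_ball)
  have M0: "0 < M p" for p using M[of p] by simp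
  have pI: "p \<in> interior (f p ` S)" if S: "x0 \<in> interior S" for p S
  proof -
    obtain e where e: "0 < e" "ball x0 e \<subseteq> S" using S by (meson mem_interior)
    define e' where "e' = min e (\<epsilon> p)"
    have "ball p (e' / M p) \<subseteq> f p ` ball x0 e'" using e(1) \<epsilon>[of p] by (intro onto) (auto simp: e'_def)
    also have "\<dots> \<subseteq> f p ` S" using e(2) by (auto simp: e'_def)
    finally have "ball p (e' / M p) \<subseteq> f p ` S" .
    moreover have "0 < e' / M p" using e(1) \<epsilon>[of p] M0[of p] by (simp add: e'_def)
    ultimately show ?thesis unfolding mem_interior by blast
  qed
  have "locally_doubling (UNIV :: 'a set)" unfolding locally_doubling_def
  proof
    fix p :: 'a
    have "packing_bounded (f p ` ball x0 (s p))"
      using f sb(1) by (intro packing_bounded_image[OF packing_bounded_subset[OF pb sb(2)] M0]) blast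
    then have "doubling (f p ` ball x0 (s p))" by (rule packing_bounded_imp_doubling)
    moreover have "p \<in> interior (f p ` ball x0 (s p))" using s by (intro pI) (simp add: interior_open)
    ultimately show "\<exists>U. neighbourhood_in UNIV p U \<and> doubling U" unfolding neighbourhood_in_UNIV by blast
  qed
  moreover have "hausdorff_dimension (UNIV :: 'a set) < \<infinity>"
  proof -
    obtain d where d: "0 < d" "hausdorff_measure d (ball x0 r0) = 0" using packing_bounded_null[OF pb bounded_ball] .
    have null: "hausdorff_measure d (ball p (s p / M p)) = 0" for p
    proof -
      have 1: "hausdorff_measure d (ball x0 (s p)) = 0" using hausdorff_measure_mono[OF sb(2), of d p] d(2) by simp
      have "(M p)-lipschitz_on (ball x0 (s p)) (f p)" using f sb(1) M0[of p] by (intro lipschitz_onI) (auto simp: subset_iff)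
      then have "hausdorff_measure d (f p ` ball x0 (s p)) = 0" using d 1 by (intro hausdorff_null_lipschitz) auto
      then show ?thesis using hausdorff_measure_mono[OF onto[OF s(1,2)], of d p] by simp
    qed
    \<comment> \<open>Second countability leaves countably many null pieces. The exponent
      \<open>d\<close> is the same for all of them because every piece lies in an image of a ball
      about \<open>x0\<close>.\<close>
    have "second_countable T" using assms(2) by (simp add: surface_def)
    then have lind: "Lindelof_space (euclidean :: 'a topology)"
      using homeomorphic_space_second_countability[OF assms(3)] second_countable_imp_Lindelof_space by blast
    define \<U> where "\<U> = range (\<lambda>p. ball p (s p / M p))"
    have "p \<in> ball p (s p / M p)" for p using s M0 by simp
    then have cov: "\<Union>\<U> = topspace (euclidean :: 'a topology)" unfolding \<U>_def by auto
    have opn: "\<forall>U\<in>\<U>. openin euclidean U" by (auto simp: \<U>_def)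
    obtain V where V: "countable V" "V \<subseteq> range (\<lambda>p. ball p (s p / M p))" "\<Union>V = (UNIV :: 'a set)"
      using lind[unfolded Lindelof_space_def, THEN spec, of \<U>, THEN mp, OF conjI, OF opn cov] unfolding \<U>_def by auto
    have Vne: "V \<noteq> {}" using V(3) by auto
    have "hausdorff_measure d (\<Union>i. from_nat_into V i) = 0"
    proof (rule hausdorff_null_UN)
      fix i
      have "from_nat_into V i \<in> range (\<lambda>p. ball p (s p / M p))" using from_nat_into[OF Vne] V(2) by blast
      then show "hausdorff_measure d (from_nat_into V i) = 0" using null by auto
    qed
    moreover have "(\<Union>i. from_nat_into V i) = UNIV" using range_from_nat_into[OF Vne V(1)] V(3) by simp
    ultimately have "hausdorff_measure d (UNIV :: 'a set) = 0" by simp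
    then have "hausdorff_dimension (UNIV :: 'a set) \<le> ennreal d"
      unfolding hausdorff_dimension_def using d(1) by (intro Inf_lower) auto
    also have "\<dots> < \<infinity>" by simp
    finally show ?thesis .
  qed
  moreover have "\<exists>c>0. \<exists>rbar>0. \<forall>r. 0 < r \<and> r < rbar \<longrightarrow> ennreal (c * r\<^sup>2) \<le> hausdorff_measure 2 (ball p r)" for p :: 'a
  proof (intro exI conjI allI impI)
    \<comment> \<open>Two powers of \<open>M p\<close> come from \<open>t = r / M p\<close>, two
      from pulling the measure back by the inverse of \<open>f p\<close>, which is
      \<open>M p\<close>-Lipschitz. The bound on \<open>r\<close> says that
      \<open>t < s p\<close>.\<close>
    show "0 < c0 / (M p)^4" "0 < s p * M p" using c0 M0[of p] s(1)[of p] by auto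
    fix r assume r: "0 < r \<and> r < s p * M p"
    define t where "t = r / M p"
    have t: "0 < t" "t \<le> s p" "M p * t = r" using r M0[of p] by (auto simp: t_def field_simps)
    have tb: "u \<in> ball x0 (\<epsilon> p)" if "u \<in> ball x0 t" for u using that t(2) s(2)[of p] by auto
    define S where "S = f p ` ball x0 t"
    define g where "g = inv_into (ball x0 t) (f p)"
    have "inj_on (f p) (ball x0 t)"
    proof (rule inj_onI)
      fix u v assume "u \<in> ball x0 t" "v \<in> ball x0 t" "f p u = f p v"
      then show "u = v" using f[of u p v] tb by simp
    qed
    then have gf: "g (f p u) = u" if "u \<in> ball x0 t" for u using that unfolding g_def by (rule inv_into_f_f)
    have "(M p)-lipschitz_on S g"
    proof (rule lipschitz_onI)
      fix a b assume "a \<in> S" "b \<in> S"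
      then obtain u v where "u \<in> ball x0 t" "v \<in> ball x0 t" "a = f p u" "b = f p v" unfolding S_def by blast
      then show "dist (g a) (g b) \<le> M p * dist a b" using f[OF tb tb] gf by simp
    qed (use M0[of p] in simp)
    then have H2g: "hausdorff_measure 2 (g ` S) \<le> ennreal (M p powr 2) * hausdorff_measure 2 S"
      using M0 by (intro hausdorff_measure_lipschitz) auto
    have gS: "g ` S = ball x0 t" unfolding S_def image_image by (rule trans[OF image_cong[OF refl gf]]) auto
    have "S \<subseteq> ball p r"
    proof
      fix w assume "w \<in> S"
      then obtain u where u: "u \<in> ball x0 t" "w = f p u" unfolding S_def by blast
      have "x0 \<in> ball x0 (\<epsilon> p)" using \<epsilon> by simp
      then have "dist p w \<le> M p * dist x0 u" using f[OF _ tb[OF u(1)], of x0] fp[of p] u(2) by simp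
      also have "\<dots> < M p * t" using u(1) M0[of p] by (intro mult_strict_left_mono) auto
      finally show "w \<in> ball p r" using t(3) by simp
    qed
    then have "hausdorff_measure 2 S \<le> hausdorff_measure 2 (ball p r)" by (rule hausdorff_measure_mono)
    then have HS: "ennreal (M p powr 2) * hausdorff_measure 2 S \<le> ennreal (M p powr 2) * hausdorff_measure 2 (ball p r)"
      by (rule mult_left_mono) simp
    have "ennreal (c0 * t\<^sup>2) \<le> hausdorff_measure 2 (ball x0 t)" using t s(3)[of p] by (intro H2) auto
    also note H2g[unfolded gS]
    also note HS
    finally have "ennreal (c0 * t\<^sup>2) \<le> ennreal (M p powr 2) * hausdorff_measure 2 (ball p r)" .
    moreover have "ennreal (c0 * t\<^sup>2) = ennreal (M p powr 2) * ennreal (c0 / (M p)^4 * r\<^sup>2)"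
    proof -
      have eq: "c0 * t\<^sup>2 = M p powr 2 * (c0 / (M p)^4 * r\<^sup>2)" using M0[of p]
        by (simp add: t_def power_divide powr_numeral power4_eq_xxxx field_simps)
      show ?thesis unfolding eq by (rule ennreal_mult) (use c0 in auto)
    qed
    ultimately show "ennreal (c0 / (M p)^4 * r\<^sup>2) \<le> hausdorff_measure 2 (ball p r)"
      using M0[of p] ennreal_mult_le_mult_iff[of "ennreal (M p powr 2)"] by simp
  qed
  moreover have "\<exists>U. neighbourhood_in UNIV p U \<and> locally_linearly_contractible U" for p :: 'a
  proof -
    obtain U where U: "x0 \<in> interior U" "U \<subseteq> ball x0 (\<epsilon> p)" "locally_linearly_contractible U" using LLC[OF \<epsilon>] by blast
    have "locally_linearly_contractible (f p ` U)"
      using f U(2) by (intro locally_linearly_contractible_image[OF U(3) M]) blast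
    then show ?thesis using pI[OF U(1)] unfolding neighbourhood_in_UNIV by blast
  qed
  ultimately show ?thesis by blast
qed

end
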